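(* Let $P\subset\mathbb{R}^3$ be a three-dimensional polytope. Then $P$ has psd rank four if and only if $P$ is one of the following: a simplex, a quadrilateral pyramid, a bisimplex, a combinatorial triangular prism, a biplanar octahedron, or a biplanar cuboid.
   Context: $\mathcal{S}_+^k$ denotes the cone of $k\times k$ real symmetric positive semidefinite (psd) matrices. An $\mathcal{S}_+^k$-lift of a polytope $P\subset\mathbb{R}^n$ is a set $\mathcal{S}_+^k\cap L$, with $L$ an affine subspace of the space of real symmetric $k\times k$ matrices, such that $P=\pi(\mathcal{S}_+^k\cap L)$ for some linear map $\pi$ to $\mathbb{R}^n$. The psd rank of $P$ is the smallest positive integer $k$ such that $P$ has an $\mathcal{S}_+^k$-lift. Two polytopes are combinatorially equivalent (have the same combinatorial type) if their face lattices are isomorphic. For three-dimensional polytopes in $\mathbb{R}^3$: a simplex is a tetrahedron; a quadrilateral pyramid is a pyramid over a convex quadrilateral; a bisimplex (double simplex) is a polytope combinatorially equivalent to a bipyramid over a triangle; a combinatorial triangular prism is a polytope combinatorially equivalent to a prism over a triangle; an octahedron is a polytope combinatorially equivalent to the regular octahedron; a cuboid is a polytope combinatorially equivalent to a cube. An octahedron $O\subset\mathbb{R}^3$ is planar with respect to a plane $E$ if $O\cap E$ contains four vertices of $O$; $O$ is biplanar if it is planar with respect to at least two distinct planes. For a polytope $Q$ containing the origin in its interior, its polar is $Q^\circ=\{y:\langle x,y\rangle\le 1\ \forall x\in Q\}$. Biplanar cuboids are the polars of biplanar octahedra: a cuboid $C$ is biplanar if, after translating $C$ so that the origin lies in its interior,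 its polar is a biplanar octahedron. (Explicitly, these are the cuboids for which there exist two distinct sets of four facets such that the four supporting planes of the facets in each set intersect in a point, possibly at infinity.) *)

theory Defs
  imports "HOL-Analysis.Analysis" "Jordan_Normal_Form.Matrix"
begin

section \<open>Positive semidefinite lifts and psd rank\<close>

text \<open>The order k of the matrices varies inside the definition of psd rank, so matrices are those of
  Jordan_Normal_Form, with explicit dimensions.  Both HOL-Analysis and Jordan_Normal_Form use
  the infix notation \<open>\<bullet>\<close>, so below \<open>inner\<close> and \<open>scalar_prod\<close> are written prefix.\<close>

definition symmetric_mats :: "nat \<Rightarrow> real mat set" where
  "symmetric_mats k = {A \<in> carrier_mat k k. transpose_mat A = A}"

definition psd_cone :: "nat \<Rightarrow> real mat set" where
  "psd_cone k = {A \<in> symmetric_mats k. \<forall>v \<in> carrier_vec k. 0 \<le> scalar_prod v (A *\<^sub>v v)}"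

text \<open>As with the library's \<open>affine\<close>, the empty set counts as affine.\<close>

definition affine_mats :: "nat \<Rightarrow> real mat set \<Rightarrow> bool" where
  "affine_mats k L \<longleftrightarrow> L \<subseteq> symmetric_mats k \<and>
     (\<forall>A \<in> L. \<forall>B \<in> L. \<forall>s t. s + t = 1 \<longrightarrow> s \<cdot>\<^sub>m A + t \<cdot>\<^sub>m B \<in> L)"

definition linear_mats :: "nat \<Rightarrow> (real mat \<Rightarrow> 'a::real_vector) \<Rightarrow> bool" where
  "linear_mats k \<pi> \<longleftrightarrow>
     (\<forall>A \<in> symmetric_mats k. \<forall>B \<in> symmetric_mats k. \<pi> (A + B) = \<pi> A + \<pi> B) \<and>
     (\<forall>A \<in> symmetric_mats k. \<forall>c. \<pi> (c \<cdot>\<^sub>m A) = c *\<^sub>R \<pi> A)"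

definition has_psd_lift :: "nat \<Rightarrow> 'a::euclidean_space set \<Rightarrow> bool" where
  "has_psd_lift k P \<longleftrightarrow>
     (\<exists>L \<pi>. affine_mats k L \<and> linear_mats k \<pi> \<and> P = \<pi> ` (psd_cone k \<inter> L))"

text \<open>The minimum is attained for every polytope; see \<open>polytope_has_psd_lift\<close> below.\<close>

definition psd_rank :: "'a::euclidean_space set \<Rightarrow> nat" where
  "psd_rank P = (LEAST k. 0 < k \<and> has_psd_lift k P)"

lemma polytope_has_psd_lift:
  fixes P :: "'a::euclidean_space set"
  assumes "polytope P"
  shows "\<exists>k>0. has_psd_lift k P"
proof -
  obtain V where V: "finite V" "P = convex hull V"
    using assms unfolding polytope_def by blast
  show ?thesis
  proof (cases "V = {}")
    case True
    have "affine_mats 1 {}" "linear_mats 1 (\<lambda>_. 0 :: 'a)"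
      by (auto simp: affine_mats_def linear_mats_def)
    moreover have "P = (\<lambda>_. 0) ` (psd_cone 1 \<inter> {})" using V True by simp
    ultimately have "has_psd_lift 1 P" unfolding has_psd_lift_def by blast
    then show ?thesis by (intro exI[of _ 1]) simp
  next
    case False
    define k where "k = card V"
    have "k > 0" using V False by (simp add: k_def card_gt_0_iff)
    obtain g where g: "bij_betw g {0..<k} V"
      using ex_bij_betw_nat_finite[OF V(1)] k_def by blast
    define L where "L = {A \<in> symmetric_mats k. (\<forall>i<k. \<forall>j<k. i \<noteq> j \<longrightarrow> A $$ (i,j) = 0) \<and>
                           (\<Sum>i=0..<k. A $$ (i,i)) = 1}"
    define \<pi> where "\<pi> A = (\<Sum>i=0..<k. A $$ (i,i) *\<^sub>R g i)" for A :: "real mat"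
    have sym: "s \<cdot>\<^sub>m A + t \<cdot>\<^sub>m B \<in> symmetric_mats k"
      if "A \<in> symmetric_mats k" "B \<in> symmetric_mats k" for A B and s t :: real
    proof -
      have c: "A \<in> carrier_mat k k" "B \<in> carrier_mat k k"
        and T: "transpose_mat A = A" "transpose_mat B = B"
        using that by (auto simp: symmetric_mats_def)
      have "transpose_mat (s \<cdot>\<^sub>m A + t \<cdot>\<^sub>m B)
            = s \<cdot>\<^sub>m transpose_mat A + t \<cdot>\<^sub>m transpose_mat B"
        using c by (intro eq_matI) auto
      then show ?thesis using c by (simp add: symmetric_mats_def T)
    qed
    have "affine_mats k L"
      unfolding affine_mats_def
    proof (intro conjI ballI allI impI)
      show "L \<subseteq> symmetric_mats k" by (auto simp: L_def)
    next
      fix A B and s t :: real assume AB: "A \<in> L" "B \<in> L" and st: "s + t = 1"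
      have c: "A \<in> carrier_mat k k" "B \<in> carrier_mat k k"
        using AB by (auto simp: L_def symmetric_mats_def)
      have "(\<Sum>i=0..<k. (s \<cdot>\<^sub>m A + t \<cdot>\<^sub>m B) $$ (i,i))
            = s * (\<Sum>i=0..<k. A $$ (i,i)) + t * (\<Sum>i=0..<k. B $$ (i,i))"
        using c by (simp add: sum.distrib sum_distrib_left)
      then show "s \<cdot>\<^sub>m A + t \<cdot>\<^sub>m B \<in> L"
        using AB c st sym[of A B s t] by (auto simp: L_def)
    qed
    moreover have "linear_mats k \<pi>"
      unfolding linear_mats_def
    proof (intro conjI ballI allI)
      fix A B assume "A \<in> symmetric_mats k" "B \<in> symmetric_mats k"
      then have "A \<in> carrier_mat k k" "B \<in> carrier_mat k k"
        by (auto simp: symmetric_mats_def)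
      then show "\<pi> (A + B) = \<pi> A + \<pi> B"
        by (simp add: \<pi>_def scaleR_add_left sum.distrib)
    next
      fix A and c :: real assume "A \<in> symmetric_mats k"
      then have "A \<in> carrier_mat k k" by (simp add: symmetric_mats_def)
      then show "\<pi> (c \<cdot>\<^sub>m A) = c *\<^sub>R \<pi> A"
        by (simp add: \<pi>_def scaleR_sum_right)
    qed
    moreover have "P = \<pi> ` (psd_cone k \<inter> L)"
    proof (intro equalityI subsetI)
      fix x assume "x \<in> P"
      then obtain u where u: "\<And>v. v \<in> V \<Longrightarrow> 0 \<le> u v" "sum u V = 1" "(\<Sum>v\<in>V. u v *\<^sub>R v) = x"
        using V by (auto simp: convex_hull_finite)
      define A where "A = mat k k (\<lambda>(i,j). if i = j then u (g i) else 0)"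
      have As: "A \<in> symmetric_mats k" by (auto simp: A_def symmetric_mats_def)
      have d: "A $$ (i,i) = u (g i)" if "i < k" for i using that by (simp add: A_def)
      have "(\<Sum>i=0..<k. A $$ (i,i)) = 1"
        using u(2) d sum.reindex_bij_betw[OF g, of u] by simp
      with As have "A \<in> L" by (auto simp: L_def A_def)
      moreover have "A \<in> psd_cone k"
        unfolding psd_cone_def
      proof (intro CollectI conjI ballI As)
        fix v :: "real Matrix.vec" assume v: "v \<in> carrier_vec k"
        have "A *\<^sub>v v = Matrix.vec k (\<lambda>i. u (g i) * vec_index v i)"
        proof (intro eq_vecI)
          fix i assume i: "i < dim_vec (Matrix.vec k (\<lambda>i. u (g i) * vec_index v i))"
          have "(\<Sum>j=0..<k. (if i = j then u (g i) else 0) * vec_index v j)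
                = (\<Sum>j=0..<k. if i = j then u (g i) * vec_index v j else 0)"
            by (intro sum.cong) auto
          also have "\<dots> = u (g i) * vec_index v i" using i by simp
          finally show "vec_index (A *\<^sub>v v) i
              = vec_index (Matrix.vec k (\<lambda>i. u (g i) * vec_index v i)) i"
            using i v by (simp add: A_def scalar_prod_def)
        qed (simp add: A_def)
        moreover have "0 \<le> vec_index v i * (u (g i) * vec_index v i)" if "i < k" for i
        proof -
          have "0 \<le> u (g i)" using u(1) g that by (auto simp: bij_betw_def)
          then have "0 \<le> u (g i) * (vec_index v i * vec_index v i)" by simp
          then show ?thesis by (simp add: algebra_simps)
        qed
        ultimately show "0 \<le> scalar_prod v (A *\<^sub>v v)"
          by (auto simp: scalar_prod_def intro!: sum_nonneg)
      qed
      moreover have "\<pi> A = x"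
        using u(3) d sum.reindex_bij_betw[OF g, of "\<lambda>v. u v *\<^sub>R v"] by (simp add: \<pi>_def)
      ultimately show "x \<in> \<pi> ` (psd_cone k \<inter> L)" by blast
    next
      fix x assume "x \<in> \<pi> ` (psd_cone k \<inter> L)"
      then obtain A where A: "A \<in> psd_cone k" "A \<in> L" "x = \<pi> A" by blast
      have c: "A \<in> carrier_mat k k" using A by (auto simp: psd_cone_def symmetric_mats_def)
      have "0 \<le> A $$ (i,i)" if i: "i < k" for i
      proof -
        have "0 \<le> scalar_prod (unit_vec k i) (A *\<^sub>v unit_vec k i)"
          using A by (auto simp: psd_cone_def)
        also have "\<dots> = A $$ (i,i)" using c i by (simp add: scalar_prod_left_unit[where n = k])
        finally show ?thesis .
      qed
      moreover have "(\<Sum>i=0..<k. A $$ (i,i)) = 1" using A by (simp add: L_def)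
      moreover have "g i \<in> convex hull V" if "i < k" for i
        using g that by (auto simp: bij_betw_def intro!: hull_inc)
      ultimately have "(\<Sum>i=0..<k. A $$ (i,i) *\<^sub>R g i) \<in> convex hull V"
        by (intro convex_sum) auto
      then show "x \<in> P" using V A by (simp add: \<pi>_def)
    qed
    ultimately have "has_psd_lift k P" unfolding has_psd_lift_def by blast
    then show ?thesis using \<open>k > 0\<close> by blast
  qed
qed


section \<open>Combinatorial types of polytopes\<close>

text \<open>The face lattice includes the empty face and the polytope itself, both of which are faces in
  the sense of \<open>face_of\<close>.  An order isomorphism of lattices is a lattice isomorphism.\<close>

definition combinatorially_equivalent ::
  "'a::euclidean_space set \<Rightarrow> 'b::euclidean_space set \<Rightarrow> bool" where
  "combinatorially_equivalent P Q \<longleftrightarrow>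
     (\<exists>f. bij_betw f {F. F face_of P} {G. G face_of Q} \<and>
          (\<forall>F F'. F face_of P \<longrightarrow> F' face_of P \<longrightarrow> (F \<subseteq> F' \<longleftrightarrow> f F \<subseteq> f F')))"

definition vertices :: "'a::euclidean_space set \<Rightarrow> 'a set" where
  "vertices P = {v. v extreme_point_of P}"

definition convex_quadrilateral :: "'a::euclidean_space set \<Rightarrow> bool" where
  "convex_quadrilateral B \<longleftrightarrow> polytope B \<and> aff_dim B = 2 \<and> card (vertices B) = 4"

definition pyramid_over :: "'a::euclidean_space set \<Rightarrow> 'a set \<Rightarrow> bool" where
  "pyramid_over B P \<longleftrightarrow> (\<exists>a. a \<notin> affine hull B \<and> P = convex hull (insert a B))"

definition bipyramid_over :: "'a::euclidean_space set \<Rightarrow> 'a set \<Rightarrow> bool" where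
  "bipyramid_over B P \<longleftrightarrow>
     (\<exists>a b. a \<notin> affine hull B \<and> open_segment a b \<inter> rel_interior B \<noteq> {} \<and>
            P = convex hull (insert a (insert b B)))"

text \<open>The base B and its translate by d; the condition on d says that d is not parallel to the
  affine hull of B.\<close>

definition prism_over :: "'a::euclidean_space set \<Rightarrow> 'a set \<Rightarrow> bool" where
  "prism_over B P \<longleftrightarrow>
     (\<exists>d. (\<forall>x \<in> B. x + d \<notin> affine hull B) \<and> P = convex hull (B \<union> (\<lambda>x. x + d) ` B))"

definition quadrilateral_pyramid :: "(real^3) set \<Rightarrow> bool" where
  "quadrilateral_pyramid P \<longleftrightarrow> (\<exists>B. convex_quadrilateral B \<and> pyramid_over B P)"

definition bisimplex :: "(real^3) set \<Rightarrow> bool" where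
  "bisimplex P \<longleftrightarrow> polytope P \<and>
     (\<exists>T Q. 2 simplex T \<and> bipyramid_over T (Q :: (real^3) set) \<and> combinatorially_equivalent P Q)"

definition combinatorial_triangular_prism :: "(real^3) set \<Rightarrow> bool" where
  "combinatorial_triangular_prism P \<longleftrightarrow> polytope P \<and>
     (\<exists>T Q. 2 simplex T \<and> prism_over T (Q :: (real^3) set) \<and> combinatorially_equivalent P Q)"

definition regular_octahedron :: "(real^3) set" where
  "regular_octahedron = convex hull (Basis \<union> uminus ` Basis)"

definition octahedron :: "(real^3) set \<Rightarrow> bool" where
  "octahedron P \<longleftrightarrow> polytope P \<and> combinatorially_equivalent P regular_octahedron"

definition cuboid :: "(real^3) set \<Rightarrow> bool" where
  "cuboid P \<longleftrightarrow> polytope P \<and> combinatorially_equivalent P (cbox (0 :: real^3) One)"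


section \<open>Biplanarity\<close>

definition planar_wrt :: "(real^3) set \<Rightarrow> (real^3) set \<Rightarrow> bool" where
  "planar_wrt O' E \<longleftrightarrow> affine E \<and> aff_dim E = 2 \<and>
     (\<exists>W. W \<subseteq> vertices O' \<and> W \<subseteq> O' \<inter> E \<and> card W = 4)"

definition biplanar_octahedron :: "(real^3) set \<Rightarrow> bool" where
  "biplanar_octahedron P \<longleftrightarrow> octahedron P \<and>
     (\<exists>E E'. E \<noteq> E' \<and> planar_wrt P E \<and> planar_wrt P E')"

definition polar :: "'a::euclidean_space set \<Rightarrow> 'a set" where
  "polar Q = {y. \<forall>x \<in> Q. inner x y \<le> 1}"

text \<open>Existence of a suitable translation is required.  The choice of the translation does not
  matter: polars of different translates are related by projective transformations, which
  preserve coplanarity of vertices.\<close>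

definition biplanar_cuboid :: "(real^3) set \<Rightarrow> bool" where
  "biplanar_cuboid P \<longleftrightarrow> cuboid P \<and>
     (\<exists>d. 0 \<in> interior ((\<lambda>x. x + d) ` P) \<and> biplanar_octahedron (polar ((\<lambda>x. x + d) ` P)))"

end

theory Submission
  imports Defs
begin

text \<open>A psd lift of size four of a three-dimensional polytope is the same as vectors \<open>a v\<close> (for the vertices)
  and \<open>b F\<close> (for the facets) in real four-space such that the slack of \<open>v\<close> at \<open>F\<close> is \<open>(a v \<bullet> b F)\<^sup>2\<close>: along a
  flag vertex, edge, facet, polytope the ranks of the psd matrices strictly increase, so the matrices at
  vertices, and dually at facets, have rank one.  The slacks themselves are inner products of
  vectors in four-space, and comparing dependencies among the \<open>a\<close>'s with affine dependencies of vertices gives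
  equations such as \<open>y = x + z\<close> and \<open>y\<^sup>2 = x\<^sup>2 + z\<^sup>2\<close>, impossible for nonzero reals.  Hence facets have at
  most four vertices, vertices lie on at most four facets, and a vertex of degree four lies on triangles
  only.  A polytope with a vertex of degree four is then a quadrilateral pyramid, a bisimplex or an
  octahedron, and in an octahedron comparing dependencies forces two coplanar quadruples;
  a polytope with a quadrilateral facet and no vertex of degree four is polar to a bisimplex or an octahedron; and a
  simple simplicial one is a tetrahedron.  Conversely, with at most five vertices the affine dependency
  rescales the vertices so that the slacks at each facet take one nonzero value, and the two
  coplanar quadruples of a biplanar octahedron determine the factorization by square roots.\<close>

text \<open>The obstruction is a clash between two tables of rank four. The slacks and their signed
  roots \<open>a v \<bullet> b F\<close> are both inner products in four-space and have the same
  zeros. So at four vertices of one facet, or at four facets of one vertex, each table has a linear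
  dependency, and the zeros force the same sparse pattern on both. Where the pattern fixes the
  coefficients up to scale, one rational identity holds for the roots and for their squares, which
  is the source of the two incompatible equations. The incidence axioms are self-dual, so a bound on
  facets is at once a bound on vertices. A combinatorial type is found by walking around the star of
  a vertex until the vertices met are closed under the facets through them; connectedness then says
  that these are all. Orders below four are excluded by the same rank count: padded with zeros to
  order four, the matrices of such a lift share a kernel vector, whereas the matrices over a
  three-dimensional polytope have none in common. In the converse direction the real task is to make
  square roots of slacks linear; each facet has to leave few nonzero terms in the relations between
  the vertices.\<close>

no_notation scalar_prod (infix "\<bullet>" 70)
no_notation vec_index (infixl "$" 100)
hide_const (open) Matrix.orthogonal
hide_fact (open) Matrix.orthogonal_def

section \<open>Facets, ridges and edges of polytopes\<close>

text \<open>Dependence is meant for the indexed family, so repeated vectors count as dependent: if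
  \<open>f\<close> takes a value twice, the coefficients 1 and -1 at these two indices already form
  a dependency.\<close>

lemma linear_dependence_image:
  fixes f :: "'i \<Rightarrow> 'a::euclidean_space"
  assumes "finite I" "dim (f ` I) < card I"
  obtains u where "\<exists>i\<in>I. u i \<noteq> 0" "(\<Sum>i\<in>I. u i *\<^sub>R f i) = 0"
proof (cases "inj_on f I")
  case True
  then have "card (f ` I) = card I" by (rule card_image)
  then have "dependent (f ` I)"
    using assms independent_bound_general[of "f ` I"] dim_eq_card_independent[of "f ` I"] by auto
  then obtain v where v: "\<exists>x\<in>f ` I. v x \<noteq> 0" "(\<Sum>x\<in>f ` I. v x *\<^sub>R x) = 0"
    using assms(1) by (auto simp: dependent_finite)
  show ?thesis
    by (rule that[of "v \<circ> f"]) (use v True in \<open>auto simp: sum.reindex\<close>)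
next
  case False
  then obtain i j where ij: "i \<in> I" "j \<in> I" "i \<noteq> j" "f i = f j"
    by (auto simp: inj_on_def)
  define u where "u = (\<lambda>k. if k = i then 1 else if k = j then -1 else (0::real))"
  have "(\<Sum>k\<in>I. u k *\<^sub>R f k) = (\<Sum>k\<in>{i,j}. u k *\<^sub>R f k)"
    using ij assms(1) by (intro sum.mono_neutral_right) (auto simp: u_def)
  also have "\<dots> = 0" using ij by (simp add: u_def)
  finally show ?thesis using ij by (intro that[of u]) (auto simp: u_def)
qed

lemma finite_vertices: "polytope P \<Longrightarrow> finite (vertices P)"
  by (simp add: vertices_def finite_polyhedron_extreme_points polytope_imp_polyhedron)

lemma convex_hull_vertices: "polytope P \<Longrightarrow> convex hull vertices P = P"
  using Krein_Milman_Minkowski[of P]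
  by (simp add: vertices_def polytope_imp_compact polytope_imp_convex)

lemma vertices_subset: "vertices P \<subseteq> P"
  by (auto simp: vertices_def extreme_point_of_def)

lemma vertices_face: "F face_of P \<Longrightarrow> vertices F = vertices P \<inter> F"
  by (auto simp: vertices_def extreme_point_of_face)

lemma face_hull_vertices:
  "polytope P \<Longrightarrow> F face_of P \<Longrightarrow> convex hull (vertices P \<inter> F) = F"
  using convex_hull_vertices[of F] by (simp add: vertices_face face_of_polytope_polytope)

lemma face_eq_iff_vertices:
  assumes "polytope P" "F face_of P" "G face_of P"
  shows "F = G \<longleftrightarrow> vertices P \<inter> F = vertices P \<inter> G"
  using face_hull_vertices assms by metis

lemma face_has_vertex:
  assumes "polytope P" "F face_of P" "F \<noteq> {}"
  shows "vertices P \<inter> F \<noteq> {}"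
  using face_hull_vertices[OF assms(1,2)] assms(3) by auto

lemma facet_functional:
  assumes "polytope P" "F facet_of P"
  obtains c d where "c \<noteq> 0" "P \<subseteq> {x. c \<bullet> x \<le> d}" "F = P \<inter> {x. c \<bullet> x = d}"
  using facet_of_polyhedron assms polytope_imp_polyhedron by metis

text \<open>Taking \<open>c\<close> parallel to the affine hull makes the normals of the facets
  comparable inside the direction space of \<open>P\<close>, also when \<open>P\<close> is not
  full-dimensional. This is applied to polygons that are themselves facets in space.\<close>

lemma facet_functional_parallel:
  fixes P :: "'a::euclidean_space set"
  assumes "polytope P" "F facet_of P"
  obtains c d where "P \<subseteq> {x. c \<bullet> x \<le> d}" "F = P \<inter> {x. c \<bullet> x = d}"
    "\<And>w. w \<in> affine hull P \<Longrightarrow> w + c \<in> affine hull P"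
proof -
  have "F exposed_face_of P"
    using assms by (simp add: exposed_face_of_polyhedron polytope_imp_polyhedron facet_of_imp_face_of)
  moreover have "F \<noteq> P" using assms by auto
  ultimately show ?thesis using that unfolding exposed_face_of_parallel by blast
qed

lemma facet_subset_facet:
  assumes "polytope P" "F facet_of P" "G facet_of P" "F \<subseteq> G"
  shows "F = G"
proof (rule ccontr)
  assume "F \<noteq> G"
  have "F face_of G" using assms by (meson face_of_subset facet_of_def facet_of_imp_subset)
  then have "aff_dim F < aff_dim G" using \<open>F \<noteq> G\<close> face_of_aff_dim_lt
    by (metis assms(1,3) face_of_imp_convex facet_of_def)
  then show False using assms by (auto simp: facet_of_def)
qed

lemma facet_interior_slack:
  assumes "polytope P" "F facet_of P" "P \<subseteq> {x. c \<bullet> x \<le> d}" "F = P \<inter> {x. c \<bullet> x = d}"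
    "z \<in> rel_interior P"
  shows "c \<bullet> z < d"
proof -
  have "F \<noteq> P" using assms by auto
  then have "F \<inter> rel_interior P = {}" 
    using assms(2) face_of_disjoint_rel_interior facet_of_imp_face_of by blast
  then show ?thesis using assms rel_interior_subset by fastforce
qed

text \<open>A segment from the interior point \<open>z\<close> to a point outside leaves
  \<open>P\<close> through a facet. The functional of that facet is strictly below its bound at
  \<open>z\<close> and at most the bound at \<open>x\<close>, so it can reach the bound only at
  \<open>x\<close> itself.\<close>

lemma polytope_mem_iff:
  fixes P :: "'a::euclidean_space set"
  assumes poly: "polytope P" and z: "z \<in> interior P"
    and cd: "\<And>F. F facet_of P \<Longrightarrow> P \<subseteq> {x. c F \<bullet> x \<le> d F} \<and> F = P \<inter> {x. c F \<bullet> x = d F}"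
  shows "x \<in> P \<longleftrightarrow> (\<forall>F. F facet_of P \<longrightarrow> c F \<bullet> x \<le> d F)"
proof
  assume *: "\<forall>F. F facet_of P \<longrightarrow> c F \<bullet> x \<le> d F"
  show "x \<in> P"
  proof (rule ccontr)
    assume x: "x \<notin> P"
    have "closed_segment z x \<inter> frontier P \<noteq> {}"
      using x z interior_subset by (intro connected_Int_frontier) auto
    then obtain y where y: "y \<in> closed_segment z x" "y \<in> frontier P" by blast
    then obtain u where u: "0 \<le> u" "u \<le> 1" "y = (1 - u) *\<^sub>R z + u *\<^sub>R x" by (auto simp: in_segment)
    have "affine hull P = UNIV" using z by (intro affine_hull_nonempty_interior) auto
    then have "frontier P = rel_frontier P" by (simp add: rel_frontier_frontier)
    then obtain F where F: "F facet_of P" "y \<in> F"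
      using y rel_frontier_of_polyhedron[of P] poly polytope_imp_polyhedron by auto
    then have yd: "c F \<bullet> y = d F" using cd by blast
    have zr: "z \<in> rel_interior P" using z interior_subset_rel_interior by blast
    have zd: "c F \<bullet> z < d F" using facet_interior_slack[OF poly F(1) _ _ zr] cd[OF F(1)] by blast
    have "d F = (1 - u) * (c F \<bullet> z) + u * (c F \<bullet> x)" using yd u(3) by (simp add: inner_add_right)
    moreover have "u * (c F \<bullet> x) \<le> u * d F" using * F(1) u by (intro mult_left_mono) auto
    ultimately have "(1 - u) * (d F - c F \<bullet> z) \<le> 0" by (simp add: algebra_simps)
    then have "u = 1" using zd u by (auto simp: mult_le_0_iff)
    then have "y = x" using u by simp
    moreover have "y \<in> P" using F facet_of_imp_subset by blast
    ultimately show False using x by simp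
  qed
qed (use cd in blast)

lemma facet_functionals:
  assumes poly: "polytope P"
  shows "\<exists>c d. \<forall>F. F facet_of P \<longrightarrow> P \<subseteq> {x. c F \<bullet> x \<le> d F} \<and> F = P \<inter> {x. c F \<bullet> x = d F}"
proof -
  have "\<forall>F\<in>{F. F facet_of P}. \<exists>cd. P \<subseteq> {x. fst cd \<bullet> x \<le> snd cd} \<and> F = P \<inter> {x. fst cd \<bullet> x = snd cd}"
  proof
    fix F assume "F \<in> {F. F facet_of P}"
    then obtain c d where "P \<subseteq> {x. c \<bullet> x \<le> d}" "F = P \<inter> {x. c \<bullet> x = d}" using facet_functional[OF poly] by blast
    then show "\<exists>cd. P \<subseteq> {x. fst cd \<bullet> x \<le> snd cd} \<and> F = P \<inter> {x. fst cd \<bullet> x = snd cd}" by (intro exI[of _ "(c, d)"]) simp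
  qed
  from bchoice[OF this] obtain h where
    "\<forall>F\<in>{F. F facet_of P}. P \<subseteq> {x. fst (h F) \<bullet> x \<le> snd (h F)} \<and> F = P \<inter> {x. fst (h F) \<bullet> x = snd (h F)}" by (elim exE)
  then show ?thesis by (intro exI[of _ "\<lambda>F. fst (h F)"] exI[of _ "\<lambda>F. snd (h F)"]) simp
qed

text \<open>The normals of the facets through a face of codimension two lie in a plane, so one of any
  three of them is a nonnegative combination of the other two.\<close>

lemma at_most_two_facets_through_ridge:
  fixes S :: "'a::euclidean_space set"
  assumes S: "polytope S" and R: "R \<noteq> {}" "aff_dim R \<ge> aff_dim S - 2"
    and F: "F1 facet_of S" "F2 facet_of S" "F3 facet_of S" "R \<subseteq> F1" "R \<subseteq> F2" "R \<subseteq> F3"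
  shows "F1 = F2 \<or> F1 = F3 \<or> F2 = F3"
proof (rule ccontr)
  assume ne: "\<not> ?thesis"
  obtain c1 d1 where 1: "S \<subseteq> {x. c1 \<bullet> x \<le> d1}" "F1 = S \<inter> {x. c1 \<bullet> x = d1}"
    "\<And>w. w \<in> affine hull S \<Longrightarrow> w + c1 \<in> affine hull S"
    using facet_functional_parallel[OF S F(1)] by metis
  obtain c2 d2 where 2: "S \<subseteq> {x. c2 \<bullet> x \<le> d2}" "F2 = S \<inter> {x. c2 \<bullet> x = d2}"
    "\<And>w. w \<in> affine hull S \<Longrightarrow> w + c2 \<in> affine hull S"
    using facet_functional_parallel[OF S F(2)] by metis
  obtain c3 d3 where 3: "S \<subseteq> {x. c3 \<bullet> x \<le> d3}" "F3 = S \<inter> {x. c3 \<bullet> x = d3}"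
    "\<And>w. w \<in> affine hull S \<Longrightarrow> w + c3 \<in> affine hull S"
    using facet_functional_parallel[OF S F(3)] by metis
  obtain r where r: "r \<in> R" using R by auto
  have rS: "r \<in> S" using r F(4) 1 by auto
  define T where "T = span ((\<lambda>x. - r + x) ` S)"
  define W where "W = span ((\<lambda>x. - r + x) ` R)"
  have dT: "aff_dim S = int (dim T)"
    unfolding T_def dim_span by (rule aff_dim_eq_dim) (simp add: hull_inc rS)
  have dW: "aff_dim R = int (dim W)"
    unfolding W_def dim_span by (rule aff_dim_eq_dim) (simp add: hull_inc r)
  have inT: "c \<in> T" if "\<And>w. w \<in> affine hull S \<Longrightarrow> w + c \<in> affine hull S" for c
  proof -
    have "r + c \<in> affine hull S" using that[of r] rS by (simp add: hull_inc)
    then obtain v where "r + c = r + v" "v \<in> span ((\<lambda>x. - r + x) ` (S - {r}))"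
      using affine_hull_span2[OF rS] by auto
    then show ?thesis unfolding T_def using span_mono[of "(\<lambda>x. - r + x) ` (S - {r})" "(\<lambda>x. - r + x) ` S"] by auto
  qed
  have "W \<subseteq> T" unfolding W_def T_def using F(4) 1 by (intro span_mono) auto
  \<comment> \<open>The orthogonal complement of \<open>W\<close> in \<open>T\<close> has dimension
    at most two, so the three normals in it are dependent.\<close>
  define N where "N = {y \<in> T. \<forall>x\<in>W. orthogonal x y}"
  have dN: "dim N + dim W = dim T"
    unfolding N_def by (rule dim_subspace_orthogonal_to_vectors) (use \<open>W \<subseteq> T\<close> in \<open>auto simp: W_def T_def\<close>)
  have inN: "c \<in> N" if "\<And>w. w \<in> affine hull S \<Longrightarrow> w + c \<in> affine hull S" "R \<subseteq> {x. c \<bullet> x = d}" for c d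
  proof -
    have "orthogonal x c" if "x \<in> W" for x
      using that unfolding W_def
    proof (rule span_induct)
      show "subspace {x. orthogonal x c}" by (simp add: subspace_def orthogonal_def inner_add_left)
    next
      fix x assume "x \<in> (\<lambda>x. - r + x) ` R"
      then obtain y where "y \<in> R" "x = y - r" by auto
      moreover have "c \<bullet> y = d" "c \<bullet> r = d" using \<open>R \<subseteq> {x. c \<bullet> x = d}\<close> r \<open>y \<in> R\<close> by auto
      ultimately show "orthogonal x c"
        by (simp add: orthogonal_def inner_commute[of _ c] inner_diff_right)
    qed
    then show ?thesis using inT[OF that(1)] by (simp add: N_def)
  qed
  have cN: "c1 \<in> N" "c2 \<in> N" "c3 \<in> N"
    using inN[of c1 d1] inN[of c2 d2] inN[of c3 d3] 1 2 3 F by blast+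
  define f where "f = (\<lambda>i::nat. if i = 1 then c1 else if i = 2 then c2 else c3)"
  have "dim (f ` {1,2,3}) \<le> dim N" using cN by (intro dim_subset) (auto simp: f_def)
  then have "dim (f ` {1,2,3}) < card {1,2,3::nat}" using dN dT dW R by simp
  then obtain u where u: "\<exists>i\<in>{1,2,3}. u i \<noteq> 0" "(\<Sum>i\<in>{1,2,3}. u i *\<^sub>R f i) = 0"
    by (rule linear_dependence_image[rotated]) auto
  define a where "a = u 1" define b where "b = u 2" define c where "c = u 3"
  have abc: "a \<noteq> 0 \<or> b \<noteq> 0 \<or> c \<noteq> 0" and "a *\<^sub>R c1 + b *\<^sub>R c2 + c *\<^sub>R c3 = 0"
    using u by (auto simp: f_def a_def b_def c_def add.assoc)
  then have rel0: "a * (c1 \<bullet> x) + b * (c2 \<bullet> x) + c * (c3 \<bullet> x) = 0" for x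
    by (metis inner_add_left inner_scaleR_left inner_zero_left)
  have dr: "d1 = c1 \<bullet> r" "d2 = c2 \<bullet> r" "d3 = c3 \<bullet> r" using r F 1 2 3 by auto
  have rel: "a * (d1 - c1 \<bullet> x) + b * (d2 - c2 \<bullet> x) + c * (d3 - c3 \<bullet> x) = 0" for x
    using rel0[of x] rel0[of r] unfolding dr by (simp add: algebra_simps)
  obtain z where z: "z \<in> rel_interior S"
    using rS rel_interior_eq_empty[of S] polytope_imp_convex[OF S] by auto
  have zs: "d1 - c1 \<bullet> z > 0" "d2 - c2 \<bullet> z > 0" "d3 - c3 \<bullet> z > 0"
    using facet_interior_slack[OF S F(1) 1(1,2) z] facet_interior_slack[OF S F(2) 2(1,2) z]
      facet_interior_slack[OF S F(3) 3(1,2) z] by auto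
  \<comment> \<open>If a multiple of the slack of \<open>G\<close> is a nonnegative combination of
    two other slacks, with positive coefficient at \<open>H\<close>, then the slack of
    \<open>H\<close> vanishes wherever that of \<open>G\<close> does.\<close>
  have key: "G = H" if "G facet_of S" "H facet_of S" "G = S \<inter> {x. g \<bullet> x = g'}" "H = S \<inter> {x. h \<bullet> x = h'}"
      "S \<subseteq> {x. h \<bullet> x \<le> h'}" "S \<subseteq> {x. k \<bullet> x \<le> k'}"
      "\<alpha> > 0" "\<gamma> \<ge> 0" "\<And>x. \<beta> * (g' - g \<bullet> x) = \<alpha> * (h' - h \<bullet> x) + \<gamma> * (k' - k \<bullet> x)" 
    for G H g g' h h' k k' and \<alpha> \<beta> \<gamma> :: real
  proof (rule facet_subset_facet[OF S that(1,2)])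
    show "G \<subseteq> H"
    proof
      fix x assume "x \<in> G"
      then have x: "x \<in> S" "g \<bullet> x = g'" using that by auto
      then have "\<alpha> * (h' - h \<bullet> x) + \<gamma> * (k' - k \<bullet> x) = 0" using that(9)[of x] by simp
      moreover have "\<alpha> * (h' - h \<bullet> x) \<ge> 0" "\<gamma> * (k' - k \<bullet> x) \<ge> 0" using that x by auto
      ultimately have "\<alpha> * (h' - h \<bullet> x) = 0" by linarith
      then show "x \<in> H" using that x by auto
    qed
  qed
  note k12 = key[OF F(1,2) 1(2) 2(2) 2(1) 3(1)] and k13 = key[OF F(1,3) 1(2) 3(2) 3(1) 2(1)]
   and k21 = key[OF F(2,1) 2(2) 1(2) 1(1) 3(1)] and k23 = key[OF F(2,3) 2(2) 3(2) 3(1) 1(1)]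
   and k31 = key[OF F(3,1) 3(2) 1(2) 1(1) 2(1)]
  have relA: "(-a) * (d1 - c1 \<bullet> x) = b * (d2 - c2 \<bullet> x) + c * (d3 - c3 \<bullet> x)"
    "(a) * (d1 - c1 \<bullet> x) = (-b) * (d2 - c2 \<bullet> x) + (-c) * (d3 - c3 \<bullet> x)"
    "(-b) * (d2 - c2 \<bullet> x) = a * (d1 - c1 \<bullet> x) + c * (d3 - c3 \<bullet> x)"
    "(b) * (d2 - c2 \<bullet> x) = (-a) * (d1 - c1 \<bullet> x) + (-c) * (d3 - c3 \<bullet> x)"
    "(-c) * (d3 - c3 \<bullet> x) = a * (d1 - c1 \<bullet> x) + b * (d2 - c2 \<bullet> x)"
    "(c) * (d3 - c3 \<bullet> x) = (-a) * (d1 - c1 \<bullet> x) + (-b) * (d2 - c2 \<bullet> x)" for x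
    using rel[of x] by (auto simp: algebra_simps)
  have relB: "(-a) * (d1 - c1 \<bullet> x) = c * (d3 - c3 \<bullet> x) + b * (d2 - c2 \<bullet> x)"
    "(a) * (d1 - c1 \<bullet> x) = (-c) * (d3 - c3 \<bullet> x) + (-b) * (d2 - c2 \<bullet> x)"
    "(-b) * (d2 - c2 \<bullet> x) = c * (d3 - c3 \<bullet> x) + a * (d1 - c1 \<bullet> x)"
    "(b) * (d2 - c2 \<bullet> x) = (-c) * (d3 - c3 \<bullet> x) + (-a) * (d1 - c1 \<bullet> x)"
    "(-c) * (d3 - c3 \<bullet> x) = b * (d2 - c2 \<bullet> x) + a * (d1 - c1 \<bullet> x)"
    "(c) * (d3 - c3 \<bullet> x) = (-b) * (d2 - c2 \<bullet> x) + (-a) * (d1 - c1 \<bullet> x)" for x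
    using relA[of x] by linarith+
  \<comment> \<open>Some two of \<open>a\<close>, \<open>b\<close>, \<open>c\<close> have weakly
    equal signs and are not both zero; taking the third slack to the other side then brings the
    relation into the form of \<open>key\<close>. The ten facts exclude these sign patterns.\<close>
  have A1: "\<not> (b > 0 \<and> c \<ge> 0)" using k12[OF _ _ relA(1)] ne by auto
  have A2: "\<not> (-b > 0 \<and> -c \<ge> 0)" using k12[OF _ _ relA(2)] ne by auto
  have A3: "\<not> (c > 0 \<and> b \<ge> 0)" using k13[OF _ _ relB(1)] ne by auto
  have A4: "\<not> (-c > 0 \<and> -b \<ge> 0)" using k13[OF _ _ relB(2)] ne by auto
  have A5: "\<not> (a > 0 \<and> c \<ge> 0)" using k21[OF _ _ relA(3)] ne by auto
  have A6: "\<not> (-a > 0 \<and> -c \<ge> 0)" using k21[OF _ _ relA(4)] ne by auto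
  have A7: "\<not> (a > 0 \<and> b \<ge> 0)" using k31[OF _ _ relA(5)] ne by auto
  have A8: "\<not> (-a > 0 \<and> -b \<ge> 0)" using k31[OF _ _ relA(6)] ne by auto
  have A9: "\<not> (c > 0 \<and> a \<ge> 0)" using k23[OF _ _ relB(3)] ne by auto
  have A10: "\<not> (-c > 0 \<and> -a \<ge> 0)" using k23[OF _ _ relB(4)] ne by auto
  from A1 A2 A3 A4 A5 A6 A7 A8 A9 A10 abc show False by (smt (verit))
qed

text \<open>A face is the intersection of the facets containing it, so a single facet would coincide
  with the ridge; at most two is the preceding lemma.\<close>

lemma ridge_two_facets:
  fixes S :: "'a::euclidean_space set"
  assumes S: "polytope S" and R: "R face_of S" "R \<noteq> {}" "aff_dim R = aff_dim S - 2"
  obtains F G where "F \<noteq> G" "{F. F facet_of S \<and> R \<subseteq> F} = {F, G}"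
proof -
  define \<G> where "\<G> = {F. F facet_of S \<and> R \<subseteq> F}"
  have eq: "R = \<Inter>\<G>" unfolding \<G>_def
    by (rule face_of_polyhedron) (use S R in \<open>auto simp: polytope_imp_polyhedron\<close>)
  obtain F where F: "F facet_of S" "R \<subseteq> F"
    by (rule face_of_polyhedron_subset_facet[of S R]) (use S R in \<open>auto simp: polytope_imp_polyhedron\<close>)
  have "\<G> \<noteq> {F}"
  proof
    assume "\<G> = {F}" then have "R = F" using eq by auto
    then show False using F R by (auto simp: facet_of_def)
  qed
  then obtain G where G: "G \<in> \<G>" "G \<noteq> F" using F by (auto simp: \<G>_def)
  have "\<G> = {F, G}"
  proof
    show "\<G> \<subseteq> {F, G}"
    proof
      fix H assume H: "H \<in> \<G>"
      have "F = G \<or> F = H \<or> G = H"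
        by (rule at_most_two_facets_through_ridge[OF S R(2)]) (use R F G H in \<open>auto simp: \<G>_def\<close>)
      then show "H \<in> {F, G}" using G by auto
    qed
  qed (use F G in \<open>auto simp: \<G>_def\<close>)
  then show ?thesis using that[of F G] G by (auto simp: \<G>_def)
qed

text \<open>The pivot step of the simplex method. A hyperplane cuts \<open>w\<close> off from the
  other vertices, \<open>c\<close> is maximized on the section, and an extreme maximizer lies on an
  edge of \<open>S\<close>. This edge starts at \<open>w\<close>, and \<open>c\<close> increases
  along it.\<close>

lemma improving_edge:
  fixes S :: "'a::euclidean_space set"
  assumes S: "polytope S" and w: "w \<in> vertices S" and x: "x \<in> S" "c \<bullet> x > c \<bullet> w"
  obtains w' where "w' \<in> vertices S" "closed_segment w w' face_of S" "c \<bullet> w' > c \<bullet> w"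
proof -
  have "{w} exposed_face_of S"
    using w S by (simp add: exposed_face_of_polyhedron polytope_imp_polyhedron vertices_def face_of_singleton)
  then obtain h h0 where h: "S \<subseteq> {x. h \<bullet> x \<le> h0}" "{w} = S \<inter> {x. h \<bullet> x = h0}"
    unfolding exposed_face_of_def by blast
  have hw: "h \<bullet> w = h0" "w \<in> S" using h by auto
  have hlt: "h \<bullet> y < h0" if "y \<in> S" "y \<noteq> w" for y using h that by fastforce
  have xw: "x \<noteq> w" using x by auto
  \<comment> \<open>Including \<open>h \<bullet> x\<close> in the maximum places \<open>x\<close>
    beyond the cutting hyperplane too. The segment from \<open>w\<close> to \<open>x\<close> then
    meets the section in \<open>z\<close>, where \<open>c\<close> already exceeds its value at
    \<open>w\<close>.\<close>
  define m where "m = Max ((\<lambda>v. h \<bullet> v) ` (vertices S - {w}) \<union> {h \<bullet> x})"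
  have fin: "finite ((\<lambda>v. h \<bullet> v) ` (vertices S - {w}) \<union> {h \<bullet> x})" using finite_vertices[OF S] by auto
  have "m \<in> (\<lambda>v. h \<bullet> v) ` (vertices S - {w}) \<union> {h \<bullet> x}" unfolding m_def by (rule Max_in) (use fin in auto)
  then have mh: "m < h0" using hlt vertices_subset[of S] x xw by auto
  have mge: "h \<bullet> v \<le> m" if "v \<in> vertices S" "v \<noteq> w" for v
    unfolding m_def by (rule Max_ge[OF fin]) (use that in auto)
  have mx: "h \<bullet> x \<le> m" unfolding m_def by (rule Max_ge[OF fin]) auto
  define \<eta> where "\<eta> = (m + h0) / 2"
  have \<eta>: "m < \<eta>" "\<eta> < h0" using mh by (auto simp: \<eta>_def)
  define T where "T = S \<inter> {x. h \<bullet> x = \<eta>}"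
  define t0 where "t0 = (h0 - \<eta>) / (h0 - h \<bullet> x)"
  have t0: "0 < t0" "t0 < 1" using \<eta> mx mh by (auto simp: t0_def field_simps)
  define z where "z = (1 - t0) *\<^sub>R w + t0 *\<^sub>R x"
  have zS: "z \<in> S" unfolding z_def
    using S hw x t0 by (intro convexD_alt) (auto simp: polytope_imp_convex)
  have "h \<bullet> z = h0 - t0 * (h0 - h \<bullet> x)" unfolding z_def using hw by (simp add: inner_add_right algebra_simps)
  then have "h \<bullet> z = \<eta>" using mx mh by (simp add: t0_def)
  then have zT: "z \<in> T" using zS by (simp add: T_def)
  have cz: "c \<bullet> z > c \<bullet> w"
  proof -
    have "c \<bullet> z - c \<bullet> w = t0 * (c \<bullet> x - c \<bullet> w)" unfolding z_def by (simp add: inner_add_right algebra_simps)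
    also have "\<dots> > 0" using t0 x by simp
    finally show ?thesis by simp
  qed
  have T: "compact T" "convex T"
    unfolding T_def using S
    by (auto intro!: compact_Int_closed closed_hyperplane convex_Int convex_hyperplane simp: polytope_imp_compact polytope_imp_convex)
  obtain t1 where t1: "t1 \<in> T" "\<And>y. y \<in> T \<Longrightarrow> c \<bullet> y \<le> c \<bullet> t1"
  proof -
    have "continuous_on T (\<lambda>y. c \<bullet> y)" by (intro continuous_intros)
    then have "\<exists>x\<in>T. \<forall>y\<in>T. c \<bullet> y \<le> c \<bullet> x"
      using continuous_attains_sup[OF T(1), of "\<lambda>y. c \<bullet> y"] zT by blast
    then show ?thesis using that by blast
  qed
  define M where "M = T \<inter> {y. c \<bullet> y = c \<bullet> t1}"
  have MT: "M face_of T" unfolding M_def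
    by (rule face_of_Int_supporting_hyperplane_le) (use T t1 in auto)
  have "compact M" "convex M" using MT T by (auto simp: face_of_imp_compact face_of_imp_convex)
  moreover have "M \<noteq> {}" using t1 by (auto simp: M_def)
  ultimately obtain t where "t extreme_point_of M" using extreme_point_exists_convex by blast
  then have tT: "t extreme_point_of T" and tM: "t \<in> M" using MT extreme_point_of_face by blast+
  then have ct: "c \<bullet> t > c \<bullet> w" and ht: "h \<bullet> t = \<eta>" and tS: "t \<in> S"
    using t1 zT cz by (force simp: M_def T_def)+
  \<comment> \<open>The smallest face containing \<open>t\<close>, which therefore has
    \<open>t\<close> in its relative interior.\<close>
  define G where "G = \<Inter>{F. F face_of S \<and> t \<in> F}"
  have Sf: "S face_of S" using S by (simp add: face_of_refl polytope_imp_convex)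
  have GF: "G face_of S" unfolding G_def using Sf tS by (intro face_of_Inter) auto
  have tG: "t \<in> G" by (auto simp: G_def)
  have Gpoly: "polytope G" using GF S face_of_polytope_polytope by blast
  have tri: "t \<in> rel_interior G"
  proof (rule ccontr)
    assume "t \<notin> rel_interior G"
    then obtain F where F: "F facet_of G" "t \<in> F"
      using rel_boundary_of_polyhedron[of G] Gpoly tG polytope_imp_polyhedron by blast
    then have "F face_of S" using GF face_of_trans facet_of_imp_face_of by blast
    then have "G \<subseteq> F" using F by (auto simp: G_def)
    then show False using F facet_of_imp_subset[of F G] by (metis facet_of_irrefl subset_antisym)
  qed
  \<comment> \<open>In a face of dimension two or more the hyperplane leaves a direction
    \<open>e\<close> in which \<open>t\<close> can be moved both ways inside the section, against
    its extremality there.\<close>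
  have dG: "aff_dim G \<le> 1"
  proof (rule ccontr)
    assume "\<not> aff_dim G \<le> 1"
    have "affine hull G \<inter> {y. h \<bullet> y = \<eta>} \<noteq> {}" using tG ht hull_inc by fastforce
    then have "aff_dim (affine hull G \<inter> {y. h \<bullet> y = \<eta>}) \<ge> 1"
      using \<open>\<not> aff_dim G \<le> 1\<close> by (simp add: aff_dim_affine_Int_hyperplane)
    then have "\<not> affine hull G \<inter> {y. h \<bullet> y = \<eta>} \<subseteq> {t}"
      using aff_dim_subset[of "affine hull G \<inter> {y. h \<bullet> y = \<eta>}" "{t}"] aff_dim_sing[of t] by linarith
    then obtain y where y: "y \<in> affine hull G" "h \<bullet> y = \<eta>" "y \<noteq> t" by auto
    define e where "e = y - t"
    have e: "e \<noteq> 0" "h \<bullet> e = 0" using y ht by (auto simp: e_def inner_diff_right)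
    have aff: "t + s *\<^sub>R e \<in> affine hull G" for s
    proof -
      have "(1 - s) *\<^sub>R t + s *\<^sub>R y \<in> affine hull G"
        using mem_affine[OF affine_affine_hull[of G] hull_inc[OF tG] y(1)] by simp
      then show ?thesis by (simp add: e_def algebra_simps)
    qed
    obtain \<epsilon> where \<epsilon>: "\<epsilon> > 0" "ball t \<epsilon> \<inter> affine hull G \<subseteq> G" using tri by (auto simp: mem_rel_interior_ball)
    define s where "s = \<epsilon> / (2 * norm e)"
    have s: "s > 0" "s * norm e < \<epsilon>" using \<epsilon> e by (auto simp: s_def)
    have ein: "t + s *\<^sub>R e \<in> G" "t + (-s) *\<^sub>R e \<in> G"
      using \<epsilon> aff[of s] aff[of "-s"] s by (auto simp: dist_norm)
    have "t + s *\<^sub>R e \<in> T" "t + (-s) *\<^sub>R e \<in> T"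
      using ein e ht GF by (auto simp: T_def inner_add_right inner_diff_right dest: face_of_imp_subset)
    moreover have "t \<in> open_segment (t + s *\<^sub>R e) (t + (-s) *\<^sub>R e)"
    proof -
      have "t = midpoint (t + s *\<^sub>R e) (t + (-s) *\<^sub>R e)" by (simp add: midpoint_def scaleR_2[symmetric] scaleR_add_right[symmetric])
      moreover have "t + s *\<^sub>R e \<noteq> t + (-s) *\<^sub>R e"
      proof
        assume "t + s *\<^sub>R e = t + (-s) *\<^sub>R e"
        then have "2 *\<^sub>R (s *\<^sub>R e) = 0" unfolding scaleR_2 by (simp add: eq_neg_iff_add_eq_0)
        then show False using e s by simp
      qed
      ultimately show ?thesis by (metis midpoint_in_open_segment)
    qed
    ultimately show False using tT by (auto simp: extreme_point_of_def)
  qed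
  have "vertices G \<noteq> {t}"
  proof
    assume "vertices G = {t}"
    then have "t \<in> vertices S" using vertices_face[OF GF] by auto
    then show False using mge[of t] ht \<eta> hw by auto
  qed
  obtain p q where pq: "G = closed_segment p q"
  proof -
    have "collinear G" using dG by (simp add: collinear_aff_dim)
    then show ?thesis using compact_convex_collinear_segment[of G] that tG Gpoly
      by (metis empty_iff polytope_imp_compact polytope_imp_convex)
  qed
  have pqS: "p \<in> vertices S" "q \<in> vertices S"
    using segment_face_of GF pq by (auto simp: vertices_def)
  have tpq: "t \<in> closed_segment p q" using tG pq by simp
  then obtain u where u: "0 \<le> u" "u \<le> 1" "t = (1 - u) *\<^sub>R p + u *\<^sub>R q"
    by (auto simp: in_segment)
  \<comment> \<open>With both ends different from \<open>w\<close>, the value of \<open>h\<close> on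
    the whole segment would stay at most \<open>m\<close>, below its value \<eta> at
    \<open>t\<close>.\<close>
  have "p = w \<or> q = w"
  proof (rule ccontr)
    assume "\<not> (p = w \<or> q = w)"
    then have "h \<bullet> p \<le> m" "h \<bullet> q \<le> m" using mge pqS by auto
    then have "(1 - u) * (h \<bullet> p) + u * (h \<bullet> q) \<le> (1 - u) * m + u * m"
      using u by (intro add_mono mult_left_mono) auto
    also have "\<dots> = m" by (simp add: algebra_simps)
    finally have "h \<bullet> t \<le> m" using u by (simp add: inner_add_right)
    then show False using ht \<eta> by simp
  qed
  then show ?thesis
  proof
    assume p: "p = w"
    have "c \<bullet> t - c \<bullet> w = u * (c \<bullet> q - c \<bullet> w)" unfolding u(3) using p by (simp add: inner_add_right algebra_simps)
    then have "u * (c \<bullet> q - c \<bullet> w) > 0" using ct by simp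
    then have "c \<bullet> q > c \<bullet> w" using u by (simp add: zero_less_mult_iff)
    then show ?thesis using that[of q] pqS GF pq p by simp
  next
    assume q: "q = w"
    have "c \<bullet> t - c \<bullet> w = (1 - u) * (c \<bullet> p - c \<bullet> w)" unfolding u(3) using q by (simp add: inner_add_right algebra_simps)
    then have "(1 - u) * (c \<bullet> p - c \<bullet> w) > 0" using ct by simp
    then have "c \<bullet> p > c \<bullet> w" using u by (simp add: zero_less_mult_iff)
    then show ?thesis using that[of p] pqS GF pq q by (simp add: closed_segment_commute)
  qed
qed

text \<open>For a vertex \<open>u\<close> outside \<open>W\<close> take a functional
  \<open>h\<close> that is maximal only at \<open>u\<close>. From the member of \<open>W\<close>
  with the largest value of \<open>h\<close> an improving edge leads to a still larger value, and
  its end is again in \<open>W\<close>.\<close>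

lemma vertices_edge_connected:
  fixes S :: "'a::euclidean_space set"
  assumes S: "polytope S" and W: "W \<subseteq> vertices S" "W \<noteq> {}"
    and clos: "\<And>w w'. \<lbrakk>w \<in> W; w' \<in> vertices S; w' \<noteq> w; closed_segment w w' face_of S\<rbrakk> \<Longrightarrow> w' \<in> W"
  shows "W = vertices S"
proof (rule ccontr)
  assume "W \<noteq> vertices S"
  then obtain u where u: "u \<in> vertices S" "u \<notin> W" using W by auto
  have "{u} exposed_face_of S"
    using u S by (simp add: exposed_face_of_polyhedron polytope_imp_polyhedron vertices_def face_of_singleton)
  then obtain h h0 where h: "S \<subseteq> {x. h \<bullet> x \<le> h0}" "{u} = S \<inter> {x. h \<bullet> x = h0}"
    unfolding exposed_face_of_def by blast
  have fin: "finite W" using W finite_vertices[OF S] finite_subset by blast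
  obtain w where w: "w \<in> W" "\<And>v. v \<in> W \<Longrightarrow> h \<bullet> v \<le> h \<bullet> w"
  proof -
    have "Max ((\<lambda>v. h \<bullet> v) ` W) \<in> (\<lambda>v. h \<bullet> v) ` W" using fin W by (intro Max_in) auto
    then show ?thesis using that Max_ge[of "(\<lambda>v. h \<bullet> v) ` W"] fin by fastforce
  qed
  have "w \<in> S" "w \<noteq> u" using w W u vertices_subset[of S] by auto
  moreover have "h \<bullet> u = h0" using h(2) by blast
  moreover have "h \<bullet> w \<noteq> h0" using h(2) \<open>w \<in> S\<close> \<open>w \<noteq> u\<close> by blast
  ultimately have "h \<bullet> w < h \<bullet> u" using h(1) by force
  moreover have "u \<in> S" using h by auto
  ultimately obtain w' where w': "w' \<in> vertices S" "closed_segment w w' face_of S" "h \<bullet> w' > h \<bullet> w"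
    using improving_edge[OF S] w W by blast
  then have "w' \<in> W" using clos[of w w'] w by auto
  then show False using w w' by fastforce
qed

lemma low_dim_face_segment:
  fixes P :: "'a::euclidean_space set"
  assumes P: "polytope P" and E: "E face_of P" "aff_dim E \<le> 1"
    and uv: "u \<in> vertices P" "v \<in> vertices P" "u \<in> E" "v \<in> E" "u \<noteq> v"
  shows "E = closed_segment u v" "vertices P \<inter> E = {u, v}"
proof -
  have pE: "polytope E" using P E face_of_polytope_polytope by blast
  have "collinear E" using E by (simp add: collinear_aff_dim)
  then obtain p q where pq: "E = closed_segment p q"
    using compact_convex_collinear_segment[of E] uv pE
    by (metis empty_iff polytope_imp_compact polytope_imp_convex)
  have "vertices E = {p, q}" by (auto simp: pq vertices_def extreme_point_of_segment)
  then have *: "vertices P \<inter> E = {p, q}" using vertices_face[OF E(1)] by simp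
  moreover have "u \<in> vertices P \<inter> E" "v \<in> vertices P \<inter> E" using uv by auto
  ultimately have "u = p \<and> v = q \<or> u = q \<and> v = p" using uv by auto
  then have "closed_segment p q = closed_segment u v" "{p, q} = {u, v}"
    by (auto simp: closed_segment_commute)
  then show "E = closed_segment u v" "vertices P \<inter> E = {u, v}"
    using pq * by simp_all
qed

lemma aff_dim_closed_segment: "aff_dim (closed_segment u v) = (if u = v then 0 else 1)"
  by (simp add: segment_convex_hull aff_dim_convex_hull aff_dim_2)

lemma aff_dim_facet_Int:
  assumes "polytope P" "F facet_of P" "G facet_of P" "F \<noteq> G"
  shows "aff_dim (F \<inter> G) \<le> aff_dim P - 2"
proof -
  have "F \<inter> G face_of F" using assms by (metis face_of_Int face_of_face facet_of_imp_face_of inf_le1)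
  moreover have "F \<inter> G \<noteq> F" using assms facet_subset_facet by blast
  moreover have "convex F" using assms facet_of_imp_face_of face_of_imp_convex by blast
  ultimately have "aff_dim (F \<inter> G) < aff_dim F" using face_of_aff_dim_lt by blast
  then show ?thesis using assms by (auto simp: facet_of_def)
qed

section \<open>Vertex-facet incidences of a three-dimensional polytope\<close>

locale polytope3 =
  fixes P :: "'a::euclidean_space set"
  assumes poly: "polytope P" and dim3: "aff_dim P = 3"
begin

lemma facet_Int_face: "F facet_of P \<Longrightarrow> G facet_of P \<Longrightarrow> F \<inter> G face_of P"
  by (simp add: face_of_Int facet_of_imp_face_of)

lemma facets_meet:
  assumes "F facet_of P" "G facet_of P" "F \<noteq> G"
    "u \<in> vertices P" "v \<in> vertices P" "u \<in> F" "u \<in> G" "v \<in> F" "v \<in> G" "u \<noteq> v"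
  shows "F \<inter> G = closed_segment u v" "vertices P \<inter> F \<inter> G = {u, v}"
  using low_dim_face_segment[OF poly facet_Int_face[OF assms(1,2)], of u v]
    aff_dim_facet_Int[OF poly assms(1-3)] assms dim3 by auto

lemma at_most_two_facets_common:
  assumes "F facet_of P" "G facet_of P" "H facet_of P" "u \<noteq> v" "{u, v} \<subseteq> F" "{u, v} \<subseteq> G" "{u, v} \<subseteq> H"
  shows "F = G \<or> F = H \<or> G = H"
  by (rule at_most_two_facets_through_ridge[OF poly, of "{u,v}"]) (use assms dim3 in \<open>auto simp: aff_dim_2\<close>)

lemma edge_two_facets:
  assumes "closed_segment u v face_of P" "u \<noteq> v"
  obtains F G where "F facet_of P" "G facet_of P" "F \<noteq> G" "u \<in> F" "u \<in> G" "v \<in> F" "v \<in> G"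
proof -
  obtain F G where FG: "F \<noteq> G" "{F. F facet_of P \<and> closed_segment u v \<subseteq> F} = {F, G}"
    by (rule ridge_two_facets[OF poly assms(1)]) (use assms dim3 in \<open>auto simp: aff_dim_closed_segment\<close>)
  then have "F facet_of P \<and> closed_segment u v \<subseteq> F" "G facet_of P \<and> closed_segment u v \<subseteq> G" by blast+
  then show ?thesis using that[of F G] FG(1) by auto
qed

lemma edge_other_facet:
  assumes "closed_segment u v face_of P" "u \<noteq> v" "F facet_of P"
  obtains G where "G facet_of P" "G \<noteq> F" "u \<in> G" "v \<in> G"
  using edge_two_facets[OF assms(1,2)] by metis

lemma face_of_facet_edge:
  assumes F: "F facet_of P" and E: "E facet_of F" and v: "v \<in> vertices P" "v \<in> E"
  obtains w where "w \<in> vertices P" "w \<noteq> v" "w \<in> F" "E = closed_segment v w" "closed_segment v w face_of P"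
proof -
  have EP: "E face_of P" using E F facet_of_imp_face_of face_of_trans by blast
  have dE: "aff_dim E = 1" using E F dim3 by (auto simp: facet_of_def)
  have "vertices P \<inter> E \<noteq> {v}"
  proof
    assume "vertices P \<inter> E = {v}"
    then have "E = {v}" using face_hull_vertices[OF poly EP] by (metis convex_hull_singleton)
    then show False using dE by simp
  qed
  then obtain w where w: "w \<in> vertices P" "w \<in> E" "w \<noteq> v" using v by auto
  have "E = closed_segment v w"
    using low_dim_face_segment[OF poly EP] dE v w by auto
  then show ?thesis using that[of w] w EP facet_of_imp_subset[OF E] by auto
qed

text \<open>The vertex \<open>v\<close> is a ridge of the polygon \<open>F\<close>, hence lies on
  two of its edges. Adjacency is expressed by a second facet \<open>G\<close> through both vertices,
  so that it can be read off from incidences alone: such a \<open>G\<close> exists along every edge,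
  and conversely \<open>F \<inter> G\<close> is then an edge.\<close>

lemma two_neighbours_in_facet:
  assumes F: "F facet_of P" and v: "v \<in> vertices P" "v \<in> F"
  shows "\<exists>w1 w2. w1 \<noteq> w2 \<and>
    {w \<in> vertices P. w \<noteq> v \<and> w \<in> F \<and> (\<exists>G. G facet_of P \<and> G \<noteq> F \<and> v \<in> G \<and> w \<in> G)} = {w1, w2}"
    (is "\<exists>w1 w2. _ \<and> ?A = _")
proof -
  have FP: "F face_of P" using F facet_of_imp_face_of by blast
  have pF: "polytope F" using FP poly face_of_polytope_polytope by blast
  have dF: "aff_dim F = 2" using F dim3 by (auto simp: facet_of_def)
  have "{v} face_of F" using v vertices_face[OF FP] by (auto simp: face_of_singleton vertices_def)
  then obtain E1 E2 where E: "E1 \<noteq> E2" "{E. E facet_of F \<and> {v} \<subseteq> E} = {E1, E2}"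
    by (rule ridge_two_facets[OF pF]) (use dF in auto)
  then have "E1 \<in> {E. E facet_of F \<and> {v} \<subseteq> E}" "E2 \<in> {E. E facet_of F \<and> {v} \<subseteq> E}" by simp_all
  then have E': "E1 facet_of F" "v \<in> E1" "E2 facet_of F" "v \<in> E2" by simp_all
  obtain w1 where w1: "w1 \<in> vertices P" "w1 \<noteq> v" "w1 \<in> F" "E1 = closed_segment v w1" "closed_segment v w1 face_of P"
    by (rule face_of_facet_edge[OF F, of E1 v]) (use v E' in auto)
  obtain w2 where w2: "w2 \<in> vertices P" "w2 \<noteq> v" "w2 \<in> F" "E2 = closed_segment v w2" "closed_segment v w2 face_of P"
    by (rule face_of_facet_edge[OF F, of E2 v]) (use v E' in auto)
  have ne: "w1 \<noteq> w2" using E(1) w1(4) w2(4) by metis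
  have "\<exists>G. G facet_of P \<and> G \<noteq> F \<and> v \<in> G \<and> w1 \<in> G" "\<exists>G. G facet_of P \<and> G \<noteq> F \<and> v \<in> G \<and> w2 \<in> G"
    by (rule edge_other_facet[OF w1(5) w1(2)[symmetric] F], blast)
       (rule edge_other_facet[OF w2(5) w2(2)[symmetric] F], blast)
  then have sup: "w1 \<in> ?A" "w2 \<in> ?A" using w1(1-3) w2(1-3) by simp_all
  have sub: "w \<in> {w1, w2}" if w: "w \<in> vertices P" "w \<noteq> v" "w \<in> F" "G facet_of P" "G \<noteq> F" "v \<in> G" "w \<in> G" for w G
  proof -
    have seg: "F \<inter> G = closed_segment v w" using facets_meet(1)[OF F w(4)] v w by auto
    have "F \<inter> G face_of F" using facet_Int_face[OF F w(4)] by (simp add: face_of_face[OF FP])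
    then have "F \<inter> G facet_of F" using dF seg w by (auto simp: facet_of_def aff_dim_closed_segment)
    then have "F \<inter> G \<in> {E. E facet_of F \<and> {v} \<subseteq> E}" using v w by simp
    then have "F \<inter> G \<in> {E1, E2}" unfolding E(2) .
    then have "closed_segment v w = closed_segment v w1 \<or> closed_segment v w = closed_segment v w2"
      unfolding w1(4) w2(4) seg by simp
    then have "{v, w} = {v, w1} \<or> {v, w} = {v, w2}" by (simp only: closed_segment_eq)
    then show ?thesis using w(2) by (metis doubleton_eq_iff insertCI)
  qed
  have "?A = {w1, w2}"
  proof (rule subset_antisym)
    show "?A \<subseteq> {w1, w2}"
    proof
      fix w assume "w \<in> ?A"
      then obtain G where "w \<in> vertices P" "w \<noteq> v" "w \<in> F" "G facet_of P" "G \<noteq> F" "v \<in> G" "w \<in> G" by auto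
      then show "w \<in> {w1, w2}" by (rule sub)
    qed
  qed (use sup in simp)
  then show ?thesis using ne by blast
qed

text \<open>Connectedness of the edge graph with edges replaced by pairs of facets with common
  vertices, the form available to an abstract incidence structure.\<close>

lemma vertices_connected:
  assumes "W \<subseteq> vertices P" "W \<noteq> {}"
    "\<And>w w' F G. \<lbrakk>w \<in> W; w' \<in> vertices P; F facet_of P; G facet_of P; F \<noteq> G; w \<in> F; w \<in> G; w' \<in> F; w' \<in> G\<rbrakk> \<Longrightarrow> w' \<in> W"
  shows "W = vertices P"
proof (rule vertices_edge_connected[OF poly assms(1,2)])
  fix w w' assume w: "w \<in> W" "w' \<in> vertices P" "w' \<noteq> w" "closed_segment w w' face_of P"
  obtain F G where "F facet_of P" "G facet_of P" "F \<noteq> G" "w \<in> F" "w \<in> G" "w' \<in> F" "w' \<in> G"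
    by (rule edge_two_facets[OF w(4)]) (use w in auto)
  then show "w' \<in> W" using assms(3) w by blast
qed

lemma facet_vertices_connected:
  assumes F: "F facet_of P" and W: "W \<subseteq> vertices P \<inter> F" "W \<noteq> {}"
    and clos: "\<And>w w' G. \<lbrakk>w \<in> W; w' \<in> vertices P; w' \<in> F; G facet_of P; G \<noteq> F; w \<in> G; w' \<in> G\<rbrakk> \<Longrightarrow> w' \<in> W"
  shows "W = vertices P \<inter> F"
proof -
  have FP: "F face_of P" using F facet_of_imp_face_of by blast
  have pF: "polytope F" using FP poly face_of_polytope_polytope by blast
  have vF: "vertices F = vertices P \<inter> F" by (rule vertices_face[OF FP])
  have "W = vertices F"
  proof (rule vertices_edge_connected[OF pF])
    show "W \<subseteq> vertices F" using W vF by simp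
  next
    fix w w' assume w: "w \<in> W" "w' \<in> vertices F" "w' \<noteq> w" "closed_segment w w' face_of F"
    then have "closed_segment w w' face_of P" using FP face_of_trans by blast
    then obtain G where "G facet_of P" "G \<noteq> F" "w \<in> G" "w' \<in> G" using edge_other_facet[OF _ _ F] w by metis
    then show "w' \<in> W" using clos[of w w' G] w vF by auto
  qed (rule W)
  then show ?thesis using vF by simp
qed

lemma vertex_in_facet: "v \<in> vertices P \<Longrightarrow> \<exists>F. F facet_of P \<and> v \<in> F"
proof -
  assume "v \<in> vertices P"
  then have "{v} face_of P" by (simp add: vertices_def face_of_singleton)
  moreover have "{v} \<noteq> P" using dim3 by auto
  ultimately show ?thesis
    using face_of_polyhedron_subset_facet[of P "{v}"] poly polytope_imp_polyhedron by (metis insert_not_empty insert_subset)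
qed

lemma facet_has_vertex: "F facet_of P \<Longrightarrow> vertices P \<inter> F \<noteq> {}"
  using face_has_vertex[OF poly] by (auto simp: facet_of_def)

lemma facet_misses_vertex: "F facet_of P \<Longrightarrow> \<exists>v\<in>vertices P. v \<notin> F"
proof (rule ccontr)
  assume F: "F facet_of P" and "\<not> ?thesis"
  then have "vertices P \<inter> F = vertices P \<inter> P" using vertices_subset[of P] by auto
  then have "F = P" using face_eq_iff_vertices[OF poly, of F P] F poly
    by (simp add: face_of_refl facet_of_imp_face_of polytope_imp_convex)
  then show False using F by auto
qed

text \<open>Follow the boundary of a facet through \<open>v\<close> past a neighbour
  \<open>w1\<close> to the next vertex \<open>y\<close>. A second facet contains the edge from
  \<open>w1\<close> to \<open>y\<close>; it meets the first one only in this edge and so avoids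
  \<open>v\<close>.\<close>

lemma vertex_misses_facet: "v \<in> vertices P \<Longrightarrow> \<exists>F. F facet_of P \<and> v \<notin> F"
proof -
  assume v: "v \<in> vertices P"
  obtain F where F: "F facet_of P" "v \<in> F" using vertex_in_facet[OF v] by auto
  obtain w1 w2 where w: "w1 \<noteq> w2"
    "{w \<in> vertices P. w \<noteq> v \<and> w \<in> F \<and> (\<exists>G. G facet_of P \<and> G \<noteq> F \<and> v \<in> G \<and> w \<in> G)} = {w1, w2}"
    using two_neighbours_in_facet[OF F(1) v F(2)] by blast
  then have w1: "w1 \<in> vertices P" "w1 \<noteq> v" "w1 \<in> F" by blast+
  have w2: "w2 \<in> vertices P" "w2 \<noteq> v" "w2 \<in> F" using w by blast+
  obtain x1 x2 where x: "x1 \<noteq> x2"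
    "{w \<in> vertices P. w \<noteq> w1 \<and> w \<in> F \<and> (\<exists>G. G facet_of P \<and> G \<noteq> F \<and> w1 \<in> G \<and> w \<in> G)} = {x1, x2}"
    using two_neighbours_in_facet[OF F(1) w1(1) w1(3)] by blast
  obtain y where y: "y \<in> {x1, x2}" "y \<noteq> v" using x(1) by auto
  then have "y \<in> {w \<in> vertices P. w \<noteq> w1 \<and> w \<in> F \<and> (\<exists>G. G facet_of P \<and> G \<noteq> F \<and> w1 \<in> G \<and> w \<in> G)}"
    using x(2) by simp
  then obtain G where G: "y \<in> vertices P" "y \<noteq> w1" "y \<in> F" "G facet_of P" "G \<noteq> F" "w1 \<in> G" "y \<in> G" by auto
  have "vertices P \<inter> F \<inter> G = {w1, y}" by (rule facets_meet(2)[OF F(1) G(4)]) (use G w1 in auto)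
  then have "v \<notin> G" using v F y w1 by auto
  then show ?thesis using G by blast
qed

end

section \<open>Combinatorial equivalence and vertex-facet incidences\<close>

text \<open>This family determines the face lattice, since a proper nonempty face is an intersection
  of facets and every face is the hull of its vertices.\<close>

definition facet_sets :: "'a::euclidean_space set \<Rightarrow> 'a set set" where
  "facet_sets P = {vertices P \<inter> F | F. F facet_of P}"

text \<open>A proper nonempty face is the intersection of the facets containing it; the
  corresponding facets of \<open>Q\<close> intersect in a face whose vertices are the
  images.\<close>

lemma vertex_map_face:
  assumes P: "polytope P" and Q: "polytope Q" and bij: "bij_betw \<phi> (vertices P) (vertices Q)"
    and fs: "(`) \<phi> ` facet_sets P \<subseteq> facet_sets Q" and F: "F face_of P"
  shows "convex hull (\<phi> ` (vertices P \<inter> F)) face_of Q"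
    and "vertices Q \<inter> convex hull (\<phi> ` (vertices P \<inter> F)) = \<phi> ` (vertices P \<inter> F)"
proof -
  have im: "\<phi> ` vertices P = vertices Q" and inj: "inj_on \<phi> (vertices P)"
    using bij by (auto simp: bij_betw_def)
  obtain F' where F': "F' face_of Q" "vertices Q \<inter> F' = \<phi> ` (vertices P \<inter> F)"
  proof -
    consider "F = {}" | "F = P" | "F \<noteq> {}" "F \<noteq> P" by blast
    then show ?thesis
    proof cases
      case 1 then show ?thesis using that[of "{}"] by simp
    next
      case 2
      have "Q face_of Q" using Q by (simp add: face_of_refl polytope_imp_convex)
      then show ?thesis using that[of Q] 2 im vertices_subset[of P] vertices_subset[of Q] by (simp add: Int_absorb2)
    next
      case 3
      define G where "G = {G. G facet_of P \<and> F \<subseteq> G}"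
      define G' where "G' = {H. H facet_of Q \<and> (\<exists>K\<in>G. vertices Q \<inter> H = \<phi> ` (vertices P \<inter> K))}"
      have eq: "F = \<Inter>G" unfolding G_def
        by (rule face_of_polyhedron) (use P F 3 in \<open>auto simp: polytope_imp_polyhedron\<close>)
      have ex: "\<exists>H\<in>G'. vertices Q \<inter> H = \<phi> ` (vertices P \<inter> K)" if "K \<in> G" for K
      proof -
        have "\<phi> ` (vertices P \<inter> K) \<in> facet_sets Q" using fs that by (auto simp: facet_sets_def G_def)
        then show ?thesis using that unfolding facet_sets_def G'_def by auto
      qed
      have "G \<noteq> {}"
        using face_of_polyhedron_subset_facet[of P F] P F 3 by (auto simp: G_def polytope_imp_polyhedron)
      then obtain H0 where "H0 \<in> G'" using ex by blast
      then have "\<Inter>G' face_of Q" by (intro face_of_Inter) (auto simp: G'_def facet_of_imp_face_of)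
      moreover have "vertices Q \<inter> \<Inter>G' = \<phi> ` (vertices P \<inter> F)"
      proof (intro subset_antisym subsetI)
        fix w assume w: "w \<in> vertices Q \<inter> \<Inter>G'"
        then obtain v where v: "v \<in> vertices P" "w = \<phi> v" using im by auto
        have "v \<in> K" if "K \<in> G" for K
        proof -
          obtain H where "H \<in> G'" "vertices Q \<inter> H = \<phi> ` (vertices P \<inter> K)" using ex[OF \<open>K \<in> G\<close>] by auto
          then have "w \<in> \<phi> ` (vertices P \<inter> K)" using w by auto
          then show ?thesis using v inj by (auto simp: inj_on_def)
        qed
        then show "w \<in> \<phi> ` (vertices P \<inter> F)" using v eq by auto
      next
        fix w assume "w \<in> \<phi> ` (vertices P \<inter> F)"
        then obtain v where v: "v \<in> vertices P" "v \<in> F" "w = \<phi> v" by auto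
        then have "w \<in> H" if "H \<in> G'" for H using that eq by (auto simp: G'_def)
        then show "w \<in> vertices Q \<inter> \<Inter>G'" using v im by auto
      qed
      ultimately show ?thesis using that by blast
    qed
  qed
  then have "convex hull (\<phi> ` (vertices P \<inter> F)) = F'" using face_hull_vertices[OF Q F'(1)] by simp
  then show "convex hull (\<phi> ` (vertices P \<inter> F)) face_of Q"
    "vertices Q \<inter> convex hull (\<phi> ` (vertices P \<inter> F)) = \<phi> ` (vertices P \<inter> F)"
    using F' by auto
qed

lemma combinatorially_equivalent_vertex_bij:
  assumes P: "polytope P" and Q: "polytope Q" and bij: "bij_betw \<phi> (vertices P) (vertices Q)"
    and fs: "(`) \<phi> ` facet_sets P = facet_sets Q"
  shows "combinatorially_equivalent P Q"
proof -
  define \<psi> where "\<psi> = inv_into (vertices P) \<phi>"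
  have bij': "bij_betw \<psi> (vertices Q) (vertices P)" unfolding \<psi>_def by (rule bij_betw_inv_into[OF bij])
  have inv: "\<psi> ` \<phi> ` X = X" if "X \<subseteq> vertices P" for X
    using that bij unfolding \<psi>_def by (simp add: bij_betw_def inv_into_image_cancel)
  have inv': "\<phi> ` \<psi> ` X = X" if "X \<subseteq> vertices Q" for X
    using that bij unfolding \<psi>_def by (simp add: bij_betw_def image_inv_into_cancel)
  have fs': "(`) \<psi> ` facet_sets Q = facet_sets P"
  proof -
    have "(`) \<psi> ` (`) \<phi> ` facet_sets P = (\<lambda>X. X) ` facet_sets P"
    proof -
      have "\<psi> ` \<phi> ` X = X" if "X \<in> facet_sets P" for X using that inv by (auto simp: facet_sets_def)
      then show ?thesis by (subst image_image, intro image_cong) auto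
    qed
    then show ?thesis using fs by simp
  qed
  define f where "f = (\<lambda>F. convex hull (\<phi> ` (vertices P \<inter> F)))"
  define g where "g = (\<lambda>F. convex hull (\<psi> ` (vertices Q \<inter> F)))"
  note fF = vertex_map_face[OF P Q bij eq_refl[OF fs]] and gF = vertex_map_face[OF Q P bij' eq_refl[OF fs']]
  have gf: "g (f F) = F" if "F face_of P" for F
    unfolding g_def f_def fF(2)[OF that] by (simp add: inv face_hull_vertices[OF P that])
  have fg: "f (g F) = F" if "F face_of Q" for F
    unfolding g_def f_def gF(2)[OF that] by (simp add: inv' face_hull_vertices[OF Q that])
  have mono: "f F \<subseteq> f F'" if "F \<subseteq> F'" for F F' unfolding f_def using that by (intro hull_mono) auto
  have mono': "g F \<subseteq> g F'" if "F \<subseteq> F'" for F F' unfolding g_def using that by (intro hull_mono) auto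
  have "bij_betw f {F. F face_of P} {G. G face_of Q}"
    by (rule bij_betw_byWitness[where f' = g]) (use fF gF gf fg in \<open>auto simp: f_def g_def\<close>)
  moreover have "F \<subseteq> F' \<longleftrightarrow> f F \<subseteq> f F'" if "F face_of P" "F' face_of P" for F F'
    using mono[of F F'] mono'[of "f F" "f F'"] gf that by auto
  ultimately show ?thesis unfolding combinatorially_equivalent_def by blast
qed

lemma combinatorially_equivalent_sym:
  assumes "combinatorially_equivalent P Q"
  shows "combinatorially_equivalent Q P"
proof -
  obtain f where f: "bij_betw f {F. F face_of P} {G. G face_of Q}"
    and m: "\<And>F F'. F face_of P \<Longrightarrow> F' face_of P \<Longrightarrow> F \<subseteq> F' \<longleftrightarrow> f F \<subseteq> f F'"
    using assms unfolding combinatorially_equivalent_def by blast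
  define g where "g = inv_into {F. F face_of P} f"
  have "bij_betw g {G. G face_of Q} {F. F face_of P}" unfolding g_def by (rule bij_betw_inv_into[OF f])
  moreover have "G \<subseteq> G' \<longleftrightarrow> g G \<subseteq> g G'" if "G face_of Q" "G' face_of Q" for G G'
  proof -
    have "g G face_of P" "g G' face_of P" "f (g G) = G" "f (g G') = G'"
      using that calculation bij_betw_inv_into_right[OF f] by (auto simp: g_def bij_betw_def)
    then show ?thesis using m[of "g G" "g G'"] by simp
  qed
  ultimately show ?thesis unfolding combinatorially_equivalent_def by blast
qed

lemma combinatorially_equivalent_trans:
  assumes "combinatorially_equivalent P Q" "combinatorially_equivalent Q R"
  shows "combinatorially_equivalent P R"
proof -
  obtain f where f: "bij_betw f {F. F face_of P} {G. G face_of Q}"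
    and m: "\<And>F F'. F face_of P \<Longrightarrow> F' face_of P \<Longrightarrow> F \<subseteq> F' \<longleftrightarrow> f F \<subseteq> f F'"
    using assms(1) unfolding combinatorially_equivalent_def by blast
  obtain g where g: "bij_betw g {F. F face_of Q} {G. G face_of R}"
    and n: "\<And>F F'. F face_of Q \<Longrightarrow> F' face_of Q \<Longrightarrow> F \<subseteq> F' \<longleftrightarrow> g F \<subseteq> g F'"
    using assms(2) unfolding combinatorially_equivalent_def by blast
  have "bij_betw (g \<circ> f) {F. F face_of P} {G. G face_of R}" by (rule bij_betw_trans[OF f g])
  moreover have "f F face_of Q" if "F face_of P" for F using f that by (auto simp: bij_betw_def)
  ultimately show ?thesis unfolding combinatorially_equivalent_def
    by (intro exI[of _ "g \<circ> f"]) (simp add: m n)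
qed

lemma combinatorially_equivalent_refl: "combinatorially_equivalent P P"
  unfolding combinatorially_equivalent_def by (intro exI[of _ id]) auto

text \<open>An order isomorphism preserves the minimal nonempty and the maximal proper elements of
  the face lattice. The former are the vertices, the latter the facets.\<close>

lemma vertex_bij_of_combinatorially_equivalent:
  assumes P: "polytope P" and Q: "polytope Q" and eqv: "combinatorially_equivalent P Q"
  obtains \<phi> where "bij_betw \<phi> (vertices P) (vertices Q)" "(`) \<phi> ` facet_sets P = facet_sets Q"
proof -
  obtain f where f: "bij_betw f {F. F face_of P} {G. G face_of Q}"
    and m: "\<And>F F'. F face_of P \<Longrightarrow> F' face_of P \<Longrightarrow> F \<subseteq> F' \<longleftrightarrow> f F \<subseteq> f F'"
    using eqv unfolding combinatorially_equivalent_def by blast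
  have ff: "f F face_of Q" if "F face_of P" for F using f that by (auto simp: bij_betw_def)
  have inj: "F = F'" if "F face_of P" "F' face_of P" "f F = f F'" for F F'
    using f that by (auto simp: bij_betw_def inj_on_def)
  have sur: "\<exists>F. F face_of P \<and> f F = G" if "G face_of Q" for G
  proof -
    have "G \<in> f ` {F. F face_of P}" using f that by (simp add: bij_betw_def)
    then show ?thesis by auto
  qed
  have PP: "P face_of P" and QQ: "Q face_of Q"
    using P Q by (auto simp: face_of_refl polytope_imp_convex)
  have f0: "f {} = {}"
  proof -
    obtain F where "F face_of P" "f F = {}" using sur[of "{}"] by auto
    then show ?thesis using m[of "{}" F] by auto
  qed
  have f1: "f P = Q"
  proof -
    obtain F where F: "F face_of P" "f F = Q" using sur[OF QQ] by auto
    then have "Q \<subseteq> f P" using m[of F P] PP face_of_imp_subset by blast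
    then show ?thesis using ff[OF PP] face_of_imp_subset by blast
  qed
  have vf: "{v} face_of P" if "v \<in> vertices P" for v using that by (simp add: vertices_def face_of_singleton)
  have vf': "{v} face_of Q" if "v \<in> vertices Q" for v using that by (simp add: vertices_def face_of_singleton)
  have v1: "\<exists>w\<in>vertices Q. f {v} = {w}" if v: "v \<in> vertices P" for v
  proof -
    have "f {v} \<noteq> {}" using inj[of "{v}" "{}"] f0 vf[OF v] by auto
    then obtain w where w: "w \<in> vertices Q" "w \<in> f {v}"
      using face_has_vertex[OF Q ff[OF vf[OF v]]] by auto
    obtain F where F: "F face_of P" "f F = {w}" using sur[OF vf'[OF w(1)]] by auto
    have "F \<subseteq> {v}" using m[OF F(1) vf[OF v]] F w by auto
    moreover have "F \<noteq> {}" using f0 F by auto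
    ultimately have "F = {v}" by auto
    then show ?thesis using F w by auto
  qed
  define \<phi> where "\<phi> = (\<lambda>v. THE w. f {v} = {w})"
  have \<phi>: "f {v} = {\<phi> v}" "\<phi> v \<in> vertices Q" if "v \<in> vertices P" for v
    using v1[OF that] by (auto simp: \<phi>_def)
  have \<phi>sur: "\<exists>v\<in>vertices P. \<phi> v = w" if w: "w \<in> vertices Q" for w
  proof -
    obtain F where F: "F face_of P" "f F = {w}" using sur[OF vf'[OF w]] by auto
    then have "F \<noteq> {}" using f0 by auto
    then obtain v where v: "v \<in> vertices P" "v \<in> F" using face_has_vertex[OF P F(1)] by auto
    then have "f {v} \<subseteq> {w}" using m[OF vf[OF v(1)] F(1)] F by auto
    then show ?thesis using \<phi>[OF v(1)] v by auto
  qed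
  have bij: "bij_betw \<phi> (vertices P) (vertices Q)"
    unfolding bij_betw_def
  proof
    show "inj_on \<phi> (vertices P)"
    proof
      fix x y assume "x \<in> vertices P" "y \<in> vertices P" "\<phi> x = \<phi> y"
      then have "f {x} = f {y}" using \<phi> by simp
      then show "x = y" using inj[of "{x}" "{y}"] vf \<open>x \<in> vertices P\<close> \<open>y \<in> vertices P\<close> by auto
    qed
    show "\<phi> ` vertices P = vertices Q" using \<phi> \<phi>sur by blast
  qed
  have vs: "vertices Q \<inter> f F = \<phi> ` (vertices P \<inter> F)" if F: "F face_of P" for F
  proof -
    have "\<phi> v \<in> f F \<longleftrightarrow> v \<in> F" if "v \<in> vertices P" for v
      using m[OF vf[OF that] F] \<phi>[OF that] by auto
    then show ?thesis using \<phi>sur \<phi>(2) by (auto simp: image_iff) blast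
  qed
  have ph: "polyhedron P" "polyhedron Q" using P Q polytope_imp_polyhedron by auto
  have fa: "f F facet_of Q" if F: "F facet_of P" for F
  proof -
    have FP: "F face_of P" "F \<noteq> {}" "F \<noteq> P" using F by (auto simp: facet_of_def)
    have "f F \<noteq> {}" "f F \<noteq> Q" using inj[OF FP(1), of "{}"] inj[OF FP(1) PP] f0 f1 FP by auto
    then obtain G where G: "G facet_of Q" "f F \<subseteq> G"
      using face_of_polyhedron_subset_facet[OF ph(2) ff[OF FP(1)]] by blast
    obtain F0 where F0: "F0 face_of P" "f F0 = G" using sur[of G] G facet_of_imp_face_of by blast
    have "F \<subseteq> F0" using m[OF FP(1) F0(1)] F0 G by auto
    moreover have "F0 \<noteq> P" using f1 F0 G by auto
    ultimately obtain F1 where F1: "F1 facet_of P" "F0 \<subseteq> F1"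
      using face_of_polyhedron_subset_facet[OF ph(1) F0(1)] FP by blast
    then have "F = F1" using facet_subset_facet[OF P F] \<open>F \<subseteq> F0\<close> by blast
    then have "F = F0" using F1 \<open>F \<subseteq> F0\<close> by auto
    then show ?thesis using F0 G by simp
  qed
  have fas: "\<exists>F. F facet_of P \<and> f F = G" if G: "G facet_of Q" for G
  proof -
    obtain F0 where F0: "F0 face_of P" "f F0 = G" using sur[of G] G facet_of_imp_face_of by blast
    have "F0 \<noteq> {}" using f0 F0 G by (auto simp: facet_of_def)
    moreover have "F0 \<noteq> P" using f1 F0 G by auto
    ultimately obtain F1 where F1: "F1 facet_of P" "F0 \<subseteq> F1"
      using face_of_polyhedron_subset_facet[OF ph(1) F0(1)] by blast
    then have "G \<subseteq> f F1" using m[OF F0(1), of F1] F0 facet_of_imp_face_of by blast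
    then have "G = f F1" using facet_subset_facet[OF Q G fa[OF F1(1)]] by blast
    then show ?thesis using F1 by auto
  qed
  have "(`) \<phi> ` facet_sets P = facet_sets Q"
  proof (intro subset_antisym subsetI)
    fix X assume "X \<in> (`) \<phi> ` facet_sets P"
    then obtain F where F: "F facet_of P" "X = \<phi> ` (vertices P \<inter> F)" by (auto simp: facet_sets_def)
    then have "X = vertices Q \<inter> f F" using vs facet_of_imp_face_of by blast
    then show "X \<in> facet_sets Q" using fa[OF F(1)] by (auto simp: facet_sets_def)
  next
    fix X assume "X \<in> facet_sets Q"
    then obtain G where G: "G facet_of Q" "X = vertices Q \<inter> G" by (auto simp: facet_sets_def)
    obtain F where F: "F facet_of P" "f F = G" using fas[OF G(1)] by auto
    then have "X = \<phi> ` (vertices P \<inter> F)" using vs G facet_of_imp_face_of by blast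
    then show "X \<in> (`) \<phi> ` facet_sets P" using F by (auto simp: facet_sets_def)
  qed
  then show ?thesis using that bij by blast
qed

lemma combinatorially_equivalent_translation:
  "combinatorially_equivalent P ((\<lambda>x. x + d) ` P)"
proof -
  have t: "(\<lambda>x. x + d) ` F = (+) d ` F" for F by (auto simp: add.commute)
  have "bij_betw ((`) ((+) d)) {F. F face_of P} {G. G face_of (+) d ` P}"
    unfolding faces_of_translation by (rule inj_on_imp_bij_betw) (auto simp: inj_on_def inj_image_eq_iff)
  then show ?thesis unfolding combinatorially_equivalent_def t
    by (intro exI[of _ "(`) ((+) d)"]) (auto simp: inj_image_subset_iff)
qed

section \<open>Polarity\<close>

text \<open>The hyperplane avoids the origin, so adjoining 0 to \<open>S\<close> raises its affine
  dimension by one, to the full dimension.\<close>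

lemma span_of_affine_hyperplane_subset:
  fixes S :: "'a::euclidean_space set"
  assumes S: "S \<subseteq> {x. y \<bullet> x = 1}" and d: "aff_dim S = int DIM('a) - 1"
  shows "span S = UNIV"
proof -
  have "affine hull S \<subseteq> {x. y \<bullet> x = 1}" using S by (rule hull_minimal) (rule affine_hyperplane)
  then have "0 \<notin> affine hull S" by auto
  then have "aff_dim (insert 0 S) = int DIM('a)" using d by (simp add: aff_dim_insert)
  then have "int (dim (insert 0 S)) = int DIM('a)"
    using aff_dim_zero[of "insert 0 S"] by (simp add: hull_inc)
  then have "dim S = DIM('a)" by (simp add: dim_insert span_zero)
  then show ?thesis by (simp add: dim_eq_full)
qed

locale origin_polytope =
  fixes P :: "'a::euclidean_space set"
  assumes poly: "polytope P" and zero_int: "0 \<in> interior P"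
begin

lemma aff_dim_full: "aff_dim P = DIM('a)"
  using zero_int by (intro aff_dim_nonempty_interior) auto

text \<open>The interior point 0 has positive slack at every facet, so the right-hand side can be
  scaled to 1; with this scaling the normal is unique.\<close>

definition normal :: "'a set \<Rightarrow> 'a" where
  "normal F = (SOME y. P \<subseteq> {x. y \<bullet> x \<le> 1} \<and> F = P \<inter> {x. y \<bullet> x = 1})"

lemma normal:
  assumes "F facet_of P"
  shows "P \<subseteq> {x. normal F \<bullet> x \<le> 1}" "F = P \<inter> {x. normal F \<bullet> x = 1}"
proof -
  obtain c d where cd: "P \<subseteq> {x. c \<bullet> x \<le> d}" "F = P \<inter> {x. c \<bullet> x = d}"
    using facet_functional[OF poly assms] by metis
  have "0 \<in> rel_interior P" using zero_int interior_subset_rel_interior by blast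
  then have d: "d > 0" using facet_interior_slack[OF poly assms cd, of 0] by simp
  have "P \<subseteq> {x. (c /\<^sub>R d) \<bullet> x \<le> 1} \<and> F = P \<inter> {x. (c /\<^sub>R d) \<bullet> x = 1}"
    using cd d by (auto simp: field_simps)
  then have "P \<subseteq> {x. normal F \<bullet> x \<le> 1} \<and> F = P \<inter> {x. normal F \<bullet> x = 1}"
    unfolding normal_def by (rule someI)
  then show "P \<subseteq> {x. normal F \<bullet> x \<le> 1}" "F = P \<inter> {x. normal F \<bullet> x = 1}" by blast+
qed

lemma normal_le: "F facet_of P \<Longrightarrow> x \<in> P \<Longrightarrow> normal F \<bullet> x \<le> 1"
  using normal(1) by blast

lemma mem_facet_iff: "F facet_of P \<Longrightarrow> x \<in> P \<Longrightarrow> x \<in> F \<longleftrightarrow> normal F \<bullet> x = 1"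
  using normal(2) by blast

lemma span_facet: "F facet_of P \<Longrightarrow> span F = UNIV"
  by (rule span_of_affine_hyperplane_subset[of _ "normal F"])
     (use normal(2) aff_dim_full in \<open>auto simp: facet_of_def\<close>)

lemma facet_normal_unique:
  assumes "F facet_of P" "\<And>x. x \<in> F \<Longrightarrow> y \<bullet> x = z \<bullet> x"
  shows "y = z"
proof -
  have "(y - z) \<bullet> x = 0" if "x \<in> span F" for x
    using that by (induction rule: span_induct) (auto simp: subspace_def inner_add_right assms(2) inner_diff_left)
  then have "(y - z) \<bullet> (y - z) = 0" using span_facet[OF assms(1)] by blast
  then show ?thesis by simp
qed

lemma normal_eqI:
  assumes "F facet_of P" "\<And>x. x \<in> F \<Longrightarrow> y \<bullet> x = 1"
  shows "normal F = y"
  by (rule facet_normal_unique[OF assms(1)]) (use assms normal(2) in auto)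

lemma inj_normal: "inj_on normal {F. F facet_of P}"
proof
  fix F G assume "F \<in> {F. F facet_of P}" "G \<in> {F. F facet_of P}" "normal F = normal G"
  then show "F = G" using normal(2)[of F] normal(2)[of G] by simp
qed

lemma mem_iff_normal: "x \<in> P \<longleftrightarrow> (\<forall>F. F facet_of P \<longrightarrow> normal F \<bullet> x \<le> 1)"
  by (rule polytope_mem_iff[OF poly zero_int]) (intro conjI normal)

lemma mem_polar_iff: "y \<in> polar P \<longleftrightarrow> (\<forall>x\<in>P. x \<bullet> y \<le> 1)"
  by (simp add: polar_def)

lemma normal_in_polar: "F facet_of P \<Longrightarrow> normal F \<in> polar P"
  using normal_le by (auto simp: mem_polar_iff inner_commute)

lemma bipolar: "polar (polar P) = P"
proof
  show "P \<subseteq> polar (polar P)" by (auto simp: polar_def inner_commute)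
  show "polar (polar P) \<subseteq> P"
    using normal_in_polar by (auto simp: mem_iff_normal polar_def)
qed

lemma finite_facets: "finite {F. F facet_of P}"
  using poly finite_polytope_facets by blast

lemma ex_facet: "\<exists>F. F facet_of P"
proof (rule ccontr)
  assume "\<not> ?thesis"
  then have "P = UNIV" using mem_iff_normal by blast
  then show False using polytope_imp_bounded[OF poly] by simp
qed

lemma convex_polar: "convex (polar P)"
proof -
  have "polar P = (\<Inter>x\<in>P. {y. x \<bullet> y \<le> 1})" by (auto simp: polar_def)
  then show ?thesis by (simp add: convex_INT convex_halfspace_le)
qed

text \<open>A point \<open>y\<close> of the polar outside the hull is separated from it by some
  \<open>e\<close> with bound \<open>m\<close>. If \<open>m\<close> is positive, \<open>e\<close>
  divided by \<open>m\<close> belongs to \<open>P\<close> and violates the inequality of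
  \<open>y\<close>. Otherwise all multiples of \<open>e\<close> by nonnegative reals belong to
  \<open>P\<close>, which is bounded.\<close>

lemma polar_eq_hull: "polar P = convex hull (normal ` {F. F facet_of P})"
proof
  let ?C = "convex hull (normal ` {F. F facet_of P})"
  show "?C \<subseteq> polar P" by (rule hull_minimal) (use normal_in_polar convex_polar in auto)
  show "polar P \<subseteq> ?C"
  proof
    fix y assume y: "y \<in> polar P"
    show "y \<in> ?C"
    proof (rule ccontr)
      assume "y \<notin> ?C"
      moreover have "closed ?C" using finite_facets by (intro compact_imp_closed compact_convex_hull finite_imp_compact) simp
      ultimately obtain a b where ab: "a \<bullet> y < b" "\<forall>x\<in>?C. a \<bullet> x > b"
        using separating_hyperplane_closed_point[of ?C y] by auto
      define e where "e = - a" define m where "m = - b"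
      have e: "e \<bullet> y > m" and en: "\<And>F. F facet_of P \<Longrightarrow> normal F \<bullet> e < m"
        using ab by (auto simp: e_def m_def inner_commute hull_inc)
      show False
      proof (cases "m > 0")
        case True
        have "(e /\<^sub>R m) \<in> P" unfolding mem_iff_normal
          using en True by (auto simp: field_simps less_imp_le)
        then have "(e /\<^sub>R m) \<bullet> y \<le> 1" using y by (auto simp: mem_polar_iff)
        then show False using e True by (simp add: field_simps)
      next
        case False
        obtain F where F: "F facet_of P" using ex_facet by blast
        then have "e \<noteq> 0" using en[OF F] False by auto
        have tin: "t *\<^sub>R e \<in> P" if "t \<ge> 0" for t
          unfolding mem_iff_normal
        proof (intro allI impI)
          fix F assume "F facet_of P"
          then have "normal F \<bullet> e \<le> 0" using en False by fastforce
          then have "t * (normal F \<bullet> e) \<le> 0" using that by (simp add: mult_nonneg_nonpos)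
          then show "normal F \<bullet> (t *\<^sub>R e) \<le> 1" by simp
        qed
        obtain B where B: "\<forall>x\<in>P. norm x \<le> B" "B > 0" using polytope_imp_bounded[OF poly] bounded_pos by blast
        have "((B + 1) / norm e) *\<^sub>R e \<in> P" using tin[of "(B + 1) / norm e"] B(2) by simp
        then have "norm (((B + 1) / norm e) *\<^sub>R e) \<le> B" using B(1) by blast
        moreover have "norm (((B + 1) / norm e) *\<^sub>R e) = B + 1" using \<open>e \<noteq> 0\<close> B(2) by simp
        ultimately show False by simp
      qed
    qed
  qed
qed

lemma polytope_polar: "polytope (polar P)"
  unfolding polar_eq_hull using finite_facets by (intro polytope_convex_hull) simp

lemma zero_int_polar: "0 \<in> interior (polar P)"
proof -
  obtain B where B: "\<forall>x\<in>P. norm x \<le> B" "B > 0" using polytope_imp_bounded[OF poly] bounded_pos by blast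
  have "ball 0 (1 / B) \<subseteq> polar P"
  proof
    fix y :: 'a assume "y \<in> ball 0 (1 / B)"
    then have ny: "norm y \<le> 1 / B" by simp
    have "x \<bullet> y \<le> 1" if "x \<in> P" for x
    proof -
      have "x \<bullet> y \<le> norm x * norm y" by (rule norm_cauchy_schwarz)
      also have "\<dots> \<le> B * (1 / B)" using B that ny by (intro mult_mono) auto
      finally show ?thesis using B by simp
    qed
    then show "y \<in> polar P" by (simp add: mem_polar_iff)
  qed
  moreover have "(0::'a) \<in> ball 0 (1 / B)" using B by simp
  ultimately show ?thesis using interior_maximal[OF _ open_ball] by blast
qed

lemma origin_polytope_polar: "origin_polytope (polar P)"
  by unfold_locales (rule polytope_polar zero_int_polar)+

lemma vertices_polar: "vertices (polar P) = normal ` {F. F facet_of P}"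
proof
  show "vertices (polar P) \<subseteq> normal ` {F. F facet_of P}"
    unfolding vertices_def polar_eq_hull by (rule extreme_points_of_convex_hull)
  show "normal ` {F. F facet_of P} \<subseteq> vertices (polar P)"
  proof clarify
    fix F assume F: "F facet_of P"
    have "normal F \<notin> open_segment a b" if ab: "a \<in> polar P" "b \<in> polar P" for a b
    proof
      assume "normal F \<in> open_segment a b"
      then obtain u where u: "0 < u" "u < 1" "normal F = (1 - u) *\<^sub>R a + u *\<^sub>R b" and "a \<noteq> b"
        by (auto simp: in_segment)
      have *: "a \<bullet> x = 1 \<and> b \<bullet> x = 1" if "x \<in> F" for x
      proof -
        have xP: "x \<in> P" using that facet_of_imp_subset[OF F] by blast
        then have le: "a \<bullet> x \<le> 1" "b \<bullet> x \<le> 1" using ab by (auto simp: mem_polar_iff inner_commute)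
        have "(1 - u) * (a \<bullet> x) + u * (b \<bullet> x) = 1"
          using mem_facet_iff[OF F xP] that unfolding u(3) by (simp add: inner_add_left)
        then have "(1 - u) * (1 - a \<bullet> x) + u * (1 - b \<bullet> x) = 0" by (simp add: algebra_simps)
        moreover have "(1 - u) * (1 - a \<bullet> x) \<ge> 0" "u * (1 - b \<bullet> x) \<ge> 0" using u le by auto
        ultimately have "(1 - u) * (1 - a \<bullet> x) = 0" "u * (1 - b \<bullet> x) = 0" by linarith+
        then show ?thesis using u by auto
      qed
      have "normal F = a" "normal F = b" using normal_eqI[OF F] * by blast+
      then show False using \<open>a \<noteq> b\<close> by simp
    qed
    then show "normal F \<in> vertices (polar P)"
      using normal_in_polar[OF F] by (auto simp: vertices_def extreme_point_of_def)
  qed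
qed

lemma bij_normal: "bij_betw normal {F. F facet_of P} (vertices (polar P))"
  by (simp add: bij_betw_def inj_normal vertices_polar)

definition dual_facet :: "'a \<Rightarrow> 'a set" where
  "dual_facet v = polar P \<inter> {y. v \<bullet> y = 1}"

text \<open>The normals of the facets through \<open>v\<close> span the space: along a vector
  \<open>u\<close> orthogonal to all of them \<open>v\<close> could be moved both ways inside
  \<open>P\<close>. As they lie in a hyperplane avoiding 0, their affine dimension is one less than
  full.\<close>

lemma dual_facet_facet:
  assumes v: "v \<in> vertices P"
  shows "dual_facet v facet_of polar P"
proof -
  have vP: "v \<in> P" using v vertices_subset by blast
  have fc: "dual_facet v face_of polar P"
    unfolding dual_facet_def
    by (rule face_of_Int_supporting_hyperplane_le) (use vP convex_polar in \<open>auto simp: mem_polar_iff\<close>)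
  define N where "N = normal ` {F. F facet_of P \<and> v \<in> F}"
  have N1: "N \<subseteq> dual_facet v"
    using normal_in_polar mem_facet_iff vP by (auto simp: N_def dual_facet_def inner_commute)
  have "span N = UNIV"
  proof (rule ccontr)
    assume "span N \<noteq> UNIV"
    then obtain u where u: "u \<noteq> 0" "span N \<subseteq> {x. u \<bullet> x = 0}" using span_not_UNIV_orthogonal by blast
    then have uN: "normal F \<bullet> u = 0" if "F facet_of P" "v \<in> F" for F
      using that span_base[of "normal F" N] by (auto simp: N_def inner_commute)
    define B where "B = {F. F facet_of P \<and> v \<notin> F}"
    have fB: "finite B" using finite_facets by (simp add: B_def)
    \<comment> \<open>A step so small that no facet avoiding \<open>v\<close> is crossed. The extra
      1 in the set makes the minimum exist also for empty \<open>B\<close>; the summand 1 in the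
      denominators keeps them positive.\<close>
    define \<epsilon> where "\<epsilon> = Min (insert 1 ((\<lambda>F. (1 - normal F \<bullet> v) / (1 + \<bar>normal F \<bullet> u\<bar>)) ` B))"
    have pos: "(1 - normal F \<bullet> v) / (1 + \<bar>normal F \<bullet> u\<bar>) > 0" if "F \<in> B" for F
      using that mem_facet_iff[of F v] normal_le[of F v] vP by (auto simp: B_def intro!: divide_pos_pos)
    have e0: "\<epsilon> > 0" unfolding \<epsilon>_def using fB pos by simp
    have eF: "\<epsilon> * \<bar>normal F \<bullet> u\<bar> \<le> 1 - normal F \<bullet> v" if "F \<in> B" for F
    proof -
      have "\<epsilon> \<le> (1 - normal F \<bullet> v) / (1 + \<bar>normal F \<bullet> u\<bar>)" unfolding \<epsilon>_def using fB that by (intro Min_le) auto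
      then have "\<epsilon> * (1 + \<bar>normal F \<bullet> u\<bar>) \<le> 1 - normal F \<bullet> v" by (simp add: pos_le_divide_eq add_pos_nonneg)
      then show ?thesis using e0 by (simp add: algebra_simps)
    qed
    have in': "v + s *\<^sub>R u \<in> P" if s: "\<bar>s\<bar> = \<epsilon>" for s
      unfolding mem_iff_normal
    proof (intro allI impI)
      fix F assume F: "F facet_of P"
      show "normal F \<bullet> (v + s *\<^sub>R u) \<le> 1"
      proof (cases "v \<in> F")
        case True then show ?thesis using uN[OF F] mem_facet_iff[OF F vP] by (simp add: inner_add_right)
      next
        case False
        have "s * (normal F \<bullet> u) \<le> \<bar>s\<bar> * \<bar>normal F \<bullet> u\<bar>" by (metis abs_ge_self abs_mult)
        also have "\<dots> \<le> 1 - normal F \<bullet> v" using eF[of F] F False s by (simp add: B_def)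
        finally show ?thesis by (simp add: inner_add_right)
      qed
    qed
    have "v + \<epsilon> *\<^sub>R u \<in> P" "v + (-\<epsilon>) *\<^sub>R u \<in> P" using in'[of \<epsilon>] in'[of "-\<epsilon>"] e0 by auto
    moreover have "v \<in> open_segment (v + \<epsilon> *\<^sub>R u) (v + (-\<epsilon>) *\<^sub>R u)"
    proof -
      have "v = midpoint (v + \<epsilon> *\<^sub>R u) (v + (-\<epsilon>) *\<^sub>R u)"
        by (simp add: midpoint_def scaleR_2[symmetric] scaleR_add_right[symmetric])
      moreover have "v + \<epsilon> *\<^sub>R u \<noteq> v + (-\<epsilon>) *\<^sub>R u"
      proof
        assume "v + \<epsilon> *\<^sub>R u = v + (-\<epsilon>) *\<^sub>R u"
        then have "2 *\<^sub>R (\<epsilon> *\<^sub>R u) = 0" unfolding scaleR_2 by (simp add: eq_neg_iff_add_eq_0)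
        then show False using u e0 by simp
      qed
      ultimately show ?thesis by (metis midpoint_in_open_segment)
    qed
    ultimately show False using v by (auto simp: vertices_def extreme_point_of_def)
  qed
  then have "dim N = DIM('a)" by (simp add: dim_eq_full)
  moreover have "affine hull N \<subseteq> {x. v \<bullet> x = 1}"
    by (intro hull_minimal affine_hyperplane) (use N1 in \<open>auto simp: dual_facet_def\<close>)
  then have "0 \<notin> affine hull N" by auto
  moreover have "aff_dim (insert 0 N) = int (dim (insert 0 N))" by (rule aff_dim_zero) (simp add: hull_inc)
  ultimately have "aff_dim N = int DIM('a) - 1" by (simp add: aff_dim_insert dim_insert span_zero)
  then have ge: "aff_dim (dual_facet v) \<ge> int DIM('a) - 1" using aff_dim_subset[OF N1] by simp
  have full: "aff_dim (polar P) = DIM('a)" using zero_int_polar by (intro aff_dim_nonempty_interior) auto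
  have "0 \<in> polar P" using zero_int_polar interior_subset by blast
  moreover have "0 \<notin> dual_facet v" by (simp add: dual_facet_def)
  ultimately have "dual_facet v \<noteq> polar P" by blast
  then have "aff_dim (dual_facet v) < int DIM('a)"
    using face_of_aff_dim_lt[OF convex_polar fc] full by simp
  moreover have "dual_facet v \<noteq> {}"
  proof
    assume "dual_facet v = {}" then have "int DIM('a) \<le> 0" using ge by simp
    then show False by simp
  qed
  ultimately show ?thesis using fc ge full by (simp add: facet_of_def)
qed

text \<open>By bipolarity the normal of \<open>G\<close> is a point of \<open>P\<close>. It is
  extreme, for if it lies between \<open>a\<close> and \<open>b\<close>, then both take the value 1
  on all of \<open>G\<close>, and the normal of a facet is unique.\<close>

lemma facet_polar_is_dual_facet:
  assumes G: "G facet_of polar P"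
  obtains v where "v \<in> vertices P" "G = dual_facet v"
proof -
  interpret R: origin_polytope "polar P" by (rule origin_polytope_polar)
  define x where "x = R.normal G"
  have "x \<in> polar (polar P)" unfolding x_def by (rule R.normal_in_polar[OF G])
  then have xP: "x \<in> P" by (simp add: bipolar)
  have "x \<notin> open_segment a b" if ab: "a \<in> P" "b \<in> P" for a b
  proof
    assume "x \<in> open_segment a b"
    then obtain u where u: "0 < u" "u < 1" "x = (1 - u) *\<^sub>R a + u *\<^sub>R b" and "a \<noteq> b"
      by (auto simp: in_segment)
    have *: "a \<bullet> y = 1 \<and> b \<bullet> y = 1" if "y \<in> G" for y
    proof -
      have yP: "y \<in> polar P" using that facet_of_imp_subset[OF G] by blast
      then have le: "a \<bullet> y \<le> 1" "b \<bullet> y \<le> 1" using ab by (auto simp: mem_polar_iff)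
      have "x \<bullet> y = 1" unfolding x_def using R.mem_facet_iff[OF G yP] that by simp
      then have "(1 - u) * (a \<bullet> y) + u * (b \<bullet> y) = 1" unfolding u(3) by (simp add: inner_add_left)
      then have "(1 - u) * (1 - a \<bullet> y) + u * (1 - b \<bullet> y) = 0" by (simp add: algebra_simps)
      moreover have "(1 - u) * (1 - a \<bullet> y) \<ge> 0" "u * (1 - b \<bullet> y) \<ge> 0" using u le by auto
      ultimately have "(1 - u) * (1 - a \<bullet> y) = 0" "u * (1 - b \<bullet> y) = 0" by linarith+
      then show ?thesis using u by auto
    qed
    have "R.normal G = a" "R.normal G = b" using R.normal_eqI[OF G] * by blast+
    then show False using \<open>a \<noteq> b\<close> by simp
  qed
  then have "x \<in> vertices P" using xP by (auto simp: vertices_def extreme_point_of_def)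
  moreover have "G = dual_facet x" unfolding dual_facet_def x_def by (rule R.normal(2)[OF G])
  ultimately show ?thesis by (rule that)
qed

lemma facets_polar: "{G. G facet_of polar P} = dual_facet ` vertices P"
proof
  show "{G. G facet_of polar P} \<subseteq> dual_facet ` vertices P"
  proof
    fix G assume "G \<in> {G. G facet_of polar P}"
    then have "G facet_of polar P" by simp
    then show "G \<in> dual_facet ` vertices P" by (rule facet_polar_is_dual_facet) simp
  qed
qed (use dual_facet_facet in auto)

lemma inj_dual_facet: "inj_on dual_facet (vertices P)"
proof
  interpret R: origin_polytope "polar P" by (rule origin_polytope_polar)
  fix v w assume vw: "v \<in> vertices P" "w \<in> vertices P" "dual_facet v = dual_facet w"
  have z: "R.normal (dual_facet z) = z" if "z \<in> vertices P" for z
    by (rule R.normal_eqI[OF dual_facet_facet[OF that]]) (simp add: dual_facet_def)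
  have "v = R.normal (dual_facet v)" by (rule z[OF vw(1), symmetric])
  also have "\<dots> = w" unfolding vw(3) by (rule z[OF vw(2)])
  finally show "v = w" .
qed

lemma normal_mem_dual_facet:
  "F facet_of P \<Longrightarrow> v \<in> vertices P \<Longrightarrow> normal F \<in> dual_facet v \<longleftrightarrow> v \<in> F"
  using mem_facet_iff[of F v] vertices_subset[of P] normal_in_polar[of F]
  by (auto simp: dual_facet_def inner_commute)

end

section \<open>Incidence structures with a factorization\<close>

text \<open>The axioms come in dual pairs, \<open>meet\<close> with \<open>meet'\<close> and
  \<open>conn\<close> with \<open>conn'\<close>, and \<open>flags\<close> implies its own dual.
  Exchanging vertices and facets therefore gives another model, and every consequence for facets
  holds for vertices.\<close>

locale incidence =
  fixes V :: "'v set" and K :: "'f set" and I :: "'v \<Rightarrow> 'f \<Rightarrow> bool"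
  assumes finV: "finite V" and finK: "finite K"
    and ex_on: "F \<in> K \<Longrightarrow> \<exists>v\<in>V. I v F" and ex_at: "v \<in> V \<Longrightarrow> \<exists>F\<in>K. I v F"
    and meet: "\<lbrakk>F \<in> K; G \<in> K; F \<noteq> G; u \<in> V; v \<in> V; w \<in> V; u \<noteq> v;
        I u F; I u G; I v F; I v G; I w F; I w G\<rbrakk> \<Longrightarrow> w = u \<or> w = v"
    and meet': "\<lbrakk>u \<in> V; v \<in> V; u \<noteq> v; F \<in> K; G \<in> K; H \<in> K; F \<noteq> G;
        I u F; I v F; I u G; I v G; I u H; I v H\<rbrakk> \<Longrightarrow> H = F \<or> H = G"
    and flags: "\<lbrakk>v \<in> V; F \<in> K; I v F\<rbrakk> \<Longrightarrow> \<exists>w1 w2. w1 \<noteq> w2 \<and>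
        {w \<in> V. w \<noteq> v \<and> I w F \<and> (\<exists>G\<in>K. G \<noteq> F \<and> I v G \<and> I w G)} = {w1, w2}"
    and conn: "\<lbrakk>F \<in> K; W \<subseteq> {v \<in> V. I v F}; W \<noteq> {};
        \<And>w w' G. \<lbrakk>w \<in> W; w' \<in> V; I w' F; G \<in> K; G \<noteq> F; I w G; I w' G\<rbrakk> \<Longrightarrow> w' \<in> W\<rbrakk>
        \<Longrightarrow> W = {v \<in> V. I v F}"
    and conn': "\<lbrakk>v \<in> V; M \<subseteq> {F \<in> K. I v F}; M \<noteq> {};
        \<And>F G w. \<lbrakk>F \<in> M; G \<in> K; I v G; w \<in> V; w \<noteq> v; I w F; I w G\<rbrakk> \<Longrightarrow> G \<in> M\<rbrakk>
        \<Longrightarrow> M = {F \<in> K. I v F}"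
begin

definition on :: "'f \<Rightarrow> 'v set" where "on F = {v \<in> V. I v F}"
text \<open>The two neighbours of \<open>v\<close> on the boundary cycle of
  \<open>F\<close>.\<close>

definition nb :: "'f \<Rightarrow> 'v \<Rightarrow> 'v set" where
  "nb F v = {w \<in> V. w \<noteq> v \<and> I w F \<and> (\<exists>G\<in>K. G \<noteq> F \<and> I v G \<and> I w G)}"

lemma finite_on: "finite (on F)"
  using finV by (simp add: on_def)

lemma nb_sub: "nb F v \<subseteq> on F - {v}"
  by (auto simp: nb_def on_def)

lemma nb_sym: "w \<in> nb F v \<Longrightarrow> v \<in> V \<Longrightarrow> I v F \<Longrightarrow> v \<in> nb F w"
  by (auto simp: nb_def)

lemma nb_two: "v \<in> V \<Longrightarrow> F \<in> K \<Longrightarrow> I v F \<Longrightarrow> \<exists>w1 w2. w1 \<noteq> w2 \<and> nb F v = {w1, w2}"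
  unfolding nb_def by (rule flags)

lemma nb_other:
  assumes "v \<in> V" "F \<in> K" "I v F" "w \<in> nb F v"
  obtains w' where "w' \<noteq> w" "nb F v = {w, w'}"
proof -
  obtain w1 w2 where "w1 \<noteq> w2" "nb F v = {w1, w2}" using nb_two assms by blast
  then show ?thesis using assms(4) that[of w1] that[of w2] by auto
qed

lemma nb_eqI: "v \<in> V \<Longrightarrow> F \<in> K \<Longrightarrow> I v F \<Longrightarrow> {x, y} \<subseteq> nb F v \<Longrightarrow> x \<noteq> y \<Longrightarrow> nb F v = {x, y}"
  using nb_two by fastforce

lemma closed_on:
  assumes "F \<in> K" "W \<subseteq> on F" "W \<noteq> {}" "\<And>w. w \<in> W \<Longrightarrow> nb F w \<subseteq> W"
  shows "on F = W"
proof -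
  have "W = {v \<in> V. I v F}"
  proof (rule conn[OF assms(1)])
    fix w w' G assume *: "w \<in> W" "w' \<in> V" "I w' F" "G \<in> K" "G \<noteq> F" "I w G" "I w' G"
    show "w' \<in> W"
    proof (cases "w' = w")
      case False
      then have "w' \<in> nb F w" using * by (auto simp: nb_def)
      then show ?thesis using assms(4) * by blast
    qed (use * in simp)
  qed (use assms in \<open>auto simp: on_def\<close>)
  then show ?thesis by (simp add: on_def)
qed

text \<open>Two facets through v that share another vertex correspond to a vertex of one of them
  that is adjacent to v.\<close>

lemma flags_dual:
  assumes v: "v \<in> V" "F \<in> K" "I v F"
  shows "\<exists>G1 G2. G1 \<noteq> G2 \<and>
     {G \<in> K. G \<noteq> F \<and> I v G \<and> (\<exists>w\<in>V. w \<noteq> v \<and> I w F \<and> I w G)} = {G1, G2}" (is "\<exists>G1 G2. _ \<and> ?A = _")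
proof -
  obtain w1 w2 where w: "w1 \<noteq> w2" "nb F v = {w1, w2}" using nb_two v by blast
  then have "w1 \<in> nb F v" "w2 \<in> nb F v" by auto
  then obtain G1 G2 where
    w1: "w1 \<in> V" "w1 \<noteq> v" "I w1 F" "G1 \<in> K" "G1 \<noteq> F" "I v G1" "I w1 G1" and
    w2: "w2 \<in> V" "w2 \<noteq> v" "I w2 F" "G2 \<in> K" "G2 \<noteq> F" "I v G2" "I w2 G2"
    by (auto simp: nb_def)
  have "G1 \<noteq> G2"
  proof
    assume "G1 = G2"
    then show False using meet[of F G1 v w1 w2] v w1 w2 w(1) by auto
  qed
  moreover have "?A = {G1, G2}"
  proof (intro subset_antisym subsetI)
    fix G assume "G \<in> ?A"
    then obtain x where x: "G \<in> K" "G \<noteq> F" "I v G" "x \<in> V" "x \<noteq> v" "I x F" "I x G" by auto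
    then have "x \<in> nb F v" using v by (auto simp: nb_def)
    then have "x = w1 \<or> x = w2" using w by auto
    then show "G \<in> {G1, G2}"
    proof
      assume "x = w1" then show ?thesis using meet'[of v w1 F G1 G] v w1 x by auto
    next
      assume "x = w2" then show ?thesis using meet'[of v w2 F G2 G] v w2 x by auto
    qed
  qed (use w1 w2 in auto)
  ultimately show ?thesis by blast
qed

lemma dual: "incidence K V (\<lambda>F v. I v F)"
proof
  show "finite K" "finite V" using finV finK by auto
next
  fix v assume "v \<in> V" then show "\<exists>F\<in>K. I v F" by (rule ex_at)
next
  fix F assume "F \<in> K" then show "\<exists>v\<in>V. I v F" by (rule ex_on)
next
  fix u v F G H assume "u \<in> V" "v \<in> V" "u \<noteq> v" "F \<in> K" "G \<in> K" "H \<in> K" "F \<noteq> G"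
    "I u F" "I v F" "I u G" "I v G" "I u H" "I v H"
  then show "H = F \<or> H = G" by (rule meet')
next
  fix u v w F G assume "F \<in> K" "G \<in> K" "F \<noteq> G" "u \<in> V" "v \<in> V" "w \<in> V" "u \<noteq> v"
    "I u F" "I u G" "I v F" "I v G" "I w F" "I w G"
  then show "w = u \<or> w = v" by (rule meet)
next
  fix F v assume "F \<in> K" "v \<in> V" "I v F"
  then show "\<exists>G1 G2. G1 \<noteq> G2 \<and> {G \<in> K. G \<noteq> F \<and> I v G \<and> (\<exists>w\<in>V. w \<noteq> v \<and> I w F \<and> I w G)} = {G1, G2}"
    by (intro flags_dual)
next
  fix v M assume 1: "v \<in> V" "M \<subseteq> {F \<in> K. I v F}" "M \<noteq> {}"
    and 2: "\<And>F G w. \<lbrakk>F \<in> M; G \<in> K; I v G; w \<in> V; w \<noteq> v; I w F; I w G\<rbrakk> \<Longrightarrow> G \<in> M"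
  show "M = {F \<in> K. I v F}" by (rule conn'[OF 1 2])
next
  fix F W assume 1: "F \<in> K" "W \<subseteq> {v \<in> V. I v F}" "W \<noteq> {}"
    and 2: "\<And>w w' G. \<lbrakk>w \<in> W; w' \<in> V; I w' F; G \<in> K; G \<noteq> F; I w G; I w' G\<rbrakk> \<Longrightarrow> w' \<in> W"
  show "W = {v \<in> V. I v F}" by (rule conn[OF 1 2])
qed

lemma on_ge3: 
  assumes F: "F \<in> K" shows "card (on F) \<ge> 3"
proof -
  obtain v where v: "v \<in> V" "I v F" using ex_on F by blast
  obtain w1 w2 where w: "w1 \<noteq> w2" "nb F v = {w1, w2}" using nb_two v F by blast
  then have "{v, w1, w2} \<subseteq> on F" "v \<noteq> w1" "v \<noteq> w2" using nb_sub[of F v] v by (auto simp: on_def)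
  then have "card {v, w1, w2} \<le> card (on F)" by (intro card_mono finite_on)
  then show ?thesis using \<open>v \<noteq> w1\<close> \<open>v \<noteq> w2\<close> w by simp
qed

lemma triangle:
  assumes F: "F \<in> K" "card (on F) = 3" and v: "v \<in> on F" "w \<in> on F" "v \<noteq> w"
  shows "w \<in> nb F v"
proof -
  have "v \<in> V" "I v F" using v by (auto simp: on_def)
  then obtain w1 w2 where w: "w1 \<noteq> w2" "nb F v = {w1, w2}" using nb_two F by blast
  have "card (on F - {v}) = 2" using F v finite_on by (simp add: card_Diff_singleton)
  moreover have "card (nb F v) = 2" using w by simp
  ultimately have "nb F v = on F - {v}" using nb_sub finite_on by (intro card_subset_eq) auto
  then show ?thesis using v by auto
qed

text \<open>The fourth vertex \<open>o'\<close> is not adjacent to \<open>v\<close>, whose two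
  neighbours are \<open>w\<close> and \<open>w'\<close>; so its own neighbours are these two as
  well.\<close>

lemma quadrilateral:
  assumes F: "F \<in> K" "card (on F) = 4" and v: "v \<in> on F" and w: "w \<in> nb F v"
  obtains o' w' where "distinct [v, w, o', w']" "on F = {v, w, o', w'}"
    "nb F v = {w, w'}" "nb F w = {v, o'}" "nb F o' = {w, w'}" "nb F w' = {v, o'}"
proof -
  have vV: "v \<in> V" "I v F" using v by (auto simp: on_def)
  obtain w' where w': "w' \<noteq> w" "nb F v = {w, w'}" using nb_other vV F w by blast
  have sub: "w \<in> on F" "w' \<in> on F" "w \<noteq> v" "w' \<noteq> v" using nb_sub[of F v] w' by auto
  have "card (on F - {v, w, w'}) = 1" using F v sub w' finite_on by (subst card_Diff_subset) auto
  then obtain o' where o: "on F - {v, w, w'} = {o'}" by (auto simp: card_1_singleton_iff)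
  then have onF: "on F = {v, w, o', w'}" and ne: "o' \<notin> {v, w, w'}" and oF: "o' \<in> on F" using v sub by auto
  have oV: "o' \<in> V" "I o' F" using oF by (auto simp: on_def)
  have "v \<notin> nb F o'" using nb_sym[of v F o'] vV oV w' ne by auto
  then have "nb F o' \<subseteq> {w, w'}" using nb_sub[of F o'] onF by auto
  moreover obtain y1 y2 where "y1 \<noteq> y2" "nb F o' = {y1, y2}" using nb_two oV F by blast
  ultimately have no: "nb F o' = {w, w'}" by auto
  have wV: "w \<in> V" "I w F" "w' \<in> V" "I w' F" using sub by (auto simp: on_def)
  have "nb F w = {v, o'}" using nb_eqI[of w F v o'] nb_sym[of w F v] nb_sym[of w F o'] wV F vV oV w' no ne by auto
  moreover have "nb F w' = {v, o'}" using nb_eqI[of w' F v o'] nb_sym[of w' F v] nb_sym[of w' F o'] wV F vV oV w' no ne by auto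
  ultimately show ?thesis using that[of o' w'] onF ne w' no sub by auto
qed

end

text \<open>Eliminating the coefficients from a dependency among the \<open>a\<close>'s expresses one product of
  roots of slacks as a sum of two others; a dependency among the \<open>p\<close>'s gives the same relation
  between the squares.\<close>

lemma trinomial_obstruction:
  fixes x y z :: real
  assumes "y = x + z" "y\<^sup>2 = x\<^sup>2 + z\<^sup>2" "x \<noteq> 0" "z \<noteq> 0"
  shows False
proof -
  have "x * z = 0" using assms(1,2) by (simp add: power2_eq_square algebra_simps)
  then show False using assms by simp
qed

text \<open>Three equations with two terms fix the ratios of the coefficients, and substitution in
  the fourth makes the coefficients disappear. The lemma is used once for the products
  \<open>a v \<bullet> b G\<close> and once for their squares.\<close>

lemma pentagon_elimination:
  fixes c1 c2 c3 c4 :: real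
  assumes ne: "c1 \<noteq> 0 \<or> c2 \<noteq> 0 \<or> c3 \<noteq> 0 \<or> c4 \<noteq> 0"
    and e: "c3 * f + c4 * h = 0" "c1 * a + c4 * i = 0" "c1 * b + c2 * d = 0" "c1 * c + c2 * e + c3 * g = 0"
    and nz: "f \<noteq> 0" "i \<noteq> 0" "d \<noteq> 0"
  shows "b * e / d = c + a * h * g / (i * f)"
proof -
  have c4: "c4 = - c1 * a / i" and c2: "c2 = - c1 * b / d" using e nz by (auto simp: field_simps)
  have c3: "c3 = - c4 * h / f" using e nz by (auto simp: field_simps)
  have "c1 \<noteq> 0" using ne c2 c3 c4 by auto
  moreover have "c1 * (c - b * e / d + a * h * g / (i * f)) = 0"
    using e(4) unfolding c3 c2 c4 by (simp add: algebra_simps)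
  ultimately show ?thesis by simp
qed

lemma pentagon_obstruction:
  fixes c1 c2 c3 c4 :: real
  assumes "c1 \<noteq> 0 \<or> c2 \<noteq> 0 \<or> c3 \<noteq> 0 \<or> c4 \<noteq> 0"
    "c3 * f\<^sup>2 + c4 * h\<^sup>2 = 0" "c1 * a\<^sup>2 + c4 * i\<^sup>2 = 0" "c1 * b\<^sup>2 + c2 * d\<^sup>2 = 0" "c1 * c\<^sup>2 + c2 * e\<^sup>2 + c3 * g\<^sup>2 = 0"
    "d1 \<noteq> 0 \<or> d2 \<noteq> 0 \<or> d3 \<noteq> 0 \<or> d4 \<noteq> 0"
    "d3 * f + d4 * h = 0" "d1 * a + d4 * i = 0" "d1 * b + d2 * d = 0" "d1 * c + d2 * e + d3 * g = 0"
    "f \<noteq> 0" "h \<noteq> 0" "a \<noteq> 0" "i \<noteq> 0" "d \<noteq> 0" "c \<noteq> 0" "g \<noteq> 0"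
  shows False
proof (rule trinomial_obstruction)
  show "b * e / d = c + a * h * g / (i * f)"
    by (rule pentagon_elimination[OF assms(6-10)]) (use assms in auto)
  have "b\<^sup>2 * e\<^sup>2 / d\<^sup>2 = c\<^sup>2 + a\<^sup>2 * h\<^sup>2 * g\<^sup>2 / (i\<^sup>2 * f\<^sup>2)"
    by (rule pentagon_elimination[OF assms(1-5)]) (use assms in auto)
  then show "(b * e / d)\<^sup>2 = c\<^sup>2 + (a * h * g / (i * f))\<^sup>2" by (simp add: power_divide power_mult_distrib)
  show "c \<noteq> 0" "a * h * g / (i * f) \<noteq> 0" using assms by auto
qed

text \<open>Again the equations with two terms fix the ratios. The one relating \<open>c1\<close>
  and \<open>c4\<close> ensures that \<open>c3\<close> is nonzero: if \<open>c3\<close> vanished,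
  all four coefficients would.\<close>

lemma star_obstruction:
  fixes c1 c2 c3 c4 :: real
  assumes "c1 \<noteq> 0 \<or> c2 \<noteq> 0 \<or> c3 \<noteq> 0 \<or> c4 \<noteq> 0"
    "c3 * a\<^sup>2 + c4 * b\<^sup>2 = 0" "c2 * c\<^sup>2 + c3 * d\<^sup>2 = 0" "c2 * e\<^sup>2 + c3 * g\<^sup>2 + c4 * h\<^sup>2 = 0" "c1 * k\<^sup>2 + c4 * l\<^sup>2 = 0"
    "d1 \<noteq> 0 \<or> d2 \<noteq> 0 \<or> d3 \<noteq> 0 \<or> d4 \<noteq> 0"
    "d3 * a + d4 * b = 0" "d2 * c + d3 * d = 0" "d2 * e + d3 * g + d4 * h = 0" "d1 * k + d4 * l = 0"
    and nz: "a \<noteq> 0" "b \<noteq> 0" "c \<noteq> 0" "d \<noteq> 0" "e \<noteq> 0" "h \<noteq> 0" "k \<noteq> 0"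
  shows False
proof (rule trinomial_obstruction)
  have *: "g = d * e / c + a * h / b"
    if "c1 \<noteq> 0 \<or> c2 \<noteq> 0 \<or> c3 \<noteq> 0 \<or> c4 \<noteq> 0"
    "c3 * a + c4 * b = 0" "c2 * c + c3 * d = 0" "c2 * e + c3 * g + c4 * h = 0" "c1 * k + c4 * l = 0"
    "b \<noteq> 0" "c \<noteq> 0" "k \<noteq> 0" for c1 c2 c3 c4 a b c d e g h k l :: real
  proof -
    have c4: "c4 = - c3 * a / b" and c2: "c2 = - c3 * d / c" using that by (auto simp: field_simps)
    have "c1 = - c4 * l / k" using that by (auto simp: field_simps)
    then have "c3 \<noteq> 0" using that(1) c4 c2 by auto
    moreover have "c3 * (g - d * e / c - a * h / b) = 0"
      using that(4) unfolding c4 c2 by (simp add: algebra_simps)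
    ultimately show ?thesis by simp
  qed
  show "g = d * e / c + a * h / b" by (rule *[OF assms(6-10)]) (use nz in auto)
  have "g\<^sup>2 = d\<^sup>2 * e\<^sup>2 / c\<^sup>2 + a\<^sup>2 * h\<^sup>2 / b\<^sup>2" by (rule *[OF assms(1-5)]) (use nz in auto)
  then show "g\<^sup>2 = (d * e / c)\<^sup>2 + (a * h / b)\<^sup>2" by (simp add: power_divide power_mult_distrib)
  show "d * e / c \<noteq> 0" "a * h / b \<noteq> 0" using nz by auto
qed

lemma four_orthogonal_dependent:
  fixes z :: "'x::euclidean_space"
  assumes D: "DIM('x) = 4" and z: "z \<noteq> 0" and o: "v1 \<bullet> z = 0" "v2 \<bullet> z = 0" "v3 \<bullet> z = 0" "v4 \<bullet> z = 0"
  obtains c1 c2 c3 c4 where "c1 \<noteq> 0 \<or> c2 \<noteq> 0 \<or> c3 \<noteq> 0 \<or> c4 \<noteq> 0"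
    "c1 *\<^sub>R v1 + c2 *\<^sub>R v2 + c3 *\<^sub>R v3 + c4 *\<^sub>R v4 = 0"
proof -
  define f where "f = (\<lambda>i::nat. if i = 1 then v1 else if i = 2 then v2 else if i = 3 then v3 else v4)"
  have "f ` {1,2,3,4} \<subseteq> {x. z \<bullet> x = 0}" using o by (auto simp: f_def inner_commute)
  then have "dim (f ` {1,2,3,4}) \<le> dim {x. z \<bullet> x = 0}" by (rule dim_subset)
  also have "\<dots> = 3" using dim_hyperplane[OF z] D by simp
  finally have "dim (f ` {1,2,3,4}) < card {1,2,3,4::nat}" by simp
  then obtain u where u: "\<exists>i\<in>{1,2,3,4}. u i \<noteq> 0" "(\<Sum>i\<in>{1,2,3,4}. u i *\<^sub>R f i) = 0"
    by (rule linear_dependence_image[rotated]) auto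
  then show ?thesis using that[of "u 1" "u 2" "u 3" "u 4"] by (auto simp: f_def add.assoc)
qed

text \<open>In the application \<open>p v\<close> is the homogeneous point \<open>(v, 1)\<close> and
  \<open>q F\<close> the pair \<open>(- c F, d F)\<close>, so their inner product is the slack of
  \<open>v\<close> at \<open>F\<close>; \<open>a\<close> and \<open>b\<close> are the vectors of the
  factorization. The first four-space is kept general because the polytope may live in any Euclidean
  space of dimension three.\<close>

locale psd_incidence = incidence V K I for V :: "'v set" and K :: "'f set" and I +
  fixes p :: "'v \<Rightarrow> 'x::euclidean_space" and q :: "'f \<Rightarrow> 'x"
    and a :: "'v \<Rightarrow> 'y::euclidean_space" and b :: "'f \<Rightarrow> 'y"
  assumes DIMs: "DIM('x) = 4" "DIM('y) = 4"
    and slack: "v \<in> V \<Longrightarrow> F \<in> K \<Longrightarrow> p v \<bullet> q F = (a v \<bullet> b F)\<^sup>2"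
    and inc: "v \<in> V \<Longrightarrow> F \<in> K \<Longrightarrow> I v F \<longleftrightarrow> a v \<bullet> b F = 0"
    and miss: "F \<in> K \<Longrightarrow> \<exists>v\<in>V. \<not> I v F" and miss': "v \<in> V \<Longrightarrow> \<exists>F\<in>K. \<not> I v F"
begin

lemma psd_dual: "psd_incidence K V (\<lambda>F v. I v F) q p b a"
proof -
  interpret D: incidence K V "\<lambda>F v. I v F" by (rule dual)
  show ?thesis
    by unfold_locales (use DIMs slack inc miss miss' in \<open>auto simp: inner_commute\<close>)
qed

text \<open>The vectors \<open>p v\<close> of vertices on \<open>F\<close> are orthogonal to
  \<open>q F\<close>, and the vectors \<open>a v\<close> to \<open>b F\<close>. Some vertex is off
  \<open>F\<close>, so \<open>q F\<close> and \<open>b F\<close> are nonzero and both families live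
  in dimension three.\<close>

lemma facet_dependence:
  assumes F: "F \<in> K" and v: "v1 \<in> on F" "v2 \<in> on F" "v3 \<in> on F" "v4 \<in> on F"
  obtains c1 c2 c3 c4 d1 d2 d3 d4 :: real where
    "c1 \<noteq> 0 \<or> c2 \<noteq> 0 \<or> c3 \<noteq> 0 \<or> c4 \<noteq> 0" "d1 \<noteq> 0 \<or> d2 \<noteq> 0 \<or> d3 \<noteq> 0 \<or> d4 \<noteq> 0"
    "\<And>G. G \<in> K \<Longrightarrow> c1 * (a v1 \<bullet> b G)\<^sup>2 + c2 * (a v2 \<bullet> b G)\<^sup>2 + c3 * (a v3 \<bullet> b G)\<^sup>2 + c4 * (a v4 \<bullet> b G)\<^sup>2 = 0"
    "\<And>G. G \<in> K \<Longrightarrow> d1 * (a v1 \<bullet> b G) + d2 * (a v2 \<bullet> b G) + d3 * (a v3 \<bullet> b G) + d4 * (a v4 \<bullet> b G) = 0"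
proof -
  have V: "v1 \<in> V" "v2 \<in> V" "v3 \<in> V" "v4 \<in> V" using v by (auto simp: on_def)
  have za: "a v1 \<bullet> b F = 0" "a v2 \<bullet> b F = 0" "a v3 \<bullet> b F = 0" "a v4 \<bullet> b F = 0"
    using v F inc by (auto simp: on_def)
  then have zp: "p v1 \<bullet> q F = 0" "p v2 \<bullet> q F = 0" "p v3 \<bullet> q F = 0" "p v4 \<bullet> q F = 0"
    using slack F V by auto
  obtain w where w: "w \<in> V" "\<not> I w F" using miss F by blast
  then have "a w \<bullet> b F \<noteq> 0" "p w \<bullet> q F \<noteq> 0" using inc F slack by auto
  then have nz: "b F \<noteq> 0" "q F \<noteq> 0" by auto
  obtain c1 c2 c3 c4 where c: "c1 \<noteq> 0 \<or> c2 \<noteq> 0 \<or> c3 \<noteq> 0 \<or> c4 \<noteq> 0"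
    "c1 *\<^sub>R p v1 + c2 *\<^sub>R p v2 + c3 *\<^sub>R p v3 + c4 *\<^sub>R p v4 = 0"
    by (rule four_orthogonal_dependent[OF DIMs(1) nz(2) zp])
  obtain d1 d2 d3 d4 where d: "d1 \<noteq> 0 \<or> d2 \<noteq> 0 \<or> d3 \<noteq> 0 \<or> d4 \<noteq> 0"
    "d1 *\<^sub>R a v1 + d2 *\<^sub>R a v2 + d3 *\<^sub>R a v3 + d4 *\<^sub>R a v4 = 0"
    by (rule four_orthogonal_dependent[OF DIMs(2) nz(1) za])
  show ?thesis
  proof (rule that[OF c(1) d(1)])
    fix G assume G: "G \<in> K"
    have "(c1 *\<^sub>R p v1 + c2 *\<^sub>R p v2 + c3 *\<^sub>R p v3 + c4 *\<^sub>R p v4) \<bullet> q G = 0" using c(2) by simp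
    then show "c1 * (a v1 \<bullet> b G)\<^sup>2 + c2 * (a v2 \<bullet> b G)\<^sup>2 + c3 * (a v3 \<bullet> b G)\<^sup>2 + c4 * (a v4 \<bullet> b G)\<^sup>2 = 0"
      using slack G V by (simp add: inner_add_left)
    have "(d1 *\<^sub>R a v1 + d2 *\<^sub>R a v2 + d3 *\<^sub>R a v3 + d4 *\<^sub>R a v4) \<bullet> b G = 0" using d(2) by simp
    then show "d1 * (a v1 \<bullet> b G) + d2 * (a v2 \<bullet> b G) + d3 * (a v3 \<bullet> b G) + d4 * (a v4 \<bullet> b G) = 0"
      by (simp add: inner_add_left)
  qed
qed

text \<open>Take consecutive vertices \<open>v1\<close>, ..., \<open>v5\<close> of \<open>F\<close>;
  they are distinct because the boundary cycle cannot close up earlier. The facet across an edge of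
  \<open>F\<close> contains no further vertex of \<open>F\<close>. Evaluating the dependencies of
  \<open>v1\<close>, ..., \<open>v4\<close> at the facets across the four edges from
  \<open>v1\<close> to \<open>v5\<close> gives the pattern of
  \<open>pentagon_obstruction\<close>.\<close>

lemma on_le4:
  assumes F: "F \<in> K" shows "card (on F) \<le> 4"
proof (rule ccontr)
  assume big: "\<not> card (on F) \<le> 4"
  have onI: "x \<in> V \<and> I x F \<and> x \<noteq> y" if "x \<in> nb F y" for x y using that by (auto simp: nb_def)
  obtain v2 where v2: "v2 \<in> V" "I v2 F" using ex_on F by blast
  obtain v1 v3 where 13: "v1 \<noteq> v3" "nb F v2 = {v1, v3}" using nb_two v2 F by blast
  have v1: "v1 \<in> V" "I v1 F" "v1 \<noteq> v2" and v3: "v3 \<in> V" "I v3 F" "v3 \<noteq> v2" using onI[of _ v2] 13 by auto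
  have "v2 \<in> nb F v3" "v2 \<in> nb F v1" using nb_sym v2 13 by auto
  then obtain v4 where 4: "v4 \<noteq> v2" "nb F v3 = {v2, v4}" using nb_other[OF v3(1) F v3(2)] by metis
  have v4: "v4 \<in> V" "I v4 F" "v4 \<noteq> v3" using onI[of _ v3] 4 by auto
  have cl: "card (on F) = card W" if "W \<subseteq> on F" "W \<noteq> {}" "\<And>w. w \<in> W \<Longrightarrow> nb F w \<subseteq> W" for W
    using closed_on[OF F that] by simp
  have vF: "v1 \<in> on F" "v2 \<in> on F" "v3 \<in> on F" "v4 \<in> on F" using v1 v2 v3 v4 by (auto simp: on_def)
  have "v4 \<noteq> v1"
  proof
    assume [simp]: "v4 = v1"
    have "nb F v1 = {v2, v3}" using nb_eqI[of v1 F v2 v3] nb_sym[of v1 F v2] nb_sym[of v1 F v3] v1 v2 v3 13 4 F by auto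
    then have "card (on F) = card {v1, v2, v3}" using 13 4 vF by (intro cl) auto
    then show False using big by (simp add: card_insert_if split: if_splits)
  qed
  have "v3 \<in> nb F v4" using nb_sym v3 4 by auto
  then obtain v5 where 5: "v5 \<noteq> v3" "nb F v4 = {v3, v5}" using nb_other[OF v4(1) F v4(2)] by metis
  have v5: "v5 \<in> V" "I v5 F" "v5 \<noteq> v4" using onI[of _ v4] 5 by auto
  have "v5 \<noteq> v1"
  proof
    assume [simp]: "v5 = v1"
    have "nb F v1 = {v2, v4}" using nb_eqI[of v1 F v2 v4] nb_sym[of v1 F v2] nb_sym[of v1 F v4] v1 v2 v4 13 5 4 F by auto
    then have "card (on F) = card {v1, v2, v3, v4}" using 13 4 5 vF by (intro cl) auto
    then show False using big by (simp add: card_insert_if split: if_splits)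
  qed
  have "v5 \<noteq> v2"
  proof
    assume [simp]: "v5 = v2"
    have "v4 \<in> nb F v2" using nb_sym[of v2 F v4] 5 v4 by auto
    then show False using 13 4 \<open>v4 \<noteq> v1\<close> v4 by auto
  qed
  have edge: "\<exists>G\<in>K. G \<noteq> F \<and> I x G \<and> I y G" if "y \<in> nb F x" for x y using that by (auto simp: nb_def)
  obtain G12 where G12: "G12 \<in> K" "G12 \<noteq> F" "I v1 G12" "I v2 G12" using edge[of v1 v2] 13 by auto
  obtain G23 where G23: "G23 \<in> K" "G23 \<noteq> F" "I v2 G23" "I v3 G23" using edge[of v3 v2] 13 by auto
  obtain G34 where G34: "G34 \<in> K" "G34 \<noteq> F" "I v3 G34" "I v4 G34" using edge[of v4 v3] 4 by auto
  obtain G45 where G45: "G45 \<in> K" "G45 \<noteq> F" "I v4 G45" "I v5 G45" using edge[of v5 v4] 5 by auto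
  have z: "a x \<bullet> b G = 0" if "I x G" "x \<in> V" "G \<in> K" for x G using that inc by blast
  have nz: "a w \<bullet> b G \<noteq> 0" if "G \<in> K" "G \<noteq> F" "x \<in> V" "y \<in> V" "x \<noteq> y" "I x G" "I y G" "I x F" "I y F" "w \<in> V" "I w F" "w \<noteq> x" "w \<noteq> y" for w x y G
    using meet[of F G x y w] that F inc by blast
  obtain c1 c2 c3 c4 d1 d2 d3 d4 where
    ne: "c1 \<noteq> 0 \<or> c2 \<noteq> 0 \<or> c3 \<noteq> 0 \<or> c4 \<noteq> 0" "d1 \<noteq> 0 \<or> d2 \<noteq> 0 \<or> d3 \<noteq> 0 \<or> d4 \<noteq> 0" and
    c: "\<And>G. G \<in> K \<Longrightarrow> c1 * (a v1 \<bullet> b G)\<^sup>2 + c2 * (a v2 \<bullet> b G)\<^sup>2 + c3 * (a v3 \<bullet> b G)\<^sup>2 + c4 * (a v4 \<bullet> b G)\<^sup>2 = 0" and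
    d: "\<And>G. G \<in> K \<Longrightarrow> d1 * (a v1 \<bullet> b G) + d2 * (a v2 \<bullet> b G) + d3 * (a v3 \<bullet> b G) + d4 * (a v4 \<bullet> b G) = 0"
    by (rule facet_dependence[OF F vF]) blast
  have z12: "a v1 \<bullet> b G12 = 0" "a v2 \<bullet> b G12 = 0" using z G12 v1 v2 by auto
  have z23: "a v2 \<bullet> b G23 = 0" "a v3 \<bullet> b G23 = 0" using z G23 v2 v3 by auto
  have z34: "a v3 \<bullet> b G34 = 0" "a v4 \<bullet> b G34 = 0" using z G34 v3 v4 by auto
  have z45: "a v4 \<bullet> b G45 = 0" using z G45 v4 by auto
  show False
  proof (rule pentagon_obstruction)
    show "c1 \<noteq> 0 \<or> c2 \<noteq> 0 \<or> c3 \<noteq> 0 \<or> c4 \<noteq> 0" "d1 \<noteq> 0 \<or> d2 \<noteq> 0 \<or> d3 \<noteq> 0 \<or> d4 \<noteq> 0" by (rule ne)+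
    show "c3 * (a v3 \<bullet> b G12)\<^sup>2 + c4 * (a v4 \<bullet> b G12)\<^sup>2 = 0" "d3 * (a v3 \<bullet> b G12) + d4 * (a v4 \<bullet> b G12) = 0"
      using c[OF G12(1)] d[OF G12(1)] z12 by simp_all
    show "c1 * (a v1 \<bullet> b G23)\<^sup>2 + c4 * (a v4 \<bullet> b G23)\<^sup>2 = 0" "d1 * (a v1 \<bullet> b G23) + d4 * (a v4 \<bullet> b G23) = 0"
      using c[OF G23(1)] d[OF G23(1)] z23 by simp_all
    show "c1 * (a v1 \<bullet> b G34)\<^sup>2 + c2 * (a v2 \<bullet> b G34)\<^sup>2 = 0" "d1 * (a v1 \<bullet> b G34) + d2 * (a v2 \<bullet> b G34) = 0"
      using c[OF G34(1)] d[OF G34(1)] z34 by simp_all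
    show "c1 * (a v1 \<bullet> b G45)\<^sup>2 + c2 * (a v2 \<bullet> b G45)\<^sup>2 + c3 * (a v3 \<bullet> b G45)\<^sup>2 = 0"
      "d1 * (a v1 \<bullet> b G45) + d2 * (a v2 \<bullet> b G45) + d3 * (a v3 \<bullet> b G45) = 0"
      using c[OF G45(1)] d[OF G45(1)] z45 by simp_all
    show "a v3 \<bullet> b G12 \<noteq> 0" "a v4 \<bullet> b G12 \<noteq> 0"
      using nz[OF G12(1,2) v1(1) v2(1) v1(3) G12(3,4) v1(2) v2(2)] v3 v4 13 4 \<open>v4 \<noteq> v1\<close> by auto
    show "a v1 \<bullet> b G23 \<noteq> 0" "a v4 \<bullet> b G23 \<noteq> 0"
      using nz[OF G23(1,2) v2(1) v3(1) v3(3)[symmetric] G23(3,4) v2(2) v3(2)] v1 v4 13 4 by auto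
    show "a v2 \<bullet> b G34 \<noteq> 0"
      using nz[OF G34(1,2) v3(1) v4(1) v4(3)[symmetric] G34(3,4) v3(2) v4(2)] v2 v3 4 by auto
    show "a v1 \<bullet> b G45 \<noteq> 0" "a v3 \<bullet> b G45 \<noteq> 0"
      using nz[OF G45(1,2) v4(1) v5(1) v5(3)[symmetric] G45(3,4) v4(2) v5(2)] v1 v3 v4 5 13 \<open>v4 \<noteq> v1\<close> \<open>v5 \<noteq> v1\<close> by auto
  qed
qed

lemma on_card: "F \<in> K \<Longrightarrow> card (on F) = 3 \<or> card (on F) = 4"
  using on_ge3 on_le4 by fastforce

definition star :: "'v \<Rightarrow> 'f set" where "star v = {F \<in> K. I v F}"

lemma star_card: "v \<in> V \<Longrightarrow> card (star v) = 3 \<or> card (star v) = 4"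
proof -
  interpret D: psd_incidence K V "\<lambda>F v. I v F" q p b a by (rule psd_dual)
  assume "v \<in> V" then show ?thesis using D.on_card[of v] by (simp add: D.on_def star_def)
qed

lemma finite_star: "finite (star v)"
  using finK by (simp add: star_def)

text \<open>Adjacency in the cycle of facets around \<open>v\<close>: a second common vertex means a
  common edge at \<open>v\<close>. It is the dual of \<open>nb\<close>.\<close>

definition meets :: "'v \<Rightarrow> 'f \<Rightarrow> 'f \<Rightarrow> bool" where
  "meets v F G \<longleftrightarrow> F \<in> star v \<and> G \<in> star v \<and> F \<noteq> G \<and> (\<exists>w\<in>V. w \<noteq> v \<and> I w F \<and> I w G)"

lemma degree_three_meets:
  assumes v: "v \<in> V" "card (star v) = 3" "F \<in> star v" "G \<in> star v" "F \<noteq> G"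
  shows "meets v F G"
proof -
  interpret D: psd_incidence K V "\<lambda>F v. I v F" q p b a by (rule psd_dual)
  have e: "D.on v = star v" by (simp add: D.on_def star_def)
  have "G \<in> D.nb v F" using D.triangle[of v F G] v e by simp
  then show ?thesis using v by (auto simp: meets_def D.nb_def)
qed

lemma degree_four_cycle:
  assumes v: "v \<in> V" "card (star v) = 4" and FG: "meets v F G"
  obtains O' H where "distinct [F, G, O', H]" "star v = {F, G, O', H}"
    "meets v G O'" "meets v O' H" "meets v H F" "\<not> meets v F O'" "\<not> meets v G H"
proof -
  interpret D: psd_incidence K V "\<lambda>F v. I v F" q p b a by (rule psd_dual)
  have e: "D.on v = star v" by (simp add: D.on_def star_def)
  have m: "A \<in> D.nb v B \<longleftrightarrow> meets v B A" if "B \<in> star v" for A B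
    using that v by (auto simp: D.nb_def meets_def star_def)
  have F: "F \<in> star v" using FG by (simp add: meets_def)
  obtain O' H where *: "distinct [F, G, O', H]" "D.on v = {F, G, O', H}"
    "D.nb v F = {G, H}" "D.nb v G = {F, O'}" "D.nb v O' = {G, H}" "D.nb v H = {F, O'}"
    using D.quadrilateral[of v F G] v e F m[of F G] FG by metis
  have st: "star v = {F, G, O', H}" using * e by simp
  show ?thesis
    by (rule that[OF *(1) st]) (use * st in \<open>auto simp: m[symmetric]\<close>)
qed

end

text \<open>The vertices \<open>s\<close> and \<open>s'\<close> are the apices, the other three form
  the equator.\<close>

definition bisimplex_sets :: "'v \<Rightarrow> 'v \<Rightarrow> 'v \<Rightarrow> 'v \<Rightarrow> 'v \<Rightarrow> 'v set set" where
  "bisimplex_sets s s' t1 t2 t3 =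
     {{s,t1,t2}, {s,t1,t3}, {s,t2,t3}, {s',t1,t2}, {s',t1,t3}, {s',t2,t3}}"

text \<open>The pairs \<open>x, x'\<close> and \<open>y, y'\<close> and \<open>z, z'\<close> are
  antipodal: a facet takes one vertex from each.\<close>

definition octahedron_sets :: "'v \<Rightarrow> 'v \<Rightarrow> 'v \<Rightarrow> 'v \<Rightarrow> 'v \<Rightarrow> 'v \<Rightarrow> 'v set set" where
  "octahedron_sets x x' y y' z z' =
     {{x,y,z}, {x,y,z'}, {x,y',z}, {x,y',z'}, {x',y,z}, {x',y,z'}, {x',y',z}, {x',y',z'}}"

section \<open>Stars of vertices of degree four\<close>

context psd_incidence
begin

lemma on_V: "x \<in> on F \<Longrightarrow> x \<in> V"
  by (simp add: on_def)

lemma star_iff: "v \<in> V \<Longrightarrow> F \<in> star v \<longleftrightarrow> F \<in> K \<and> v \<in> on F"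
  by (auto simp: on_def star_def)

lemma meetsI: "v \<in> V \<Longrightarrow> F \<in> star v \<Longrightarrow> G \<in> star v \<Longrightarrow> F \<noteq> G \<Longrightarrow> w \<in> on F \<Longrightarrow> w \<in> on G \<Longrightarrow> w \<noteq> v \<Longrightarrow> meets v F G"
  by (auto simp: meets_def on_def)

lemma meetsE:
  assumes "meets v F G"
  obtains w where "w \<in> on F" "w \<in> on G" "w \<noteq> v"
  using assms by (auto simp: meets_def on_def)

lemma three_facets_share:
  assumes "v \<in> V" "x \<noteq> v" "F \<in> star v" "G \<in> star v" "H \<in> star v" "F \<noteq> G" "F \<noteq> H" "G \<noteq> H"
    "x \<in> on F" "x \<in> on G" "x \<in> on H"
  shows False
  using meet'[of v x F G H] assms by (auto simp: star_def on_def)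

text \<open>Let \<open>x\<close> be the vertex opposite to \<open>v\<close> in a quadrilateral
  \<open>F1\<close>; of the facets at \<open>v\<close> it lies on \<open>F1\<close> only. The
  dependencies of the four facets at \<open>v\<close>, evaluated at the neighbours
  \<open>u1\<close>, \<open>u4\<close>, \<open>u2\<close> of \<open>v\<close> and at
  \<open>x\<close>, have the pattern of \<open>star_obstruction\<close>, with three terms at
  \<open>x\<close>.\<close>

lemma triangles_at_degree_four:
  assumes v: "v \<in> V" "card (star v) = 4" "F1 \<in> star v"
  shows "card (on F1) = 3"
proof (rule ccontr)
  assume "card (on F1) \<noteq> 3"
  have F1: "F1 \<in> K" "I v F1" using v by (auto simp: star_def)
  then have c4: "card (on F1) = 4" using on_card \<open>card (on F1) \<noteq> 3\<close> by blast
  have von: "v \<in> on F1" using F1 v by (simp add: on_def)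
  obtain y1 y2 where "nb F1 v = {y1, y2}" using nb_two v F1 by blast
  then have "y1 \<in> nb F1 v" by simp
  then obtain F2 where "F2 \<in> K" "F2 \<noteq> F1" "I v F2" "I y1 F2" "y1 \<in> V" "y1 \<noteq> v" "I y1 F1" by (auto simp: nb_def)
  then have m12: "meets v F1 F2" using v by (auto simp: meets_def star_def)
  obtain F3 F4 where cyc: "distinct [F1, F2, F3, F4]" "star v = {F1, F2, F3, F4}"
    "meets v F2 F3" "meets v F3 F4" "meets v F4 F1" "\<not> meets v F1 F3" "\<not> meets v F2 F4"
    by (rule degree_four_cycle[OF v(1,2) m12])
  have K: "F2 \<in> K" "F3 \<in> K" "F4 \<in> K" using cyc(2) by (auto simp: star_def)
  obtain u1 where u1: "u1 \<in> on F1" "u1 \<in> on F2" "u1 \<noteq> v" using m12 by (rule meetsE)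
  obtain u2 where u2: "u2 \<in> on F2" "u2 \<in> on F3" "u2 \<noteq> v" using cyc(3) by (rule meetsE)
  obtain u4 where u4: "u4 \<in> on F4" "u4 \<in> on F1" "u4 \<noteq> v" using cyc(5) by (rule meetsE)
  note uV = on_V[OF u1(1)] on_V[OF u2(1)] on_V[OF u4(1)]
  have vF: "v \<in> on F1" "v \<in> on F2" "v \<in> on F3" "v \<in> on F4" using cyc(2) v(1) by (auto simp: star_def on_def)
  have ne: "u1 \<noteq> u4" using three_facets_share[OF v(1) u1(3), of F1 F2 F4] u1 u4 cyc by auto
  have nbv: "nb F1 v = {u1, u4}"
    by (rule nb_eqI[OF v(1) F1]) (use u1 u4 vF cyc K ne in \<open>auto simp: nb_def on_def\<close>)
  have "u1 \<in> nb F1 v" using nbv by simp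
  then obtain x w' where x: "distinct [v, u1, x, w']" "on F1 = {v, u1, x, w'}" "nb F1 v = {u1, w'}"
    using quadrilateral[OF F1(1) c4 von] by metis
  have w': "w' = u4" using x(3) nbv ne by (auto simp: doubleton_eq_iff)
  have xF: "x \<in> on F1" and xV: "x \<in> V" using x on_V by auto
  have x2: "x \<notin> on F2" using meet[of F1 F2 v u1 x] F1 K cyc(1) v u1 uV xF xV vF x(1) by (auto simp: on_def)
  have x4: "x \<notin> on F4" using meet[of F1 F4 v u4 x] F1 K cyc(1) v u4 uV xF xV vF x(1) w' by (auto simp: on_def)
  have u14: "u1 \<notin> on F4" using meet[of F1 F4 v u4 u1] F1 K cyc(1) v u4 u1 uV vF ne by (auto simp: on_def)
  have u42: "u4 \<notin> on F2" using meet[of F1 F2 v u1 u4] F1 K cyc(1) v u4 u1 uV vF ne by (auto simp: on_def)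
  have n13: "y \<notin> on F3" if "y \<in> on F1" "y \<noteq> v" for y
    using cyc(1,2,6) meetsI[OF v(1), of F1 F3 y] that by auto
  have u21: "u2 \<notin> on F1" using n13[of u2] u2 by auto
  have z: "a y \<bullet> b F = 0" if "y \<in> on F" "F \<in> K" for y F using that inc by (auto simp: on_def)
  have nz: "b F \<bullet> a y \<noteq> 0" if "y \<notin> on F" "F \<in> K" "y \<in> V" for y F using that inc by (auto simp: on_def inner_commute)
  interpret D: psd_incidence K V "\<lambda>F v. I v F" q p b a by (rule psd_dual)
  have st: "F1 \<in> D.on v" "F2 \<in> D.on v" "F3 \<in> D.on v" "F4 \<in> D.on v" using cyc(2) by (auto simp: star_def D.on_def)
  obtain c1 c2 c3 c4 d1 d2 d3 d4 where
    cd: "c1 \<noteq> 0 \<or> c2 \<noteq> 0 \<or> c3 \<noteq> 0 \<or> c4 \<noteq> 0" "d1 \<noteq> 0 \<or> d2 \<noteq> 0 \<or> d3 \<noteq> 0 \<or> d4 \<noteq> 0" and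
    c: "\<And>G. G \<in> V \<Longrightarrow> c1 * (b F1 \<bullet> a G)\<^sup>2 + c2 * (b F2 \<bullet> a G)\<^sup>2 + c3 * (b F3 \<bullet> a G)\<^sup>2 + c4 * (b F4 \<bullet> a G)\<^sup>2 = 0" and
    d: "\<And>G. G \<in> V \<Longrightarrow> d1 * (b F1 \<bullet> a G) + d2 * (b F2 \<bullet> a G) + d3 * (b F3 \<bullet> a G) + d4 * (b F4 \<bullet> a G) = 0"
    by (rule D.facet_dependence[OF v(1) st]) blast
  have z1: "b F1 \<bullet> a u1 = 0" "b F2 \<bullet> a u1 = 0" using z u1 F1 K by (auto simp: inner_commute)
  have z4: "b F1 \<bullet> a u4 = 0" "b F4 \<bullet> a u4 = 0" using z u4 F1 K by (auto simp: inner_commute)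
  have zx: "b F1 \<bullet> a x = 0" using z xF F1 by (auto simp: inner_commute)
  have z2: "b F2 \<bullet> a u2 = 0" "b F3 \<bullet> a u2 = 0" using z u2 K by (auto simp: inner_commute)
  show False
  proof (rule star_obstruction)
    show "c1 \<noteq> 0 \<or> c2 \<noteq> 0 \<or> c3 \<noteq> 0 \<or> c4 \<noteq> 0" "d1 \<noteq> 0 \<or> d2 \<noteq> 0 \<or> d3 \<noteq> 0 \<or> d4 \<noteq> 0" by (rule cd)+
    show "c3 * (b F3 \<bullet> a u1)\<^sup>2 + c4 * (b F4 \<bullet> a u1)\<^sup>2 = 0" "d3 * (b F3 \<bullet> a u1) + d4 * (b F4 \<bullet> a u1) = 0"
      using c[OF uV(1)] d[OF uV(1)] z1 by simp_all
    show "c2 * (b F2 \<bullet> a u4)\<^sup>2 + c3 * (b F3 \<bullet> a u4)\<^sup>2 = 0" "d2 * (b F2 \<bullet> a u4) + d3 * (b F3 \<bullet> a u4) = 0"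
      using c[OF uV(3)] d[OF uV(3)] z4 by simp_all
    show "c2 * (b F2 \<bullet> a x)\<^sup>2 + c3 * (b F3 \<bullet> a x)\<^sup>2 + c4 * (b F4 \<bullet> a x)\<^sup>2 = 0"
      "d2 * (b F2 \<bullet> a x) + d3 * (b F3 \<bullet> a x) + d4 * (b F4 \<bullet> a x) = 0"
      using c[OF xV] d[OF xV] zx by simp_all
    show "c1 * (b F1 \<bullet> a u2)\<^sup>2 + c4 * (b F4 \<bullet> a u2)\<^sup>2 = 0" "d1 * (b F1 \<bullet> a u2) + d4 * (b F4 \<bullet> a u2) = 0"
      using c[OF uV(2)] d[OF uV(2)] z2 by simp_all
    show "b F3 \<bullet> a u1 \<noteq> 0" "b F4 \<bullet> a u1 \<noteq> 0" "b F2 \<bullet> a u4 \<noteq> 0" "b F3 \<bullet> a u4 \<noteq> 0"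
      "b F2 \<bullet> a x \<noteq> 0" "b F4 \<bullet> a x \<noteq> 0" "b F1 \<bullet> a u2 \<noteq> 0"
      using nz u14 u42 n13[OF u1(1,3)] n13[OF u4(2,3)] x2 x4 u21 uV xV K F1 by auto
  qed
qed

lemma triangle_eq:
  assumes "F \<in> K" "card (on F) = 3" "x \<in> on F" "y \<in> on F" "z \<in> on F" "distinct [x, y, z]"
  shows "on F = {x, y, z}"
proof -
  have "{x, y, z} = on F" by (rule card_subset_eq) (use assms finite_on in auto)
  then show ?thesis by simp
qed

lemma star3_eq:
  assumes "card (star v) = 3" "x \<in> star v" "y \<in> star v" "z \<in> star v" "distinct [x, y, z]"
  shows "star v = {x, y, z}"
proof -
  have "{x, y, z} = star v" by (rule card_subset_eq) (use assms finite_star in auto)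
  then show ?thesis by simp
qed

lemma star4_eq:
  assumes "v \<in> V" "x \<in> star v" "y \<in> star v" "z \<in> star v" "w \<in> star v" "distinct [x, y, z, w]"
  shows "star v = {x, y, z, w}"
proof -
  have "card {x, y, z, w} \<le> card (star v)" by (rule card_mono) (use assms finite_star in auto)
  then have "card (star v) = 4" using star_card[OF assms(1)] assms(6) by auto
  then have "{x, y, z, w} = star v" by (intro card_subset_eq) (use assms finite_star in auto)
  then show ?thesis by simp
qed

text \<open>All facets at a vertex of degree four are triangles, so the star is a wheel with hub
  \<open>v\<close> and rim \<open>u1\<close>, \<open>u2\<close>, \<open>u3\<close>,
  \<open>u4\<close> in cyclic order.\<close>

lemma degree_four_star:
  assumes v: "v \<in> V" "card (star v) = 4" and F: "F1 \<in> star v" "F2 \<in> star v" "F1 \<noteq> F2"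
    and u1: "u1 \<in> on F1" "u1 \<in> on F2" "u1 \<noteq> v"
  obtains F3 F4 u2 u3 u4 where "distinct [F1, F2, F3, F4]" "star v = {F1, F2, F3, F4}"
    "distinct [v, u1, u2, u3, u4]"
    "on F1 = {v, u4, u1}" "on F2 = {v, u1, u2}" "on F3 = {v, u2, u3}" "on F4 = {v, u3, u4}"
proof -
  have m12: "meets v F1 F2" by (rule meetsI[OF v(1) F u1])
  obtain F3 F4 where cyc: "distinct [F1, F2, F3, F4]" "star v = {F1, F2, F3, F4}"
    "meets v F2 F3" "meets v F3 F4" "meets v F4 F1" "\<not> meets v F1 F3" "\<not> meets v F2 F4"
    by (rule degree_four_cycle[OF v(1,2) m12])
  have K: "F1 \<in> K" "F2 \<in> K" "F3 \<in> K" "F4 \<in> K" using cyc(2) by (auto simp: star_def)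
  have vF: "v \<in> on F1" "v \<in> on F2" "v \<in> on F3" "v \<in> on F4" using cyc(2) v(1) by (auto simp: star_def on_def)
  obtain u2 where u2: "u2 \<in> on F2" "u2 \<in> on F3" "u2 \<noteq> v" using cyc(3) by (rule meetsE)
  obtain u3 where u3: "u3 \<in> on F3" "u3 \<in> on F4" "u3 \<noteq> v" using cyc(4) by (rule meetsE)
  obtain u4 where u4: "u4 \<in> on F4" "u4 \<in> on F1" "u4 \<noteq> v" using cyc(5) by (rule meetsE)
  have s: "F1 \<in> star v" "F2 \<in> star v" "F3 \<in> star v" "F4 \<in> star v" using cyc(2) by auto
  have "u1 \<noteq> u2" using three_facets_share[OF v(1) u1(3) s(1,2,3)] u1 u2 cyc(1) by auto
  moreover have "u1 \<noteq> u3" using three_facets_share[OF v(1) u1(3) s(1,2,3)] u1 u3 cyc(1) by auto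
  moreover have "u1 \<noteq> u4" using three_facets_share[OF v(1) u1(3) s(1,2,4)] u1 u4 cyc(1) by auto
  moreover have "u2 \<noteq> u3" using three_facets_share[OF v(1) u2(3) s(2,3,4)] u2 u3 cyc(1) by auto
  moreover have "u2 \<noteq> u4" using three_facets_share[OF v(1) u2(3) s(2,3,4)] u2 u4 cyc(1) by auto
  moreover have "u3 \<noteq> u4" using three_facets_share[OF v(1) u3(3) s(1,3,4)] u3 u4 cyc(1) by auto
  ultimately have d: "distinct [v, u1, u2, u3, u4]" using u1 u2 u3 u4 by auto
  note t = triangles_at_degree_four[OF v]
  have "on F1 = {v, u4, u1}" by (rule triangle_eq[OF K(1) t[OF s(1)]]) (use vF u1 u4 d in auto)
  moreover have "on F2 = {v, u1, u2}" by (rule triangle_eq[OF K(2) t[OF s(2)]]) (use vF u1 u2 d in auto)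
  moreover have "on F3 = {v, u2, u3}" by (rule triangle_eq[OF K(3) t[OF s(3)]]) (use vF u2 u3 d in auto)
  moreover have "on F4 = {v, u3, u4}" by (rule triangle_eq[OF K(4) t[OF s(4)]]) (use vF u3 u4 d in auto)
  ultimately show ?thesis using that cyc(1,2) d by blast
qed

text \<open>A cycle of length four contains no triangle.\<close>

lemma degree_four_no_triple:
  assumes "v \<in> V" "card (star v) = 4" "meets v F G" "meets v F H" "meets v G H"
  shows False
proof -
  obtain X Y where *: "distinct [F, G, X, Y]" "star v = {F, G, X, Y}"
    "meets v G X" "meets v X Y" "meets v Y F" "\<not> meets v F X" "\<not> meets v G Y"
    by (rule degree_four_cycle[OF assms(1-3)])
  have "H \<in> star v" "H \<noteq> F" "H \<noteq> G" using assms by (auto simp: meets_def)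
  then show False using * assms by auto
qed

end

lemma six_element_set_permute: "{a, b, c, d, e, f} = {b, a, e, c, d, f}"
  by auto

lemma eight_element_set_permute: "{a, b, c, d, e, f, g, h} = {b, a, c, d, f, e, g, h}"
  by auto

text \<open>Global connectedness is what turns a set of vertices closed under the facets through its
  members into the set of all vertices.\<close>

locale connected_psd_incidence = psd_incidence +
  assumes vconn: "\<lbrakk>W \<subseteq> V; W \<noteq> {};
    \<And>w w' F G. \<lbrakk>w \<in> W; w' \<in> V; F \<in> K; G \<in> K; F \<noteq> G; I w F; I w G; I w' F; I w' G\<rbrakk> \<Longrightarrow> w' \<in> W\<rbrakk>
    \<Longrightarrow> W = V"
begin

lemma V_eqI:
  assumes "W \<subseteq> V" "W \<noteq> {}" "\<And>w F. w \<in> W \<Longrightarrow> F \<in> star w \<Longrightarrow> on F \<subseteq> W"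
  shows "V = W"
proof -
  have "W = V"
  proof (rule vconn[OF assms(1,2)])
    fix w w' F G assume "w \<in> W" "w' \<in> V" "F \<in> K" "G \<in> K" "F \<noteq> G" "I w F" "I w G" "I w' F" "I w' G"
    then have "F \<in> star w" "w' \<in> on F" by (auto simp: star_def on_def)
    then show "w' \<in> W" using assms(3) \<open>w \<in> W\<close> by blast
  qed
  then show ?thesis by simp
qed

lemma K_eqI: "(\<And>w. w \<in> V \<Longrightarrow> star w \<subseteq> M) \<Longrightarrow> M \<subseteq> K \<Longrightarrow> K = M"
  using ex_on by (fastforce simp: star_def)

text \<open>The third facet \<open>G\<close> at \<open>u1\<close> shares edges with
  \<open>F1\<close> and \<open>F2\<close>, hence contains \<open>u4\<close> and \<open>u2\<close>.
  If \<open>G\<close> is a triangle, one more facet \<open>H\<close> closes the surface, to a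
  bisimplex with apices \<open>u1\<close> and \<open>u3\<close>. If \<open>G\<close> is a
  quadrilateral, all its vertices have degree three, it passes through \<open>u3\<close>, and
  \<open>v\<close> is the apex of a pyramid over it.\<close>

lemma degree_three_neighbour:
  assumes v: "v \<in> V" "card (star v) = 4"
    and F: "F1 \<in> star v" "F2 \<in> star v" "F1 \<noteq> F2" "u1 \<in> on F1" "u1 \<in> on F2" "u1 \<noteq> v"
    and d3: "card (star u1) = 3"
  shows "(\<exists>x u1 u2 u3 u4 G. distinct [x, u1, u2, u3, u4] \<and> V = {x, u1, u2, u3, u4} \<and> G \<in> K \<and> on G = {u1, u2, u3, u4})
    \<or> (\<exists>s s' t1 t2 t3. distinct [s, s', t1, t2, t3] \<and> V = {s, s', t1, t2, t3} \<and> on ` K = bisimplex_sets s s' t1 t2 t3)"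
proof -
  obtain F3 F4 u2 u3 u4 where Fd: "distinct [F1, F2, F3, F4]" and sv: "star v = {F1, F2, F3, F4}"
    and ud: "distinct [v, u1, u2, u3, u4]"
    and onF: "on F1 = {v, u4, u1}" "on F2 = {v, u1, u2}" "on F3 = {v, u2, u3}" "on F4 = {v, u3, u4}"
    by (rule degree_four_star[OF v F])
  have FK: "F1 \<in> K" "F2 \<in> K" "F3 \<in> K" "F4 \<in> K" using sv by (auto simp: star_def)
  have uV: "u1 \<in> V" "u2 \<in> V" "u3 \<in> V" "u4 \<in> V" using on_V[of u1 F1] on_V[of u2 F2] on_V[of u3 F3] on_V[of u4 F4] onF by auto
  note si = star_iff[OF v(1)] star_iff[OF uV(1)] star_iff[OF uV(2)] star_iff[OF uV(3)] star_iff[OF uV(4)]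
  have "card (star u1 - {F1, F2}) = 1"
    using d3 si FK onF Fd finite_star by (subst card_Diff_subset) auto
  then obtain G where G: "star u1 - {F1, F2} = {G}" by (auto simp: card_1_singleton_iff)
  have su1: "star u1 = {F1, F2, G}" and GF: "G \<noteq> F1" "G \<noteq> F2" using G si FK onF by auto
  have GK: "G \<in> K" and u1G: "u1 \<in> on G" using su1 si by auto
  have vG: "v \<notin> on G"
  proof
    assume "v \<in> on G"
    then have "G \<in> {F1, F2, F3, F4}" using GK si sv by auto
    then show False using GF u1G onF ud by auto
  qed
  then have GF': "G \<noteq> F3" "G \<noteq> F4" using onF by auto
  have "meets u1 G F1" by (rule degree_three_meets[OF uV(1) d3]) (use su1 GF in auto)
  then have u4G: "u4 \<in> on G" using vG onF by (auto elim!: meetsE)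
  have "meets u1 G F2" by (rule degree_three_meets[OF uV(1) d3]) (use su1 GF in auto)
  then have u2G: "u2 \<in> on G" using vG onF by (auto elim!: meetsE)
  show ?thesis
  proof (cases "card (on G) = 3")
    case True
    have onG: "on G = {u1, u2, u4}" by (rule triangle_eq[OF GK True u1G u2G u4G]) (use ud in auto)
    have s2: "F2 \<in> star u2" "F3 \<in> star u2" "G \<in> star u2" using si FK GK onF u2G by auto
    \<comment> \<open>In a star of degree three any two facets share a second vertex, but
      \<open>F3\<close> and \<open>G\<close> have only \<open>u2\<close> in common.\<close>
    have "card (star u2) \<noteq> 3"
    proof
      assume "card (star u2) = 3"
      then have "meets u2 F3 G" by (rule degree_three_meets[OF uV(2)]) (use s2 GF' in auto)
      then show False using onF onG ud by (auto elim!: meetsE)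
    qed
    then have d2: "card (star u2) = 4" using star_card uV by blast
    have "meets u2 F2 F3" by (rule meetsI[OF uV(2) s2(1,2), of v]) (use Fd onF ud in auto)
    then obtain H X where H: "distinct [F2, F3, H, X]" "star u2 = {F2, F3, H, X}"
      "meets u2 F3 H" "meets u2 H X" "meets u2 X F2" "\<not> meets u2 F2 H" "\<not> meets u2 F3 X"
      by (rule degree_four_cycle[OF uV(2) d2])
    \<comment> \<open>This identifies \<open>G\<close> in the cycle around \<open>u2\<close>: of the
      facets there, \<open>F2\<close> is adjacent to \<open>F3\<close> and \<open>X\<close> but not
      to \<open>H\<close>.\<close>
    have "meets u2 F2 G" by (rule meetsI[OF uV(2) s2(1,3), of u1]) (use GF onF onG ud in auto)
    then have X: "X = G" using H(2,6) s2(3) GF GF' by auto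
    have HK: "H \<in> K" and u2H: "u2 \<in> on H" using H(2) si by auto
    have HF: "H \<noteq> F1" "H \<noteq> F4" using u2H onF ud by auto
    have vH: "v \<notin> on H" using sv si HK H(1) HF by auto
    have u3H: "u3 \<in> on H" using H(3) onF vH by (auto elim!: meetsE)
    have u1H: "u1 \<notin> on H" using su1 si HK H(1) HF X by auto
    have u4H: "u4 \<in> on H" using H(4) onG u1H unfolding X by (auto elim!: meetsE)
    have "card (on H) = 3" by (rule triangles_at_degree_four[OF uV(2) d2]) (use H in auto)
    then have onH: "on H = {u2, u3, u4}" by (intro triangle_eq[OF HK _ u2H u3H u4H]) (use ud in auto)
    have su4: "star u4 = {F4, F1, G, H}"
      by (rule star4_eq[OF uV(4)]) (use si FK GK HK onF onG onH Fd GF GF' HF H X in auto)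
    have s3: "F3 \<in> star u3" "F4 \<in> star u3" "H \<in> star u3" using si FK HK onF onH by auto
    \<comment> \<open>The facets \<open>F3\<close>, \<open>F4\<close>, \<open>H\<close> are pairwise
      adjacent at \<open>u3\<close>, which does not occur in a cycle of length four.\<close>
    have "card (star u3) \<noteq> 4"
    proof
      assume d: "card (star u3) = 4"
      have "meets u3 F3 F4" by (rule meetsI[OF uV(3) s3(1,2), of v]) (use Fd onF ud in auto)
      moreover have "meets u3 F3 H" by (rule meetsI[OF uV(3) s3(1,3), of u2]) (use H onF onH ud in auto)
      moreover have "meets u3 F4 H" by (rule meetsI[OF uV(3) s3(2,3), of u4]) (use HF onF onH ud in auto)
      ultimately show False by (rule degree_four_no_triple[OF uV(3) d])
    qed
    then have "card (star u3) = 3" using star_card uV by blast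
    then have su3: "star u3 = {F3, F4, H}" by (rule star3_eq[OF _ s3]) (use Fd H HF in auto)
    have "star v \<subseteq> {F1, F2, F3, F4, G, H}" "star u1 \<subseteq> {F1, F2, F3, F4, G, H}"
      "star u2 \<subseteq> {F1, F2, F3, F4, G, H}" "star u3 \<subseteq> {F1, F2, F3, F4, G, H}" "star u4 \<subseteq> {F1, F2, F3, F4, G, H}"
      unfolding sv su1 H(2) su3 su4 X by simp_all
    then have stars: "star w \<subseteq> {F1, F2, F3, F4, G, H}" if "w \<in> {v, u1, u2, u3, u4}" for w using that by blast
    have Veq: "V = {v, u1, u2, u3, u4}"
    proof (rule V_eqI)
      fix w F assume "w \<in> {v, u1, u2, u3, u4}" "F \<in> star w"
      then have "F \<in> {F1, F2, F3, F4, G, H}" using stars by blast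
      moreover have "on F1 \<subseteq> {v, u1, u2, u3, u4}" "on F2 \<subseteq> {v, u1, u2, u3, u4}" "on F3 \<subseteq> {v, u1, u2, u3, u4}"
        "on F4 \<subseteq> {v, u1, u2, u3, u4}" "on G \<subseteq> {v, u1, u2, u3, u4}" "on H \<subseteq> {v, u1, u2, u3, u4}"
        unfolding onF onG onH by simp_all
      ultimately show "on F \<subseteq> {v, u1, u2, u3, u4}" by blast
    qed (use v uV in auto)
    have "K = {F1, F2, F3, F4, G, H}"
    proof (rule K_eqI)
      fix w assume "w \<in> V"
      then have "w \<in> {v, u1, u2, u3, u4}" by (subst Veq[symmetric])
      then show "star w \<subseteq> {F1, F2, F3, F4, G, H}" by (rule stars)
    qed (use FK GK HK in simp)
    then have "on ` K = {{v, u4, u1}, {v, u1, u2}, {v, u2, u3}, {v, u3, u4}, {u1, u2, u4}, {u2, u3, u4}}"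
      using onF onG onH by auto
    also have "\<dots> = bisimplex_sets u1 u3 v u2 u4"
    proof -
      have e: "{v, u4, u1} = {u1, v, u4}" "{v, u1, u2} = {u1, v, u2}" "{v, u2, u3} = {u3, v, u2}"
        "{v, u3, u4} = {u3, v, u4}" "{u2, u3, u4} = {u3, u2, u4}" by auto
      show ?thesis unfolding bisimplex_sets_def e by (rule six_element_set_permute)
    qed
    finally have "on ` K = bisimplex_sets u1 u3 v u2 u4" .
    moreover have "V = {u1, u3, v, u2, u4}" "distinct [u1, u3, v, u2, u4]" using Veq ud by auto
    ultimately show ?thesis by blast
  next
    case False
    then have c4: "card (on G) = 4" using on_card GK by blast
    have deg: "card (star u) = 3" if "u \<in> on G" for u
    proof (rule ccontr)
      assume "card (star u) \<noteq> 3"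
      then have "card (star u) = 4" using star_card on_V[OF that] by blast
      then have "card (on G) = 3"
        using triangles_at_degree_four[OF on_V[OF that], of G] star_iff[OF on_V[OF that]] GK that by blast
      then show False using False by simp
    qed
    have s2: "F2 \<in> star u2" "F3 \<in> star u2" "G \<in> star u2" using si FK GK onF u2G by auto
    have "meets u2 F3 G" by (rule degree_three_meets[OF uV(2) deg[OF u2G]]) (use s2 GF' in auto)
    then have u3G: "u3 \<in> on G" using onF vG by (auto elim!: meetsE)
    have "{u1, u2, u3, u4} = on G"
      by (rule card_subset_eq) (use finite_on u1G u2G u3G u4G ud c4 in auto)
    then have onG: "on G = {u1, u2, u3, u4}" by simp
    have su2: "star u2 = {F2, F3, G}" by (rule star3_eq[OF deg[OF u2G] s2]) (use Fd GF GF' in auto)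
    have su3: "star u3 = {F3, F4, G}" by (rule star3_eq[OF deg[OF u3G]]) (use si FK GK onF onG Fd GF GF' in auto)
    have su4: "star u4 = {F4, F1, G}" by (rule star3_eq[OF deg[OF u4G]]) (use si FK GK onF onG Fd GF GF' in auto)
    have "star v \<subseteq> {F1, F2, F3, F4, G}" "star u1 \<subseteq> {F1, F2, F3, F4, G}"
      "star u2 \<subseteq> {F1, F2, F3, F4, G}" "star u3 \<subseteq> {F1, F2, F3, F4, G}" "star u4 \<subseteq> {F1, F2, F3, F4, G}"
      unfolding sv su1 su2 su3 su4 by simp_all
    then have stars: "star w \<subseteq> {F1, F2, F3, F4, G}" if "w \<in> {v, u1, u2, u3, u4}" for w using that by blast
    have Veq: "V = {v, u1, u2, u3, u4}"
    proof (rule V_eqI)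
      fix w F assume "w \<in> {v, u1, u2, u3, u4}" "F \<in> star w"
      then have "F \<in> {F1, F2, F3, F4, G}" using stars by blast
      moreover have "on F1 \<subseteq> {v, u1, u2, u3, u4}" "on F2 \<subseteq> {v, u1, u2, u3, u4}" "on F3 \<subseteq> {v, u1, u2, u3, u4}"
        "on F4 \<subseteq> {v, u1, u2, u3, u4}" "on G \<subseteq> {v, u1, u2, u3, u4}"
        unfolding onF onG by simp_all
      ultimately show "on F \<subseteq> {v, u1, u2, u3, u4}" by blast
    qed (use v uV in auto)
    then show ?thesis using ud onG GK by blast
  qed
qed

text \<open>Each rim vertex has two facets beyond the star of \<open>v\<close>, and these share a
  far vertex. Neighbouring rim vertices have one of these facets in common, so all far vertices
  coincide, and this point is the antipode of \<open>v\<close>.\<close>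

lemma all_degree_four:
  assumes d4: "\<And>v. v \<in> V \<Longrightarrow> card (star v) = 4" and ne: "v \<in> V"
  shows "\<exists>x x' y y' z z'. distinct [x, x', y, y', z, z'] \<and> V = {x, x', y, y', z, z'} \<and> on ` K = octahedron_sets x x' y y' z z'"
proof -
  have "card (star v) = 4" using d4 ne by blast
  then have "star v \<noteq> {}" by auto
  then obtain F where "F \<in> K" "I v F" by (auto simp: star_def)
  obtain y1 y2 where "nb F v = {y1, y2}" using nb_two ne \<open>F \<in> K\<close> \<open>I v F\<close> by blast
  then have "y1 \<in> nb F v" by simp
  then obtain F' u where "F' \<in> K" "F' \<noteq> F" "I v F'" "u \<in> V" "u \<noteq> v" "I u F" "I u F'" by (auto simp: nb_def)
  then have F: "F \<in> star v" "F' \<in> star v" "F \<noteq> F'" "u \<in> on F" "u \<in> on F'" "u \<noteq> v"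
    using \<open>F \<in> K\<close> \<open>I v F\<close> by (auto simp: star_def on_def)
  obtain F1 F2 F3 F4 u1 u2 u3 u4 where Fd: "distinct [F1, F2, F3, F4]" and sv: "star v = {F1, F2, F3, F4}"
    and ud: "distinct [v, u1, u2, u3, u4]"
    and onF: "on F1 = {v, u4, u1}" "on F2 = {v, u1, u2}" "on F3 = {v, u2, u3}" "on F4 = {v, u3, u4}"
    by (rule degree_four_star[OF ne d4[OF ne] F]) blast
  have FK: "F1 \<in> K" "F2 \<in> K" "F3 \<in> K" "F4 \<in> K" using sv by (auto simp: star_def)
  have uV: "u1 \<in> V" "u2 \<in> V" "u3 \<in> V" "u4 \<in> V" using on_V[of u1 F1] on_V[of u2 F2] on_V[of u3 F3] on_V[of u4 F4] onF by auto
  note si = star_iff[OF ne] star_iff[OF uV(1)] star_iff[OF uV(2)] star_iff[OF uV(3)] star_iff[OF uV(4)]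
  note tri = triangles_at_degree_four[OF _ d4]
  \<comment> \<open>At a rim vertex \<open>w\<close> with rim neighbours \<open>s\<close> and
    \<open>t\<close>, the facets \<open>A\<close> and \<open>B\<close> beyond the star of
    \<open>v\<close> are triangles over the edges to \<open>s\<close> and \<open>t\<close>; their
    common edge ends in \<open>y\<close>.\<close>
  have link: "\<exists>A B y. star w = {A', B', B, A} \<and> distinct [A', B', B, A] \<and> on A = {w, s, y} \<and> on B = {w, t, y} \<and> y \<notin> {v, w, s, t}"
    if A'B': "A' \<in> star v" "B' \<in> star v" "A' \<noteq> B'" and w: "w \<in> V" "on A' = {v, s, w}" "on B' = {v, w, t}"
      and dis: "distinct [v, w, s, t]" for A' B' w s t
  proof -
    have K': "A' \<in> K" "B' \<in> K" using A'B' by (auto simp: star_def)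
    note sw = star_iff[OF w(1)]
    have m: "A' \<in> star w" "B' \<in> star w" "v \<in> on A'" "v \<in> on B'" "v \<noteq> w" using sw K' w dis by auto
    obtain B A where *: "distinct [A', B', B, A]" "star w = {A', B', B, A}"
    "meets w B' B" "meets w B A" "meets w A A'" "\<not> meets w A' B" "\<not> meets w B' A"
      by (rule degree_four_cycle[OF w(1) d4[OF w(1)] meetsI[OF w(1) m(1,2) A'B'(3) m(3,4,5)]])
    have AB: "A \<in> K" "B \<in> K" "w \<in> on A" "w \<in> on B" using * sw by auto
    have vA: "v \<notin> on A" "v \<notin> on B"
      using three_facets_share[OF w(1) m(5), of A' B' A] three_facets_share[OF w(1) m(5), of A' B' B] * m by auto
    have sA: "s \<in> on A" using *(5) vA w by (auto elim!: meetsE)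
    have tB: "t \<in> on B" using *(3) vA w by (auto elim!: meetsE)
    have sB: "s \<notin> on B" using three_facets_share[OF w(1), of s A' B A] * sA w dis by auto
    have tA: "t \<notin> on A" using three_facets_share[OF w(1), of t B' B A] * tB w dis by auto
    obtain y where y: "y \<in> on B" "y \<in> on A" "y \<noteq> w" using *(4) by (rule meetsE)
    have yn: "y \<notin> {v, w, s, t}" using y vA sB tA by auto
    have "on A = {w, s, y}" by (rule triangle_eq[OF AB(1) tri[OF w(1) w(1)]]) (use * AB sA y yn dis in auto)
    moreover have "on B = {w, t, y}" by (rule triangle_eq[OF AB(2) tri[OF w(1) w(1)]]) (use * AB tB y yn dis in auto)
    ultimately show ?thesis using * yn by blast
  qed
  obtain A B y where A: "star u1 = {F1, F2, B, A}" "distinct [F1, F2, B, A]" "on A = {u1, u4, y}" "on B = {u1, u2, y}" "y \<notin> {v, u1, u4, u2}"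
    using link[of F1 F2 u1 u4 u2] sv Fd uV onF ud by auto
  obtain A2 C y2 where C: "star u2 = {F2, F3, C, A2}" "distinct [F2, F3, C, A2]" "on A2 = {u2, u1, y2}" "on C = {u2, u3, y2}" "y2 \<notin> {v, u2, u1, u3}"
    using link[of F2 F3 u2 u1 u3] sv Fd uV onF ud by auto
  obtain A3 D y3 where D: "star u3 = {F3, F4, D, A3}" "distinct [F3, F4, D, A3]" "on A3 = {u3, u2, y3}" "on D = {u3, u4, y3}" "y3 \<notin> {v, u3, u2, u4}"
    using link[of F3 F4 u3 u2 u4] sv Fd uV onF ud by auto
  have ABK: "A \<in> K" "B \<in> K" using A(1) si by auto
  \<comment> \<open>The facet beyond the rim edge from \<open>u1\<close> to \<open>u2\<close> is
    seen from both ends, as \<open>B\<close> and as \<open>A2\<close>; hence the far vertices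
    \<open>y\<close> and \<open>y2\<close> agree. The next edge is treated likewise.\<close>
  have "B \<in> star u2" using ABK A si by auto
  then have "B = A2" using A(2,4) C ud onF(3) by auto
  then have y2: "y2 = y" using A(4,5) C(3,5) by auto
  have "C \<in> star u2" "D \<in> star u3" unfolding C(1) D(1) by simp_all
  then have CK: "C \<in> K" "D \<in> K" by (simp_all add: star_def)
  have "C \<in> star u3" using CK C(4) si(4) by simp
  moreover have "u2 \<in> on C" "u2 \<notin> on F4" "u2 \<notin> on D" using C(4) D(4,5) ud onF(4) by auto
  ultimately have "C = A3" using C(2) unfolding D(1) by auto
  then have y3: "y3 = y" using C(4,5) D(3,5) y2 by auto
  have yu3: "y \<noteq> u3" using C(5) y2 by simp
  have yV: "y \<in> V" using on_V[of y A] A by auto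
  have onA: "on A = {u1, u4, y}" "on B = {u1, u2, y}" "on C = {u2, u3, y}" "on D = {u3, u4, y}"
    using A(3,4) C(4) D(4) y2 y3 by simp_all
  have yd: "distinct [v, u1, u2, u3, u4, y]" using ud A(5) yu3 by auto
  have "u1 \<in> on A" "u1 \<notin> on F4" "u1 \<notin> on C" "u1 \<notin> on D" "u1 \<in> on B" "u3 \<in> on D" "u3 \<notin> on F1"
    unfolding onA onF using yd by auto
  then have neq: "A \<noteq> F4" "A \<noteq> C" "A \<noteq> D" "B \<noteq> C" "B \<noteq> D" "D \<noteq> F1" by blast+
  have dABCD: "distinct [A, B, C, D]" using neq A(2) D(2) \<open>C = A3\<close> by auto
  have su4: "star u4 = {F4, F1, A, D}"
  proof (rule star4_eq[OF uV(4)])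
    show "F4 \<in> star u4" "F1 \<in> star u4" "A \<in> star u4" "D \<in> star u4"
      unfolding si(5) onA onF using FK ABK CK by simp_all
    show "distinct [F4, F1, A, D]" using neq Fd A(2) D(2) by auto
  qed
  have sy: "star y = {A, B, C, D}"
  proof (rule star4_eq[OF yV _ _ _ _ dABCD])
    show "A \<in> star y" "B \<in> star y" "C \<in> star y" "D \<in> star y"
      unfolding star_iff[OF yV] onA using ABK CK by simp_all
  qed
  have "star v \<subseteq> {F1, F2, F3, F4, A, B, C, D}" "star u1 \<subseteq> {F1, F2, F3, F4, A, B, C, D}"
    "star u2 \<subseteq> {F1, F2, F3, F4, A, B, C, D}" "star u3 \<subseteq> {F1, F2, F3, F4, A, B, C, D}"
    "star u4 \<subseteq> {F1, F2, F3, F4, A, B, C, D}" "star y \<subseteq> {F1, F2, F3, F4, A, B, C, D}"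
    unfolding sv A(1) C(1) D(1) su4 sy \<open>B = A2\<close>[symmetric] \<open>C = A3\<close>[symmetric] by simp_all
  then have stars: "star w \<subseteq> {F1, F2, F3, F4, A, B, C, D}" if "w \<in> {v, y, u1, u3, u2, u4}" for w using that by blast
  have Veq: "V = {v, y, u1, u3, u2, u4}"
  proof (rule V_eqI)
    fix w F assume "w \<in> {v, y, u1, u3, u2, u4}" "F \<in> star w"
    then have "F \<in> {F1, F2, F3, F4, A, B, C, D}" using stars by blast
    moreover have "on F1 \<subseteq> {v, y, u1, u3, u2, u4}" "on F2 \<subseteq> {v, y, u1, u3, u2, u4}" "on F3 \<subseteq> {v, y, u1, u3, u2, u4}"
      "on F4 \<subseteq> {v, y, u1, u3, u2, u4}" "on A \<subseteq> {v, y, u1, u3, u2, u4}" "on B \<subseteq> {v, y, u1, u3, u2, u4}"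
      "on C \<subseteq> {v, y, u1, u3, u2, u4}" "on D \<subseteq> {v, y, u1, u3, u2, u4}"
      unfolding onF A(3,4) C(4) D(4) y2 y3 by simp_all
    ultimately show "on F \<subseteq> {v, y, u1, u3, u2, u4}" by blast
  qed (use ne uV yV in auto)
  have "K = {F1, F2, F3, F4, A, B, C, D}"
  proof (rule K_eqI)
    fix w assume "w \<in> V"
    then have "w \<in> {v, y, u1, u3, u2, u4}" by (subst Veq[symmetric])
    then show "star w \<subseteq> {F1, F2, F3, F4, A, B, C, D}" by (rule stars)
  qed (use FK ABK CK in simp)
  then have "on ` K = {{v, u4, u1}, {v, u1, u2}, {v, u2, u3}, {v, u3, u4}, {u1, u4, y}, {u1, u2, y}, {u2, u3, y}, {u3, u4, y}}"
    using onF A(3,4) C(4) D(4) y2 y3 by auto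
  also have "\<dots> = octahedron_sets v y u1 u3 u2 u4"
  proof -
    have e: "{v, u4, u1} = {v, u1, u4}" "{v, u2, u3} = {v, u3, u2}" "{u1, u4, y} = {y, u1, u4}"
      "{u1, u2, y} = {y, u1, u2}" "{u2, u3, y} = {y, u3, u2}" "{u3, u4, y} = {y, u3, u4}" by auto
    show ?thesis unfolding octahedron_sets_def e by (rule eight_element_set_permute)
  qed
  finally have "on ` K = octahedron_sets v y u1 u3 u2 u4" .
  moreover have "distinct [v, y, u1, u3, u2, u4]" using ud A(5) yu3 by auto
  ultimately show ?thesis using Veq by blast
qed

text \<open>Unless every vertex has degree four, connectedness yields one of degree four that shares
  two facets with one of degree three.\<close>

theorem degree_four_classification:
  assumes v: "v \<in> V" "card (star v) = 4"
  shows "(\<exists>x u1 u2 u3 u4 G. distinct [x, u1, u2, u3, u4] \<and> V = {x, u1, u2, u3, u4} \<and> G \<in> K \<and> on G = {u1, u2, u3, u4})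
    \<or> (\<exists>s s' t1 t2 t3. distinct [s, s', t1, t2, t3] \<and> V = {s, s', t1, t2, t3} \<and> on ` K = bisimplex_sets s s' t1 t2 t3)
    \<or> (\<exists>x x' y y' z z'. distinct [x, x', y, y', z, z'] \<and> V = {x, x', y, y', z, z'} \<and> on ` K = octahedron_sets x x' y y' z z')"
proof (cases "\<forall>w\<in>V. card (star w) = 4")
  case True
  then show ?thesis using all_degree_four[OF _ v(1)] by blast
next
  case False
  have "{w \<in> V. card (star w) = 4} \<noteq> V" using False by blast
  then obtain w w' F G where w: "w \<in> V" "card (star w) = 4" "w' \<in> V" "card (star w') \<noteq> 4"
    "F \<in> K" "G \<in> K" "F \<noteq> G" "I w F" "I w G" "I w' F" "I w' G"
    using vconn[of "{w \<in> V. card (star w) = 4}"] v by blast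
  then have "card (star w') = 3" using star_card by blast
  moreover have "F \<in> star w" "G \<in> star w" "w' \<in> on F" "w' \<in> on G" "w' \<noteq> w"
    using w by (auto simp: star_def on_def)
  ultimately show ?thesis using degree_three_neighbour[OF w(1,2), of F G w'] w(7) by blast
qed

text \<open>The three triangles at \<open>v\<close> have a rim \<open>x\<close>, \<open>y\<close>,
  \<open>z\<close>. A further facet at a rim vertex avoids \<open>v\<close> and shares edges with
  the two triangles there, so it is the rim triangle.\<close>

lemma simplicial_simple:
  assumes d3: "\<And>v. v \<in> V \<Longrightarrow> card (star v) = 3" and t: "\<And>F. F \<in> K \<Longrightarrow> card (on F) = 3" and ne: "v \<in> V"
  shows "card V = 4"
proof -
  obtain F1 F2 F3 where F: "distinct [F1, F2, F3]" "star v = {F1, F2, F3}"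
    using d3[OF ne] by (auto simp: card_3_iff)
  have K: "F1 \<in> K" "F2 \<in> K" "F3 \<in> K" using F(2) by (auto simp: star_def)
  have "meets v F1 F2" "meets v F2 F3" "meets v F3 F1"
    by (rule degree_three_meets[OF ne d3[OF ne]]; use F in auto)+
  then obtain x y z where x: "x \<in> on F1" "x \<in> on F2" "x \<noteq> v" and y: "y \<in> on F2" "y \<in> on F3" "y \<noteq> v"
    and z: "z \<in> on F3" "z \<in> on F1" "z \<noteq> v" by (metis meetsE)
  have d: "distinct [v, x, y, z]"
    using three_facets_share[OF ne, of x F1 F2 F3] three_facets_share[OF ne, of y F1 F2 F3] F x y z by auto
  have vF: "v \<in> on F1" "v \<in> on F2" "v \<in> on F3" using F(2) ne by (auto simp: star_def on_def)
  have onF1: "on F1 = {v, x, z}" by (rule triangle_eq[OF K(1) t[OF K(1)]]) (use x z d vF in auto)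
  have onF2: "on F2 = {v, x, y}" by (rule triangle_eq[OF K(2) t[OF K(2)]]) (use x y d vF in auto)
  have onF3: "on F3 = {v, y, z}" by (rule triangle_eq[OF K(3) t[OF K(3)]]) (use y z d vF in auto)
  note onF = onF1 onF2 onF3
  have V: "x \<in> V" "y \<in> V" "z \<in> V" using x y z on_V by auto
  have "V = {v, x, y, z}"
  proof (rule V_eqI)
    have other: "on G \<subseteq> {v, x, y, z}" if w: "w \<in> V" "w \<noteq> v" and A: "A \<in> star v" "B \<in> star v" "A \<noteq> B" "on A = {v, w, s}" "on B = {v, w, t}"
      and st: "{s, t} \<subseteq> {v, x, y, z}" "w \<in> {v, x, y, z}" "distinct [w, s, t]" and G: "G \<in> star w" "G \<noteq> A" "G \<noteq> B" for w A B s t G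
    proof -
      have "w \<in> on A" "w \<in> on B" unfolding A by simp_all
      then have AB: "A \<in> star w" "B \<in> star w" using A(1,2) by (simp_all add: star_def on_def)
      have "v \<notin> on G" using three_facets_share[OF w(1), of v A B G] A AB G w by auto
      moreover have "meets w G A" "meets w G B" by (rule degree_three_meets[OF w(1) d3[OF w(1)]]; use G AB in auto)+
      ultimately have "s \<in> on G" "t \<in> on G" using A by (auto elim!: meetsE)
      moreover have "w \<in> on G" "G \<in> K" using G w by (auto simp: star_def on_def)
      ultimately have "on G = {w, s, t}" using st by (intro triangle_eq t) auto
      then show ?thesis using st by auto
    qed
    have s: "F1 \<in> star v" "F2 \<in> star v" "F3 \<in> star v" using F by auto
    fix w G assume w: "w \<in> {v, x, y, z}" "G \<in> star w"
    consider "G \<in> {F1, F2, F3}" | "w = x" "G \<notin> {F1, F2, F3}" | "w = y" "G \<notin> {F1, F2, F3}" | "w = z" "G \<notin> {F1, F2, F3}"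
      using w F by auto
    then show "on G \<subseteq> {v, x, y, z}"
    proof cases
      case 1 then show ?thesis using onF by auto
    next
      case 2 show ?thesis by (rule other[of x F1 F2 z y G]) (use 2 V F onF d w s in auto)
    next
      case 3 show ?thesis by (rule other[of y F2 F3 x z G]) (use 3 V F onF d w s in auto)
    next
      case 4 show ?thesis by (rule other[of z F1 F3 x y G]) (use 4 V F onF d w s in auto)
    qed
  qed (use ne V in auto)
  then show ?thesis using d by auto
qed

end

section \<open>Psd lifts of size four and factorizations of slacks\<close>

text \<open>The cone of order four inside the Euclidean space \<open>real^4^4\<close>, the setting
  for the arguments by compactness and separation.\<close>

definition psd4 :: "(real^4^4) set" where
  "psd4 = {A. transpose A = A \<and> (\<forall>x. 0 \<le> x \<bullet> (A *v x))}"

section \<open>Transfer of lifts between the two kinds of matrices\<close>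

lemma ex_enumeration_4:
  "\<exists>(h :: 4 \<Rightarrow> nat) g. (\<forall>i. h i < 4) \<and> (\<forall>i. g (h i) = i) \<and> (\<forall>n<4. h (g n) = n)"
proof -
  obtain h :: "4 \<Rightarrow> nat" where h: "bij_betw h UNIV {0..<4}"
    using ex_bij_betw_finite_nat[of "UNIV :: 4 set"] by auto
  have r: "inj h" "range h = {0..<4}" using h by (simp_all add: bij_betw_def)
  have "h i < 4" for i
  proof -
    have "h i \<in> {0..<4}" unfolding r(2)[symmetric] by (rule rangeI)
    then show ?thesis by simp
  qed
  moreover have "inv_into UNIV h (h i) = i" for i using r(1) by simp
  moreover have "h (inv_into UNIV h n) = n" if "n < 4" for n
  proof -
    have "n \<in> range h" unfolding r(2) using that by simp
    then show ?thesis by (rule f_inv_into_f)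
  qed
  ultimately show ?thesis by blast
qed

lemma sum_enumerate_4:
  fixes h :: "4 \<Rightarrow> nat"
  assumes h: "\<And>i. h i < 4" "\<And>i. g (h i) = i" "\<And>n. n < 4 \<Longrightarrow> h (g n) = n" and k: "k \<le> 4"
    and z: "\<And>i. \<not> h i < k \<Longrightarrow> F i = 0"
  shows "(\<Sum>i\<in>UNIV. F i) = (\<Sum>n=0..<k. F (g n) :: real)"
proof -
  have "(\<Sum>i\<in>UNIV. F i) = (\<Sum>i\<in>g ` {0..<k}. F i)"
  proof (rule sum.mono_neutral_right)
    show "\<forall>i\<in>UNIV - g ` {0..<k}. F i = 0"
    proof
      fix i assume "i \<in> UNIV - g ` {0..<k}"
      then have "\<not> h i < k" using h(2)[of i] by (metis DiffD2 atLeastLessThan_iff imageI zero_le)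
      then show "F i = 0" by (rule z)
    qed
  qed auto
  also have "\<dots> = (\<Sum>n=0..<k. F (g n))"
  proof (rule sum.reindex_cong[OF _ refl refl])
    show "inj_on g {0..<k}"
    proof
      fix m n assume mn: "m \<in> {0..<k}" "n \<in> {0..<k}" "g m = g n"
      have "h (g m) = m" "h (g n) = n" by (rule h(3), use mn k in simp)+
      then show "m = n" using mn(3) by metis
    qed
  qed
  finally show ?thesis .
qed

lemma quadratic_form_mat:
  assumes "A \<in> carrier_mat k k" "v \<in> carrier_vec k"
  shows "scalar_prod v (A *\<^sub>v v) = (\<Sum>i=0..<k. \<Sum>j=0..<k. vec_index v i * (A $$ (i, j) * vec_index v j))"
proof -
  have "scalar_prod v (A *\<^sub>v v) = (\<Sum>i=0..<k. vec_index v i * (\<Sum>j=0..<k. A $$ (i, j) * vec_index v j))"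
    using assms by (auto simp: scalar_prod_def intro!: sum.cong)
  then show ?thesis by (simp add: sum_distrib_left)
qed

lemma quadratic_form_cart:
  "(x::real^'n) \<bullet> (A *v x) = (\<Sum>i\<in>UNIV. \<Sum>j\<in>UNIV. x $ i * (A $ i $ j * x $ j))"
  by (simp add: inner_vec_def matrix_vector_mult_def sum_distrib_left)

locale enumeration4 =
  fixes h :: "4 \<Rightarrow> nat" and g :: "nat \<Rightarrow> 4" and k :: nat
  assumes h: "\<And>i. h i < 4" "\<And>i. g (h i) = i" "\<And>n. n < 4 \<Longrightarrow> h (g n) = n" and k: "k \<le> 4"
begin

definition emb :: "real mat \<Rightarrow> real^4^4" where
  "emb A = (\<chi> i j. if h i < k \<and> h j < k then A $$ (h i, h j) else 0)"

text \<open>The symmetrization sends every matrix to a symmetric one. Thus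
  \<open>\<pi> \<circ> ret\<close> is linear on all of \<open>real^4^4\<close>, although
  \<open>\<pi>\<close> is known to be linear on symmetric matrices only.\<close>

definition ret :: "real^4^4 \<Rightarrow> real mat" where
  "ret B = mat k k (\<lambda>(i, j). (B $ g i $ g j + B $ g j $ g i) / 2)"

lemma hg: "n < k \<Longrightarrow> h (g n) = n"
  using h(3) k by simp

lemma ret_sym: "ret B \<in> symmetric_mats k"
  unfolding symmetric_mats_def ret_def by (auto intro!: eq_matI)

lemma sym_index: "A \<in> symmetric_mats k \<Longrightarrow> i < k \<Longrightarrow> j < k \<Longrightarrow> A $$ (j, i) = A $$ (i, j)"
proof -
  assume A: "A \<in> symmetric_mats k" and ij: "i < k" "j < k"
  have c: "A \<in> carrier_mat k k" and T: "transpose_mat A = A" using A by (simp_all add: symmetric_mats_def)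
  have "A $$ (j, i) = transpose_mat A $$ (i, j)" using c ij by simp
  then show "A $$ (j, i) = A $$ (i, j)" unfolding T .
qed

lemma ret_emb: "A \<in> symmetric_mats k \<Longrightarrow> ret (emb A) = A"
  unfolding ret_def emb_def
  by (rule eq_matI) (auto simp: hg sym_index symmetric_mats_def)

lemma emb_sym: "A \<in> symmetric_mats k \<Longrightarrow> transpose (emb A) = emb A"
  by (auto simp: emb_def transpose_def Finite_Cartesian_Product.vec_eq_iff sym_index)

lemma emb_ret: "k = 4 \<Longrightarrow> transpose B = B \<Longrightarrow> emb (ret B) = B"
proof -
  assume k4: "k = 4" and B: "transpose B = B"
  have "B $ j $ i = B $ i $ j" for i j
  proof -
    have "transpose B $ i $ j = B $ j $ i" by (simp add: transpose_def)
    then show ?thesis using B by simp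
  qed
  then show ?thesis unfolding emb_def ret_def using h k4 by (auto simp: Finite_Cartesian_Product.vec_eq_iff)
qed

lemma emb_lincomb:
  "A \<in> carrier_mat k k \<Longrightarrow> B \<in> carrier_mat k k \<Longrightarrow> emb (s \<cdot>\<^sub>m A + t \<cdot>\<^sub>m B) = s *\<^sub>R emb A + t *\<^sub>R emb B"
  by (auto simp: emb_def Finite_Cartesian_Product.vec_eq_iff)

lemma ret_lincomb: "ret (s *\<^sub>R A + t *\<^sub>R B) = s \<cdot>\<^sub>m ret A + t \<cdot>\<^sub>m ret B"
  by (rule eq_matI) (auto simp: ret_def field_simps)

lemma quadratic_form_emb:
  assumes A: "A \<in> carrier_mat k k"
  shows "x \<bullet> (emb A *v x) = scalar_prod (Matrix.vec k (\<lambda>n. x $ g n)) (A *\<^sub>v Matrix.vec k (\<lambda>n. x $ g n))"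
proof -
  have "x \<bullet> (emb A *v x) = (\<Sum>i\<in>UNIV. \<Sum>j\<in>UNIV. x $ i * (emb A $ i $ j * x $ j))"
    by (rule quadratic_form_cart)
  also have "\<dots> = (\<Sum>i\<in>UNIV. \<Sum>n=0..<k. x $ i * (emb A $ i $ g n * x $ g n))"
    by (intro sum.cong refl sum_enumerate_4[where h = h]) (use h k in \<open>auto simp: emb_def\<close>)
  also have "\<dots> = (\<Sum>m=0..<k. \<Sum>n=0..<k. x $ g m * (emb A $ g m $ g n * x $ g n))"
    by (rule sum_enumerate_4[where h = h]) (use h k in \<open>auto simp: emb_def\<close>)
  also have "\<dots> = (\<Sum>m=0..<k. \<Sum>n=0..<k. x $ g m * (A $$ (m, n) * x $ g n))"
    by (intro sum.cong refl) (auto simp: emb_def hg)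
  also have "\<dots> = scalar_prod (Matrix.vec k (\<lambda>n. x $ g n)) (A *\<^sub>v Matrix.vec k (\<lambda>n. x $ g n))"
    by (subst quadratic_form_mat[OF A]) (auto intro!: sum.cong)
  finally show ?thesis .
qed

lemma emb_psd: "A \<in> symmetric_mats k \<Longrightarrow> emb A \<in> psd4 \<longleftrightarrow> A \<in> psd_cone k"
proof -
  assume A: "A \<in> symmetric_mats k"
  then have Ac: "A \<in> carrier_mat k k" by (simp add: symmetric_mats_def)
  show ?thesis
  proof
    assume e: "emb A \<in> psd4"
    have "0 \<le> scalar_prod v (A *\<^sub>v v)" if v: "v \<in> carrier_vec k" for v
    proof -
      define x where "x = (\<chi> i. if h i < k then vec_index v (h i) else 0)"
      have xv: "Matrix.vec k (\<lambda>n. x $ g n) = v" using v by (auto simp: x_def hg)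
      have "0 \<le> x \<bullet> (emb A *v x)" using e by (simp add: psd4_def)
      then show ?thesis unfolding quadratic_form_emb[OF Ac] xv .
    qed
    then show "A \<in> psd_cone k" using A by (simp add: psd_cone_def)
  next
    assume "A \<in> psd_cone k"
    then show "emb A \<in> psd4"
      using emb_sym[OF A] quadratic_form_emb[OF Ac] by (auto simp: psd4_def psd_cone_def)
  qed
qed

end

text \<open>The last conjunct records the trace of a smaller order: the basis vector at index
  \<open>k\<close> is killed by all padded matrices.\<close>

lemma has_psd_lift_cart:
  fixes P :: "'a::euclidean_space set"
  assumes "has_psd_lift k P" "k \<le> 4"
  shows "\<exists>L (\<pi> :: real^4^4 \<Rightarrow> 'a). affine L \<and> (\<forall>A\<in>L. transpose A = A) \<and> linear \<pi> \<and>
    P = \<pi> ` (L \<inter> psd4) \<and> (k < 4 \<longrightarrow> (\<exists>e. e \<noteq> 0 \<and> (\<forall>A\<in>L. A *v e = 0)))"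
proof -
  obtain h :: "4 \<Rightarrow> nat" and g where "\<forall>i. h i < 4" "\<forall>i. g (h i) = i" "\<forall>n<4. h (g n) = n"
    using ex_enumeration_4 by blast
  then interpret enumeration4 h g k by unfold_locales (use assms in auto)
  obtain L \<pi> where L: "affine_mats k L" "linear_mats k \<pi>" "P = \<pi> ` (psd_cone k \<inter> L)"
    using assms(1) unfolding has_psd_lift_def by blast
  have sym: "A \<in> symmetric_mats k" and car: "A \<in> carrier_mat k k" if "A \<in> L" for A
    using L(1) that by (auto simp: affine_mats_def symmetric_mats_def)
  show ?thesis
  proof (intro exI[of _ "emb ` L"] exI[of _ "\<pi> \<circ> ret"] conjI ballI impI)
    show "affine (emb ` L)"
      unfolding affine_def
    proof (intro ballI allI impI)
      fix X Y s t assume "X \<in> emb ` L" "Y \<in> emb ` L" and st: "s + t = (1::real)"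
      then obtain A B where AB: "A \<in> L" "B \<in> L" "X = emb A" "Y = emb B" by blast
      then have "s *\<^sub>R X + t *\<^sub>R Y = emb (s \<cdot>\<^sub>m A + t \<cdot>\<^sub>m B)" using emb_lincomb car by simp
      moreover have "s \<cdot>\<^sub>m A + t \<cdot>\<^sub>m B \<in> L" using L(1) AB st by (auto simp: affine_mats_def)
      ultimately show "s *\<^sub>R X + t *\<^sub>R Y \<in> emb ` L" by blast
    qed
    show "transpose A = A" if "A \<in> emb ` L" for A using that emb_sym sym by auto
    show "linear (\<pi> \<circ> ret)"
    proof
      fix A B :: "real^4^4" and c :: real
      have "ret (A + B) = ret A + ret B"
        using ret_lincomb[of 1 A 1 B] by (auto simp: ret_def)
      then show "(\<pi> \<circ> ret) (A + B) = (\<pi> \<circ> ret) A + (\<pi> \<circ> ret) B"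
        using L(2) ret_sym by (simp add: linear_mats_def)
      have "ret (c *\<^sub>R A) = c \<cdot>\<^sub>m ret A"
        by (rule eq_matI) (auto simp: ret_def field_simps)
      then show "(\<pi> \<circ> ret) (c *\<^sub>R A) = c *\<^sub>R (\<pi> \<circ> ret) A"
        using L(2) ret_sym by (simp add: linear_mats_def)
    qed
    have "emb ` L \<inter> psd4 = emb ` (psd_cone k \<inter> L)" using emb_psd sym by blast
    then have "(\<pi> \<circ> ret) ` (emb ` L \<inter> psd4) = (\<lambda>A. \<pi> (ret (emb A))) ` (psd_cone k \<inter> L)"
      by (simp add: image_image)
    also have "\<dots> = \<pi> ` (psd_cone k \<inter> L)" by (intro image_cong) (auto simp: ret_emb sym)
    finally show "P = (\<pi> \<circ> ret) ` (emb ` L \<inter> psd4)" using L(3) by simp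
    show "\<exists>e. e \<noteq> 0 \<and> (\<forall>A\<in>emb ` L. A *v e = 0)" if "k < 4"
    proof (intro exI conjI ballI)
      show "axis (g k) (1::real) \<noteq> 0" by simp
      fix X assume "X \<in> emb ` L"
      then obtain A where A: "X = emb A" by blast
      have "h (g k) = k" using h that by blast
      then show "X *v axis (g k) 1 = 0"
        by (simp add: A matrix_vector_mult_basis column_def emb_def Finite_Cartesian_Product.vec_eq_iff)
    qed
  qed
qed

lemma has_psd_lift_4I:
  fixes \<pi> :: "real^4^4 \<Rightarrow> 'a::euclidean_space"
  assumes L: "affine L" "\<And>A. A \<in> L \<Longrightarrow> transpose A = A" "linear \<pi>"
  shows "has_psd_lift 4 (\<pi> ` (L \<inter> psd4))"
proof -
  obtain h :: "4 \<Rightarrow> nat" and g where "\<forall>i. h i < 4" "\<forall>i. g (h i) = i" "\<forall>n<4. h (g n) = n"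
    using ex_enumeration_4 by blast
  then interpret enumeration4 h g 4 by unfold_locales auto
  have "affine_mats 4 (ret ` L)"
    unfolding affine_mats_def
  proof (intro conjI ballI allI impI)
    show "ret ` L \<subseteq> symmetric_mats 4" using ret_sym by blast
    fix X Y s t assume "X \<in> ret ` L" "Y \<in> ret ` L" and st: "s + t = (1::real)"
    then obtain A B where AB: "A \<in> L" "B \<in> L" "X = ret A" "Y = ret B" by blast
    then have "s \<cdot>\<^sub>m X + t \<cdot>\<^sub>m Y = ret (s *\<^sub>R A + t *\<^sub>R B)" by (simp add: ret_lincomb)
    moreover have "s *\<^sub>R A + t *\<^sub>R B \<in> L" using L(1) AB st by (auto simp: affine_def)
    ultimately show "s \<cdot>\<^sub>m X + t \<cdot>\<^sub>m Y \<in> ret ` L" by blast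
  qed
  moreover have "linear_mats 4 (\<pi> \<circ> emb)"
    unfolding linear_mats_def
  proof (intro conjI ballI allI)
    fix A B :: "real mat" assume AB: "A \<in> symmetric_mats 4" "B \<in> symmetric_mats 4"
    then have "A \<in> carrier_mat 4 4" "B \<in> carrier_mat 4 4" by (auto simp: symmetric_mats_def)
    then have "emb (A + B) = emb A + emb B" by (auto simp: emb_def Finite_Cartesian_Product.vec_eq_iff)
    then show "(\<pi> \<circ> emb) (A + B) = (\<pi> \<circ> emb) A + (\<pi> \<circ> emb) B" by (simp add: linear_add[OF L(3)])
  next
    fix A :: "real mat" and c :: real assume "A \<in> symmetric_mats 4"
    then have "A \<in> carrier_mat 4 4" by (auto simp: symmetric_mats_def)
    then have "emb (c \<cdot>\<^sub>m A) = c *\<^sub>R emb A" by (auto simp: emb_def Finite_Cartesian_Product.vec_eq_iff)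
    then show "(\<pi> \<circ> emb) (c \<cdot>\<^sub>m A) = c *\<^sub>R (\<pi> \<circ> emb) A" by (simp add: linear_cmul[OF L(3)])
  qed
  moreover have "\<pi> ` (L \<inter> psd4) = (\<pi> \<circ> emb) ` (psd_cone 4 \<inter> ret ` L)"
  proof -
    have er: "emb (ret A) = A" if "A \<in> L" for A using emb_ret L(2) that by blast
    have "ret A \<in> psd_cone 4 \<longleftrightarrow> A \<in> psd4" if "A \<in> L" for A
      using emb_psd[OF ret_sym, of A] unfolding er[OF that] by blast
    then have "psd_cone 4 \<inter> ret ` L = ret ` (L \<inter> psd4)" by blast
    then have "(\<pi> \<circ> emb) ` (psd_cone 4 \<inter> ret ` L) = (\<lambda>A. \<pi> (emb (ret A))) ` (L \<inter> psd4)"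
      by (simp add: image_image)
    also have "\<dots> = \<pi> ` (L \<inter> psd4)" by (intro image_cong) (auto simp: er)
    finally show ?thesis by simp
  qed
  ultimately show ?thesis unfolding has_psd_lift_def by blast
qed

text \<open>The facet functionals are left free, because a positive rescaling of the slacks at
  \<open>F\<close> is absorbed by \<open>b F\<close>.\<close>

definition psd_factorization ::
  "'a::euclidean_space set \<Rightarrow> ('a \<Rightarrow> real^4) \<Rightarrow> ('a set \<Rightarrow> real^4) \<Rightarrow> bool" where
  "psd_factorization P a b \<longleftrightarrow> (\<exists>c d. \<forall>F. F facet_of P \<longrightarrow>
     P \<subseteq> {x. c F \<bullet> x \<le> d F} \<and> F = P \<inter> {x. c F \<bullet> x = d F} \<and>
     (\<forall>v\<in>vertices P. d F - c F \<bullet> v = (a v \<bullet> b F)\<^sup>2))"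

definition outer :: "real^4 \<Rightarrow> real^4^4" where
  "outer y = (\<chi> i j. y $ i * y $ j)"

text \<open>The inner product of \<open>real^4^4\<close> is the sum of the products of entries, that
  is, the trace form.\<close>

lemma inner_outer: "B \<bullet> outer y = y \<bullet> (B *v y)"
proof -
  have "B \<bullet> outer y = (\<Sum>i\<in>UNIV. \<Sum>j\<in>UNIV. B $ i $ j * (y $ i * y $ j))"
    by (simp add: outer_def inner_vec_def)
  then show ?thesis unfolding quadratic_form_cart by (simp add: mult_ac)
qed

lemma quadratic_form_outer: "x \<bullet> (outer y *v z) = (y \<bullet> x) * (y \<bullet> z)"
proof -
  have "outer y *v z = (y \<bullet> z) *\<^sub>R y"
    by (simp add: outer_def matrix_vector_mult_def Finite_Cartesian_Product.vec_eq_iff inner_vec_def sum_distrib_left sum_distrib_right mult_ac)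
  then show ?thesis by (simp add: inner_commute)
qed

lemma inner_outer_outer: "outer x \<bullet> outer y = (x \<bullet> y)\<^sup>2"
  by (simp add: inner_outer quadratic_form_outer power2_eq_square)

lemma outer_psd: "outer y \<in> psd4"
proof -
  have "transpose (outer y) = outer y"
    by (simp add: outer_def transpose_def Finite_Cartesian_Product.vec_eq_iff mult.commute)
  then show ?thesis by (simp add: psd4_def quadratic_form_outer)
qed

section \<open>Kernels and faces of the psd cone\<close>

lemma symmetric_form:
  assumes "transpose A = (A :: real^'n^'n)"
  shows "x \<bullet> (A *v y) = y \<bullet> (A *v x)"
proof -
  have "x \<bullet> (A *v y) = (x v* A) \<bullet> y" by (rule dot_lmul_matrix[symmetric])
  also have "x v* A = transpose A *v x" by (rule transpose_matrix_vector[symmetric])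
  finally show ?thesis unfolding assms by (simp add: inner_commute)
qed

text \<open>The number \<open>r\<close> satisfies \<open>r * \<beta> \<le> 1\<close>, so at
  \<open>t = - \<alpha> * r\<close> the polynomial is a positive multiple of
  \<open>r * \<beta> - 2\<close>, which is negative.\<close>

lemma quadratic_nonneg_linear_zero:
  fixes \<alpha> \<beta> :: real
  assumes "\<And>t. 0 \<le> 2 * t * \<alpha> + t\<^sup>2 * \<beta>" shows "\<alpha> = 0"
proof (rule ccontr)
  assume "\<alpha> \<noteq> 0"
  define r where "r = 1 / (1 + \<bar>\<beta>\<bar>)"
  have r: "r > 0" by (simp add: r_def add_pos_nonneg)
  have "r * \<beta> \<le> r * (1 + \<bar>\<beta>\<bar>)" using r by (intro mult_left_mono) auto
  also have "\<dots> = 1" by (simp add: r_def add_pos_nonneg less_imp_neq[symmetric])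
  finally have "r * \<beta> - 2 < 0" by simp
  moreover have "0 \<le> (\<alpha>\<^sup>2 * r) * (r * \<beta> - 2)"
    using assms[of "- \<alpha> * r"] by (simp add: algebra_simps power2_eq_square)
  moreover have "\<alpha>\<^sup>2 * r > 0" using \<open>\<alpha> \<noteq> 0\<close> r by simp
  ultimately show False by (simp add: zero_le_mult_iff)
qed

text \<open>With \<open>y = A *v x\<close>, the form at \<open>x + t *\<^sub>R y\<close> is a
  nonnegative polynomial in \<open>t\<close> without constant term, so its linear coefficient, twice
  the squared norm of \<open>y\<close>, vanishes.\<close>

lemma psd_kernel:
  assumes A: "A \<in> psd4" and x: "x \<bullet> (A *v x) = 0"
  shows "A *v x = 0"
proof -
  define y where "y = A *v x"
  have sym: "x \<bullet> (A *v y) = y \<bullet> (A *v x)" using A by (intro symmetric_form) (simp add: psd4_def)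
  have "y \<bullet> (A *v x) = 0"
  proof (rule quadratic_nonneg_linear_zero)
    fix t
    have "0 \<le> (x + t *\<^sub>R y) \<bullet> (A *v (x + t *\<^sub>R y))" using A by (simp add: psd4_def)
    also have "\<dots> = 2 * t * (y \<bullet> (A *v x)) + t\<^sup>2 * (y \<bullet> (A *v y))"
      using x sym by (simp add: matrix_vector_right_distrib matrix_vector_mult_scaleR
          inner_add_left inner_add_right algebra_simps power2_eq_square)
    finally show "0 \<le> 2 * t * (y \<bullet> (A *v x)) + t\<^sup>2 * (y \<bullet> (A *v y))" .
  qed
  then show ?thesis by (simp add: y_def)
qed

text \<open>On the unit sphere of \<open>T\<close> the form of \<open>A\<close> has a positive
  minimum and that of \<open>M\<close> a finite maximum; homogeneity of degree two extends the
  comparison to \<open>T\<close>.\<close>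

lemma quadratic_form_bound:
  fixes A M :: "real^4^4"
  assumes T: "subspace T" and pos: "\<And>x. x \<in> T \<Longrightarrow> x \<noteq> 0 \<Longrightarrow> 0 < x \<bullet> (A *v x)"
  obtains C where "C > 0" "\<And>x. x \<in> T \<Longrightarrow> x \<bullet> (M *v x) \<le> C * (x \<bullet> (A *v x))"
proof (cases "T \<subseteq> {0}")
  case True
  show ?thesis by (rule that[of 1]) (use True in auto)
next
  case False
  define S where "S = T \<inter> sphere 0 1"
  have cS: "compact S" unfolding S_def using T by (intro closed_Int_compact closed_subspace) auto
  have "\<exists>x\<in>T. x \<noteq> 0" using False by auto
  then obtain x0 where x0: "x0 \<in> T" "x0 \<noteq> 0" by auto
  then have "x0 /\<^sub>R norm x0 \<in> S" using T by (auto simp: S_def subspace_scale)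
  then have "S \<noteq> {}" by auto
  have cont: "continuous_on S (\<lambda>x. x \<bullet> (X *v x))" for X :: "real^4^4"
    by (intro continuous_on_inner continuous_on_id linear_continuous_on matrix_vector_mul_bounded_linear)
  obtain u where u: "u \<in> S" "\<And>x. x \<in> S \<Longrightarrow> u \<bullet> (A *v u) \<le> x \<bullet> (A *v x)"
    using continuous_attains_inf[OF cS \<open>S \<noteq> {}\<close> cont[of A]] by blast
  obtain w where w: "w \<in> S" "\<And>x. x \<in> S \<Longrightarrow> x \<bullet> (M *v x) \<le> w \<bullet> (M *v w)"
    using continuous_attains_sup[OF cS \<open>S \<noteq> {}\<close> cont[of M]] by blast
  \<comment> \<open>The absolute value and the summand 1 make \<open>m\<close> positive whatever the
    sign of the maximum, so that \<open>m / l\<close> can serve as \<open>C\<close>.\<close>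
  define l where "l = u \<bullet> (A *v u)" define m where "m = \<bar>w \<bullet> (M *v w)\<bar> + 1"
  have "u \<noteq> 0" using u(1) by (auto simp: S_def)
  then have l: "l > 0" using pos[of u] u(1) by (auto simp: l_def S_def)
  have m: "m > 0" by (simp add: m_def)
  show ?thesis
  proof (rule that[of "m / l"])
    show "m / l > 0" using l m by simp
    fix x assume x: "x \<in> T"
    show "x \<bullet> (M *v x) \<le> m / l * (x \<bullet> (A *v x))"
    proof (cases "x = 0")
      case True then show ?thesis by simp
    next
      case False
      define y where "y = x /\<^sub>R norm x"
      have yS: "y \<in> S" using x T False by (auto simp: S_def y_def subspace_scale)
      have xy: "x = norm x *\<^sub>R y" using False by (simp add: y_def)
      have sc: "x \<bullet> (X *v x) = (norm x)\<^sup>2 * (y \<bullet> (X *v y))" for X :: "real^4^4"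
        by (subst (1 2) xy) (simp add: matrix_vector_mult_scaleR power2_eq_square)
      have "y \<bullet> (M *v y) \<le> m" using w(2)[OF yS] by (simp add: m_def)
      also have "\<dots> = m / l * l" using l by simp
      also have "\<dots> \<le> m / l * (y \<bullet> (A *v y))"
        using u(2)[OF yS] l m by (intro mult_left_mono) (auto simp: l_def)
      finally have "(norm x)\<^sup>2 * (y \<bullet> (M *v y)) \<le> (norm x)\<^sup>2 * (m / l * (y \<bullet> (A *v y)))"
        by (intro mult_left_mono) auto
      then show ?thesis unfolding sc by (simp add: mult_ac)
    qed
  qed
qed

definition ker :: "real^4^4 \<Rightarrow> (real^4) set" where
  "ker A = {x. A *v x = 0}"

lemma subspace_ker: "subspace (ker A)"
  by (auto simp: ker_def subspace_def matrix_vector_right_distrib matrix_vector_mult_scaleR)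

lemma ker_form: "A \<in> psd4 \<Longrightarrow> x \<in> ker A \<longleftrightarrow> x \<bullet> (A *v x) = 0"
  using psd_kernel by (auto simp: ker_def)

text \<open>The segment from \<open>M\<close> to \<open>A\<close> can be prolonged beyond
  \<open>A\<close> inside the cone. On the orthogonal complement of its kernel \<open>A\<close> is
  positive definite and dominates a positive multiple of \<open>M\<close>; on the kernel both
  vanish.\<close>

lemma psd_perturb:
  assumes A: "A \<in> psd4" and M: "M \<in> psd4" and k: "ker A \<subseteq> ker M"
  obtains \<epsilon> where "\<epsilon> > 0" "A + \<epsilon> *\<^sub>R (A - M) \<in> psd4"
proof -
  define T where "T = {y. \<forall>x\<in>ker A. orthogonal x y}"
  have T: "subspace T" unfolding T_def by (rule subspace_orthogonal_to_vectors)
  have pos: "0 < x \<bullet> (A *v x)" if "x \<in> T" "x \<noteq> 0" for x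
  proof -
    have "x \<notin> ker A" using that by (auto simp: T_def orthogonal_self)
    then have "x \<bullet> (A *v x) \<noteq> 0" using ker_form[OF A] by blast
    moreover have "0 \<le> x \<bullet> (A *v x)" using A by (simp add: psd4_def)
    ultimately show ?thesis by simp
  qed
  obtain C where C: "C > 0" "\<And>x. x \<in> T \<Longrightarrow> x \<bullet> (M *v x) \<le> C * (x \<bullet> (A *v x))"
    using quadratic_form_bound[OF T pos, of M] by blast
  have bound: "x \<bullet> (M *v x) \<le> C * (x \<bullet> (A *v x))" for x
  proof -
    obtain n y where ny: "n \<in> span (ker A)" "\<And>w. w \<in> span (ker A) \<Longrightarrow> orthogonal y w" "x = n + y"
      using orthogonal_subspace_decomp_exists[of "ker A" x] by metis
    have n: "n \<in> ker A" using ny(1) subspace_ker span_eq_iff by blast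
    have y: "y \<in> T" using ny(2) by (auto simp: T_def orthogonal_commute span_base)
    have "x \<bullet> (X *v x) = y \<bullet> (X *v y)" if "X \<in> psd4" "n \<in> ker X" for X
    proof -
      have "X *v n = 0" using that by (simp add: ker_def)
      moreover have "n \<bullet> (X *v y) = y \<bullet> (X *v n)" using that by (intro symmetric_form) (simp add: psd4_def)
      ultimately show ?thesis by (simp add: ny(3) matrix_vector_right_distrib inner_add_left)
    qed
    then show ?thesis using C(2)[OF y] A M n k by auto
  qed
  show ?thesis
  proof (rule that[of "1 / C"])
    show "1 / C > 0" using C by simp
    have "transpose (A + (1 / C) *\<^sub>R (A - M)) = A + (1 / C) *\<^sub>R (A - M)"
      using A M unfolding psd4_def by (simp add: transpose_def Finite_Cartesian_Product.vec_eq_iff)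
    moreover have "0 \<le> x \<bullet> ((A + (1 / C) *\<^sub>R (A - M)) *v x)" for x
    proof -
      have e: "x \<bullet> ((A + (1 / C) *\<^sub>R (A - M)) *v x) = x \<bullet> (A *v x) + (1 / C) * (x \<bullet> (A *v x) - x \<bullet> (M *v x))"
        by (simp add: matrix_vector_mult_add_rdistrib matrix_vector_mult_diff_rdistrib scaleR_matrix_vector_assoc[symmetric]
            inner_add_right inner_diff_right)
      have "(1 / C) * (x \<bullet> (M *v x)) \<le> x \<bullet> (A *v x)" using bound[of x] C by (simp add: field_simps)
      moreover have "0 \<le> (1 / C) * (x \<bullet> (A *v x))" using A C by (simp add: psd4_def)
      ultimately show ?thesis unfolding e by (simp add: algebra_simps)
    qed
    ultimately show "A + (1 / C) *\<^sub>R (A - M) \<in> psd4" by (simp add: psd4_def)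
  qed
qed

lemma psd4_convex_comb:
  assumes "A \<in> psd4" "B \<in> psd4" "0 \<le> s" "0 \<le> t"
  shows "s *\<^sub>R A + t *\<^sub>R B \<in> psd4"
  using assms by (auto simp: psd4_def transpose_def Finite_Cartesian_Product.vec_eq_iff
      matrix_vector_mult_add_rdistrib scaleR_matrix_vector_assoc[symmetric] inner_add_right)

lemma ker_midpoint:
  assumes "A \<in> psd4" "B \<in> psd4"
  shows "ker ((1/2) *\<^sub>R A + (1/2) *\<^sub>R B) = ker A \<inter> ker B"
proof -
  have M: "(1/2) *\<^sub>R A + (1/2) *\<^sub>R B \<in> psd4" by (rule psd4_convex_comb) (use assms in auto)
  have e: "x \<bullet> (((1/2) *\<^sub>R A + (1/2) *\<^sub>R B) *v x) = (1/2) * (x \<bullet> (A *v x)) + (1/2) * (x \<bullet> (B *v x))" for x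
    by (simp add: matrix_vector_mult_add_rdistrib scaleR_matrix_vector_assoc[symmetric] inner_add_right)
  have "0 \<le> x \<bullet> (A *v x)" "0 \<le> x \<bullet> (B *v x)" for x using assms by (auto simp: psd4_def)
  then have "x \<bullet> (A *v x) + x \<bullet> (B *v x) = 0 \<longleftrightarrow> x \<bullet> (A *v x) = 0 \<and> x \<bullet> (B *v x) = 0" for x
    by (rule add_nonneg_eq_0_iff)
  then show ?thesis using ker_form[OF M] ker_form[OF assms(1)] ker_form[OF assms(2)] unfolding e
    by (auto simp: add_divide_distrib[symmetric])
qed

text \<open>The kernel of a midpoint is the intersection of the two kernels. A kernel of least
  dimension therefore cannot shrink further and lies in all others.\<close>

lemma common_kernel:
  assumes K: "K \<subseteq> psd4" "convex K" "K \<noteq> {}"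
  obtains A where "A \<in> K" "\<And>B. B \<in> K \<Longrightarrow> ker A \<subseteq> ker B"
proof -
  obtain A where A: "A \<in> K" "\<And>B. B \<in> K \<Longrightarrow> dim (ker A) \<le> dim (ker B)"
    using K(3) ex_has_least_nat[of "\<lambda>A. A \<in> K" _ "\<lambda>A. dim (ker A)"] by blast
  show ?thesis
  proof (rule that[OF A(1)])
    fix B assume B: "B \<in> K"
    have AB: "A \<in> psd4" "B \<in> psd4" using A B K by auto
    have "(1/2) *\<^sub>R A + (1/2) *\<^sub>R B \<in> K" using K(2) A(1) B by (intro convexD) auto
    then have "dim (ker A) \<le> dim (ker A \<inter> ker B)" using A(2) ker_midpoint[OF AB] by metis
    then have "ker A \<inter> ker B = ker A"
      by (intro subspace_dim_equal subspace_inter subspace_ker) auto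
    then show "ker A \<subseteq> ker B" by blast
  qed
qed

text \<open>A kernel of dimension three is the complement of a unit vector \<open>u\<close>, and
  \<open>A\<close> is then \<open>l\<close> times the projection onto \<open>u\<close>; the square
  root of \<open>l\<close> goes into \<open>a\<close>.\<close>

lemma rank_one:
  assumes A: "A \<in> psd4" and d: "dim (ker A) \<ge> 3"
  obtains a where "\<And>x y. x \<bullet> (A *v y) = (a \<bullet> x) * (a \<bullet> y)"
proof (cases "ker A = UNIV")
  case True
  then have "A *v y = 0" for y by (auto simp: ker_def)
  then show ?thesis using that[of 0] by simp
next
  case False
  then have "span (ker A) \<noteq> UNIV" using subspace_ker span_eq_iff by metis
  then obtain w where w: "w \<noteq> 0" "span (ker A) \<subseteq> {x. w \<bullet> x = 0}" using span_not_UNIV_orthogonal by blast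
  define u where "u = w /\<^sub>R norm w"
  have u1: "u \<bullet> u = 1" using w(1) by (simp add: u_def dot_square_norm power2_eq_square)
  have "ker A \<subseteq> {x. u \<bullet> x = 0}" using w(2) span_superset[of "ker A"] by (auto simp: u_def)
  moreover have "dim {x. u \<bullet> x = 0} = 3" using dim_hyperplane[of u] u1 by force
  ultimately have ku: "ker A = {x. u \<bullet> x = 0}"
    using d by (intro subspace_dim_equal subspace_ker subspace_hyperplane) auto
  define l where "l = u \<bullet> (A *v u)"
  have l: "l \<ge> 0" using A by (simp add: l_def psd4_def)
  have Ax: "A *v y = (u \<bullet> y) *\<^sub>R (A *v u)" for y
  proof -
    have "y - (u \<bullet> y) *\<^sub>R u \<in> ker A" unfolding ku using u1 by (simp add: inner_diff_right)
    then show ?thesis by (simp add: ker_def matrix_vector_mult_diff_distrib matrix_vector_mult_scaleR)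
  qed
  have sy: "transpose A = A" using A by (simp add: psd4_def)
  have "x \<bullet> (A *v y) = (u \<bullet> x) * (u \<bullet> y) * l" for x y
  proof -
    have "x \<bullet> (A *v y) = (u \<bullet> y) * (x \<bullet> (A *v u))" by (subst Ax) simp
    also have "x \<bullet> (A *v u) = u \<bullet> (A *v x)" by (rule symmetric_form[OF sy])
    also have "\<dots> = (u \<bullet> x) * l" by (subst Ax) (simp add: l_def)
    finally show ?thesis by (simp add: mult_ac)
  qed
  then have "x \<bullet> (A *v y) = ((sqrt l *\<^sub>R u) \<bullet> x) * ((sqrt l *\<^sub>R u) \<bullet> y)" for x y
    using l by (simp add: mult_ac)
  then show ?thesis by (rule that)
qed

lemma rank_one_outer:
  assumes "\<And>x y. x \<bullet> (A *v y) = (a \<bullet> x) * (a \<bullet> y)"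
  shows "A = outer a"
proof -
  have "A $ i $ j = a $ i * a $ j" for i j
    using assms[of "axis i 1" "axis j 1"]
    by (simp add: inner_axis' inner_axis matrix_vector_mult_basis column_def)
  then show ?thesis by (simp add: outer_def Finite_Cartesian_Product.vec_eq_iff)
qed

lemma inner_transpose: "(transpose B :: real^'n^'n) \<bullet> A = B \<bullet> transpose A"
  by (simp add: inner_vec_def transpose_def sum.swap[of "\<lambda>i j. B $ j $ i * A $ i $ j"])

text \<open>Positivity is asked of all matrices of \<open>real^4^4\<close>, symmetric or not. This
  makes the set full-dimensional, so a matrix separating from it may be nonsymmetric and is
  symmetrized afterwards.\<close>

definition posdef :: "(real^4^4) set" where
  "posdef = {A. \<forall>x. x \<noteq> 0 \<longrightarrow> 0 < x \<bullet> (A *v x)}"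

lemma form_lincomb: "x \<bullet> ((s *\<^sub>R A + t *\<^sub>R B) *v x) = s * (x \<bullet> (A *v x)) + t * (x \<bullet> ((B :: real^4^4) *v x))"
  by (simp add: matrix_vector_mult_add_rdistrib scaleR_matrix_vector_assoc[symmetric] inner_add_right)

lemma convex_posdef: "convex posdef"
  unfolding convex_def posdef_def
proof (intro ballI allI impI CollectI)
  fix A B :: "real^4^4" and s t :: real and x :: "real^4"
  assume *: "A \<in> {A. \<forall>x. x \<noteq> 0 \<longrightarrow> 0 < x \<bullet> (A *v x)}" "B \<in> {A. \<forall>x. x \<noteq> 0 \<longrightarrow> 0 < x \<bullet> (A *v x)}"
    "0 \<le> s" "0 \<le> t" "s + t = 1" "x \<noteq> 0"
  then have p: "0 < x \<bullet> (A *v x)" "0 < x \<bullet> (B *v x)" by auto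
  show "0 < x \<bullet> ((s *\<^sub>R A + t *\<^sub>R B) *v x)"
  proof (cases "s = 0")
    case True then show ?thesis using * p by (simp add: form_lincomb)
  next
    case False
    then have "0 < s * (x \<bullet> (A *v x))" "0 \<le> t * (x \<bullet> (B *v x))" using * p by auto
    then show ?thesis unfolding form_lincomb by linarith
  qed
qed

lemma posdef_add_psd: "A \<in> posdef \<Longrightarrow> B \<in> psd4 \<Longrightarrow> 0 < s \<Longrightarrow> s *\<^sub>R A + B \<in> posdef"
  using form_lincomb[of _ s A 1 B] by (auto simp: posdef_def psd4_def intro!: add_pos_nonneg)

lemma posdef_perturb:
  assumes "A \<in> posdef"
  obtains \<epsilon> where "\<epsilon> > 0" "A - \<epsilon> *\<^sub>R M \<in> posdef"
proof -
  obtain C where C: "C > 0" "\<And>x. x \<in> UNIV \<Longrightarrow> x \<bullet> (M *v x) \<le> C * (x \<bullet> (A *v x))"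
    using quadratic_form_bound[of UNIV A M] assms by (auto simp: posdef_def)
  show ?thesis
  proof (rule that[of "1 / (2 * C)"])
    show "1 / (2 * C) > 0" using C by simp
    have "0 < x \<bullet> ((A - (1 / (2 * C)) *\<^sub>R M) *v x)" if "x \<noteq> 0" for x
    proof -
      have "0 < x \<bullet> (A *v x)" using assms that by (simp add: posdef_def)
      moreover have "(1 / (2 * C)) * (x \<bullet> (M *v x)) \<le> (1 / 2) * (x \<bullet> (A *v x))"
        using C(2)[of x] C(1) by (simp add: field_simps)
      ultimately show ?thesis using form_lincomb[of x 1 A "- (1 / (2 * C))" M] by simp
    qed
    then show "A - (1 / (2 * C)) *\<^sub>R M \<in> posdef" by (simp add: posdef_def)
  qed
qed

lemma mat1_posdef: "(Finite_Cartesian_Product.mat 1 :: real^4^4) \<in> posdef"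
  by (simp add: posdef_def)

text \<open>Conic duality: a functional that is nonnegative on a spectrahedron meeting the interior of
  the cone is the restriction of a psd matrix; the hyperplane comes from separating its zero set
  from the positive definite matrices.\<close>

lemma spectrahedron_duality:
  fixes f :: "real^4^4 \<Rightarrow> real"
  assumes L: "affine L" "\<And>A. A \<in> L \<Longrightarrow> transpose A = A"
    and f: "\<And>A B C t. A \<in> L \<Longrightarrow> B \<in> L \<Longrightarrow> C \<in> L \<Longrightarrow> f (A + t *\<^sub>R (B - C)) = f A + t * (f B - f C)"
    and A0: "A0 \<in> L" "A0 \<in> posdef" "f A0 > 0" and A1: "A1 \<in> L" "A1 \<in> psd4" "f A1 = 0"
    and disj: "\<And>A. A \<in> L \<Longrightarrow> f A = 0 \<Longrightarrow> A \<notin> posdef"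
  shows "\<exists>B\<in>psd4. (\<forall>A\<in>L. f A = B \<bullet> A) \<and> (\<forall>A\<in>psd4. 0 \<le> B \<bullet> A)"
proof -
  define D where "D = {A \<in> L. f A = 0}"
  have L3: "A + t *\<^sub>R (B - C) \<in> L" if "A \<in> L" "B \<in> L" "C \<in> L" for A B C t
    using mem_affine_3_minus[OF L(1) that] .
  have cD: "convex D"
    unfolding convex_alt
  proof (intro ballI allI impI)
    fix A B u assume "A \<in> D" "B \<in> D" "0 \<le> u \<and> u \<le> (1::real)"
    then have "A + u *\<^sub>R (B - A) \<in> D" using f[of A B A u] L3[of A B A u] by (simp add: D_def)
    then show "(1 - u) *\<^sub>R A + u *\<^sub>R B \<in> D" by (simp add: algebra_simps)
  qed
  have "D \<noteq> {}" "posdef \<noteq> {}" "D \<inter> posdef = {}" using A0 A1 disj by (auto simp: D_def)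
  then obtain B \<beta> where B: "B \<noteq> 0" "\<forall>A\<in>D. B \<bullet> A \<le> \<beta>" "\<forall>A\<in>posdef. \<beta> \<le> B \<bullet> A"
    using separating_hyperplane_sets[OF cD convex_posdef] by blast
  have scale: "t *\<^sub>R A \<in> posdef" if "A \<in> posdef" "t > 0" for A t
    using that by (simp add: posdef_def scaleR_matrix_vector_assoc[symmetric])
  \<comment> \<open>\<open>posdef\<close> is a cone: scaling up a matrix with negative value would
    push the value below \<beta>.\<close>
  have nn: "0 \<le> B \<bullet> A" if "A \<in> posdef" for A
  proof (rule ccontr)
    assume neg: "\<not> 0 \<le> B \<bullet> A"
    define t where "t = (\<bar>\<beta>\<bar> + 1) / (- (B \<bullet> A))"
    have "t > 0" unfolding t_def using neg by (intro divide_pos_pos) auto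
    then have "\<beta> \<le> B \<bullet> (t *\<^sub>R A)" using B(3) scale[OF that] by blast
    also have "B \<bullet> (t *\<^sub>R A) = - (\<bar>\<beta>\<bar> + 1)" using neg by (simp add: t_def field_simps)
    finally show False by simp
  qed
  \<comment> \<open>A psd matrix becomes positive definite on adding \<open>t\<close> times the
    identity; \<open>t\<close> is so small that a negative value would remain negative.\<close>
  have nnp: "0 \<le> B \<bullet> A" if "A \<in> psd4" for A
  proof (rule ccontr)
    assume neg: "\<not> 0 \<le> B \<bullet> A"
    define t where "t = - (B \<bullet> A) / (2 * (B \<bullet> Finite_Cartesian_Product.mat 1 + 1))"
    have p: "B \<bullet> Finite_Cartesian_Product.mat 1 \<ge> 0" by (rule nn[OF mat1_posdef])
    then have t: "t > 0" unfolding t_def using neg by (intro divide_pos_pos) auto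
    have "0 \<le> B \<bullet> (t *\<^sub>R Finite_Cartesian_Product.mat 1 + A)" by (rule nn[OF posdef_add_psd[OF mat1_posdef that t]])
    then have "0 \<le> t * (B \<bullet> Finite_Cartesian_Product.mat 1) + B \<bullet> A" by (simp add: inner_add_right)
    moreover have "t * (B \<bullet> Finite_Cartesian_Product.mat 1) \<le> t * (B \<bullet> Finite_Cartesian_Product.mat 1 + 1)" using t by simp
    moreover have "t * (B \<bullet> Finite_Cartesian_Product.mat 1 + 1) = - (B \<bullet> A) / 2" using p by (simp add: t_def field_simps)
    ultimately show False using neg by simp
  qed
  \<comment> \<open>The values at small multiples of the identity tend to 0 and are bounded below by
    \<beta>.\<close>
  have "\<beta> \<le> 0"
  proof (rule ccontr)
    assume pos: "\<not> \<beta> \<le> 0"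
    define t where "t = \<beta> / (2 * (B \<bullet> Finite_Cartesian_Product.mat 1 + 1))"
    have p: "B \<bullet> Finite_Cartesian_Product.mat 1 \<ge> 0" by (rule nn[OF mat1_posdef])
    then have t: "t > 0" unfolding t_def using pos by (intro divide_pos_pos) auto
    have "\<beta> \<le> B \<bullet> (t *\<^sub>R Finite_Cartesian_Product.mat 1)" using B(3) scale[OF mat1_posdef t] by blast
    also have "\<dots> \<le> t * (B \<bullet> Finite_Cartesian_Product.mat 1 + 1)" using t by simp
    also have "\<dots> = \<beta> / 2" using p by (simp add: t_def field_simps)
    finally show False using pos by simp
  qed
  have A1D: "A1 \<in> D" using A1 by (simp add: D_def)
  then have BA1: "B \<bullet> A1 = 0" using nnp[OF A1(2)] B(2) \<open>\<beta> \<le> 0\<close> by force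
  \<comment> \<open>\<open>D\<close> is closed under reflection in \<open>A1\<close>, where
    \<open>B\<close> vanishes, so the bound \<open>B \<bullet> A \<le> 0\<close> on \<open>D\<close>
    holds at \<open>A\<close> and at its mirror image.\<close>
  have zero: "B \<bullet> A = 0" if A: "A \<in> D" for A
  proof -
    have "A1 + 1 *\<^sub>R (A1 - A) \<in> D" using f[of A1 A1 A 1] L3[of A1 A1 A 1] A A1 by (simp add: D_def)
    then have "B \<bullet> (A1 + 1 *\<^sub>R (A1 - A)) \<le> 0" using B(2) \<open>\<beta> \<le> 0\<close> by force
    moreover have "B \<bullet> (A1 + 1 *\<^sub>R (A1 - A)) = B \<bullet> A1 + (B \<bullet> A1 - B \<bullet> A)"
      by (simp only: inner_add_right inner_diff_right scaleR_one)
    ultimately have "B \<bullet> A \<ge> 0" using BA1 by simp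
    moreover have "B \<bullet> A \<le> 0" using B(2) \<open>\<beta> \<le> 0\<close> A by force
    ultimately show ?thesis by simp
  qed
  \<comment> \<open>From \<open>A0\<close> one can move a little in the direction of
    \<open>- B\<close> within \<open>posdef\<close>; if the value at \<open>A0\<close> were 0, it
    would become negative.\<close>
  have BA0: "B \<bullet> A0 > 0"
  proof (rule ccontr)
    assume "\<not> B \<bullet> A0 > 0"
    then have z: "B \<bullet> A0 = 0" using nn[OF A0(2)] by simp
    obtain \<epsilon> where e: "\<epsilon> > 0" "A0 - \<epsilon> *\<^sub>R B \<in> posdef" using posdef_perturb[OF A0(2)] by blast
    have "B \<bullet> (A0 - \<epsilon> *\<^sub>R B) = B \<bullet> A0 - \<epsilon> * (B \<bullet> B)"
      by (simp only: inner_diff_right inner_scaleR_right)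
    then have "\<epsilon> * (B \<bullet> B) \<le> 0" using nn[OF e(2)] z by linarith
    moreover have "\<epsilon> * (B \<bullet> B) > 0" using e(1) B(1) by simp
    ultimately show False by linarith
  qed
  \<comment> \<open>Every matrix of \<open>L\<close> can be moved along \<open>A0 - A1\<close> into
    \<open>D\<close>, where \<open>B\<close> vanishes; hence on \<open>L\<close> the functional
    \<open>B\<close> is the multiple of \<open>f\<close> by this factor.\<close>
  define l where "l = B \<bullet> A0 / f A0"
  have l: "l > 0" using BA0 A0 by (simp add: l_def)
  have Bf: "B \<bullet> A = l * f A" if A: "A \<in> L" for A
  proof -
    let ?t = "- f A / f A0"
    have "A + ?t *\<^sub>R (A0 - A1) \<in> D" using f[OF A A0(1) A1(1), of ?t] L3[OF A A0(1) A1(1), of ?t] A0 A1 by (simp add: D_def)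
    then have "B \<bullet> (A + ?t *\<^sub>R (A0 - A1)) = 0" by (rule zero)
    then have "B \<bullet> A + ?t * (B \<bullet> A0) = 0" using BA1 by (simp add: inner_add_right inner_diff_right)
    then show ?thesis by (simp add: l_def field_simps)
  qed
  \<comment> \<open>Against a symmetric matrix \<open>B\<close> and its transpose have the same
    value, hence the 2 in the denominator; dividing by \<open>l\<close> turns \<open>B\<close> into
    \<open>f\<close> on \<open>L\<close>.\<close>
  define S where "S = (1 / (2 * l)) *\<^sub>R (B + transpose B)"
  have Ssym: "transpose S = S"
    by (simp add: S_def transpose_def Finite_Cartesian_Product.vec_eq_iff add.commute)
  have SA: "S \<bullet> A = (1 / l) * (B \<bullet> A)" if "transpose A = A" for A
    using inner_transpose[of B A] that by (simp add: S_def inner_add_left)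
  have Snn: "0 \<le> S \<bullet> A" if "A \<in> psd4" for A
    using SA[of A] nnp[OF that] that l by (simp add: psd4_def)
  have "S \<in> psd4" using Ssym Snn[OF outer_psd] by (simp add: psd4_def inner_outer)
  moreover have "f A = S \<bullet> A" if "A \<in> L" for A using SA[OF L(2)[OF that]] Bf[OF that] l by simp
  ultimately show ?thesis using Snn by blast
qed

section \<open>Ranks of the matrices over the faces of a lifted polytope\<close>

locale lifted_polytope3 = polytope3 P for P :: "'a::euclidean_space set" +
  fixes L and \<pi> :: "real^4^4 \<Rightarrow> 'a"
  assumes L: "affine L" "\<And>A. A \<in> L \<Longrightarrow> transpose A = A" "linear \<pi>" "P = \<pi> ` (L \<inter> psd4)"
begin

definition over :: "'a set \<Rightarrow> (real^4^4) set" where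
  "over F = {A \<in> L \<inter> psd4. \<pi> A \<in> F}"

text \<open>For a nonempty face this is the kernel of a single matrix of largest rank over it, by
  \<open>null_attained\<close>; its dimension is the measure for the rank count along a
  flag.\<close>

definition null :: "'a set \<Rightarrow> (real^4) set" where
  "null F = {x. \<forall>A\<in>over F. A *v x = 0}"

lemma subspace_null: "subspace (null F)"
  by (auto simp: null_def subspace_def matrix_vector_right_distrib matrix_vector_mult_scaleR)

lemma over_nonempty: "F \<subseteq> P \<Longrightarrow> F \<noteq> {} \<Longrightarrow> over F \<noteq> {}"
  using L(4) by (auto simp: over_def)

lemma convex_over: "convex F \<Longrightarrow> convex (over F)"
  unfolding convex_def
proof (intro ballI allI impI)
  fix A B s t assume F: "\<forall>x\<in>F. \<forall>y\<in>F. \<forall>u\<ge>0. \<forall>v\<ge>0. u + v = 1 \<longrightarrow> u *\<^sub>R x + v *\<^sub>R y \<in> F"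
    and AB: "A \<in> over F" "B \<in> over F" and st: "0 \<le> s" "0 \<le> t" "s + t = (1::real)"
  have "s *\<^sub>R A + t *\<^sub>R B \<in> L" using L(1) AB st by (auto simp: affine_def over_def)
  moreover have "s *\<^sub>R A + t *\<^sub>R B \<in> psd4" using AB st by (intro psd4_convex_comb) (auto simp: over_def)
  moreover have "\<pi> (s *\<^sub>R A + t *\<^sub>R B) \<in> F"
    using F AB st by (simp add: linear_add[OF L(3)] linear_cmul[OF L(3)] over_def)
  ultimately show "s *\<^sub>R A + t *\<^sub>R B \<in> over F" by (simp add: over_def)
qed

lemma null_attained:
  assumes F: "F \<subseteq> P" "F \<noteq> {}" "convex F"
  obtains A where "A \<in> over F" "ker A = null F"
proof -
  obtain A where A: "A \<in> over F" "\<And>B. B \<in> over F \<Longrightarrow> ker A \<subseteq> ker B"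
    using common_kernel[OF _ convex_over[OF F(3)] over_nonempty[OF F(1,2)]] by (auto simp: over_def)
  then have "ker A = null F" by (auto simp: null_def ker_def)
  then show ?thesis using that A by blast
qed

text \<open>Suppose that the two null spaces agree, and let \<open>A\<close> over \<open>F\<close>
  attain the null space. For \<open>M\<close> over \<open>G\<close> with image outside
  \<open>F\<close>, the segment from \<open>M\<close> to \<open>A\<close> can be prolonged beyond
  \<open>A\<close> in the cone. Then \<open>\<pi> A\<close> lies in \<open>F\<close> and strictly
  between \<open>\<pi> M\<close> and another point of \<open>P\<close>, so the face property puts
  \<open>\<pi> M\<close> into \<open>F\<close>.\<close>

lemma null_dim_less:
  assumes F: "F face_of P" "F \<noteq> {}" and G: "G face_of P" "F \<subset> G"
  shows "dim (null G) < dim (null F)"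
proof -
  have FG: "over F \<subseteq> over G" using G by (auto simp: over_def)
  then have sub: "null G \<subseteq> null F" by (auto simp: null_def)
  have "null F \<noteq> null G"
  proof
    assume eq: "null F = null G"
    have cvx: "convex F" "convex G" using F G face_of_imp_convex by auto
    have FP: "F \<subseteq> P" "G \<subseteq> P" using F G face_of_imp_subset by auto
    obtain A where A: "A \<in> over F" "ker A = null F" by (rule null_attained[OF FP(1) F(2) cvx(1)])
    have Gne: "G \<noteq> {}" using G(2) by auto
    obtain M0 where M0: "M0 \<in> over G" "ker M0 = null G" by (rule null_attained[OF FP(2) Gne cvx(2)])
    obtain g where g: "g \<in> G" "g \<notin> F" using G(2) by auto
    then obtain B where B: "B \<in> over G" "\<pi> B = g" using FP(2) L(4) by (auto simp: over_def)
    define M where "M = (1/2) *\<^sub>R M0 + (1/2) *\<^sub>R B"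
    have MG: "M \<in> over G" unfolding M_def using convex_over[OF cvx(2)] M0(1) B(1) by (intro convexD) auto
    have pM: "\<pi> M = midpoint (\<pi> M0) g"
      by (simp add: M_def midpoint_def linear_add[OF L(3)] linear_cmul[OF L(3)] B(2) scaleR_add_right)
    have MF: "\<pi> M \<notin> F"
    proof
      assume m: "\<pi> M \<in> F"
      show False
      proof (cases "\<pi> M0 = g")
        case True then show ?thesis using m pM g by simp
      next
        case False
        then have "\<pi> M \<in> open_segment (\<pi> M0) g" unfolding pM by (simp add: midpoint_in_open_segment)
        moreover have "\<pi> M0 \<in> P" "g \<in> P" using M0(1) g(1) FP(2) by (auto simp: over_def)
        ultimately have "g \<in> F" using face_ofD[OF F(1)] m by blast
        then show ?thesis using g by simp
      qed
    qed
    have "ker A \<subseteq> ker M" using A(2) eq MG by (auto simp: null_def ker_def)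
    moreover have pA: "A \<in> psd4" "M \<in> psd4" "A \<in> L" "M \<in> L" using A MG by (auto simp: over_def)
    ultimately obtain \<epsilon> where e: "\<epsilon> > 0" "A + \<epsilon> *\<^sub>R (A - M) \<in> psd4" using psd_perturb by blast
    define C where "C = A + \<epsilon> *\<^sub>R (A - M)"
    have "C \<in> L" unfolding C_def by (rule mem_affine_3_minus[OF L(1) pA(3,3,4)])
    then have CP: "\<pi> C \<in> P" using e(2) L(4) by (auto simp: C_def)
    have pC: "\<pi> C = \<pi> A + \<epsilon> *\<^sub>R (\<pi> A - \<pi> M)"
      by (simp add: C_def linear_add[OF L(3)] linear_cmul[OF L(3)] linear_diff[OF L(3)])
    have AF: "\<pi> A \<in> F" using A(1) by (simp add: over_def)
    have ne: "\<pi> C \<noteq> \<pi> M"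
    proof
      assume "\<pi> C = \<pi> M"
      then have "(1 + \<epsilon>) *\<^sub>R (\<pi> A - \<pi> M) = 0" unfolding pC by (simp add: algebra_simps)
      then have "\<pi> A = \<pi> M" using e(1) by simp
      then show False using AF MF by simp
    qed
    have "\<pi> A = (1 - 1 / (1 + \<epsilon>)) *\<^sub>R \<pi> M + (1 / (1 + \<epsilon>)) *\<^sub>R \<pi> C"
    proof -
      have "(1 + \<epsilon>) *\<^sub>R \<pi> A = \<epsilon> *\<^sub>R \<pi> M + \<pi> C" unfolding pC by (simp add: algebra_simps)
      then have "(1 / (1 + \<epsilon>)) *\<^sub>R ((1 + \<epsilon>) *\<^sub>R \<pi> A) = (1 / (1 + \<epsilon>)) *\<^sub>R (\<epsilon> *\<^sub>R \<pi> M + \<pi> C)" by simp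
      moreover have "1 - 1 / (1 + \<epsilon>) = \<epsilon> / (1 + \<epsilon>)" using e(1) by (simp add: field_simps)
      ultimately show ?thesis using e(1) by (simp add: scaleR_add_right)
    qed
    then have "\<pi> A \<in> open_segment (\<pi> M) (\<pi> C)" using ne e(1) by (auto simp: in_segment intro!: exI[of _ "1 / (1 + \<epsilon>)"])
    moreover have "\<pi> M \<in> P" using pA L(4) by auto
    ultimately have "\<pi> M \<in> F" using face_ofD[OF F(1) _ _ CP AF] by blast
    then show False using MF by simp
  qed
  then have "null G \<subset> null F" using sub by auto
  then show ?thesis using subspace_null by (metis dim_psubset span_eq_iff)
qed

text \<open>If every vector is in the null space, then the zero matrix lies in \<open>L\<close>, so
  the lift is a cone and \<open>P\<close> is closed under nonnegative scaling; being bounded, it is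
  at most a point.\<close>

lemma null_vertex_proper:
  assumes v: "v \<in> vertices P" shows "null {v} \<noteq> UNIV"
proof
  assume u: "null {v} = UNIV"
  have vP: "v \<in> P" using v vertices_subset by blast
  obtain A where A: "A \<in> over {v}" "ker A = null {v}"
    by (rule null_attained[of "{v}"]) (use vP in auto)
  then have "A *v x = 0" for x using u by (auto simp: ker_def)
  then have "A = 0" by (simp add: matrix_eq)
  then have zL: "0 \<in> L" using A by (simp add: over_def)
  obtain c where c: "\<And>x. x \<in> P \<Longrightarrow> norm x \<le> c" using polytope_imp_bounded[OF poly] by (auto simp: bounded_iff)
  have "x = 0" if xP: "x \<in> P" for x
  proof (rule ccontr)
    assume x: "x \<noteq> 0"
    obtain B where B: "B \<in> L" "B \<in> psd4" "x = \<pi> B" using xP L(4) by auto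
    define t where "t = (\<bar>c\<bar> + 1) / norm x"
    have t: "t \<ge> 0" by (simp add: t_def)
    have "(1 - t) *\<^sub>R 0 + t *\<^sub>R B \<in> L" using L(1) zL B by (intro mem_affine) auto
    moreover have "t *\<^sub>R B + 0 *\<^sub>R B \<in> psd4" by (rule psd4_convex_comb) (use B t in auto)
    ultimately have "t *\<^sub>R B \<in> L \<inter> psd4" by simp
    then have "\<pi> (t *\<^sub>R B) \<in> P" using L(4) by blast
    then have "norm (\<pi> (t *\<^sub>R B)) \<le> c" by (rule c)
    then have "norm (t *\<^sub>R x) \<le> c" unfolding B(3) linear_cmul[OF L(3)] .
    moreover have "norm (t *\<^sub>R x) = \<bar>c\<bar> + 1" using x t by (simp add: t_def)
    ultimately show False by simp
  qed
  then have "P \<subseteq> {0}" by auto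
  then have "aff_dim P \<le> 0" using aff_dim_subset[of P "{0}"] aff_dim_sing[of "0::'a"] by linarith
  then show False using dim3 by simp
qed

text \<open>Along vertex, edge, facet, polytope the dimensions strictly decrease from a value below
  four, which leaves only 3, 2, 1, 0.\<close>

lemma null_dims:
  assumes F: "F facet_of P" and v: "v \<in> vertices P" "v \<in> F"
  shows "dim (null {v}) = 3" "dim (null F) = 1" "dim (null P) = 0"
proof -
  obtain w1 w2 where w: "w1 \<noteq> w2"
    "{w \<in> vertices P. w \<noteq> v \<and> w \<in> F \<and> (\<exists>G. G facet_of P \<and> G \<noteq> F \<and> v \<in> G \<and> w \<in> G)} = {w1, w2}"
    using two_neighbours_in_facet[OF F v] by blast
  then have "w1 \<in> {w \<in> vertices P. w \<noteq> v \<and> w \<in> F \<and> (\<exists>G. G facet_of P \<and> G \<noteq> F \<and> v \<in> G \<and> w \<in> G)}" by simp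
  then obtain G where G: "w1 \<noteq> v" "w1 \<in> F" "G facet_of P" "G \<noteq> F" "v \<in> G" "w1 \<in> G" by auto
  have E: "F \<inter> G face_of P" by (rule facet_Int_face[OF F G(3)])
  have FP: "F face_of P" using F facet_of_imp_face_of by blast
  have vf: "{v} face_of P" using v by (simp add: vertices_def face_of_singleton)
  have PP: "P face_of P" using poly by (simp add: face_of_refl polytope_imp_convex)
  have 1: "dim (null (F \<inter> G)) < dim (null {v})" by (rule null_dim_less[OF vf _ E]) (use G v in auto)
  have "F \<inter> G \<noteq> F" using facet_subset_facet[OF poly F G(3)] G(4) by blast
  then have 2: "dim (null F) < dim (null (F \<inter> G))" by (intro null_dim_less[OF E _ FP]) (use G v in auto)
  have "F \<noteq> P" using F by auto
  then have 3: "dim (null P) < dim (null F)"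
    using face_of_imp_subset[OF FP] v by (intro null_dim_less[OF FP _ PP]) auto
  have "dim (null {v}) < 4"
  proof (rule ccontr)
    assume "\<not> dim (null {v}) < 4"
    then have "dim (null {v}) = DIM(real^4)" using dim_subset_UNIV[of "null {v}"] by simp
    then have "span (null {v}) = UNIV" by (simp only: dim_eq_full)
    then have "null {v} = UNIV" using subspace_null span_eq_iff by metis
    then show False using null_vertex_proper[OF v(1)] by simp
  qed
  then show "dim (null {v}) = 3" "dim (null F) = 1" "dim (null P) = 0" using 1 2 3 by linarith+
qed

end

context lifted_polytope3
begin

text \<open>This has two uses: some matrix of the lift is positive definite, as the duality argument
  requires, and lifts of order below four are impossible.\<close>

lemma null_P_trivial: "null P \<subseteq> {0}"
proof -
  obtain F v where "F facet_of P" "v \<in> vertices P" "v \<in> F"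
    using polytope_facet_exists[OF poly] dim3 facet_has_vertex by (metis Int_emptyI zero_less_numeral)
  then have "dim (null P) = 0" by (rule null_dims(3))
  then show ?thesis by simp
qed

lemma vertex_rank_one:
  assumes v: "v \<in> vertices P"
  shows "\<exists>a. outer a \<in> L \<and> \<pi> (outer a) = v"
proof -
  obtain F where F: "F facet_of P" "v \<in> F" using vertex_in_facet[OF v] by blast
  have vP: "v \<in> P" using v vertices_subset by blast
  obtain A where A: "A \<in> over {v}" "ker A = null {v}"
    by (rule null_attained[of "{v}"]) (use vP in auto)
  have Ap: "A \<in> psd4" "A \<in> L" "\<pi> A = v" using A(1) by (auto simp: over_def)
  obtain a where "\<And>x y. x \<bullet> (A *v y) = (a \<bullet> x) * (a \<bullet> y)"
    by (rule rank_one[OF Ap(1)]) (use A(2) null_dims(1)[OF F(1) v F(2)] in auto)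
  then have "A = outer a" by (rule rank_one_outer)
  then show ?thesis using Ap by blast
qed

text \<open>Conic duality is applied to the slack functional. Matrices over \<open>P\<close> with
  trivial kernel are positive definite, while every matrix over \<open>F\<close> has a kernel
  vector, so the zero set of the slack avoids \<open>posdef\<close>. The resulting \<open>B\<close>
  is orthogonal to a matrix \<open>A1\<close> of largest rank over \<open>F\<close>, which leaves it
  rank at most one.\<close>

lemma facet_rank_one:
  assumes F: "F facet_of P" and cd: "P \<subseteq> {x. c \<bullet> x \<le> d}" "F = P \<inter> {x. c \<bullet> x = d}"
  shows "\<exists>b. \<forall>A\<in>L. d - c \<bullet> \<pi> A = outer b \<bullet> A"
proof -
  obtain v where v: "v \<in> vertices P" "v \<in> F" using facet_has_vertex[OF F] by blast
  have dF: "dim (null F) = 1" by (rule null_dims(2)[OF F v])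
  have cP: "convex P" using poly by (rule polytope_imp_convex)
  have FP: "F \<subseteq> P" "F \<noteq> {}" using F v facet_of_imp_subset by auto
  have cF: "convex F" using F facet_of_imp_face_of face_of_imp_convex by blast
  obtain A0 where A0: "A0 \<in> over P" "ker A0 = null P" by (rule null_attained[OF subset_refl _ cP]) (use FP in auto)
  obtain A1 where A1: "A1 \<in> over F" "ker A1 = null F" by (rule null_attained[OF FP cF])
  have over_pos: "A \<notin> posdef" if "A \<in> over F" for A
  proof
    assume "A \<in> posdef"
    then have "ker A \<subseteq> {0}" by (force simp: ker_def posdef_def)
    moreover have "null F \<subseteq> ker A" using that by (auto simp: null_def ker_def)
    ultimately have "null F \<subseteq> {0}" by blast
    then show False using dF by (metis dim_eq_0 zero_neq_one)
  qed
  have A0p: "A0 \<in> psd4" "A0 \<in> L" "\<pi> A0 \<in> P" using A0(1) by (auto simp: over_def)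
  have A1p: "A1 \<in> psd4" "A1 \<in> L" "\<pi> A1 \<in> F" using A1(1) by (auto simp: over_def)
  have A0pos: "A0 \<in> posdef"
    unfolding posdef_def
  proof (intro CollectI allI impI)
    fix x :: "real^4" assume "x \<noteq> 0"
    then have "x \<notin> ker A0" using A0(2) null_P_trivial by auto
    then have "x \<bullet> (A0 *v x) \<noteq> 0" using ker_form[OF A0p(1)] by blast
    moreover have "0 \<le> x \<bullet> (A0 *v x)" using A0p(1) by (simp add: psd4_def)
    ultimately show "0 < x \<bullet> (A0 *v x)" by simp
  qed
  define f where "f = (\<lambda>A. d - c \<bullet> \<pi> A)"
  have f0: "f A0 > 0"
  proof -
    have "A0 \<notin> over F" using over_pos A0pos by blast
    then have "\<pi> A0 \<notin> F" using A0p by (simp add: over_def)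
    then have "c \<bullet> \<pi> A0 \<noteq> d" using cd(2) A0p(3) by blast
    moreover have "c \<bullet> \<pi> A0 \<le> d" using cd(1) A0p(3) by blast
    ultimately show ?thesis by (simp add: f_def)
  qed
  have f1: "f A1 = 0" using A1p(3) cd(2) by (auto simp: f_def)
  have disj: "A \<notin> posdef" if A: "A \<in> L" "f A = 0" for A
  proof
    assume p: "A \<in> posdef"
    have "0 \<le> x \<bullet> (A *v x)" for x using p by (cases "x = 0") (auto simp: posdef_def less_imp_le)
    then have "A \<in> psd4" using L(2)[OF A(1)] by (simp add: psd4_def)
    then have "\<pi> A \<in> P" using A(1) L(4) by blast
    then have "\<pi> A \<in> F" using A(2) cd(2) by (simp add: f_def)
    then have "A \<in> over F" using A(1) \<open>A \<in> psd4\<close> by (simp add: over_def)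
    then show False using over_pos p by blast
  qed
  have flin: "f (A + t *\<^sub>R (B - C)) = f A + t * (f B - f C)" for A B C t
    by (simp add: f_def linear_add[OF L(3)] linear_cmul[OF L(3)] linear_diff[OF L(3)] inner_add_right inner_diff_right algebra_simps)
  obtain B where B: "B \<in> psd4" "\<And>A. A \<in> L \<Longrightarrow> f A = B \<bullet> A" "\<And>A. A \<in> psd4 \<Longrightarrow> 0 \<le> B \<bullet> A"
    using spectrahedron_duality[of L f A0 A1, OF L(1,2) flin A0p(2) A0pos f0 A1p(2,1) f1 disj] by blast
  \<comment> \<open>For \<open>y\<close> orthogonal to the kernel of \<open>A1\<close>, a small
    multiple of \<open>outer y\<close> can be subtracted from a multiple of \<open>A1\<close>
    without leaving the cone. As \<open>B\<close> vanishes at \<open>A1\<close> and is nonnegative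
    on the cone, its form vanishes at \<open>y\<close>. Such \<open>y\<close> fill a space of
    dimension three.\<close>
  define T where "T = {y \<in> UNIV. \<forall>x\<in>ker A1. orthogonal x y}"
  have "dim T + dim (ker A1) = dim (UNIV :: (real^4) set)"
    unfolding T_def by (rule dim_subspace_orthogonal_to_vectors) (auto simp: subspace_ker)
  then have dT: "dim T = 3" using A1(2) dF by simp
  have "T \<subseteq> ker B"
  proof
    fix y assume y: "y \<in> T"
    have "ker A1 \<subseteq> ker (outer y)"
    proof
      fix x assume "x \<in> ker A1"
      then have "y \<bullet> x = 0" using y by (auto simp: T_def orthogonal_def inner_commute)
      then show "x \<in> ker (outer y)" by (simp add: ker_form[OF outer_psd] quadratic_form_outer)
    qed
    then obtain \<epsilon> where e: "\<epsilon> > 0" "A1 + \<epsilon> *\<^sub>R (A1 - outer y) \<in> psd4"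
      using psd_perturb[OF A1p(1) outer_psd] by blast
    have "B \<bullet> A1 = 0" using B(2)[OF A1p(2)] f1 by simp
    moreover have "B \<bullet> (A1 + \<epsilon> *\<^sub>R (A1 - outer y)) = B \<bullet> A1 + \<epsilon> * (B \<bullet> A1 - y \<bullet> (B *v y))"
      by (simp only: inner_add_right inner_scaleR_right inner_diff_right inner_outer)
    ultimately have "0 \<le> \<epsilon> * (- (y \<bullet> (B *v y)))" using B(3)[OF e(2)] by simp
    then have "y \<bullet> (B *v y) \<le> 0" using e(1) by (simp add: mult_le_0_iff)
    moreover have "0 \<le> y \<bullet> (B *v y)" using B(1) by (simp add: psd4_def)
    ultimately show "y \<in> ker B" using ker_form[OF B(1)] by simp
  qed
  then have "dim T \<le> dim (ker B)" by (rule dim_subset)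
  then have "dim (ker B) \<ge> 3" using dT by simp
  then obtain b where "\<And>x y. x \<bullet> (B *v y) = (b \<bullet> x) * (b \<bullet> y)" using rank_one[OF B(1)] by blast
  then have "B = outer b" by (rule rank_one_outer)
  then show ?thesis using B(2) by (auto simp: f_def)
qed

lemma ex_psd_factorization: "\<exists>a b. psd_factorization P a b"
proof -
  have "\<forall>v\<in>vertices P. \<exists>a. outer a \<in> L \<and> \<pi> (outer a) = v" using vertex_rank_one by blast
  from bchoice[OF this] obtain a where a: "\<And>v. v \<in> vertices P \<Longrightarrow> outer (a v) \<in> L \<and> \<pi> (outer (a v)) = v" by blast
  define R where "R = (\<lambda>F c d b. P \<subseteq> {x. c \<bullet> x \<le> d} \<and> F = P \<inter> {x. c \<bullet> x = d} \<and>
     (\<forall>A\<in>L. d - c \<bullet> \<pi> A = outer b \<bullet> A))"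
  have "\<exists>t. R F (fst t) (fst (snd t)) (snd (snd t))" if F: "F facet_of P" for F
  proof -
    obtain c d where cd: "P \<subseteq> {x. c \<bullet> x \<le> d}" "F = P \<inter> {x. c \<bullet> x = d}"
      using facet_functional[OF poly F] by metis
    obtain b where "\<forall>A\<in>L. d - c \<bullet> \<pi> A = outer b \<bullet> A" using facet_rank_one[OF F cd] by blast
    then have "R F c d b" using cd unfolding R_def by blast
    then show ?thesis by (intro exI[of _ "(c, d, b)"]) simp
  qed
  then have "\<forall>F\<in>{F. F facet_of P}. \<exists>t. R F (fst t) (fst (snd t)) (snd (snd t))" by simp
  from bchoice[OF this] obtain t where t: "\<forall>F\<in>{F. F facet_of P}. R F (fst (t F)) (fst (snd (t F))) (snd (snd (t F)))" ..
  define c where "c = (\<lambda>F. fst (t F))" define d where "d = (\<lambda>F. fst (snd (t F)))"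
  define b where "b = (\<lambda>F. snd (snd (t F)))"
  have cdb: "P \<subseteq> {x. c F \<bullet> x \<le> d F}" "F = P \<inter> {x. c F \<bullet> x = d F}"
     "\<And>A. A \<in> L \<Longrightarrow> d F - c F \<bullet> \<pi> A = outer (b F) \<bullet> A" if "F facet_of P" for F
  proof -
    have "R F (c F) (d F) (b F)" using t that by (simp add: c_def d_def b_def)
    then show "P \<subseteq> {x. c F \<bullet> x \<le> d F}" "F = P \<inter> {x. c F \<bullet> x = d F}"
     "\<And>A. A \<in> L \<Longrightarrow> d F - c F \<bullet> \<pi> A = outer (b F) \<bullet> A" unfolding R_def by blast+
  qed
  have "psd_factorization P a b"
    unfolding psd_factorization_def
  proof (intro exI[of _ c] exI[of _ d] allI impI conjI ballI)
    fix F v assume F: "F facet_of P" and v: "v \<in> vertices P"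
    have "d F - c F \<bullet> v = outer (b F) \<bullet> outer (a v)" using cdb(3)[OF F, of "outer (a v)"] a[OF v] by simp
    also have "\<dots> = (a v \<bullet> b F)\<^sup>2"
      by (simp add: inner_outer_outer inner_commute)
    finally show "d F - c F \<bullet> v = (a v \<bullet> b F)\<^sup>2" .
  qed (rule cdb(1,2), assumption)+
  then show ?thesis by blast
qed

end

text \<open>Points are recovered linearly from their slacks, as a bounded polytope has no common zero
  or common direction of its facet functionals.\<close>

lemma recover_from_slacks:
  fixes P :: "'a::euclidean_space set"
  assumes poly: "polytope P" and z: "z \<in> interior P"
    and cd: "\<And>F. F facet_of P \<Longrightarrow> P \<subseteq> {x. c F \<bullet> x \<le> d F} \<and> F = P \<inter> {x. c F \<bullet> x = d F}"
  obtains m :: "'a set \<Rightarrow> 'a" where "\<And>x. x = (\<Sum>F | F facet_of P. (d F - c F \<bullet> x) *\<^sub>R m F)"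
proof -
  have mem: "x \<in> P \<longleftrightarrow> (\<forall>F. F facet_of P \<longrightarrow> c F \<bullet> x \<le> d F)" for x
    by (rule polytope_mem_iff[OF poly z]) (rule cd)
  let ?K = "{F. F facet_of P}"
  have fin: "finite ?K" using poly finite_polytope_facets by blast
  define g where "g = (\<lambda>F. (c F, d F))"
  have inj: "inj_on g ?K"
  proof
    fix F G assume FG: "F \<in> ?K" "G \<in> ?K" "g F = g G"
    have "F = P \<inter> {x. c F \<bullet> x = d F}" "G = P \<inter> {x. c G \<bullet> x = d G}" using cd FG(1,2) by blast+
    moreover have "c F = c G" "d F = d G" using FG(3) by (simp_all add: g_def)
    ultimately show "F = G" by metis
  qed
  obtain r where r: "\<And>x. x \<in> P \<Longrightarrow> norm x \<le> r" using polytope_imp_bounded[OF poly] by (auto simp: bounded_iff)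
  have unb: False if "p \<in> P" "y \<noteq> 0" "\<And>s. s \<ge> 0 \<Longrightarrow> p + s *\<^sub>R y \<in> P" for p y
  proof -
    define s where "s = (\<bar>r\<bar> + norm p + 1) / norm y"
    have s: "s \<ge> 0" "norm (s *\<^sub>R y) = \<bar>r\<bar> + norm p + 1" using that(2) by (auto simp: s_def)
    have "norm (s *\<^sub>R y) \<le> norm (p + s *\<^sub>R y) + norm p" using norm_triangle_ineq4[of "p + s *\<^sub>R y" p] by simp
    then show False using s r[OF that(3)[OF s(1)]] by simp
  qed
  have zP: "z \<in> P" using z interior_subset by blast
  have "span (g ` ?K) = UNIV"
  proof (rule ccontr)
    assume "span (g ` ?K) \<noteq> UNIV"
    then obtain w where w: "w \<noteq> 0" "span (g ` ?K) \<subseteq> {x. w \<bullet> x = 0}" using span_not_UNIV_orthogonal by blast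
    obtain y t where yt: "w = (y, t)" by (cases w)
    have o: "c F \<bullet> y + t * d F = 0" if "F facet_of P" for F
    proof -
      have "g F \<in> span (g ` ?K)" using that by (intro span_base) auto
      then show ?thesis using w(2) by (auto simp: g_def yt inner_commute)
    qed
    show False
    proof (cases "t = 0")
      case True
      then have "y \<noteq> 0" using w(1) unfolding yt by (auto simp: zero_prod_def)
      moreover have "z + s *\<^sub>R y \<in> P" for s
      proof (unfold mem, intro allI impI)
        fix F assume F: "F facet_of P"
        have "c F \<bullet> z \<le> d F" using zP mem F by blast
        then show "c F \<bullet> (z + s *\<^sub>R y) \<le> d F" using o[OF F] True by (simp add: inner_add_right)
      qed
      ultimately show False by (rule unb[OF zP])
    next
      case False
      define p where "p = - y /\<^sub>R t"
      have cp: "c F \<bullet> p = d F" if "F facet_of P" for F using o[OF that] False by (simp add: p_def field_simps)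
      then have pP: "p \<in> P" unfolding mem by simp
      have "p + s *\<^sub>R (z - p) \<in> P" if s: "s \<ge> 0" for s
      proof (unfold mem, intro allI impI)
        fix F assume F: "F facet_of P"
        have "c F \<bullet> z \<le> d F" using zP mem F by blast
        then have "s * (c F \<bullet> z) \<le> s * d F" by (rule mult_left_mono[OF _ s])
        then show "c F \<bullet> (p + s *\<^sub>R (z - p)) \<le> d F" using cp[OF F] by (simp add: inner_add_right inner_diff_right algebra_simps)
      qed
      moreover have "z \<noteq> p"
      proof -
        have zr: "z \<in> rel_interior P" using z interior_subset_rel_interior by blast
        obtain F where F: "F facet_of P"
        proof -
          have "aff_dim P = DIM('a)" using z by (intro aff_dim_nonempty_interior) auto
          then show ?thesis using that polytope_facet_exists[OF poly] by auto
        qed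
        then have "c F \<bullet> z < d F" using facet_interior_slack[OF poly F _ _ zr] cd[OF F] by blast
        then show ?thesis using cp[OF F] by auto
      qed
      then have "z - p \<noteq> 0" by simp
      ultimately show False using unb[OF pP] by blast
    qed
  qed
  \<comment> \<open>Once \<open>(- i, 0)\<close> is a combination of the pairs
    \<open>(c F, d F)\<close>, pairing with \<open>(x, - 1)\<close> expresses
    \<open>i \<bullet> x\<close> by the slacks of \<open>x\<close>.\<close>
  then have "\<forall>i::'a. \<exists>u. (- i, 0) = (\<Sum>F\<in>?K. u F *\<^sub>R g F)"
  proof (intro allI)
    fix i :: 'a
    have "(- i, 0) \<in> span (g ` ?K)" unfolding \<open>span (g ` ?K) = UNIV\<close> by simp
    then obtain u where "(- i, 0) = (\<Sum>v\<in>g ` ?K. u v *\<^sub>R v)" using fin by (auto simp: span_finite)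
    also have "\<dots> = (\<Sum>F\<in>?K. u (g F) *\<^sub>R g F)" using inj by (simp add: sum.reindex)
    finally show "\<exists>u. (- i, 0) = (\<Sum>F\<in>?K. u F *\<^sub>R g F)" by (intro exI[of _ "\<lambda>F. u (g F)"])
  qed
  from choice[OF this] obtain u where u: "\<And>i::'a. (- i, 0) = (\<Sum>F\<in>?K. u i F *\<^sub>R g F)" by blast
  have ex: "i \<bullet> x = (\<Sum>F\<in>?K. u i F * (d F - c F \<bullet> x))" for i x
  proof -
    have "(- i, 0) \<bullet> (x, - 1 :: real) = (\<Sum>F\<in>?K. u i F *\<^sub>R g F) \<bullet> (x, - 1 :: real)" by (simp only: u[of i, symmetric])
    then have "- (i \<bullet> x) = (\<Sum>F\<in>?K. u i F * (c F \<bullet> x - d F))"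
      by (simp add: g_def inner_sum_left right_diff_distrib)
    also have "\<dots> = - (\<Sum>F\<in>?K. u i F * (d F - c F \<bullet> x))"
      by (simp add: sum_negf[symmetric] right_diff_distrib)
    finally show ?thesis by simp
  qed
  show ?thesis
  proof (rule that[of "\<lambda>F. \<Sum>i\<in>Basis. u i F *\<^sub>R i"])
    fix x :: 'a
    have "x = (\<Sum>i\<in>Basis. (i \<bullet> x) *\<^sub>R i)" by (simp only: inner_commute[of _ x] euclidean_representation)
    also have "\<dots> = (\<Sum>i\<in>Basis. \<Sum>F\<in>?K. (d F - c F \<bullet> x) *\<^sub>R (u i F *\<^sub>R i))"
    proof (intro sum.cong refl)
      fix i :: 'a
      have "(i \<bullet> x) *\<^sub>R i = (\<Sum>F\<in>?K. u i F * (d F - c F \<bullet> x)) *\<^sub>R i" by (simp only: ex[of i x, symmetric])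
      also have "\<dots> = (\<Sum>F\<in>?K. (d F - c F \<bullet> x) *\<^sub>R (u i F *\<^sub>R i))" by (simp add: scaleR_sum_left mult.commute)
      finally show "(i \<bullet> x) *\<^sub>R i = (\<Sum>F\<in>?K. (d F - c F \<bullet> x) *\<^sub>R (u i F *\<^sub>R i))" .
    qed
    also have "\<dots> = (\<Sum>F\<in>?K. \<Sum>i\<in>Basis. (d F - c F \<bullet> x) *\<^sub>R (u i F *\<^sub>R i))" by (rule sum.swap)
    also have "\<dots> = (\<Sum>F\<in>?K. (d F - c F \<bullet> x) *\<^sub>R (\<Sum>i\<in>Basis. u i F *\<^sub>R i))"
      by (simp only: scaleR_sum_right)
    finally show "x = (\<Sum>F | F facet_of P. (d F - c F \<bullet> x) *\<^sub>R (\<Sum>i\<in>Basis. u i F *\<^sub>R i))" .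
  qed
qed

text \<open>The lift is the affine hull of the matrices \<open>outer (a v)\<close>. On it the
  quadratic form at \<open>b F\<close> is the slack at \<open>F\<close>, so \<open>\<pi>\<close>
  reads off slacks and recovers the point from them. A psd matrix has nonnegative forms, hence its
  image satisfies all facet inequalities.\<close>

lemma psd_factorization_imp_lift:
  fixes P :: "'a::euclidean_space set"
  assumes poly: "polytope P" and z: "z \<in> interior P" and fac: "psd_factorization P a b"
  shows "has_psd_lift 4 P"
proof -
  obtain c d where cds: "\<forall>F. F facet_of P \<longrightarrow> P \<subseteq> {x. c F \<bullet> x \<le> d F} \<and> F = P \<inter> {x. c F \<bullet> x = d F} \<and>
     (\<forall>v\<in>vertices P. d F - c F \<bullet> v = (a v \<bullet> b F)\<^sup>2)"
    using fac unfolding psd_factorization_def by (elim exE)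
  have cd: "P \<subseteq> {x. c F \<bullet> x \<le> d F} \<and> F = P \<inter> {x. c F \<bullet> x = d F}"
    and sl: "v \<in> vertices P \<Longrightarrow> d F - c F \<bullet> v = (a v \<bullet> b F)\<^sup>2" if "F facet_of P" for F v
    using cds[rule_format, OF that] by blast+
  have mem: "x \<in> P \<longleftrightarrow> (\<forall>F. F facet_of P \<longrightarrow> c F \<bullet> x \<le> d F)" for x
    by (rule polytope_mem_iff[OF poly z]) (rule cd)
  obtain m where m: "\<And>x. x = (\<Sum>F | F facet_of P. (d F - c F \<bullet> x) *\<^sub>R m F)"
    using recover_from_slacks[OF poly z cd] by blast
  define V where "V = vertices P"
  have fV: "finite V" using poly by (simp add: V_def finite_vertices)
  define S where "S = (\<lambda>u. \<Sum>v\<in>V. u v *\<^sub>R outer (a v))"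
  define L where "L = {S u | u. sum u V = 1}"
  define \<pi> where "\<pi> = (\<lambda>A. \<Sum>F | F facet_of P. (b F \<bullet> (A *v b F)) *\<^sub>R m F)"
  have sym: "transpose (S u) = S u" for u
    by (simp add: S_def transpose_def Finite_Cartesian_Product.vec_eq_iff outer_def mult.commute)
  have Slin: "s *\<^sub>R S u + t *\<^sub>R S w = S (\<lambda>v. s * u v + t * w v)" for s t u w
    by (simp add: S_def scaleR_sum_right scaleR_add_left sum.distrib)
  have aff: "affine L"
    unfolding affine_def
  proof (intro ballI allI impI)
    fix X Y s t assume "X \<in> L" "Y \<in> L" and st: "s + t = (1::real)"
    then obtain u w where uw: "X = S u" "Y = S w" "sum u V = 1" "sum w V = 1" by (auto simp: L_def)
    have "sum (\<lambda>v. s * u v + t * w v) V = s * sum u V + t * sum w V" by (simp add: sum.distrib sum_distrib_left)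
    then show "s *\<^sub>R X + t *\<^sub>R Y \<in> L" unfolding uw Slin L_def using uw st by auto
  qed
  have lin: "linear \<pi>"
  proof
    fix A B :: "real^4^4" and r :: real
    show "\<pi> (A + B) = \<pi> A + \<pi> B"
      by (simp add: \<pi>_def matrix_vector_mult_add_rdistrib inner_add_right scaleR_add_left sum.distrib)
    show "\<pi> (r *\<^sub>R A) = r *\<^sub>R \<pi> A"
      by (simp add: \<pi>_def scaleR_matrix_vector_assoc[symmetric] scaleR_sum_right)
  qed
  have bS: "b F \<bullet> (S u *v b F) = d F * sum u V - c F \<bullet> (\<Sum>v\<in>V. u v *\<^sub>R v)" if F: "F facet_of P" for F u
  proof -
    have "b F \<bullet> (S u *v b F) = S u \<bullet> outer (b F)" by (simp add: inner_outer)
    also have "\<dots> = (\<Sum>v\<in>V. u v * (outer (a v) \<bullet> outer (b F)))" by (simp add: S_def inner_sum_left)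
    also have "\<dots> = (\<Sum>v\<in>V. u v * (d F - c F \<bullet> v))"
      by (intro sum.cong refl)
        (simp add: sl[OF F] V_def inner_outer_outer)
    also have "\<dots> = d F * sum u V - c F \<bullet> (\<Sum>v\<in>V. u v *\<^sub>R v)"
      by (simp add: inner_sum_right sum_distrib_left sum_subtractf algebra_simps)
    finally show ?thesis .
  qed
  have pS: "\<pi> (S u) = (\<Sum>v\<in>V. u v *\<^sub>R v)" if "sum u V = 1" for u
  proof -
    have "\<pi> (S u) = (\<Sum>F | F facet_of P. (d F - c F \<bullet> (\<Sum>v\<in>V. u v *\<^sub>R v)) *\<^sub>R m F)"
      unfolding \<pi>_def by (intro sum.cong refl) (simp add: bS that)
    also have "\<dots> = (\<Sum>v\<in>V. u v *\<^sub>R v)" by (rule m[symmetric])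
    finally show ?thesis .
  qed
  have "P = \<pi> ` (L \<inter> psd4)"
  proof
    show "P \<subseteq> \<pi> ` (L \<inter> psd4)"
    proof
      fix x assume "x \<in> P"
      then have "x \<in> convex hull V" using convex_hull_vertices[OF poly] by (simp add: V_def)
      then obtain u where u: "\<forall>v\<in>V. 0 \<le> u v" "sum u V = 1" "(\<Sum>v\<in>V. u v *\<^sub>R v) = x"
        unfolding convex_hull_finite[OF fV] by blast
      have "0 \<le> x \<bullet> (S u *v x)" for x
      proof -
        have "x \<bullet> (S u *v x) = (\<Sum>v\<in>V. u v * (a v \<bullet> x)\<^sup>2)"
          unfolding inner_outer[symmetric] S_def inner_sum_left by (simp add: inner_outer_outer)
        also have "\<dots> \<ge> 0" using u(1) by (intro sum_nonneg) auto
        finally show ?thesis .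
      qed
      then have "S u \<in> psd4" using sym by (simp add: psd4_def)
      moreover have "S u \<in> L" using u(2) by (auto simp: L_def)
      moreover have "\<pi> (S u) = x" using pS[OF u(2)] u(3) by simp
      ultimately show "x \<in> \<pi> ` (L \<inter> psd4)" by blast
    qed
    show "\<pi> ` (L \<inter> psd4) \<subseteq> P"
    proof clarify
      fix A assume "A \<in> L" and p: "A \<in> psd4"
      then obtain u where u: "A = S u" "sum u V = 1" by (auto simp: L_def)
      show "\<pi> A \<in> P" unfolding mem
      proof (intro allI impI)
        fix F assume F: "F facet_of P"
        have "0 \<le> b F \<bullet> (A *v b F)" using p by (simp add: psd4_def)
        then show "c F \<bullet> \<pi> A \<le> d F" unfolding u(1) bS[OF F] pS[OF u(2)] using u(2) by simp
      qed
    qed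
  qed
  then show ?thesis using has_psd_lift_4I[of L \<pi>] aff sym lin by (auto simp: L_def)
qed

theorem psd_rank_four_iff:
  fixes P :: "'a::euclidean_space set"
  assumes poly: "polytope P" and dim: "aff_dim P = 3" "DIM('a) = 3"
  shows "psd_rank P = 4 \<longleftrightarrow> (\<exists>a b. psd_factorization P a b)"
proof -
  have lift: "lifted_polytope3 P L \<pi>" if "affine L" "\<And>A. A \<in> L \<Longrightarrow> transpose A = A" "linear \<pi>" "P = \<pi> ` (L \<inter> psd4)"
    for L and \<pi> :: "real^4^4 \<Rightarrow> 'a"
    by (intro lifted_polytope3.intro lifted_polytope3_axioms.intro polytope3.intro) (fact poly dim that)+
  have ge: "4 \<le> k" if k: "has_psd_lift k P" for k
  proof (rule ccontr)
    assume "\<not> 4 \<le> k"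
    then have k4: "k < 4" "k \<le> 4" by simp_all
    obtain L and \<pi> :: "real^4^4 \<Rightarrow> 'a" where lf: "affine L \<and> (\<forall>A\<in>L. transpose A = A) \<and> linear \<pi> \<and>
      P = \<pi> ` (L \<inter> psd4) \<and> (k < 4 \<longrightarrow> (\<exists>e. e \<noteq> 0 \<and> (\<forall>A\<in>L. A *v e = 0)))"
      using has_psd_lift_cart[OF k k4(2)] by (elim exE)
    interpret lifted_polytope3 P L \<pi> by (rule lift) (use lf in blast)+
    obtain e where e: "e \<noteq> 0" "\<forall>A\<in>L. A *v e = 0" using lf k4 by blast
    then have "e \<in> null P" unfolding null_def over_def by blast
    then show False using null_P_trivial e by auto
  qed
  obtain z where z: "z \<in> interior P"
  proof -
    have "affine hull P = UNIV" using dim aff_dim_eq_full[of P] by simp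
    then have "rel_interior P = interior P" by (rule rel_interior_interior)
    moreover have "P \<noteq> {}" using dim by auto
    then have "rel_interior P \<noteq> {}" using rel_interior_eq_empty[OF polytope_imp_convex[OF poly]] by simp
    ultimately show ?thesis using that by blast
  qed
  show ?thesis
  proof
    assume r: "psd_rank P = 4"
    have "0 < psd_rank P \<and> has_psd_lift (psd_rank P) P"
      unfolding psd_rank_def by (rule LeastI_ex) (use polytope_has_psd_lift[OF poly] in blast)
    then have l4: "has_psd_lift 4 P" using r by simp
    obtain L and \<pi> :: "real^4^4 \<Rightarrow> 'a" where lf: "affine L \<and> (\<forall>A\<in>L. transpose A = A) \<and> linear \<pi> \<and>
      P = \<pi> ` (L \<inter> psd4) \<and> ((4::nat) < 4 \<longrightarrow> (\<exists>e. e \<noteq> 0 \<and> (\<forall>A\<in>L. A *v e = 0)))"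
      using has_psd_lift_cart[OF l4 order_refl] by (elim exE)
    interpret lifted_polytope3 P L \<pi> by (rule lift) (use lf in blast)+
    show "\<exists>a b. psd_factorization P a b" by (rule ex_psd_factorization)
  next
    assume "\<exists>a b. psd_factorization P a b"
    then have "has_psd_lift 4 P" using psd_factorization_imp_lift[OF poly z] by blast
    then show "psd_rank P = 4" unfolding psd_rank_def by (intro Least_equality) (use ge in auto)
  qed
qed

section \<open>Incidences and factorizations of three-dimensional polytopes\<close>

lemma vertices_translation: "vertices ((+) t ` P) = (+) t ` vertices P"
  unfolding vertices_def by (rule extreme_points_of_translation)

lemma facet_of_translation_iff: "(+) t ` F facet_of (+) t ` P \<longleftrightarrow> F facet_of P"
  by (simp add: facet_of_def aff_dim_translation_eq)

lemma facet_of_translationE: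
  assumes "G facet_of (+) t ` P"
  obtains F where "F facet_of P" "G = (+) t ` F"
proof -
  have "G \<in> {G. G face_of (+) t ` P}" using assms facet_of_imp_face_of by blast
  then obtain F where "G = (+) t ` F" unfolding faces_of_translation by blast
  then show ?thesis using that assms by (simp add: facet_of_translation_iff)
qed

lemma psd_factorization_translation:
  assumes "psd_factorization P a b"
  shows "psd_factorization ((+) t ` P) (\<lambda>x. a (x - t)) (\<lambda>G. b ((+) (- t) ` G))"
proof -
  obtain c d where cd: "\<forall>F. F facet_of P \<longrightarrow> P \<subseteq> {x. c F \<bullet> x \<le> d F} \<and> F = P \<inter> {x. c F \<bullet> x = d F} \<and>
     (\<forall>v\<in>vertices P. d F - c F \<bullet> v = (a v \<bullet> b F)\<^sup>2)"
    using assms unfolding psd_factorization_def by (elim exE)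
  define c' where "c' = (\<lambda>G. c ((+) (- t) ` G))"
  define d' where "d' = (\<lambda>G. d ((+) (- t) ` G) + c' G \<bullet> t)"
  show ?thesis
    unfolding psd_factorization_def
  proof (intro exI[of _ c'] exI[of _ d'] allI impI)
    fix G assume "G facet_of (+) t ` P"
    then obtain F where F: "F facet_of P" "G = (+) t ` F" by (rule facet_of_translationE)
    have bk: "(+) (- t) ` G = F" unfolding F(2) by (simp add: image_image)
    have cG: "c' G = c F" "d' G = d F + c F \<bullet> t" unfolding c'_def d'_def bk by simp_all
    have f: "P \<subseteq> {x. c F \<bullet> x \<le> d F}" "F = P \<inter> {x. c F \<bullet> x = d F}"
      "\<And>v. v \<in> vertices P \<Longrightarrow> d F - c F \<bullet> v = (a v \<bullet> b F)\<^sup>2" using cd[rule_format, OF F(1)] by blast+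
    have "(+) t ` P \<subseteq> {x. c' G \<bullet> x \<le> d' G}" using f(1) by (auto simp: cG inner_add_right)
    moreover have "G = (+) t ` P \<inter> {x. c' G \<bullet> x = d' G}"
    proof -
      have "G = (+) t ` (P \<inter> {x. c F \<bullet> x = d F})" using F(2) f(2) by metis
      also have "\<dots> = (+) t ` P \<inter> {x. c' G \<bullet> x = d' G}" unfolding cG by (auto simp: inner_add_right)
      finally show ?thesis .
    qed
    moreover have "d' G - c' G \<bullet> w = (a (w - t) \<bullet> b ((+) (- t) ` G))\<^sup>2" if w: "w \<in> vertices ((+) t ` P)" for w
    proof -
      obtain v where v: "v \<in> vertices P" "w = t + v" using w by (auto simp: vertices_translation)
      show ?thesis unfolding cG bk v(2) using f(3)[OF v(1)] by (simp add: inner_add_right)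
    qed
    ultimately show "(+) t ` P \<subseteq> {x. c' G \<bullet> x \<le> d' G} \<and> G = (+) t ` P \<inter> {x. c' G \<bullet> x = d' G} \<and>
      (\<forall>v\<in>vertices ((+) t ` P). d' G - c' G \<bullet> v = (a (v - t) \<bullet> b ((+) (- t) ` G))\<^sup>2)" by blast
  qed
qed

context origin_polytope
begin

text \<open>The facets through \<open>v\<close> become the vertices of the polygon dual to
  \<open>v\<close>, where \<open>facet_vertices_connected\<close> applies.\<close>

lemma star_connected:
  assumes dim: "DIM('a) = 3" and v: "v \<in> vertices P"
    and M: "M \<subseteq> {F. F facet_of P \<and> v \<in> F}" "M \<noteq> {}"
    and clos: "\<And>F G w. \<lbrakk>F \<in> M; G facet_of P; v \<in> G; w \<in> vertices P; w \<noteq> v; w \<in> F; w \<in> G\<rbrakk> \<Longrightarrow> G \<in> M"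
  shows "M = {F. F facet_of P \<and> v \<in> F}"
proof -
  interpret R: origin_polytope "polar P" by (rule origin_polytope_polar)
  interpret R3: polytope3 "polar P"
    by unfold_locales (use polytope_polar R.aff_dim_full dim in auto)
  have MF: "F facet_of P" "v \<in> F" if "F \<in> M" for F using M(1) that by auto
  have eq: "normal ` M = vertices (polar P) \<inter> dual_facet v"
  proof (rule R3.facet_vertices_connected[OF dual_facet_facet[OF v]])
    show "normal ` M \<subseteq> vertices (polar P) \<inter> dual_facet v"
    proof
      fix y assume "y \<in> normal ` M"
      then obtain F where F: "F \<in> M" "y = normal F" by blast
      show "y \<in> vertices (polar P) \<inter> dual_facet v"
        unfolding F(2) vertices_polar using MF[OF F(1)] normal_mem_dual_facet[OF _ v] by simp
    qed
    show "normal ` M \<noteq> {}" using M(2) by simp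
  next
    fix y y' H assume y: "y \<in> normal ` M" and y': "y' \<in> vertices (polar P)" "y' \<in> dual_facet v"
      and H: "H facet_of polar P" "H \<noteq> dual_facet v" "y \<in> H" "y' \<in> H"
    obtain F where F: "F \<in> M" "y = normal F" using y by blast
    obtain G where G: "G facet_of P" "y' = normal G" using y'(1) unfolding vertices_polar by blast
    obtain w where w: "w \<in> vertices P" "H = dual_facet w" by (rule facet_polar_is_dual_facet[OF H(1)])
    have "w \<noteq> v" using H(2) w(2) by blast
    moreover have "w \<in> F" using normal_mem_dual_facet[OF MF(1)[OF F(1)] w(1)] H(3) F(2) w(2) by simp
    moreover have "w \<in> G" using normal_mem_dual_facet[OF G(1) w(1)] H(4) G(2) w(2) by simp
    moreover have "v \<in> G" using normal_mem_dual_facet[OF G(1) v] y'(2) G(2) by simp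
    ultimately have "G \<in> M" using clos[OF F(1) G(1) _ w(1)] by blast
    then show "y' \<in> normal ` M" unfolding G(2) by (rule imageI)
  qed
  show ?thesis
  proof
    show "{F. F facet_of P \<and> v \<in> F} \<subseteq> M"
    proof
      fix G assume "G \<in> {F. F facet_of P \<and> v \<in> F}"
      then have G: "G facet_of P" "v \<in> G" by auto
      then have "normal G \<in> normal ` M"
        unfolding eq vertices_polar using normal_mem_dual_facet[OF G(1) v] by simp
      then obtain F where F: "F \<in> M" "normal G = normal F" by blast
      have "G = F" using inj_onD[OF inj_normal F(2)] G MF[OF F(1)] by simp
      then show "G \<in> M" using F by simp
    qed
  qed (rule M(1))
qed

end

lemma ex_origin_translate:
  fixes P :: "'a::euclidean_space set"
  assumes poly: "polytope P" and dim: "aff_dim P = DIM('a)"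
  obtains t where "origin_polytope ((+) t ` P)" 
proof -
  have "affine hull P = UNIV" using dim aff_dim_eq_full[of P] by simp
  then have "rel_interior P = interior P" by (rule rel_interior_interior)
  moreover have "P \<noteq> {}" using dim by auto
  then have "rel_interior P \<noteq> {}" using rel_interior_eq_empty[OF polytope_imp_convex[OF poly]] by simp
  ultimately obtain z where z: "z \<in> interior P" by blast
  have "interior ((+) (- z) ` P) = (+) (- z) ` interior P" by (rule interior_translation)
  then have "0 \<in> interior ((+) (- z) ` P)" using z by force
  moreover have "polytope ((+) (- z) ` P)" using poly by (subst polytope_translation_eq)
  ultimately have "origin_polytope ((+) (- z) ` P)" unfolding origin_polytope_def by (intro conjI)
  then show ?thesis by (rule that)
qed

context polytope3
begin

lemma star_connected:
  assumes dim: "DIM('a) = 3" and v: "v \<in> vertices P"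
    and M: "M \<subseteq> {F. F facet_of P \<and> v \<in> F}" "M \<noteq> {}"
    and clos: "\<And>F G w. \<lbrakk>F \<in> M; G facet_of P; v \<in> G; w \<in> vertices P; w \<noteq> v; w \<in> F; w \<in> G\<rbrakk> \<Longrightarrow> G \<in> M"
  shows "M = {F. F facet_of P \<and> v \<in> F}"
proof -
  obtain t where "origin_polytope ((+) t ` P)" using ex_origin_translate[OF poly] dim3 dim by auto
  then interpret T: origin_polytope "(+) t ` P" .
  have mem: "t + x \<in> (+) t ` F \<longleftrightarrow> x \<in> F" for x F by auto
  have eq: "(`) ((+) t) ` M = {F. F facet_of (+) t ` P \<and> t + v \<in> F}"
  proof (rule T.star_connected[OF dim])
    show "t + v \<in> vertices ((+) t ` P)" using v by (simp add: vertices_translation)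
    show "(`) ((+) t) ` M \<subseteq> {F. F facet_of (+) t ` P \<and> t + v \<in> F}"
      using M(1) by (auto simp: facet_of_translation_iff)
    show "(`) ((+) t) ` M \<noteq> {}" using M(2) by simp
    fix F' G' w' assume F': "F' \<in> (`) ((+) t) ` M" and G': "G' facet_of (+) t ` P" "t + v \<in> G'"
      and w': "w' \<in> vertices ((+) t ` P)" "w' \<noteq> t + v" "w' \<in> F'" "w' \<in> G'"
    obtain F where F: "F \<in> M" "F' = (+) t ` F" using F' by blast
    obtain G where G: "G facet_of P" "G' = (+) t ` G" by (rule facet_of_translationE[OF G'(1)])
    obtain w where w: "w \<in> vertices P" "w' = t + w" using w'(1) by (auto simp: vertices_translation)
    have "G \<in> M" using clos[OF F(1) G(1) _ w(1)] w' G'(2) unfolding F(2) G(2) w(2) mem by blast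
    then show "G' \<in> (`) ((+) t) ` M" unfolding G(2) by (rule imageI)
  qed
  show ?thesis
  proof
    show "{F. F facet_of P \<and> v \<in> F} \<subseteq> M"
    proof
      fix G assume "G \<in> {F. F facet_of P \<and> v \<in> F}"
      then have "(+) t ` G \<in> (`) ((+) t) ` M" unfolding eq by (simp add: facet_of_translation_iff)
      then obtain F where "F \<in> M" "(+) t ` G = (+) t ` F" by blast
      then show "G \<in> M" by (simp add: inj_image_eq_iff)
    qed
  qed (rule M(1))
qed

lemma incidence:
  assumes dim: "DIM('a) = 3"
  shows "incidence (vertices P) {F. F facet_of P} (\<in>)"
proof
  show "finite (vertices P)" "finite {F. F facet_of P}"
    using poly by (simp_all add: finite_vertices finite_polytope_facets)
next
  fix F assume "F \<in> {F. F facet_of P}" then show "\<exists>v\<in>vertices P. v \<in> F" using facet_has_vertex by blast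
next
  fix v assume "v \<in> vertices P" then show "\<exists>F\<in>{F. F facet_of P}. v \<in> F" using vertex_in_facet by blast
next
  fix F G u v w assume "F \<in> {F. F facet_of P}" "G \<in> {F. F facet_of P}" "F \<noteq> G"
    "u \<in> vertices P" "v \<in> vertices P" "w \<in> vertices P" "u \<noteq> v" "u \<in> F" "u \<in> G" "v \<in> F" "v \<in> G" "w \<in> F" "w \<in> G"
  then have "w \<in> vertices P \<inter> F \<inter> G" "vertices P \<inter> F \<inter> G = {u, v}"
    using facets_meet(2)[of F G u v] by blast+
  then show "w = u \<or> w = v" by blast
next
  fix u v F G H assume "u \<in> vertices P" "v \<in> vertices P" "u \<noteq> v" "F \<in> {F. F facet_of P}" "G \<in> {F. F facet_of P}"
    "H \<in> {F. F facet_of P}" "F \<noteq> G" "u \<in> F" "v \<in> F" "u \<in> G" "v \<in> G" "u \<in> H" "v \<in> H"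
  then show "H = F \<or> H = G" using at_most_two_facets_common[of F G H u v] by blast
next
  fix v F assume "v \<in> vertices P" "F \<in> {F. F facet_of P}" "v \<in> F"
  then show "\<exists>w1 w2. w1 \<noteq> w2 \<and> {w \<in> vertices P. w \<noteq> v \<and> w \<in> F \<and> (\<exists>G\<in>{F. F facet_of P}. G \<noteq> F \<and> v \<in> G \<and> w \<in> G)} = {w1, w2}"
    using two_neighbours_in_facet[of F v] by simp
next
  fix F W assume F: "F \<in> {F. F facet_of P}" "W \<subseteq> {v \<in> vertices P. v \<in> F}" "W \<noteq> {}"
    and c: "\<And>w w' G. \<lbrakk>w \<in> W; w' \<in> vertices P; w' \<in> F; G \<in> {F. F facet_of P}; G \<noteq> F; w \<in> G; w' \<in> G\<rbrakk> \<Longrightarrow> w' \<in> W"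
  have "W = vertices P \<inter> F"
  proof (rule facet_vertices_connected)
    fix w w' G assume "w \<in> W" "w' \<in> vertices P" "w' \<in> F" "G facet_of P" "G \<noteq> F" "w \<in> G" "w' \<in> G"
    then show "w' \<in> W" using c[of w w' G] by simp
  qed (use F in auto)
  then show "W = {v \<in> vertices P. v \<in> F}" by auto
next
  fix v M assume v: "v \<in> vertices P" "M \<subseteq> {F \<in> {F. F facet_of P}. v \<in> F}" "M \<noteq> {}"
    and c: "\<And>F G w. \<lbrakk>F \<in> M; G \<in> {F. F facet_of P}; v \<in> G; w \<in> vertices P; w \<noteq> v; w \<in> F; w \<in> G\<rbrakk> \<Longrightarrow> G \<in> M"
  have "M = {F. F facet_of P \<and> v \<in> F}"
  proof (rule star_connected[OF dim v(1)])
    fix F G w assume "F \<in> M" "G facet_of P" "v \<in> G" "w \<in> vertices P" "w \<noteq> v" "w \<in> F" "w \<in> G"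
    then show "G \<in> M" using c[of F G w] by simp
  qed (use v in auto)
  then show "M = {F \<in> {F. F facet_of P}. v \<in> F}" by simp
qed

lemma psd_incidence:
  assumes dim: "DIM('a) = 3" and fac: "psd_factorization P a b"
  shows "\<exists>c d. (\<forall>F. F facet_of P \<longrightarrow> P \<subseteq> {x. c F \<bullet> x \<le> d F} \<and> F = P \<inter> {x. c F \<bullet> x = d F}) \<and>
    connected_psd_incidence (vertices P) {F. F facet_of P} (\<in>) (\<lambda>v. (v, 1 :: real)) (\<lambda>F. (- c F, d F)) a b"
proof -
  obtain c d where cds: "\<forall>F. F facet_of P \<longrightarrow> P \<subseteq> {x. c F \<bullet> x \<le> d F} \<and> F = P \<inter> {x. c F \<bullet> x = d F} \<and>
     (\<forall>v\<in>vertices P. d F - c F \<bullet> v = (a v \<bullet> b F)\<^sup>2)"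
    using fac unfolding psd_factorization_def by (elim exE)
  have cd: "P \<subseteq> {x. c F \<bullet> x \<le> d F}" "F = P \<inter> {x. c F \<bullet> x = d F}"
    and sl: "v \<in> vertices P \<Longrightarrow> d F - c F \<bullet> v = (a v \<bullet> b F)\<^sup>2" if "F facet_of P" for F v
    using cds[rule_format, OF that] by blast+
  interpret incidence "vertices P" "{F. F facet_of P}" "(\<in>)" by (rule incidence[OF dim])
  have mem: "v \<in> F \<longleftrightarrow> a v \<bullet> b F = 0" if "F facet_of P" "v \<in> vertices P" for v F
  proof -
    have "v \<in> P" using that(2) vertices_subset by blast
    then have "v \<in> F \<longleftrightarrow> c F \<bullet> v = d F" using cd(2)[OF that(1)] by blast
    also have "\<dots> \<longleftrightarrow> (a v \<bullet> b F)\<^sup>2 = 0" using sl[OF that] by linarith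
    finally show ?thesis by simp
  qed
  have "connected_psd_incidence (vertices P) {F. F facet_of P} (\<in>) (\<lambda>v. (v, 1 :: real)) (\<lambda>F. (- c F, d F)) a b"
  proof unfold_locales
    show "DIM('a \<times> real) = 4" "DIM(real^4) = 4" using dim by simp_all
    show "(v, 1) \<bullet> (- c F, d F) = (a v \<bullet> b F)\<^sup>2" if "v \<in> vertices P" "F \<in> {F. F facet_of P}" for v F
      using sl[of F v] that by (simp add: inner_commute)
    show "v \<in> F \<longleftrightarrow> a v \<bullet> b F = 0" if "v \<in> vertices P" "F \<in> {F. F facet_of P}" for v F
      using mem[of F v] that by simp
    show "\<exists>v\<in>vertices P. v \<notin> F" if "F \<in> {F. F facet_of P}" for F
      using facet_misses_vertex that by simp
    show "\<exists>F\<in>{F. F facet_of P}. v \<notin> F" if "v \<in> vertices P" for v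
      using vertex_misses_facet[OF that] by blast
    fix W assume W: "W \<subseteq> vertices P" "W \<noteq> {}"
      and c: "\<And>w w' F G. \<lbrakk>w \<in> W; w' \<in> vertices P; F \<in> {F. F facet_of P}; G \<in> {F. F facet_of P}; F \<noteq> G; w \<in> F; w \<in> G; w' \<in> F; w' \<in> G\<rbrakk> \<Longrightarrow> w' \<in> W"
    show "W = vertices P"
    proof (rule vertices_connected[OF W])
      fix w w' F G assume "w \<in> W" "w' \<in> vertices P" "F facet_of P" "G facet_of P" "F \<noteq> G" "w \<in> F" "w \<in> G" "w' \<in> F" "w' \<in> G"
      then show "w' \<in> W" using c[of w w' F G] by simp
    qed
  qed
  then show ?thesis using cds by blast
qed

end

text \<open>The normals of the polar facets are the vertices, so a factorization transposes.\<close>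

lemma (in origin_polytope) psd_factorization_polar:
  assumes "psd_factorization P a b"
  shows "\<exists>a' b'. psd_factorization (polar P) a' b'"
proof -
  interpret R: origin_polytope "polar P" by (rule origin_polytope_polar)
  obtain c d where cds: "\<forall>F. F facet_of P \<longrightarrow> P \<subseteq> {x. c F \<bullet> x \<le> d F} \<and> F = P \<inter> {x. c F \<bullet> x = d F} \<and>
     (\<forall>v\<in>vertices P. d F - c F \<bullet> v = (a v \<bullet> b F)\<^sup>2)"
    using assms unfolding psd_factorization_def by (elim exE)
  define iF where "iF = inv_into {F. F facet_of P} normal"
  define iv where "iv = inv_into (vertices P) dual_facet"
  have iF: "iF (normal F) = F" if "F facet_of P" for F
    unfolding iF_def using inj_normal that by (intro inv_into_f_f) auto
  have iv: "iv (dual_facet v) = v" if "v \<in> vertices P" for v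
    unfolding iv_def using inj_dual_facet that by (intro inv_into_f_f)
  have z: "0 \<in> rel_interior P" using zero_int interior_subset_rel_interior by blast
  have sl: "1 - normal F \<bullet> v = (b F \<bullet> a v)\<^sup>2 / d F" "d F > 0" if F: "F facet_of P" and v: "v \<in> vertices P" for F v
  proof -
    have f: "P \<subseteq> {x. c F \<bullet> x \<le> d F}" "F = P \<inter> {x. c F \<bullet> x = d F}" "d F - c F \<bullet> v = (a v \<bullet> b F)\<^sup>2"
      using cds[rule_format, OF F] v by blast+
    show d: "d F > 0" using facet_interior_slack[OF poly F f(1,2) z] by simp
    have "normal F = c F /\<^sub>R d F"
    proof (rule normal_eqI[OF F])
      fix x assume "x \<in> F"
      then have "c F \<bullet> x = d F" using f(2) by blast
      then show "(c F /\<^sub>R d F) \<bullet> x = 1" using d by simp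
    qed
    then have "1 - normal F \<bullet> v = (d F - c F \<bullet> v) / d F" using d by (simp add: field_simps)
    then show "1 - normal F \<bullet> v = (b F \<bullet> a v)\<^sup>2 / d F" using f(3) by (simp add: inner_commute)
  qed
  \<comment> \<open>The normal with right-hand side 1 is \<open>c F\<close> divided by
    \<open>d F\<close>; the slacks are divided by \<open>d F\<close> too, and the vectors by its
    root.\<close>
  define a' where "a' = (\<lambda>y. b (iF y) /\<^sub>R sqrt (d (iF y)))"
  define b' where "b' = (\<lambda>G. a (iv G))"
  have "psd_factorization (polar P) a' b'"
    unfolding psd_factorization_def
  proof (intro exI[of _ iv] exI[of _ "\<lambda>_. 1"] allI impI)
    fix G assume "G facet_of polar P"
    then obtain v where v: "v \<in> vertices P" "G = dual_facet v" by (rule facet_polar_is_dual_facet)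
    have ivG: "iv G = v" unfolding v(2) by (rule iv[OF v(1)])
    have vP: "v \<in> P" using v(1) vertices_subset by blast
    have Gv: "G = polar P \<inter> {x. v \<bullet> x = 1}" unfolding v(2) dual_facet_def by simp
    have "polar P \<subseteq> {x. v \<bullet> x \<le> 1}" using vP by (auto simp: mem_polar_iff)
    moreover have "1 - v \<bullet> y = (a' y \<bullet> b' G)\<^sup>2" if y: "y \<in> vertices (polar P)" for y
    proof -
      obtain F where F: "F facet_of P" "y = normal F" using y unfolding vertices_polar by blast
      have "1 - v \<bullet> y = (b F \<bullet> a v)\<^sup>2 / d F" using sl(1)[OF F(1) v(1)] F(2) by (simp add: inner_commute)
      also have "\<dots> = (a' y \<bullet> b' G)\<^sup>2"
        using sl(2)[OF F(1) v(1)] by (simp add: a'_def b'_def F(2) iF[OF F(1)] ivG power_mult_distrib power_inverse[symmetric] field_simps)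
      finally show ?thesis .
    qed
    ultimately show "polar P \<subseteq> {x. iv G \<bullet> x \<le> 1} \<and> G = polar P \<inter> {x. iv G \<bullet> x = 1} \<and>
      (\<forall>y\<in>vertices (polar P). 1 - iv G \<bullet> y = (a' y \<bullet> b' G)\<^sup>2)"
      unfolding ivG using Gv by blast
  qed
  then show ?thesis by blast
qed

section \<open>Octahedra and bisimplices\<close>

text \<open>The complement of a facet is the antipodal facet. So facets can be addressed by the
  three vertices that they miss, which are those with nonzero entries.\<close>

lemma octahedron_sets_complement:
  assumes "distinct [x, x', y, y', z, z']" "\<xi> \<in> {x, x'}" "\<eta> \<in> {y, y'}" "\<zeta> \<in> {z, z'}"
  shows "{x, x', y, y', z, z'} - {\<xi>, \<eta>, \<zeta>} \<in> octahedron_sets x x' y y' z z'"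
proof -
  have "{x, x', y, y', z, z'} - {\<xi>, \<eta>, \<zeta>} =
    {if \<xi> = x then x' else x, if \<eta> = y then y' else y, if \<zeta> = z then z' else z}"
    using assms by auto
  moreover have "\<dots> \<in> octahedron_sets x x' y y' z z'" by (simp add: octahedron_sets_def)
  ultimately show ?thesis by simp
qed

context psd_incidence
begin

text \<open>The dependencies \<open>c\<close> and \<open>d\<close> of the \<open>p\<close>'s and of the \<open>a\<close>'s at \<open>x, x', y, y', z\<close> satisfy \<open>c = \<mu> d\<^sup>2\<close> at
  \<open>x, x'\<close> and \<open>c = - \<mu> d\<^sup>2\<close> at \<open>y, y'\<close>, by the facets through \<open>z\<close>.  On the facets through
  \<open>z'\<close> this fixes the ratio of the slacks, so \<open>c\<close> and the dependency \<open>e\<close> with \<open>z'\<close> in place of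
  \<open>z\<close> are proportional on \<open>x, x'\<close> and on \<open>y, y'\<close>, with different factors; subtracting
  eliminates either pair.\<close>

lemma octahedron_coplanar:
  assumes dst: "distinct [x, x', y, y', z, z']" and V: "V = {x, x', y, y', z, z'}"
    and K: "on ` K = octahedron_sets x x' y y' z z'"
    and ncop: "\<And>u v. (\<Sum>v\<in>{x, x', y, y'}. u v *\<^sub>R p v) = 0 \<Longrightarrow> v \<in> {x, x', y, y'} \<Longrightarrow> u v = 0"
  shows "\<exists>u. u z \<noteq> 0 \<and> (\<Sum>v\<in>{x, x', z, z'}. u v *\<^sub>R p v) = 0"
    and "\<exists>u. u z \<noteq> 0 \<and> (\<Sum>v\<in>{y, y', z, z'}. u v *\<^sub>R p v) = 0"
proof -
  have facet: "\<exists>F\<in>K. (\<forall>v\<in>V. p v \<bullet> q F = (a v \<bullet> b F)\<^sup>2 \<and> (a v \<bullet> b F = 0 \<longleftrightarrow> v \<notin> {\<xi>, \<eta>, \<zeta>}))"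
    if "\<xi> \<in> {x, x'}" "\<eta> \<in> {y, y'}" "\<zeta> \<in> {z, z'}" for \<xi> \<eta> \<zeta>
  proof -
    have "V - {\<xi>, \<eta>, \<zeta>} \<in> on ` K"
      using octahedron_sets_complement[OF dst that] unfolding K[symmetric] V[symmetric] .
    then obtain F where F: "F \<in> K" "V - {\<xi>, \<eta>, \<zeta>} = on F" by blast
    have "a v \<bullet> b F = 0 \<longleftrightarrow> v \<notin> {\<xi>, \<eta>, \<zeta>}" if "v \<in> V" for v
    proof -
      have "a v \<bullet> b F = 0 \<longleftrightarrow> v \<in> on F" using inc[OF that F(1)] that by (simp add: on_def)
      also have "\<dots> \<longleftrightarrow> v \<notin> {\<xi>, \<eta>, \<zeta>}" unfolding F(2)[symmetric] using that by simp
      finally show ?thesis .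
    qed
    then show ?thesis using slack F(1) by blast
  qed
  have dep: "\<exists>u. (\<exists>i\<in>I. u i \<noteq> 0) \<and> (\<Sum>i\<in>I. u i *\<^sub>R f i) = 0"
    if "DIM('w) = 4" "card I = 5" for I :: "'v set" and f :: "'v \<Rightarrow> 'w::euclidean_space"
  proof -
    have "finite I" using that(2) card.infinite by fastforce
    moreover have "dim (f ` I) < card I" using dim_subset_UNIV[of "f ` I"] that by simp
    ultimately show ?thesis by (rule linear_dependence_image) blast
  qed
  have c5: "card {x, x', y, y', \<zeta>} = 5" if "\<zeta> \<in> {z, z'}" for \<zeta> using dst that by auto
  obtain c where c: "\<exists>i\<in>{x, x', y, y', z}. c i \<noteq> 0" "(\<Sum>i\<in>{x, x', y, y', z}. c i *\<^sub>R p i) = 0"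
    using dep[OF DIMs(1) c5[of z], of p] by blast
  obtain d where d: "\<exists>i\<in>{x, x', y, y', z}. d i \<noteq> 0" "(\<Sum>i\<in>{x, x', y, y', z}. d i *\<^sub>R a i) = 0"
    using dep[OF DIMs(2) c5[of z], of a] by blast
  obtain e where e: "\<exists>i\<in>{x, x', y, y', z'}. e i \<noteq> 0" "(\<Sum>i\<in>{x, x', y, y', z'}. e i *\<^sub>R p i) = 0"
    using dep[OF DIMs(1) c5[of z'], of p] by blast
  have cz: "c z \<noteq> 0"
  proof
    assume "c z = 0"
    moreover from this have "(\<Sum>v\<in>{x, x', y, y'}. c v *\<^sub>R p v) = 0" using c(2) dst by (simp add: algebra_simps)
    ultimately show False using ncop[of c] c(1) by blast
  qed
  have restrict: "(\<Sum>i\<in>J. k i * (a i \<bullet> b F)) = 0" if "(\<Sum>i\<in>S. k i *\<^sub>R a i) = 0"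
      and "S \<subseteq> V" "J \<subseteq> S" "S - J \<subseteq> V - A" and F: "\<forall>v\<in>V. p v \<bullet> q F = (a v \<bullet> b F)\<^sup>2 \<and> (a v \<bullet> b F = 0 \<longleftrightarrow> v \<notin> A)"
    for k :: "'v \<Rightarrow> real" and S J F A
  proof -
    have "0 = (\<Sum>i\<in>S. k i *\<^sub>R a i) \<bullet> b F" unfolding that(1) by simp
    also have "\<dots> = (\<Sum>i\<in>S. k i * (a i \<bullet> b F))" unfolding inner_sum_left by simp
    also have "\<dots> = (\<Sum>i\<in>J. k i * (a i \<bullet> b F))"
      by (rule sum.mono_neutral_right[OF finite_subset[OF \<open>S \<subseteq> V\<close> finV] \<open>J \<subseteq> S\<close>]) (use F \<open>S - J \<subseteq> V - A\<close> in auto)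
    finally show ?thesis by simp
  qed
  have restrict2: "(\<Sum>i\<in>J. k i * (a i \<bullet> b F)\<^sup>2) = 0" if "(\<Sum>i\<in>S. k i *\<^sub>R p i) = 0"
      and "S \<subseteq> V" "J \<subseteq> S" "S - J \<subseteq> V - A" and F: "\<forall>v\<in>V. p v \<bullet> q F = (a v \<bullet> b F)\<^sup>2 \<and> (a v \<bullet> b F = 0 \<longleftrightarrow> v \<notin> A)"
    for k :: "'v \<Rightarrow> real" and S J F A
  proof -
    have "0 = (\<Sum>i\<in>S. k i *\<^sub>R p i) \<bullet> q F" unfolding that(1) by simp
    also have "\<dots> = (\<Sum>i\<in>S. k i * (a i \<bullet> b F)\<^sup>2)"
      unfolding inner_sum_left using F \<open>S \<subseteq> V\<close> by (intro sum.cong) auto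
    also have "\<dots> = (\<Sum>i\<in>J. k i * (a i \<bullet> b F)\<^sup>2)"
      by (rule sum.mono_neutral_right[OF finite_subset[OF \<open>S \<subseteq> V\<close> finV] \<open>J \<subseteq> S\<close>]) (use F \<open>S - J \<subseteq> V - A\<close> in auto)
    finally show ?thesis by simp
  qed
  \<comment> \<open>The facet missing \<xi>, \<eta> and \<open>z'\<close> contains \<open>z\<close>,
    so only the terms at \<xi> and \<eta> survive from the dependencies \<open>c\<close> and
    \<open>d\<close>.\<close>
  have z1: "c \<xi> * (a \<xi> \<bullet> b F)\<^sup>2 + c \<eta> * (a \<eta> \<bullet> b F)\<^sup>2 = 0" "d \<xi> * (a \<xi> \<bullet> b F) + d \<eta> * (a \<eta> \<bullet> b F) = 0"
    if F: "\<forall>v\<in>V. p v \<bullet> q F = (a v \<bullet> b F)\<^sup>2 \<and> (a v \<bullet> b F = 0 \<longleftrightarrow> v \<notin> {\<xi>, \<eta>, z'})"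
      and \<xi>\<eta>: "\<xi> \<in> {x, x'}" "\<eta> \<in> {y, y'}" for F \<xi> \<eta>
  proof -
    have ne: "\<xi> \<noteq> \<eta>" and sub: "{x, x', y, y', z} \<subseteq> V" "{\<xi>, \<eta>} \<subseteq> {x, x', y, y', z}"
      "{x, x', y, y', z} - {\<xi>, \<eta>} \<subseteq> V - {\<xi>, \<eta>, z'}" using \<xi>\<eta> dst V by auto
    show "c \<xi> * (a \<xi> \<bullet> b F)\<^sup>2 + c \<eta> * (a \<eta> \<bullet> b F)\<^sup>2 = 0" using restrict2[OF c(2) sub F] ne by simp
    show "d \<xi> * (a \<xi> \<bullet> b F) + d \<eta> * (a \<eta> \<bullet> b F) = 0" using restrict[OF d(2) sub F] ne by simp
  qed
  have z2: "c \<xi> * (a \<xi> \<bullet> b F)\<^sup>2 + c \<eta> * (a \<eta> \<bullet> b F)\<^sup>2 + c z * (a z \<bullet> b F)\<^sup>2 = 0"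
      "d \<xi> * (a \<xi> \<bullet> b F) + d \<eta> * (a \<eta> \<bullet> b F) + d z * (a z \<bullet> b F) = 0"
      "e \<xi> * (a \<xi> \<bullet> b F)\<^sup>2 + e \<eta> * (a \<eta> \<bullet> b F)\<^sup>2 = 0"
    if F: "\<forall>v\<in>V. p v \<bullet> q F = (a v \<bullet> b F)\<^sup>2 \<and> (a v \<bullet> b F = 0 \<longleftrightarrow> v \<notin> {\<xi>, \<eta>, z})"
      and \<xi>\<eta>: "\<xi> \<in> {x, x'}" "\<eta> \<in> {y, y'}" for F \<xi> \<eta>
  proof -
    have ne: "\<xi> \<noteq> \<eta>" "\<xi> \<noteq> z" "\<eta> \<noteq> z"
      and sub: "{x, x', y, y', z} \<subseteq> V" "{\<xi>, \<eta>, z} \<subseteq> {x, x', y, y', z}" "{x, x', y, y', z} - {\<xi>, \<eta>, z} \<subseteq> V - {\<xi>, \<eta>, z}"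
      and sub': "{x, x', y, y', z'} \<subseteq> V" "{\<xi>, \<eta>} \<subseteq> {x, x', y, y', z'}" "{x, x', y, y', z'} - {\<xi>, \<eta>} \<subseteq> V - {\<xi>, \<eta>, z}"
      using \<xi>\<eta> dst V by auto
    show "c \<xi> * (a \<xi> \<bullet> b F)\<^sup>2 + c \<eta> * (a \<eta> \<bullet> b F)\<^sup>2 + c z * (a z \<bullet> b F)\<^sup>2 = 0" using restrict2[OF c(2) sub F] ne by simp
    show "d \<xi> * (a \<xi> \<bullet> b F) + d \<eta> * (a \<eta> \<bullet> b F) + d z * (a z \<bullet> b F) = 0" using restrict[OF d(2) sub F] ne by simp
    show "e \<xi> * (a \<xi> \<bullet> b F)\<^sup>2 + e \<eta> * (a \<eta> \<bullet> b F)\<^sup>2 = 0" using restrict2[OF e(2) sub' F] ne by simp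
  qed
  have nz: "a v \<bullet> b F \<noteq> 0" if "\<forall>v\<in>V. p v \<bullet> q F = (a v \<bullet> b F)\<^sup>2 \<and> (a v \<bullet> b F = 0 \<longleftrightarrow> v \<notin> A)" "v \<in> A" "v \<in> V" for v F A
    using that by blast
  have r1: "d \<xi> = 0 \<longleftrightarrow> d \<eta> = 0" "c \<xi> * (d \<eta>)\<^sup>2 = - c \<eta> * (d \<xi>)\<^sup>2" "d \<xi> \<noteq> 0 \<Longrightarrow> c \<xi> = 0 \<longleftrightarrow> c \<eta> = 0"
    if \<xi>\<eta>: "\<xi> \<in> {x, x'}" "\<eta> \<in> {y, y'}" for \<xi> \<eta>
  proof -
    obtain F where F: "F \<in> K" "\<forall>v\<in>V. p v \<bullet> q F = (a v \<bullet> b F)\<^sup>2 \<and> (a v \<bullet> b F = 0 \<longleftrightarrow> v \<notin> {\<xi>, \<eta>, z'})"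
      using facet[OF \<xi>\<eta>, of z'] by blast
    define X where "X = a \<xi> \<bullet> b F"
    define Y where "Y = a \<eta> \<bullet> b F"
    have nzs: "X \<noteq> 0" "Y \<noteq> 0" unfolding X_def Y_def using nz[OF F(2)] \<xi>\<eta> V by auto
    have E: "c \<xi> * X\<^sup>2 + c \<eta> * Y\<^sup>2 = 0" "d \<xi> * X + d \<eta> * Y = 0" unfolding X_def Y_def by (rule z1[OF F(2) \<xi>\<eta>])+
    show i: "d \<xi> = 0 \<longleftrightarrow> d \<eta> = 0" using E(2) nzs by auto
    show "c \<xi> = 0 \<longleftrightarrow> c \<eta> = 0" using E(1) nzs by auto
    show "c \<xi> * (d \<eta>)\<^sup>2 = - c \<eta> * (d \<xi>)\<^sup>2"
    proof -
      have "d \<xi> * X = - (d \<eta> * Y)" using E(2) by simp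
      then have "(d \<xi> * X)\<^sup>2 = (d \<eta> * Y)\<^sup>2" by simp
      then have "(d \<xi>)\<^sup>2 * X\<^sup>2 = (d \<eta>)\<^sup>2 * Y\<^sup>2" by (simp add: power_mult_distrib)
      then have "(c \<xi> * (d \<eta>)\<^sup>2 + c \<eta> * (d \<xi>)\<^sup>2) * Y\<^sup>2 = (d \<xi>)\<^sup>2 * (c \<xi> * X\<^sup>2 + c \<eta> * Y\<^sup>2)"
        by (simp add: algebra_simps)
      then have "c \<xi> * (d \<eta>)\<^sup>2 + c \<eta> * (d \<xi>)\<^sup>2 = 0" using E(1) nzs by simp
      then show ?thesis by simp
    qed
  qed
  have azn: "a v \<noteq> 0" if "v \<in> V" for v
    using miss'[OF that] inc[OF that] by auto
  have pzn: "p v \<noteq> 0" if "v \<in> V" for v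
    using miss'[OF that] inc[OF that] slack[OF that] by (metis inner_zero_left power_eq_0_iff zero_eq_power2)
  have dnz: "d x \<noteq> 0" "d x' \<noteq> 0" "d y \<noteq> 0" "d y' \<noteq> 0"
  proof -
    have eqs: "d x = 0 \<longleftrightarrow> d y = 0" "d x' = 0 \<longleftrightarrow> d y = 0" "d x = 0 \<longleftrightarrow> d y' = 0" using r1(1) by auto
    have "d x \<noteq> 0"
    proof
      assume "d x = 0"
      then have z: "d x = 0" "d x' = 0" "d y = 0" "d y' = 0" using eqs by auto
      then have "d z *\<^sub>R a z = 0" using d(2) dst by simp
      then have "d z = 0" using azn[of z] V by simp
      then show False using d(1) z by blast
    qed
    then show "d x \<noteq> 0" "d x' \<noteq> 0" "d y \<noteq> 0" "d y' \<noteq> 0" using eqs by auto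
  qed
  have dnz': "d v \<noteq> 0" if "v \<in> {x, x', y, y'}" for v using that dnz by blast
  define \<mu> where "\<mu> = c x / (d x)\<^sup>2"
  have ceta: "c \<eta> = - \<mu> * (d \<eta>)\<^sup>2" if "\<eta> \<in> {y, y'}" for \<eta>
    using r1(2)[OF _ that, of x] dnz(1) by (simp add: \<mu>_def field_simps)
  have cxi: "c \<xi> = \<mu> * (d \<xi>)\<^sup>2" if "\<xi> \<in> {x, x'}" for \<xi>
    using r1(2)[OF that, of y] dnz(3) ceta[of y] by (simp add: field_simps)
  have rel: "\<exists>k. k \<noteq> 0 \<and> (\<forall>\<xi>\<in>{x,x'}. \<forall>\<eta>\<in>{y,y'}. e \<xi> * c \<eta> = k * e \<eta> * c \<xi> \<and> (e \<xi> = 0 \<longleftrightarrow> e \<eta> = 0) \<and> c \<xi> \<noteq> 0 \<and> c \<eta> \<noteq> 0)"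
  proof -
    \<comment> \<open>Put \<open>x1 = d \<xi> * X\<close>, \<open>y1 = d \<eta> * Y\<close> and
      \<open>\<nu> = c z / (d z)\<^sup>2\<close>. Eliminating \<open>Z\<close> from the two
      relations and cancelling the nonzero \<open>x1 + y1\<close> leaves
      \<open>\<mu> * (x1 - y1) + \<nu> * (x1 + y1) = 0\<close>. So \<open>y1 = \<rho> * x1\<close>,
      with a factor depending neither on \<xi> nor on \<eta>.\<close>
    define \<rho> where "\<rho> = (\<mu> + c z / (d z)\<^sup>2) / (\<mu> - c z / (d z)\<^sup>2)"
    have step: "\<rho> \<noteq> 0 \<and> \<mu> \<noteq> 0 \<and> e \<xi> * (d \<eta>)\<^sup>2 = - (\<rho>\<^sup>2 * e \<eta> * (d \<xi>)\<^sup>2) \<and> (e \<xi> = 0 \<longleftrightarrow> e \<eta> = 0)"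
      if \<xi>\<eta>: "\<xi> \<in> {x, x'}" "\<eta> \<in> {y, y'}" for \<xi> \<eta>
    proof -
      obtain F where F: "F \<in> K" "\<forall>v\<in>V. p v \<bullet> q F = (a v \<bullet> b F)\<^sup>2 \<and> (a v \<bullet> b F = 0 \<longleftrightarrow> v \<notin> {\<xi>, \<eta>, z})"
        using facet[OF \<xi>\<eta>, of z] by blast
      define X where "X = a \<xi> \<bullet> b F"
      define Y where "Y = a \<eta> \<bullet> b F"
      define Z where "Z = a z \<bullet> b F"
      have nzs: "X \<noteq> 0" "Y \<noteq> 0" "Z \<noteq> 0" unfolding X_def Y_def Z_def using nz[OF F(2)] \<xi>\<eta> V by auto
      have E: "c \<xi> * X\<^sup>2 + c \<eta> * Y\<^sup>2 + c z * Z\<^sup>2 = 0" "d \<xi> * X + d \<eta> * Y + d z * Z = 0" "e \<xi> * X\<^sup>2 + e \<eta> * Y\<^sup>2 = 0"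
        unfolding X_def Y_def Z_def by (rule z2[OF F(2) \<xi>\<eta>])+
      have dn: "d \<xi> \<noteq> 0" "d \<eta> \<noteq> 0" using dnz' \<xi>\<eta> by blast+
      define x1 where "x1 = d \<xi> * X"
      define y1 where "y1 = d \<eta> * Y"
      have n1: "x1 \<noteq> 0" "y1 \<noteq> 0" using dn nzs by (simp_all add: x1_def y1_def)
      have E1: "\<mu> * x1\<^sup>2 - \<mu> * y1\<^sup>2 + c z * Z\<^sup>2 = 0"
        using E(1) unfolding ceta[OF \<xi>\<eta>(2)] cxi[OF \<xi>\<eta>(1)] x1_def y1_def by (simp add: power_mult_distrib algebra_simps)
      have E2: "d z * Z = - (x1 + y1)" using E(2) by (simp add: x1_def y1_def)
      have dz: "d z \<noteq> 0"
      proof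
        assume "d z = 0"
        then have "x1 = - y1" using E2 by simp
        then show False using E1 cz nzs(3) by simp
      qed
      define \<nu> where "\<nu> = c z / (d z)\<^sup>2"
      have Z: "Z = - ((x1 + y1) / d z)" using E2 dz by (simp add: field_simps)
      have s0: "x1 + y1 \<noteq> 0" using Z nzs(3) by auto
      have "c z * Z\<^sup>2 = \<nu> * (x1 + y1)\<^sup>2" unfolding Z \<nu>_def by (simp add: power_divide)
      then have "(x1 + y1) * (\<mu> * (x1 - y1) + \<nu> * (x1 + y1)) = 0" using E1 by (simp add: algebra_simps power2_eq_square)
      then have "\<mu> * (x1 - y1) + \<nu> * (x1 + y1) = 0" using s0 by simp
      then have lin: "(\<mu> + \<nu>) * x1 = (\<mu> - \<nu>) * y1" by (simp add: algebra_simps)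
      have nu0: "\<nu> \<noteq> 0" using cz dz by (simp add: \<nu>_def)
      have mn: "\<mu> + \<nu> \<noteq> 0 \<and> \<mu> - \<nu> \<noteq> 0"
      proof (rule ccontr)
        assume "\<not> ?thesis"
        then have "\<mu> + \<nu> = 0" "\<mu> - \<nu> = 0" using lin n1 by auto
        then show False using nu0 by simp
      qed
      have mu0: "\<mu> \<noteq> 0"
      proof
        assume "\<mu> = 0"
        then show False using E1 cz nzs(3) by simp
      qed
      have rho: "\<rho> \<noteq> 0" "y1 = \<rho> * x1" unfolding \<rho>_def \<nu>_def[symmetric] using mn lin by (auto simp: field_simps)
      have "y1\<^sup>2 = \<rho>\<^sup>2 * x1\<^sup>2" unfolding rho(2) by (simp add: power_mult_distrib)
      then have sq: "(d \<eta>)\<^sup>2 * Y\<^sup>2 = \<rho>\<^sup>2 * ((d \<xi>)\<^sup>2 * X\<^sup>2)" by (simp add: x1_def y1_def power_mult_distrib)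
      have "X\<^sup>2 * (e \<xi> * (d \<eta>)\<^sup>2 + e \<eta> * \<rho>\<^sup>2 * (d \<xi>)\<^sup>2) = (d \<eta>)\<^sup>2 * (e \<xi> * X\<^sup>2 + e \<eta> * Y\<^sup>2)"
        using sq by (simp add: algebra_simps)
      then have "e \<xi> * (d \<eta>)\<^sup>2 + e \<eta> * \<rho>\<^sup>2 * (d \<xi>)\<^sup>2 = 0" using E(3) nzs by simp
      moreover have "e \<xi> = 0 \<longleftrightarrow> e \<eta> = 0" using E(3) nzs by auto
      ultimately show ?thesis using rho(1) mu0 by (simp add: algebra_simps add_eq_0_iff2)
    qed
    have "e \<xi> * c \<eta> = \<rho>\<^sup>2 * e \<eta> * c \<xi> \<and> (e \<xi> = 0 \<longleftrightarrow> e \<eta> = 0) \<and> c \<xi> \<noteq> 0 \<and> c \<eta> \<noteq> 0"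
      if \<xi>\<eta>: "\<xi> \<in> {x, x'}" "\<eta> \<in> {y, y'}" for \<xi> \<eta>
    proof -
      have st: "\<mu> \<noteq> 0" "e \<xi> * (d \<eta>)\<^sup>2 = - (\<rho>\<^sup>2 * e \<eta> * (d \<xi>)\<^sup>2)" "e \<xi> = 0 \<longleftrightarrow> e \<eta> = 0"
        using step[OF \<xi>\<eta>] by blast+
      have dn: "d \<xi> \<noteq> 0" "d \<eta> \<noteq> 0" using dnz' \<xi>\<eta> by blast+
      have "e \<xi> * c \<eta> = - \<mu> * (e \<xi> * (d \<eta>)\<^sup>2)" unfolding ceta[OF \<xi>\<eta>(2)] by simp
      also have "\<dots> = \<rho>\<^sup>2 * e \<eta> * c \<xi>" unfolding st(2) cxi[OF \<xi>\<eta>(1)] by simp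
      finally show ?thesis using st dn unfolding ceta[OF \<xi>\<eta>(2)] cxi[OF \<xi>\<eta>(1)] by simp
    qed
    moreover have "\<rho>\<^sup>2 \<noteq> 0" using step[of x y] by simp
    ultimately show ?thesis by blast
  qed
  then obtain k where k: "k \<noteq> 0"
    and kk: "\<forall>\<xi>\<in>{x,x'}. \<forall>\<eta>\<in>{y,y'}. e \<xi> * c \<eta> = k * e \<eta> * c \<xi> \<and> (e \<xi> = 0 \<longleftrightarrow> e \<eta> = 0) \<and> c \<xi> \<noteq> 0 \<and> c \<eta> \<noteq> 0"
    by (elim exE conjE)
  have K: "e x * c y = k * e y * c x" "e x * c y' = k * e y' * c x" "e x' * c y = k * e y * c x'"
    and cn: "c x \<noteq> 0" "c x' \<noteq> 0" "c y \<noteq> 0" "c y' \<noteq> 0"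
    using kk by simp_all
  have ez: "e x = 0 \<longleftrightarrow> e y = 0" "e x = 0 \<longleftrightarrow> e y' = 0" "e x' = 0 \<longleftrightarrow> e y = 0"
    using kk by auto
  have ex: "e x \<noteq> 0"
  proof
    assume "e x = 0"
    then have z: "e x = 0" "e x' = 0" "e y = 0" "e y' = 0" using ez by auto
    then have "e z' *\<^sub>R p z' = 0" using e(2) dst by simp
    then have "e z' = 0" using pzn[of z'] V by simp
    then show False using e(1) z by blast
  qed
  have en: "e x' \<noteq> 0" "e y \<noteq> 0" "e y' \<noteq> 0" using ex ez by auto
  have ratio: "c x / e x = c x' / e x'" "c y / e y = c y' / e y'"
  proof -
    have "c x = e x * c y / (k * e y)" "c x' = e x' * c y / (k * e y)"
      using K(1,3) k en by (simp_all add: field_simps)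
    then show "c x / e x = c x' / e x'" using ex en by simp
    have "c y = k * e y * c x / e x" "c y' = k * e y' * c x / e x"
      using K(1,2) ex by (simp_all add: field_simps)
    then show "c y / e y = c y' / e y'" using ex en by simp
  qed
  \<comment> \<open>\<open>c\<close> equals \<open>r\<close> times \<open>e\<close> on the pair
    \<open>x, x'\<close> and \<open>t\<close> times \<open>e\<close> on \<open>y, y'\<close>.
    Subtracting \<open>t\<close> times the second dependency cancels \<open>y, y'\<close>, and
    subtracting \<open>r\<close> times it cancels \<open>x, x'\<close>.\<close>
  define r where "r = c x / e x"
  define t where "t = c y / e y"
  have r: "c x = r * e x" "c x' = r * e x'" using ratio(1) ex en unfolding r_def by (simp_all add: field_simps)
  have t: "c y = t * e y" "c y' = t * e y'" using ratio(2) ex en unfolding t_def by (simp_all add: field_simps)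
  have C: "c x *\<^sub>R p x + c x' *\<^sub>R p x' + c y *\<^sub>R p y + c y' *\<^sub>R p y' + c z *\<^sub>R p z = 0"
    using c(2) dst by (simp add: add.assoc)
  have E: "e x *\<^sub>R p x + e x' *\<^sub>R p x' + e y *\<^sub>R p y + e y' *\<^sub>R p y' + e z' *\<^sub>R p z' = 0"
    using e(2) dst by (simp add: add.assoc)
  have CE: "c x *\<^sub>R p x + c x' *\<^sub>R p x' + c y *\<^sub>R p y + c y' *\<^sub>R p y' + c z *\<^sub>R p z -
     s *\<^sub>R (e x *\<^sub>R p x + e x' *\<^sub>R p x' + e y *\<^sub>R p y + e y' *\<^sub>R p y' + e z' *\<^sub>R p z') = 0" for s
    unfolding C E by simp
  define u where "u = (\<lambda>s v. if v = z then c z else if v = z' then - s * e z' else c v - s * e v)"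
  have "(\<Sum>v\<in>{x, x', z, z'}. u t v *\<^sub>R p v) = 0"
  proof -
    have "(\<Sum>v\<in>{x, x', z, z'}. u t v *\<^sub>R p v) =
       (c x - t * e x) *\<^sub>R p x + ((c x' - t * e x') *\<^sub>R p x' + (c z *\<^sub>R p z + (- t * e z') *\<^sub>R p z'))"
      using dst by (auto simp: u_def)
    also have "\<dots> = 0" using CE[of t] by (simp add: t algebra_simps)
    finally show ?thesis .
  qed
  moreover have "(\<Sum>v\<in>{y, y', z, z'}. u r v *\<^sub>R p v) = 0"
  proof -
    have "(\<Sum>v\<in>{y, y', z, z'}. u r v *\<^sub>R p v) =
       (c y - r * e y) *\<^sub>R p y + ((c y' - r * e y') *\<^sub>R p y' + (c z *\<^sub>R p z + (- r * e z') *\<^sub>R p z'))"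
      using dst by (auto simp: u_def)
    also have "\<dots> = 0" using CE[of r] by (simp add: r algebra_simps)
    finally show ?thesis .
  qed
  moreover have "u s z \<noteq> 0" for s using cz by (simp add: u_def)
  ultimately show "\<exists>u. u z \<noteq> 0 \<and> (\<Sum>v\<in>{x, x', z, z'}. u v *\<^sub>R p v) = 0"
    "\<exists>u. u z \<noteq> 0 \<and> (\<Sum>v\<in>{y, y', z, z'}. u v *\<^sub>R p v) = 0" by blast+
qed

end

text \<open>The slack of a facet is an affine function, hence it annihilates every affine dependency
  of the vertices.\<close>

lemma facet_set_slack:
  assumes poly: "polytope P" and A: "A \<in> facet_sets P"
  shows "\<exists>\<sigma>. (\<forall>v\<in>vertices P. 0 \<le> \<sigma> v \<and> (\<sigma> v = 0 \<longleftrightarrow> v \<in> A)) \<and>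
    (\<forall>f. sum f (vertices P) = 0 \<longrightarrow> (\<Sum>v\<in>vertices P. f v *\<^sub>R v) = 0 \<longrightarrow> (\<Sum>v\<in>vertices P. f v * \<sigma> v) = 0)"
proof -
  obtain F where F: "F facet_of P" "A = vertices P \<inter> F" using A unfolding facet_sets_def by blast
  obtain c d where cd: "P \<subseteq> {x. c \<bullet> x \<le> d}" "F = P \<inter> {x. c \<bullet> x = d}"
    using facet_functional[OF poly F(1)] by metis
  show ?thesis
  proof (intro exI[of _ "\<lambda>v. d - c \<bullet> v"] conjI ballI allI impI)
    fix v assume v: "v \<in> vertices P"
    then have "v \<in> P" using vertices_subset by blast
    then show "0 \<le> d - c \<bullet> v" using cd(1) by auto
    have "v \<in> A \<longleftrightarrow> c \<bullet> v = d" unfolding F(2) cd(2) using v \<open>v \<in> P\<close> by simp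
    then show "d - c \<bullet> v = 0 \<longleftrightarrow> v \<in> A" by auto
  next
    fix f :: "'a \<Rightarrow> real" assume f: "sum f (vertices P) = 0" "(\<Sum>v\<in>vertices P. f v *\<^sub>R v) = 0"
    have "(\<Sum>v\<in>vertices P. f v * (d - c \<bullet> v)) = d * sum f (vertices P) - c \<bullet> (\<Sum>v\<in>vertices P. f v *\<^sub>R v)"
      by (simp add: right_diff_distrib sum_subtractf sum_distrib_left inner_sum_right mult.commute)
    then show "(\<Sum>v\<in>vertices P. f v * (d - c \<bullet> v)) = 0" using f by simp
  qed
qed

text \<open>In the slack sum of the dependency only \<open>u\<close> and \<open>w\<close>
  contribute, and their slacks are positive.\<close>

lemma facet_set_opposite_signs:
  assumes poly: "polytope P" and A: "A \<in> facet_sets P"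
    and uw: "u \<in> vertices P - A" "w \<in> vertices P - A" "u \<noteq> w"
    and zero: "\<And>v. v \<in> vertices P - A \<Longrightarrow> v \<noteq> u \<Longrightarrow> v \<noteq> w \<Longrightarrow> f v = 0"
    and f: "sum f (vertices P) = 0" "(\<Sum>v\<in>vertices P. f v *\<^sub>R v) = 0"
  shows "sgn (f u) = - sgn (f w)"
proof -
  obtain \<sigma> where \<sigma>: "\<forall>v\<in>vertices P. 0 \<le> \<sigma> v \<and> (\<sigma> v = 0 \<longleftrightarrow> v \<in> A)"
    and fs: "\<forall>f. sum f (vertices P) = 0 \<longrightarrow> (\<Sum>v\<in>vertices P. f v *\<^sub>R v) = 0 \<longrightarrow> (\<Sum>v\<in>vertices P. f v * \<sigma> v) = 0"
    using facet_set_slack[OF poly A] by (elim exE conjE)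
  have pos: "\<sigma> v > 0" if "v \<in> vertices P - A" for v using \<sigma> that by (simp add: order_less_le)
  have uwV: "{u, w} \<subseteq> vertices P" using uw by simp
  have "0 = (\<Sum>v\<in>vertices P. f v * \<sigma> v)" using fs f by simp
  also have "\<dots> = (\<Sum>v\<in>{u, w}. f v * \<sigma> v)"
  proof (rule sum.mono_neutral_right[OF finite_vertices[OF poly] uwV], rule ballI)
    fix v assume v: "v \<in> vertices P - {u, w}"
    then show "f v * \<sigma> v = 0" using \<sigma> zero[of v] by (cases "v \<in> A") simp_all
  qed
  finally have "f u * \<sigma> u = - (f w * \<sigma> w)" using uw(3) by simp
  then have "sgn (f u * \<sigma> u) = sgn (- (f w * \<sigma> w))" by (rule arg_cong)
  then show ?thesis using pos[OF uw(1)] pos[OF uw(2)] by (simp add: sgn_mult)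
qed

section \<open>Recognizing polytopes from the vertex sets of their facets\<close>

lemma pyramid_pattern:
  fixes P :: "(real^3) set"
  assumes poly: "polytope P" and dim: "aff_dim P = 3" and dst: "distinct [x, u1, u2, u3, u4]"
    and V: "vertices P = {x, u1, u2, u3, u4}" and G: "G facet_of P" "vertices P \<inter> G = {u1, u2, u3, u4}"
  shows "quadrilateral_pyramid P"
proof -
  have Gf: "G face_of P" using G(1) by (rule facet_of_imp_face_of)
  obtain c d where cd: "P \<subseteq> {x. c \<bullet> x \<le> d}" "G = P \<inter> {x. c \<bullet> x = d}"
    using facet_functional[OF poly G(1)] by metis
  have GV: "convex hull {u1, u2, u3, u4} = G" using face_hull_vertices[OF poly Gf] unfolding G(2) .
  have "convex_quadrilateral G"
    unfolding convex_quadrilateral_def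
  proof (intro conjI)
    show "polytope G" using face_of_polytope_polytope[OF poly Gf] .
    show "aff_dim G = 2" using G(1) dim by (simp add: facet_of_def)
    show "card (vertices G) = 4" unfolding vertices_face[OF Gf] G(2) using dst by simp
  qed
  moreover have "pyramid_over G P"
    unfolding pyramid_over_def
  proof (intro exI[of _ x] conjI)
    have "x \<notin> G"
    proof
      assume "x \<in> G"
      then have "x \<in> vertices P \<inter> G" using V by blast
      then show False unfolding G(2) using dst by simp
    qed
    moreover have "x \<in> P" using V vertices_subset by blast
    ultimately have "c \<bullet> x \<noteq> d" using cd(2) by blast
    moreover have "affine hull G \<subseteq> {x. c \<bullet> x = d}" by (rule hull_minimal) (use cd(2) in \<open>auto simp: affine_hyperplane\<close>)
    ultimately show "x \<notin> affine hull G" by blast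
    have "P = convex hull (insert x {u1, u2, u3, u4})" using convex_hull_vertices[OF poly] unfolding V by simp
    also have "\<dots> = convex hull (insert x G)" unfolding GV[symmetric] by (rule hull_insert)
    finally show "P = convex hull (insert x G)" .
  qed
  ultimately show ?thesis unfolding quadrilateral_pyramid_def by blast
qed

text \<open>The facet missing one \<open>t\<close> and one apex forces opposite signs at these two
  in any affine dependency. So the Radon partition separates the apices from the equator, and the
  Radon point \<open>z\<close> lies inside both the segment and the triangle: \<open>P\<close> is
  itself a bipyramid.\<close>

lemma bisimplex_pattern:
  fixes P :: "(real^3) set"
  assumes poly: "polytope P" and dim: "aff_dim P = 3" and dst: "distinct [s, s', t1, t2, t3]"
    and V: "vertices P = {s, s', t1, t2, t3}" and K: "facet_sets P = bisimplex_sets s s' t1 t2 t3"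
  shows "bisimplex P"
proof -
  let ?V = "{s, s', t1, t2, t3}"
  let ?T = "{t1, t2, t3}"
  have opp: "sgn (f t) = - sgn (f s')" "sgn (f t) = - sgn (f s)"
    if f: "sum f ?V = 0" "(\<Sum>v\<in>?V. f v *\<^sub>R v) = 0" and t: "t \<in> ?T" for f t
  proof -
    have f': "sum f (vertices P) = 0" "(\<Sum>v\<in>vertices P. f v *\<^sub>R v) = 0" unfolding V by (rule f)+
    have A: "insert s (?T - {t}) \<in> facet_sets P" "insert s' (?T - {t}) \<in> facet_sets P"
      using t dst unfolding K bisimplex_sets_def by auto
    have e: "vertices P - insert s (?T - {t}) = {t, s'}" "vertices P - insert s' (?T - {t}) = {t, s}" "t \<noteq> s" "t \<noteq> s'"
      using t dst unfolding V by auto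
    show "sgn (f t) = - sgn (f s')" by (rule facet_set_opposite_signs[OF poly A(1) _ _ e(4) _ f']) (simp_all add: e(1))
    show "sgn (f t) = - sgn (f s)" by (rule facet_set_opposite_signs[OF poly A(2) _ _ e(3) _ f']) (simp_all add: e(2))
  qed
  have zero: "\<forall>v\<in>?V. f v = 0" if f: "sum f ?V = 0" "(\<Sum>v\<in>?V. f v *\<^sub>R v) = 0" and z: "f s = 0 \<or> f s' = 0" for f
  proof -
    have "sgn (f t1) = 0" using opp[OF f, of t1] z by auto
    then have "sgn (f t1) = 0" "sgn (f s) = 0" "sgn (f s') = 0" "sgn (f t2) = 0" "sgn (f t3) = 0"
      using opp[OF f, of t1] opp[OF f, of t2] opp[OF f, of t3] by auto
    then show ?thesis by (simp add: sgn_zero_iff)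
  qed
  have indep: "\<not> affine_dependent U" if U: "U \<subseteq> ?V" "s \<notin> U \<or> s' \<notin> U" for U
  proof
    assume "affine_dependent U"
    moreover have fin: "finite U" using U(1) finite_subset by blast
    ultimately obtain g where g: "sum g U = 0" "\<exists>v\<in>U. g v \<noteq> 0" "(\<Sum>v\<in>U. g v *\<^sub>R v) = 0"
      unfolding affine_dependent_explicit_finite[OF fin] by blast
    define f where "f = (\<lambda>v. if v \<in> U then g v else 0)"
    have "sum f ?V = sum f U" by (rule sum.mono_neutral_right[OF _ U(1)]) (auto simp: f_def)
    moreover have "sum f U = sum g U" by (rule sum.cong) (auto simp: f_def)
    moreover have "(\<Sum>v\<in>?V. f v *\<^sub>R v) = (\<Sum>v\<in>U. f v *\<^sub>R v)" by (rule sum.mono_neutral_right[OF _ U(1)]) (auto simp: f_def)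
    moreover have "(\<Sum>v\<in>U. f v *\<^sub>R v) = (\<Sum>v\<in>U. g v *\<^sub>R v)" by (rule sum.cong) (auto simp: f_def)
    moreover have "f s = 0 \<or> f s' = 0" using U(2) by (auto simp: f_def)
    ultimately have "\<forall>v\<in>?V. f v = 0" using zero[of f] g by metis
    then show False using g(2) U(1) by (auto simp: f_def split: if_splits)
  qed
  have indT: "\<not> affine_dependent ?T" by (rule indep) (use dst in auto)
  have "card ?V = 5" using dst by simp
  then have "affine_dependent ?V" by (intro affine_dependent_biggerset) auto
  then obtain g where g: "sum g ?V = 0" "\<exists>v\<in>?V. g v \<noteq> 0" "(\<Sum>v\<in>?V. g v *\<^sub>R v) = 0"
    using affine_dependent_explicit_finite[of ?V] by auto
  \<comment> \<open>The sign normalizes the dependency to be positive at \<open>s\<close>, hence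
    positive at \<open>s'\<close> and negative on the equator.\<close>
  define f where "f = (\<lambda>v. sgn (g s) * g v)"
  have gs: "g s \<noteq> 0" using zero[OF g(1,3)] g(2) by blast
  have f: "sum f ?V = 0" "(\<Sum>v\<in>?V. f v *\<^sub>R v) = 0"
    using g(1,3) unfolding f_def by (simp_all only: sum_distrib_left[symmetric] scaleR_scaleR[symmetric] scaleR_sum_right[symmetric]) simp_all
  have fs: "f s > 0" using gs by (simp add: f_def abs_sgn[symmetric] mult.commute[of "sgn _"])
  have ft: "f t < 0" if "t \<in> ?T" for t
    using opp(2)[OF f that] fs by (simp add: sgn_if split: if_splits)
  have fs': "f s' > 0" using opp(1)[OF f, of t1] ft[of t1] by (simp add: sgn_if split: if_splits)
  define N where "N = f s + f s'"
  have N: "N > 0" using fs fs' by (simp add: N_def)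
  have sums: "f s + f s' = - (f t1 + f t2 + f t3)" "f s *\<^sub>R s + f s' *\<^sub>R s' = - (f t1 *\<^sub>R t1 + f t2 *\<^sub>R t2 + f t3 *\<^sub>R t3)"
    unfolding eq_neg_iff_add_eq_0 using f dst by (simp_all add: add.assoc)
  define z where "z = (f s / N) *\<^sub>R s + (f s' / N) *\<^sub>R s'"
  have zT: "z = (- f t1 / N) *\<^sub>R t1 + (- f t2 / N) *\<^sub>R t2 + (- f t3 / N) *\<^sub>R t3"
  proof -
    have "z = (1 / N) *\<^sub>R (f s *\<^sub>R s + f s' *\<^sub>R s')" by (simp add: z_def scaleR_add_right)
    then show ?thesis unfolding sums(2) by (simp add: scaleR_add_right scaleR_diff_right)
  qed
  let ?B = "convex hull ?T"
  have "z \<in> open_segment s s'"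
    unfolding in_segment
  proof (intro conjI exI[of _ "f s' / N"])
    show "s \<noteq> s'" using dst by simp
    show "0 < f s' / N" "f s' / N < 1" using fs fs' N by (simp_all add: N_def)
    have "1 - f s' / N = f s / N" using N by (simp add: N_def field_simps)
    then show "z = (1 - f s' / N) *\<^sub>R s + (f s' / N) *\<^sub>R s'" by (simp add: z_def)
  qed
  moreover have "z \<in> rel_interior ?B"
    unfolding rel_interior_convex_hull_explicit[OF indT]
  proof (intro CollectI exI[of _ "\<lambda>t. - f t / N"] conjI ballI)
    show "0 < - f t / N" if "t \<in> ?T" for t using ft[OF that] N by (simp add: divide_neg_pos)
    have "(\<Sum>t\<in>?T. - f t / N) = (f s + f s') / N" unfolding sums(1) using dst by (simp add: add_divide_distrib diff_divide_distrib)
    then show "(\<Sum>t\<in>?T. - f t / N) = 1" using N by (simp add: N_def)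
    show "(\<Sum>t\<in>?T. (- f t / N) *\<^sub>R t) = z" unfolding zT using dst by (simp add: add.assoc)
  qed
  ultimately have meet: "open_segment s s' \<inter> rel_interior ?B \<noteq> {}" by blast
  have sn: "s \<notin> affine hull ?B"
  proof
    assume "s \<in> affine hull ?B"
    moreover have "insert s ?T - {s} = ?T" using dst by auto
    ultimately have "s \<in> affine hull (insert s ?T - {s})" by (simp only: affine_hull_convex_hull)
    then have "affine_dependent (insert s ?T)" unfolding affine_dependent_def by blast
    moreover have "\<not> affine_dependent (insert s ?T)" by (rule indep) (use dst in auto)
    ultimately show False by blast
  qed
  have hI: "convex hull (insert x (convex hull S)) = convex hull (insert x S)" for x :: "real^3" and S
    by (rule hull_insert[symmetric])
  have "P = convex hull (insert s (insert s' ?T))" using convex_hull_vertices[OF poly] unfolding V by simp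
  also have "\<dots> = convex hull (insert s (convex hull (insert s' (convex hull ?T))))" unfolding hI ..
  also have "\<dots> = convex hull (insert s (insert s' ?B))" by (rule hI)
  finally have "bipyramid_over ?B P" unfolding bipyramid_over_def using meet sn by blast
  moreover have "2 simplex ?B" unfolding simplex_def using indT dst by (intro exI[of _ ?T]) simp
  ultimately show ?thesis
    unfolding bisimplex_def using poly combinatorially_equivalent_refl by blast
qed

lemma vertices_aff_dim:
  assumes "polytope P" shows "aff_dim (vertices P) = aff_dim P"
  using convex_hull_vertices[OF assms] aff_dim_convex_hull by metis

lemma three_vertices_not_collinear:
  assumes V: "u \<in> vertices P" "v \<in> vertices P" "w \<in> vertices P" and dst: "distinct [u, v, w]"
  shows "\<not> affine_dependent {u, v, w}"
proof
  assume "affine_dependent {u, v, w}"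
  then have "collinear {u, v, w}" by (simp add: collinear_3_eq_affine_dependent)
  then have "u \<in> closed_segment v w \<or> v \<in> closed_segment w u \<or> w \<in> closed_segment u v"
    by (simp add: collinear_between_cases between_mem_segment)
  moreover have "p \<notin> open_segment q r" if "p \<in> vertices P" "q \<in> vertices P" "r \<in> vertices P" for p q r
    using that vertices_subset[of P] by (auto simp: vertices_def extreme_point_of_def)
  ultimately show False using V dst by (auto simp: open_segment_def)
qed

lemma planar_wrt_affine_hull:
  assumes poly: "polytope P" and S: "S \<subseteq> vertices P" "card S = 4" "affine_dependent S"
  shows "planar_wrt P (affine hull S)"
proof -
  have fin: "finite S" using S(2) card.infinite by fastforce
  have "aff_dim S \<le> int (card S) - 1" by (rule aff_dim_le_card[OF fin])
  moreover have "aff_dim S \<noteq> int (card S) - 1" using S(3) fin affine_independent_iff_card by blast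
  ultimately have le: "aff_dim S \<le> 2" using S(2) by simp
  have "3 \<le> card S" using S(2) by simp
  then obtain U where U: "U \<subseteq> S" "card U = 3" by (rule obtain_subset_with_card_n)
  obtain u v w where uvw: "U = {u, v, w}" "distinct [u, v, w]" using U(2) by (auto simp: card_3_iff)
  have "\<not> affine_dependent U" unfolding uvw(1)
    by (rule three_vertices_not_collinear[of _ P, OF _ _ _ uvw(2)]) (use subset_trans[OF U(1) S(1)] in \<open>simp_all add: uvw(1)\<close>)
  then have "aff_dim U = 2" using affine_independent_iff_card[of U] U(2) by simp
  then have "aff_dim S = 2" using le aff_dim_subset[OF U(1)] by simp
  then show ?thesis
    unfolding planar_wrt_def using S vertices_subset[of P] hull_subset[of S affine]
    by (intro conjI exI[of _ S]) auto
qed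

lemma affine_dependent_homogeneous_iff:
  assumes "finite S"
  shows "affine_dependent S \<longleftrightarrow> (\<exists>u. (\<exists>v\<in>S. u v \<noteq> 0) \<and> (\<Sum>v\<in>S. u v *\<^sub>R (v, 1 :: real)) = 0)"
proof -
  have "(\<Sum>v\<in>S. u v *\<^sub>R (v, 1 :: real)) = 0 \<longleftrightarrow> sum u S = 0 \<and> (\<Sum>v\<in>S. u v *\<^sub>R v) = 0" for u
    by (auto simp: sum_prod zero_prod_def)
  then show ?thesis unfolding affine_dependent_explicit_finite[OF assms] by blast
qed

text \<open>If one of the three quadruples formed by two antipodal pairs is affinely independent,
  \<open>octahedron_coplanar\<close> makes the other two coplanar. So at least two of them are
  coplanar in every case.\<close>

lemma octahedron_pattern_two_planes:
  fixes P :: "(real^3) set"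
  assumes poly: "polytope P" and dim: "aff_dim P = 3" and fac: "psd_factorization P a b"
    and dst: "distinct [x, x', y, y', z, z']" and V: "vertices P = {x, x', y, y', z, z'}"
    and K: "facet_sets P = octahedron_sets x x' y y' z z'"
  shows "\<exists>E E'. E \<noteq> E' \<and> planar_wrt P E \<and> planar_wrt P E'"
proof -
  interpret polytope3 P using poly dim by unfold_locales
  obtain c d where "connected_psd_incidence (vertices P) {F. F facet_of P} (\<in>) (\<lambda>v. (v, 1 :: real)) (\<lambda>F. (- c F, d F)) a b"
    using psd_incidence[OF _ fac] by auto
  then interpret I: connected_psd_incidence "vertices P" "{F. F facet_of P}" "(\<in>)" "\<lambda>v. (v, 1 :: real)" "\<lambda>F. (- c F, d F)" a b .
  have onK: "I.on ` {F. F facet_of P} = facet_sets P" unfolding I.on_def facet_sets_def by blast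
  \<comment> \<open>Two of the quadruples cover all vertices, so a common plane would contain the
    polytope.\<close>
  have planes: "\<exists>E E'. E \<noteq> E' \<and> planar_wrt P E \<and> planar_wrt P E'"
    if S: "S \<union> T = vertices P" "card S = 4" "card T = 4" "affine_dependent S" "affine_dependent T" for S T
  proof (intro exI conjI)
    have sub: "S \<subseteq> vertices P" "T \<subseteq> vertices P" using S(1) by auto
    show "planar_wrt P (affine hull S)" "planar_wrt P (affine hull T)"
      by (rule planar_wrt_affine_hull[OF poly]; use sub S in simp)+
    then have "aff_dim S = 2" by (simp add: planar_wrt_def)
    show "affine hull S \<noteq> affine hull T"
    proof
      assume "affine hull S = affine hull T"
      then have "vertices P \<subseteq> affine hull S" unfolding S(1)[symmetric] using hull_subset by (metis Un_least)
      then have "aff_dim (vertices P) \<le> aff_dim (affine hull S)" by (rule aff_dim_subset)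
      then show False using vertices_aff_dim[OF poly] dim \<open>aff_dim S = 2\<close> by simp
    qed
  qed
  have step: "affine_dependent {x, x', z, z'} \<and> affine_dependent {y, y', z, z'}"
    if ind: "\<not> affine_dependent {x, x', y, y'}" and d: "distinct [x, x', y, y', z, z']"
      and V: "vertices P = {x, x', y, y', z, z'}" and K: "facet_sets P = octahedron_sets x x' y y' z z'"
    for x x' y y' z z'
  proof -
    have n: "u v = 0" if "(\<Sum>v\<in>{x, x', y, y'}. u v *\<^sub>R (v, 1 :: real)) = 0" "v \<in> {x, x', y, y'}" for u v
      using ind that affine_dependent_homogeneous_iff[of "{x, x', y, y'}"] by blast
    have "\<exists>u. u z \<noteq> 0 \<and> (\<Sum>v\<in>{x, x', z, z'}. u v *\<^sub>R (v, 1 :: real)) = 0"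
      by (rule I.octahedron_coplanar(1)[OF d V K[folded onK]]) (rule n)
    moreover have "\<exists>u. u z \<noteq> 0 \<and> (\<Sum>v\<in>{y, y', z, z'}. u v *\<^sub>R (v, 1 :: real)) = 0"
      by (rule I.octahedron_coplanar(2)[OF d V K[folded onK]]) (rule n)
    ultimately show ?thesis
      using affine_dependent_homogeneous_iff[of "{x, x', z, z'}"]
        affine_dependent_homogeneous_iff[of "{y, y', z, z'}"] by blast
  qed
  have c: "card {x, x', y, y'} = 4" "card {x, x', z, z'} = 4" "card {y, y', z, z'} = 4" using dst by auto
  have e: "{x, x', y, y'} \<union> {x, x', z, z'} = vertices P" "{x, x', z, z'} \<union> {y, y', z, z'} = vertices P"
    "{x, x', y, y'} \<union> {y, y', z, z'} = vertices P" unfolding V by auto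
  show ?thesis
  proof (cases "affine_dependent {x, x', y, y'}")
    case False
    then show ?thesis using planes[OF e(2) c(2,3)] step[OF False dst V K] by blast
  next
    case A: True
    show ?thesis
    proof (cases "affine_dependent {x, x', z, z'}")
      case True
      then show ?thesis using planes[OF e(1) c(1,2) A] by blast
    next
      case False
      have "octahedron_sets x x' y y' z z' = octahedron_sets x x' z z' y y'"
        unfolding octahedron_sets_def by (simp add: insert_commute)
      then have K': "facet_sets P = octahedron_sets x x' z z' y y'" using K by simp
      have V': "vertices P = {x, x', z, z', y, y'}" unfolding V by auto
      have "affine_dependent {z, z', y, y'}" using step[OF False _ V' K'] dst by auto
      moreover have "{z, z', y, y'} = {y, y', z, z'}" by auto
      ultimately have "affine_dependent {y, y', z, z'}" by simp
      then show ?thesis using planes[OF e(3) c(1,3) A] by blast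
    qed
  qed
qed

section \<open>Polarity and combinatorial types with labelled vertices\<close>

lemma ex_bij_map_lists:
  assumes "distinct xs" "distinct ys" "length xs = length ys"
  shows "\<exists>\<phi>. map \<phi> xs = ys \<and> bij_betw \<phi> (set xs) (set ys)"
proof -
  define \<phi> where "\<phi> = (\<lambda>x. the (map_of (zip xs ys) x))"
  have "map \<phi> xs = ys"
    by (rule nth_equalityI) (use assms in \<open>simp_all add: \<phi>_def map_of_zip_nth\<close>)
  moreover from this have "inj_on \<phi> (set xs)" "\<phi> ` set xs = set ys"
    using assms distinct_map[of \<phi> xs] set_map[of \<phi> xs] by auto
  ultimately show ?thesis by (auto simp: bij_betw_def)
qed

lemma vertexI:
  assumes "polytope P" "vertices P \<subseteq> S" "x \<in> P" "\<And>y. y \<in> S \<Longrightarrow> y \<noteq> x \<Longrightarrow> c \<bullet> y < c \<bullet> x"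
  shows "x \<in> vertices P"
proof (rule ccontr)
  assume "x \<notin> vertices P"
  then have "vertices P \<subseteq> {y. c \<bullet> y < c \<bullet> x}" using assms by auto
  then have "convex hull vertices P \<subseteq> {y. c \<bullet> y < c \<bullet> x}" by (rule hull_minimal) (rule convex_halfspace_lt)
  then show False using convex_hull_vertices[OF assms(1)] assms(3) by auto
qed

lemma polar_convex_hull: "polar (convex hull S) = {y. \<forall>x\<in>S. x \<bullet> y \<le> 1}"
proof
  show "polar (convex hull S) \<subseteq> {y. \<forall>x\<in>S. x \<bullet> y \<le> 1}" using hull_subset[of S convex] by (auto simp: polar_def)
  show "{y. \<forall>x\<in>S. x \<bullet> y \<le> 1} \<subseteq> polar (convex hull S)"
  proof
    fix y assume "y \<in> {y. \<forall>x\<in>S. x \<bullet> y \<le> 1}"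
    then have "S \<subseteq> {x. y \<bullet> x \<le> 1}" by (auto simp: inner_commute)
    then have "convex hull S \<subseteq> {x. y \<bullet> x \<le> 1}" by (rule hull_minimal) (rule convex_halfspace_le)
    then show "y \<in> polar (convex hull S)" by (auto simp: polar_def inner_commute)
  qed
qed

text \<open>If 0 is not interior, some nonzero \<open>a\<close> has
  \<open>a \<bullet> x \<le> 0\<close> on \<open>S\<close>: a hyperplane containing \<open>S\<close>
  provides it when the interior is empty, and separation of the interior from 0 otherwise. The ray
  spanned by \<open>a\<close> then lies in the polar.\<close>

lemma zero_interior_of_bounded_polar:
  fixes S :: "'a::euclidean_space set"
  assumes conv: "convex S" and bd: "bounded (polar S)"
  shows "0 \<in> interior S"
proof (rule ccontr)
  assume z: "0 \<notin> interior S"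
  have "\<exists>a. a \<noteq> 0 \<and> (\<forall>x\<in>S. a \<bullet> x \<le> 0)"
  proof (cases "interior S = {}")
    case True
    obtain a b where ab: "a \<noteq> 0" "S \<subseteq> {x. a \<bullet> x = b}" by (rule empty_interior_subset_hyperplane[OF conv True])
    show ?thesis
    proof (cases "b \<le> 0")
      case True then show ?thesis using ab by (intro exI[of _ a]) auto
    next
      case False then show ?thesis using ab by (intro exI[of _ "- a"]) auto
    qed
  next
    case False
    obtain a where a: "a \<noteq> 0" "\<forall>x\<in>interior S. 0 \<le> a \<bullet> x"
      using separating_hyperplane_set_0[OF convex_interior[OF conv] z] by blast
    have "closure (interior S) \<subseteq> {x. a \<bullet> x \<ge> 0}"
      by (rule closure_minimal) (use a in \<open>auto simp: closed_halfspace_ge\<close>)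
    then have "S \<subseteq> {x. a \<bullet> x \<ge> 0}"
      using convex_closure_interior[OF conv False] closure_subset[of S] by auto
    then show ?thesis using a by (intro exI[of _ "- a"]) auto
  qed
  then obtain a where a: "a \<noteq> 0" "\<forall>x\<in>S. a \<bullet> x \<le> 0" by blast
  obtain B where B: "\<forall>y\<in>polar S. norm y \<le> B" using bd bounded_iff by blast
  define t where "t = (\<bar>B\<bar> + 1) / norm a"
  have "t *\<^sub>R a \<in> polar S"
    unfolding polar_def
  proof (intro CollectI ballI)
    fix x assume "x \<in> S"
    then have "a \<bullet> x \<le> 0" using a by blast
    moreover have "0 \<le> t" by (simp add: t_def)
    ultimately have "t * (a \<bullet> x) \<le> 0" by (simp add: mult_nonneg_nonpos)
    then show "x \<bullet> t *\<^sub>R a \<le> 1" by (simp add: inner_commute)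
  qed
  then have "norm (t *\<^sub>R a) \<le> B" using B by blast
  then show False using a(1) by (simp add: t_def)
qed

lemma (in origin_polytope) facet_sets_normals:
  "facet_sets P = (\<lambda>n. {v \<in> vertices P. n \<bullet> v = 1}) ` vertices (polar P)"
proof -
  have e: "vertices P \<inter> F = {v \<in> vertices P. normal F \<bullet> v = 1}" if "F facet_of P" for F
    using mem_facet_iff[OF that] vertices_subset[of P] by blast
  show ?thesis unfolding facet_sets_def vertices_polar using e by (auto simp: image_iff)
qed

lemma (in origin_polytope) facet_sets_polar:
  "facet_sets (polar P) = (\<lambda>v. normal ` {F. F facet_of P \<and> v \<in> F}) ` vertices P"
proof -
  have e: "vertices (polar P) \<inter> dual_facet v = normal ` {F. F facet_of P \<and> v \<in> F}" if "v \<in> vertices P" for v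
    unfolding vertices_polar using normal_mem_dual_facet[OF _ that] by blast
  have "facet_sets (polar P) = (\<lambda>G. vertices (polar P) \<inter> G) ` {G. G facet_of polar P}"
    unfolding facet_sets_def by blast
  also have "\<dots> = (\<lambda>v. vertices (polar P) \<inter> dual_facet v) ` vertices P" unfolding facets_polar by blast
  also have "\<dots> = (\<lambda>v. normal ` {F. F facet_of P \<and> v \<in> F}) ` vertices P" using e by (rule image_cong[OF refl])
  finally show ?thesis .
qed

text \<open>The vertices of the polar are the facet normals, and a facet of the polar collects the
  normals of the facets through one vertex. So the bijection \<gamma> of facets induced by \<phi>
  serves as the vertex bijection of the polars.\<close>

lemma combinatorially_equivalent_polar:
  fixes P Q :: "'a::euclidean_space set"
  assumes "origin_polytope P" "origin_polytope Q" and eqv: "combinatorially_equivalent P Q"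
  shows "combinatorially_equivalent (polar P) (polar Q)"
proof -
  interpret P: origin_polytope P by fact
  interpret Q: origin_polytope Q by fact
  obtain \<phi> where \<phi>: "bij_betw \<phi> (vertices P) (vertices Q)" "(`) \<phi> ` facet_sets P = facet_sets Q"
    by (rule vertex_bij_of_combinatorially_equivalent[OF P.poly Q.poly eqv])
  have inj: "inj_on \<phi> (vertices P)" and im: "\<phi> ` vertices P = vertices Q" using \<phi>(1) by (auto simp: bij_betw_def)
  have "\<forall>F\<in>{F. F facet_of P}. \<exists>G. G facet_of Q \<and> vertices Q \<inter> G = \<phi> ` (vertices P \<inter> F)"
  proof
    fix F assume "F \<in> {F. F facet_of P}"
    then have "vertices P \<inter> F \<in> facet_sets P" unfolding facet_sets_def by blast
    then have "\<phi> ` (vertices P \<inter> F) \<in> facet_sets Q" unfolding \<phi>(2)[symmetric] by (rule imageI)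
    then show "\<exists>G. G facet_of Q \<and> vertices Q \<inter> G = \<phi> ` (vertices P \<inter> F)" unfolding facet_sets_def by auto
  qed
  from bchoice[OF this] obtain \<gamma> where
    \<gamma>: "\<forall>F\<in>{F. F facet_of P}. \<gamma> F facet_of Q \<and> vertices Q \<inter> \<gamma> F = \<phi> ` (vertices P \<inter> F)" by (elim exE)
  then have \<gamma>f: "\<gamma> F facet_of Q" and \<gamma>v: "vertices Q \<inter> \<gamma> F = \<phi> ` (vertices P \<inter> F)" if "F facet_of P" for F
    using that by simp_all
  have mem: "\<phi> v \<in> \<gamma> F \<longleftrightarrow> v \<in> F" if "F facet_of P" "v \<in> vertices P" for F v
  proof -
    have "\<phi> v \<in> \<gamma> F \<longleftrightarrow> \<phi> v \<in> vertices Q \<inter> \<gamma> F" using im that(2) by blast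
    also have "\<dots> \<longleftrightarrow> v \<in> F" unfolding \<gamma>v[OF that(1)] using inj that(2) by (auto dest: inj_onD)
    finally show ?thesis .
  qed
  have \<gamma>bij: "bij_betw \<gamma> {F. F facet_of P} {G. G facet_of Q}"
    unfolding bij_betw_def
  proof
    show "inj_on \<gamma> {F. F facet_of P}"
    proof
      fix F F' assume F: "F \<in> {F. F facet_of P}" "F' \<in> {F. F facet_of P}" "\<gamma> F = \<gamma> F'"
      then have "vertices P \<inter> F = vertices P \<inter> F'" using mem[of F] mem[of F'] by auto
      then show "F = F'" using face_eq_iff_vertices[OF P.poly] F facet_of_imp_face_of by blast
    qed
    show "\<gamma> ` {F. F facet_of P} = {G. G facet_of Q}"
    proof
      show "\<gamma> ` {F. F facet_of P} \<subseteq> {G. G facet_of Q}" using \<gamma>f by blast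
      show "{G. G facet_of Q} \<subseteq> \<gamma> ` {F. F facet_of P}"
      proof
        fix G assume "G \<in> {G. G facet_of Q}"
        then have G: "G facet_of Q" by simp
        then have "vertices Q \<inter> G \<in> facet_sets Q" unfolding facet_sets_def by blast
        then have "vertices Q \<inter> G \<in> (`) \<phi> ` facet_sets P" unfolding \<phi>(2) .
        then obtain F where F: "F facet_of P" "vertices Q \<inter> G = \<phi> ` (vertices P \<inter> F)" unfolding facet_sets_def by blast
        have "vertices Q \<inter> G = vertices Q \<inter> \<gamma> F" unfolding F(2) \<gamma>v[OF F(1)] ..
        then have "G = \<gamma> F"
          using face_eq_iff_vertices[OF Q.poly, of G "\<gamma> F"] G \<gamma>f[OF F(1)] by (simp add: facet_of_imp_face_of)
        then show "G \<in> \<gamma> ` {F. F facet_of P}" using F(1) by blast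
      qed
    qed
  qed
  define \<psi> where "\<psi> = Q.normal \<circ> (\<gamma> \<circ> inv_into {F. F facet_of P} P.normal)"
  have \<psi>n: "\<psi> (P.normal F) = Q.normal (\<gamma> F)" if "F facet_of P" for F
    using inv_into_f_f[OF P.inj_normal, of F] that by (simp add: \<psi>_def)
  have st: "\<psi> ` P.normal ` {F. F facet_of P \<and> v \<in> F} = Q.normal ` {G. G facet_of Q \<and> \<phi> v \<in> G}" if v: "v \<in> vertices P" for v
  proof -
    have "\<psi> ` P.normal ` {F. F facet_of P \<and> v \<in> F} = Q.normal ` \<gamma> ` {F. F facet_of P \<and> v \<in> F}"
      unfolding image_image by (rule image_cong) (auto simp: \<psi>n)
    also have "\<gamma> ` {F. F facet_of P \<and> v \<in> F} = {G. G facet_of Q \<and> \<phi> v \<in> G}"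
    proof
      show "\<gamma> ` {F. F facet_of P \<and> v \<in> F} \<subseteq> {G. G facet_of Q \<and> \<phi> v \<in> G}" using \<gamma>f mem v by blast
      show "{G. G facet_of Q \<and> \<phi> v \<in> G} \<subseteq> \<gamma> ` {F. F facet_of P \<and> v \<in> F}"
      proof
        fix G assume G: "G \<in> {G. G facet_of Q \<and> \<phi> v \<in> G}"
        then obtain F where "F facet_of P" "G = \<gamma> F" using \<gamma>bij unfolding bij_betw_def by blast
        then show "G \<in> \<gamma> ` {F. F facet_of P \<and> v \<in> F}" using G mem[of F v] v by blast
      qed
    qed
    finally show ?thesis .
  qed
  show ?thesis
  proof (rule combinatorially_equivalent_vertex_bij[OF P.polytope_polar Q.polytope_polar])
    show "bij_betw \<psi> (vertices (polar P)) (vertices (polar Q))"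
      unfolding \<psi>_def by (rule bij_betw_trans[OF bij_betw_trans[OF bij_betw_inv_into[OF P.bij_normal] \<gamma>bij] Q.bij_normal])
    have "(`) \<psi> ` facet_sets (polar P) = (\<lambda>v. Q.normal ` {G. G facet_of Q \<and> \<phi> v \<in> G}) ` vertices P"
      unfolding P.facet_sets_polar image_image[of "(`) \<psi>"] using st by (rule image_cong[OF refl])
    also have "\<dots> = (\<lambda>v. Q.normal ` {G. G facet_of Q \<and> v \<in> G}) ` (\<phi> ` vertices P)" by (simp add: image_image)
    also have "\<dots> = facet_sets (polar Q)" unfolding im Q.facet_sets_polar by (rule refl)
    finally show "(`) \<psi> ` facet_sets (polar P) = facet_sets (polar Q)" .
  qed
qed

text \<open>With labelled vertices a relabelling does the work of an isomorphism of face
  lattices.\<close>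

definition octahedral :: "'a::euclidean_space set \<Rightarrow> 'a \<Rightarrow> 'a \<Rightarrow> 'a \<Rightarrow> 'a \<Rightarrow> 'a \<Rightarrow> 'a \<Rightarrow> bool" where
  "octahedral P x x' y y' z z' \<longleftrightarrow> distinct [x, x', y, y', z, z'] \<and>
     vertices P = {x, x', y, y', z, z'} \<and> facet_sets P = octahedron_sets x x' y y' z z'"

definition bisimplicial :: "'a::euclidean_space set \<Rightarrow> 'a \<Rightarrow> 'a \<Rightarrow> 'a \<Rightarrow> 'a \<Rightarrow> 'a \<Rightarrow> bool" where
  "bisimplicial P s s' t1 t2 t3 \<longleftrightarrow> distinct [s, s', t1, t2, t3] \<and>
     vertices P = {s, s', t1, t2, t3} \<and> facet_sets P = bisimplex_sets s s' t1 t2 t3"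

lemma octahedral_equivalent:
  assumes "polytope P" "polytope Q" "octahedral P x x' y y' z z'" "octahedral Q u u' v v' w w'"
  shows "combinatorially_equivalent P Q"
proof -
  obtain \<phi> where \<phi>: "map \<phi> [x, x', y, y', z, z'] = [u, u', v, v', w, w']"
    "bij_betw \<phi> (set [x, x', y, y', z, z']) (set [u, u', v, v', w, w'])"
    using ex_bij_map_lists[of "[x, x', y, y', z, z']" "[u, u', v, v', w, w']"] assms(3,4) unfolding octahedral_def by auto
  show ?thesis
  proof (rule combinatorially_equivalent_vertex_bij[OF assms(1,2)])
    show "bij_betw \<phi> (vertices P) (vertices Q)" using \<phi>(2) assms(3,4) unfolding octahedral_def by simp
    show "(`) \<phi> ` facet_sets P = facet_sets Q"
      using \<phi>(1) assms(3,4) unfolding octahedral_def by (simp add: octahedron_sets_def)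
  qed
qed

lemma bisimplicial_equivalent:
  assumes "polytope P" "polytope Q" "bisimplicial P s s' t1 t2 t3" "bisimplicial Q u u' v1 v2 v3"
  shows "combinatorially_equivalent P Q"
proof -
  obtain \<phi> where \<phi>: "map \<phi> [s, s', t1, t2, t3] = [u, u', v1, v2, v3]"
    "bij_betw \<phi> (set [s, s', t1, t2, t3]) (set [u, u', v1, v2, v3])"
    using ex_bij_map_lists[of "[s, s', t1, t2, t3]" "[u, u', v1, v2, v3]"] assms(3,4) unfolding bisimplicial_def by auto
  show ?thesis
  proof (rule combinatorially_equivalent_vertex_bij[OF assms(1,2)])
    show "bij_betw \<phi> (vertices P) (vertices Q)" using \<phi>(2) assms(3,4) unfolding bisimplicial_def by simp
    show "(`) \<phi> ` facet_sets P = facet_sets Q"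
      using \<phi>(1) assms(3,4) unfolding bisimplicial_def by (simp add: bisimplex_sets_def)
  qed
qed

lemma octahedral_of_equivalent:
  assumes P: "polytope P" and Q: "polytope Q" and eqv: "combinatorially_equivalent P Q" and oct: "octahedral P x x' y y' z z'"
  shows "\<exists>u u' v v' w w'. octahedral Q u u' v v' w w'"
proof -
  obtain \<phi> where \<phi>: "bij_betw \<phi> (vertices P) (vertices Q)" "(`) \<phi> ` facet_sets P = facet_sets Q"
    by (rule vertex_bij_of_combinatorially_equivalent[OF P Q eqv])
  have o: "distinct [x, x', y, y', z, z']" "vertices P = set [x, x', y, y', z, z']" "facet_sets P = octahedron_sets x x' y y' z z'"
    using oct unfolding octahedral_def by auto
  have "distinct (map \<phi> [x, x', y, y', z, z'])" using \<phi>(1) o(1) unfolding o(2) bij_betw_def distinct_map by blast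
  moreover have "vertices Q = set (map \<phi> [x, x', y, y', z, z'])" using \<phi>(1) unfolding o(2) bij_betw_def set_map by simp
  moreover have "facet_sets Q = octahedron_sets (\<phi> x) (\<phi> x') (\<phi> y) (\<phi> y') (\<phi> z) (\<phi> z')"
    unfolding \<phi>(2)[symmetric] o(3) by (simp add: octahedron_sets_def)
  ultimately have "octahedral Q (\<phi> x) (\<phi> x') (\<phi> y) (\<phi> y') (\<phi> z) (\<phi> z')" unfolding octahedral_def by simp
  then show ?thesis by blast
qed

section \<open>The regular octahedron and a standard prism\<close>

abbreviation ax :: "3 \<Rightarrow> real^3" where "ax i \<equiv> axis i 1"

lemma Basis_ax: "(Basis :: (real^3) set) = {ax 1, ax 2, ax 3}"
  by (auto simp: Basis_vec_def UNIV_3)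

lemma inner_ax: "ax i \<bullet> y = y $ i" "y \<bullet> ax i = y $ i"
  by (simp_all add: inner_axis' inner_axis)

lemma ax_nth: "ax i $ j = (if i = j then 1 else 0)"
  by (simp add: axis_def)

lemma regular_octahedron_hull: "regular_octahedron = convex hull {ax 1, - ax 1, ax 2, - ax 2, ax 3, - ax 3}"
proof -
  have "Basis \<union> uminus ` Basis = {ax 1, - ax 1, ax 2, - ax 2, ax 3, - ax 3}" unfolding Basis_ax by auto
  then show ?thesis unfolding regular_octahedron_def by simp
qed

lemma mem_cube: "y \<in> cbox (- One) One \<longleftrightarrow> (\<forall>i. \<bar>y $ i\<bar> \<le> 1)" for y :: "real^3"
proof -
  have "y \<in> cbox (- One) One \<longleftrightarrow> (\<forall>i\<in>Basis. - 1 \<le> y \<bullet> i \<and> y \<bullet> i \<le> 1)" by (simp add: mem_box)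
  then show ?thesis unfolding Basis_ax by (auto simp: inner_ax forall_3 abs_le_iff)
qed

lemma polar_regular_octahedron: "polar regular_octahedron = cbox (- One) One"
  unfolding regular_octahedron_hull polar_convex_hull
  by (auto simp: mem_cube inner_ax forall_3 abs_le_iff)

lemma origin_polytope_regular_octahedron: "origin_polytope regular_octahedron"
proof
  show "polytope regular_octahedron" unfolding regular_octahedron_hull by (rule polytope_convex_hull) simp
  show "0 \<in> interior regular_octahedron"
  proof (rule zero_interior_of_bounded_polar)
    show "convex regular_octahedron" by (simp add: regular_octahedron_def)
    show "bounded (polar regular_octahedron)" by (simp add: polar_regular_octahedron)
  qed
qed

lemma vertices_regular_octahedron: "vertices regular_octahedron = {ax 1, - ax 1, ax 2, - ax 2, ax 3, - ax 3}" (is "_ = ?S")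
proof
  interpret origin_polytope regular_octahedron by (rule origin_polytope_regular_octahedron)
  show sub: "vertices regular_octahedron \<subseteq> ?S"
    unfolding vertices_def regular_octahedron_hull by (rule extreme_points_of_convex_hull)
  show "?S \<subseteq> vertices regular_octahedron"
  proof
    fix x assume x: "x \<in> ?S"
    have xx: "x \<bullet> x = 1" using x by (elim insertE emptyE) (simp_all add: inner_ax ax_nth)
    have xy: "\<forall>y\<in>?S. y = x \<or> x \<bullet> y \<le> 0"
      using x by (elim insertE emptyE; hypsubst) (simp_all add: inner_ax ax_nth)
    show "x \<in> vertices regular_octahedron"
    proof (rule vertexI[OF poly sub, of _ x])
      show "x \<in> regular_octahedron" unfolding regular_octahedron_hull by (rule hull_inc[OF x])
      show "x \<bullet> y < x \<bullet> x" if y: "y \<in> ?S" "y \<noteq> x" for y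
        using bspec[OF xy y(1)] y(2) xx by linarith
    qed
  qed
qed

lemma sign_cases:
  fixes n :: "real^'n"
  assumes "\<forall>i. \<bar>n $ i\<bar> = 1"
  shows "n $ i = 1 \<or> n $ i = - 1"
  using assms[rule_format, of i] by linarith

lemma vertices_cube: "vertices (cbox (- One) One :: (real^3) set) = {n. \<forall>i. \<bar>n $ i\<bar> = 1}" (is "_ = ?N")
proof
  interpret R: origin_polytope regular_octahedron by (rule origin_polytope_regular_octahedron)
  have poly: "polytope (cbox (- One) One :: (real^3) set)"
    using R.polytope_polar unfolding polar_regular_octahedron .
  show sub: "vertices (cbox (- One) One) \<subseteq> ?N"
  proof (rule subsetI, rule ccontr)
    fix n :: "real^3" assume n: "n \<in> vertices (cbox (- One) One)" "n \<notin> ?N"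
    then have nc: "n \<in> cbox (- One) One" using vertices_subset by blast
    then obtain i where i: "\<bar>n $ i\<bar> < 1" using n(2) unfolding mem_cube by (auto simp: order_less_le)
    define t where "t = 1 - \<bar>n $ i\<bar>"
    have t: "t > 0" using i by (simp add: t_def)
    have c: "n + s *\<^sub>R ax i \<in> cbox (- One) One" if s: "\<bar>s\<bar> \<le> t" for s
      unfolding mem_cube
    proof
      fix j show "\<bar>(n + s *\<^sub>R ax i) $ j\<bar> \<le> 1"
        using nc[unfolded mem_cube, rule_format, of j] s by (auto simp: ax_nth t_def)
    qed
    have "n + t *\<^sub>R ax i \<in> cbox (- One) One" "n + (- t) *\<^sub>R ax i \<in> cbox (- One) One"
      by (rule c; use t in simp)+
    moreover have "n \<in> open_segment (n + t *\<^sub>R ax i) (n + (- t) *\<^sub>R ax i)"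
    proof -
      have "(n + t *\<^sub>R ax i) $ i \<noteq> (n + (- t) *\<^sub>R ax i) $ i" using t by (simp add: ax_nth)
      then have "n + t *\<^sub>R ax i \<noteq> n + (- t) *\<^sub>R ax i" by metis
      moreover have "n = (1 - 1/2) *\<^sub>R (n + t *\<^sub>R ax i) + (1/2) *\<^sub>R (n + (- t) *\<^sub>R ax i)"
        by (simp add: Finite_Cartesian_Product.vec_eq_iff field_simps)
      ultimately show ?thesis unfolding in_segment by (intro conjI exI[of _ "1/2"]) simp_all
    qed
    ultimately show False using n(1) by (auto simp: vertices_def extreme_point_of_def)
  qed
  show "?N \<subseteq> vertices (cbox (- One) One)"
  proof
    fix n :: "real^3" assume n: "n \<in> ?N"
    show "n \<in> vertices (cbox (- One) One)"
    proof (rule vertexI[OF poly sub, of _ n])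
      show "n \<in> cbox (- One) One" using n by (simp add: mem_cube)
      fix y assume y: "y \<in> ?N" "y \<noteq> n"
      have le: "n $ i * y $ i \<le> 1 \<and> n $ i * n $ i = 1 \<and> (n $ i * y $ i = 1 \<longrightarrow> y $ i = n $ i)" for i
        using sign_cases[of n i] sign_cases[of y i] n y(1) by auto
      obtain j where "y $ j \<noteq> n $ j" using y(2) by (auto simp: Finite_Cartesian_Product.vec_eq_iff)
      then have "n $ j * y $ j < n $ j * n $ j" using le[of j] by linarith
      then show "n \<bullet> y < n \<bullet> n"
        unfolding inner_vec_def inner_real_def
        by (intro sum_strict_mono_ex1) (use le in auto)
    qed
  qed
qed

text \<open>The facet normals are the vertices of the polar cube, that is, the sign vectors; the
  normal \<open>n\<close> selects from each antipodal pair the vertex with the sign of its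
  coordinate.\<close>

lemma octahedral_regular_octahedron: "octahedral regular_octahedron (ax 1) (- ax 1) (ax 2) (- ax 2) (ax 3) (- ax 3)"
proof -
  interpret origin_polytope regular_octahedron by (rule origin_polytope_regular_octahedron)
  let ?V = "{ax 1, - ax 1, ax 2, - ax 2, ax 3, - ax 3}"
  have d: "distinct [ax 1, - ax 1, ax 2, - ax 2, ax 3, - ax 3]"
    by (auto simp: Finite_Cartesian_Product.vec_eq_iff forall_3 ax_nth)
  have s: "{v \<in> ?V. n \<bullet> v = 1} = {(n $ 1) *\<^sub>R ax 1, (n $ 2) *\<^sub>R ax 2, (n $ 3) *\<^sub>R ax 3}" if "\<forall>i. \<bar>n $ i\<bar> = 1" for n :: "real^3"
  proof -
    have c: "n $ i = 1 \<or> n $ i = -1" for i using sign_cases[OF that] .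
    show ?thesis using c[of 1] c[of 2] c[of 3] by (elim disjE) (auto simp: inner_ax)
  qed
  have "facet_sets regular_octahedron = (\<lambda>n. {v \<in> ?V. n \<bullet> v = 1}) ` {n. \<forall>i. \<bar>n $ i\<bar> = 1}"
    unfolding facet_sets_normals polar_regular_octahedron vertices_cube vertices_regular_octahedron ..
  also have "\<dots> = (\<lambda>n. {(n $ 1) *\<^sub>R ax 1, (n $ 2) *\<^sub>R ax 2, (n $ 3) *\<^sub>R ax 3}) ` {n :: real^3. \<forall>i. \<bar>n $ i\<bar> = 1}"
    by (rule image_cong[OF refl]) (rule s, simp)
  also have "\<dots> = octahedron_sets (ax 1) (- ax 1) (ax 2) (- ax 2) (ax 3) (- ax 3)" (is "?f ` ?N = ?O")
  proof
    show "?f ` ?N \<subseteq> ?O"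
    proof (rule image_subsetI)
      fix n :: "real^3" assume "n \<in> ?N"
      then have c: "n $ i = 1 \<or> n $ i = -1" for i using sign_cases[of n i] by simp
      show "?f n \<in> ?O" using c[of 1] c[of 2] c[of 3] unfolding octahedron_sets_def by (elim disjE) simp_all
    qed
    have m: "{a *\<^sub>R ax 1, b *\<^sub>R ax 2, c *\<^sub>R ax 3} \<in> ?f ` ?N" if "\<bar>a\<bar> = 1" "\<bar>b\<bar> = 1" "\<bar>c\<bar> = 1" for a b c
      by (rule image_eqI[of _ _ "vector [a, b, c]"]) (use that in \<open>simp_all add: vector_3 forall_3\<close>)
    show "?O \<subseteq> ?f ` ?N"
      unfolding octahedron_sets_def insert_subset
      using m[of 1 1 1] m[of 1 1 "-1"] m[of 1 "-1" 1] m[of 1 "-1" "-1"] m[of "-1" 1 1] m[of "-1" 1 "-1"] m[of "-1" "-1" 1] m[of "-1" "-1" "-1"]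
      by simp
  qed
  finally show ?thesis unfolding octahedral_def vertices_regular_octahedron using d by simp
qed

lemma octahedron_iff_octahedral:
  "octahedron P \<longleftrightarrow> polytope P \<and> (\<exists>x x' y y' z z'. octahedral P x x' y y' z z')"
proof -
  interpret origin_polytope regular_octahedron by (rule origin_polytope_regular_octahedron)
  show ?thesis
  proof
    assume "octahedron P"
    then show "polytope P \<and> (\<exists>x x' y y' z z'. octahedral P x x' y y' z z')"
      unfolding octahedron_def
      using octahedral_of_equivalent[OF poly _ combinatorially_equivalent_sym octahedral_regular_octahedron] by blast
  next
    assume "polytope P \<and> (\<exists>x x' y y' z z'. octahedral P x x' y y' z z')"
    then show "octahedron P"
      unfolding octahedron_def using octahedral_equivalent[OF _ poly _ octahedral_regular_octahedron] by blast
  qed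
qed

text \<open>Polarity produces the centred cube of side two, whereas \<open>cuboid\<close> refers to
  the unit cube.\<close>

lemma cube_equivalent_unit_cube: "combinatorially_equivalent (cbox (- One) One :: (real^3) set) (cbox (0 :: real^3) One)"
proof -
  have lin: "linear (\<lambda>x :: real^3. (1/2) *\<^sub>R x)" by (rule linear_scaleR)
  have inj: "inj (\<lambda>x :: real^3. (1/2) *\<^sub>R x)" by (auto intro: injI)
  let ?h = "\<lambda>x :: real^3. (1/2) *\<^sub>R x"
  let ?C = "cbox (- One) One :: (real^3) set"
  have "bij_betw ((`) ?h) {F. F face_of ?C} {G. G face_of ?h ` ?C}"
    unfolding faces_of_linear_image[OF lin inj]
    by (rule inj_on_imp_bij_betw) (use inj in \<open>auto simp: inj_on_def inj_image_eq_iff\<close>)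
  then have 1: "combinatorially_equivalent ?C (?h ` ?C)"
    unfolding combinatorially_equivalent_def using inj_image_subset_iff[OF inj] by (intro exI[of _ "(`) ?h"]) auto
  have 2: "combinatorially_equivalent (?h ` ?C) ((\<lambda>x. x + (1/2) *\<^sub>R One) ` ?h ` ?C)"
    by (rule combinatorially_equivalent_translation)
  have 3: "(\<lambda>x. x + (1/2) *\<^sub>R One) ` ?h ` ?C = cbox 0 One"
  proof -
    have "0 \<in> ?C" by (simp add: mem_cube)
    then have ne: "?C \<noteq> {}" by blast
    have "(\<lambda>x. x + (1/2) *\<^sub>R One) ` ?h ` ?C = (\<lambda>x. (1/2) *\<^sub>R x + (1/2) *\<^sub>R One) ` ?C" by (simp add: image_image)
    also have "\<dots> = cbox ((1/2) *\<^sub>R (- One) + (1/2) *\<^sub>R One) ((1/2) *\<^sub>R One + (1/2) *\<^sub>R One)"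
      unfolding image_affinity_cbox using ne by simp
    also have "\<dots> = cbox 0 One" by (simp add: scaleR_left_distrib[symmetric])
    finally show ?thesis .
  qed
  show ?thesis using combinatorially_equivalent_trans[OF 1 2] unfolding 3 .
qed

text \<open>The three equatorial points sum to zero, so the origin is an interior point and the
  polar is a prism with vertices that can be written down.\<close>

definition standard_bisimplex :: "(real^3) set" where
  "standard_bisimplex = convex hull {ax 3, - ax 3, ax 1, ax 2, - ax 1 - ax 2}"

text \<open>The corners of the triangle with \<open>y $ 1 \<le> 1\<close>,
  \<open>y $ 2 \<le> 1\<close> and \<open>- y $ 1 - y $ 2 \<le> 1\<close>, placed at height -1. The
  inequalities belong to the equatorial vertices of \<open>standard_bisimplex\<close>.\<close>

definition prism_base :: "(real^3) set" where
  "prism_base = {vector [1, 1, - 1], vector [1, - 2, - 1], vector [- 2, 1, - 1]}"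

definition standard_prism :: "(real^3) set" where
  "standard_prism = convex hull (prism_base \<union> (\<lambda>x. x + 2 *\<^sub>R ax 3) ` prism_base)"

lemma prism_top: "(\<lambda>x. x + 2 *\<^sub>R ax 3) ` prism_base = {vector [1, 1, 1], vector [1, - 2, 1], vector [- 2, 1, 1]}"
proof -
  have "vector [a, b, - 1] + 2 *\<^sub>R ax 3 = (vector [a, b, 1] :: real^3)" for a b
    by (simp add: Finite_Cartesian_Product.vec_eq_iff forall_3 vector_3 ax_nth)
  then show ?thesis by (simp add: prism_base_def)
qed

lemma polar_standard_bisimplex: "polar standard_bisimplex = standard_prism"
proof
  have in_polar: "y \<in> polar standard_bisimplex \<longleftrightarrow> \<bar>y $ 3\<bar> \<le> 1 \<and> y $ 1 \<le> 1 \<and> y $ 2 \<le> 1 \<and> - y $ 1 - y $ 2 \<le> 1" for y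
    unfolding standard_bisimplex_def polar_convex_hull by (auto simp: inner_ax inner_diff_left abs_le_iff)
  show "polar standard_bisimplex \<subseteq> standard_prism"
  proof
    fix y assume "y \<in> polar standard_bisimplex"
    then have y: "\<bar>y $ 3\<bar> \<le> 1" "y $ 1 \<le> 1" "y $ 2 \<le> 1" "- y $ 1 - y $ 2 \<le> 1" by (simp_all add: in_polar)
    define p where "p = vector [y $ 1, y $ 2, - 1] + 0 *\<^sub>R ax 3"
    let ?B = "convex hull prism_base"
    have p: "p \<in> ?B"
    proof -
      \<comment> \<open>Barycentric coordinates: each weight is the slack of the inequality opposite
        to that corner, divided by 3 because the three slacks add up to 3.\<close>
      have "p = ((1 + y $ 1 + y $ 2) / 3) *\<^sub>R vector [1, 1, - 1] + ((1 - y $ 2) / 3) *\<^sub>R vector [1, - 2, - 1] + ((1 - y $ 1) / 3) *\<^sub>R vector [- 2, 1, - 1]"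
        by (simp add: p_def Finite_Cartesian_Product.vec_eq_iff forall_3 vector_3 field_simps)
      moreover have "(1 + y $ 1 + y $ 2) / 3 + (1 - y $ 2) / 3 + (1 - y $ 1) / 3 = 1" by (simp add: field_simps)
      ultimately show ?thesis
        unfolding prism_base_def convex_hull_3 using y
        by (intro CollectI exI[of _ "(1 + y $ 1 + y $ 2) / 3"] exI[of _ "(1 - y $ 2) / 3"] exI[of _ "(1 - y $ 1) / 3"]) simp
    qed
    have sub: "?B \<subseteq> standard_prism" "convex hull ((\<lambda>x. x + 2 *\<^sub>R ax 3) ` prism_base) \<subseteq> standard_prism"
      unfolding standard_prism_def by (rule hull_mono; blast)+
    have "p + 2 *\<^sub>R ax 3 \<in> (\<lambda>x. x + 2 *\<^sub>R ax 3) ` ?B" using p by blast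
    also have "\<dots> = (+) (2 *\<^sub>R ax 3) ` ?B" by (auto simp: add.commute)
    also have "\<dots> = convex hull ((+) (2 *\<^sub>R ax 3) ` prism_base)" by (rule convex_hull_translation[symmetric])
    also have "(+) (2 *\<^sub>R ax 3) ` prism_base = (\<lambda>x. x + 2 *\<^sub>R ax 3) ` prism_base" by (auto simp: add.commute)
    finally have q: "p + 2 *\<^sub>R ax 3 \<in> standard_prism" using sub(2) by blast
    have e: "y = (1 - (1 + y $ 3) / 2) *\<^sub>R p + ((1 + y $ 3) / 2) *\<^sub>R (p + 2 *\<^sub>R ax 3)"
      by (simp add: p_def Finite_Cartesian_Product.vec_eq_iff forall_3 vector_3 ax_nth field_simps)
    show "y \<in> standard_prism"
      by (subst e, rule convexD_alt) (use p q sub(1) y(1) in \<open>auto simp: standard_prism_def abs_le_iff\<close>)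
  qed
  show "standard_prism \<subseteq> polar standard_bisimplex"
    unfolding standard_prism_def prism_top
  proof (rule hull_minimal)
    show "prism_base \<union> {vector [1, 1, 1], vector [1, - 2, 1], vector [- 2, 1, 1]} \<subseteq> polar standard_bisimplex"
      by (simp add: prism_base_def in_polar vector_3)
    have "polar standard_bisimplex = (\<Inter>x\<in>standard_bisimplex. {y. x \<bullet> y \<le> 1})" by (auto simp: polar_def)
    then show "convex (polar standard_bisimplex)" by (simp add: convex_INT convex_halfspace_le)
  qed
qed

lemma polytope_standard_prism: "polytope standard_prism"
  unfolding standard_prism_def by (rule polytope_convex_hull) (simp add: prism_base_def)

lemma origin_polytope_standard_bisimplex: "origin_polytope standard_bisimplex"
proof
  show "polytope standard_bisimplex" unfolding standard_bisimplex_def by (rule polytope_convex_hull) simp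
  show "0 \<in> interior standard_bisimplex"
  proof (rule zero_interior_of_bounded_polar)
    show "convex standard_bisimplex" by (simp add: standard_bisimplex_def)
    show "bounded (polar standard_bisimplex)"
      unfolding polar_standard_bisimplex by (rule polytope_imp_bounded[OF polytope_standard_prism])
  qed
qed

lemma vertices_standard_prism:
  "vertices standard_prism = {vector [1, 1, - 1], vector [1, - 2, - 1], vector [- 2, 1, - 1], vector [1, 1, 1], vector [1, - 2, 1], vector [- 2, 1, 1]}"
    (is "_ = ?S")
proof
  have hull: "standard_prism = convex hull ?S"
    unfolding standard_prism_def prism_top by (simp only: prism_base_def Un_insert_left Un_empty_left)
  show sub: "vertices standard_prism \<subseteq> ?S"
    unfolding vertices_def hull by (rule extreme_points_of_convex_hull)
  have S: "x \<in> standard_prism" if "x \<in> ?S" for x unfolding hull by (rule hull_inc[OF that])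
  have v: "x \<in> vertices standard_prism"
    if x: "x \<in> ?S" and c: "c \<bullet> x = 3" "\<forall>y\<in>?S. y = x \<or> c \<bullet> y < 3" for x c
    by (rule vertexI[OF polytope_standard_prism sub S[OF x], of c]) (use c in auto)
  have ip: "vector [a, b, c] \<bullet> (vector [a', b', c'] :: real^3) = a * a' + b * b' + c * c'" for a b c a' b' c' :: real
    by (simp add: inner_vec_def sum_3 vector_3)
  show "?S \<subseteq> vertices standard_prism"
    unfolding insert_subset
  proof (intro conjI empty_subsetI)
    show "vector [1, 1, - 1] \<in> vertices standard_prism" by (rule v[of _ "vector [1, 1, - 1]"]) (simp_all add: ip)
    show "vector [1, - 2, - 1] \<in> vertices standard_prism" by (rule v[of _ "vector [0, - 1, - 1]"]) (simp_all add: ip)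
    show "vector [- 2, 1, - 1] \<in> vertices standard_prism" by (rule v[of _ "vector [- 1, 0, - 1]"]) (simp_all add: ip)
    show "vector [1, 1, 1] \<in> vertices standard_prism" by (rule v[of _ "vector [1, 1, 1]"]) (simp_all add: ip)
    show "vector [1, - 2, 1] \<in> vertices standard_prism" by (rule v[of _ "vector [0, - 1, 1]"]) (simp_all add: ip)
    show "vector [- 2, 1, 1] \<in> vertices standard_prism" by (rule v[of _ "vector [- 1, 0, 1]"]) (simp_all add: ip)
  qed
qed

lemma vertices_standard_bisimplex: "vertices standard_bisimplex = {ax 3, - ax 3, ax 1, ax 2, - ax 1 - ax 2}" (is "_ = ?S")
proof
  interpret origin_polytope standard_bisimplex by (rule origin_polytope_standard_bisimplex)
  show sub: "vertices standard_bisimplex \<subseteq> ?S"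
    unfolding vertices_def standard_bisimplex_def by (rule extreme_points_of_convex_hull)
  have S: "x \<in> standard_bisimplex" if "x \<in> ?S" for x unfolding standard_bisimplex_def by (rule hull_inc[OF that])
  have v: "x \<in> vertices standard_bisimplex"
    if x: "x \<in> ?S" and c: "c \<bullet> x > 0" "\<forall>y\<in>?S. y = x \<or> c \<bullet> y \<le> 0" for x c
    by (rule vertexI[OF poly sub S[OF x], of c]) (use c in \<open>auto intro: le_less_trans\<close>)
  show "?S \<subseteq> vertices standard_bisimplex"
    unfolding insert_subset
  proof (intro conjI empty_subsetI)
    show "ax 3 \<in> vertices standard_bisimplex" by (rule v[of _ "ax 3"]) (simp_all add: inner_ax ax_nth)
    show "- ax 3 \<in> vertices standard_bisimplex" by (rule v[of _ "- ax 3"]) (simp_all add: inner_ax ax_nth)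
    show "ax 1 \<in> vertices standard_bisimplex" by (rule v[of _ "ax 1"]) (simp_all add: inner_ax ax_nth)
    show "ax 2 \<in> vertices standard_bisimplex" by (rule v[of _ "ax 2"]) (simp_all add: inner_ax ax_nth)
    show "- ax 1 - ax 2 \<in> vertices standard_bisimplex" by (rule v[of _ "- ax 1 - ax 2"]) (simp_all add: inner_ax ax_nth inner_diff_left)
  qed
qed

lemma bisimplicial_standard_bisimplex: "bisimplicial standard_bisimplex (ax 3) (- ax 3) (ax 1) (ax 2) (- ax 1 - ax 2)"
proof -
  interpret origin_polytope standard_bisimplex by (rule origin_polytope_standard_bisimplex)
  let ?V = "{ax 3, - ax 3, ax 1, ax 2, - ax 1 - ax 2}"
  have d: "distinct [ax 3, - ax 3, ax 1, ax 2, - ax 1 - ax 2]"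
    by (auto simp: Finite_Cartesian_Product.vec_eq_iff forall_3 ax_nth)
  have ins: "{v \<in> insert x S. Q v} = (if Q x then insert x {v \<in> S. Q v} else {v \<in> S. Q v})" "{v \<in> {}. Q v} = {}"
    for x :: "real^3" and S Q by auto
  have "facet_sets standard_bisimplex = bisimplex_sets (ax 3) (- ax 3) (ax 1) (ax 2) (- ax 1 - ax 2)"
    unfolding facet_sets_normals polar_standard_bisimplex vertices_standard_prism vertices_standard_bisimplex
      image_insert image_empty ins bisimplex_sets_def
    by (simp add: inner_ax inner_diff_right vector_3 insert_commute)
  then show ?thesis unfolding bisimplicial_def vertices_standard_bisimplex using d by simp
qed

lemma prism_over_standard_prism: "2 simplex (convex hull prism_base) \<and> prism_over (convex hull prism_base) standard_prism"
proof
  have d: "distinct [vector [1, 1, - 1], vector [1, - 2, - 1], vector [- 2, 1, - 1] :: real^3]"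
    by (auto simp: Finite_Cartesian_Product.vec_eq_iff forall_3 vector_3)
  have "\<not> affine_dependent prism_base" unfolding prism_base_def
    by (rule three_vertices_not_collinear[of _ standard_prism, OF _ _ _ d]) (simp_all add: vertices_standard_prism)
  moreover have "card prism_base = 3" unfolding prism_base_def using d by simp
  ultimately show "2 simplex (convex hull prism_base)" unfolding simplex_def by (intro exI[of _ prism_base]) simp
  let ?t = "\<lambda>x. x + 2 *\<^sub>R ax 3"
  have hull: "affine hull (convex hull prism_base) \<subseteq> {x. ax 3 \<bullet> x = - 1}"
    unfolding affine_hull_convex_hull
  proof (rule hull_minimal)
    show "prism_base \<subseteq> {x. ax 3 \<bullet> x = - 1}" by (simp add: prism_base_def inner_ax vector_3)
  qed (rule affine_hyperplane)
  show "prism_over (convex hull prism_base) standard_prism"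
    unfolding prism_over_def
  proof (intro exI[of _ "2 *\<^sub>R ax 3"] conjI ballI)
    fix x assume "x \<in> convex hull prism_base"
    then have "ax 3 \<bullet> x = - 1" using hull hull_subset[of "convex hull prism_base" affine] by blast
    then have "ax 3 \<bullet> (x + 2 *\<^sub>R ax 3) \<noteq> - 1" by (simp add: inner_add_right inner_ax ax_nth)
    then show "x + 2 *\<^sub>R ax 3 \<notin> affine hull (convex hull prism_base)" using hull by blast
  next
    have "?t ` (convex hull prism_base) = convex hull (?t ` prism_base)"
      using convex_hull_translation[of "2 *\<^sub>R ax 3" prism_base] by (simp add: add.commute)
    then show "standard_prism = convex hull (convex hull prism_base \<union> ?t ` (convex hull prism_base))"
      unfolding standard_prism_def by (simp only: hull_Un_left[symmetric] hull_Un_right[symmetric])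
  qed
qed

section \<open>Factorizations of the listed polytopes\<close>

text \<open>Carries the homogeneous coordinates in \<open>'a \<times> real\<close> to
  \<open>real^4\<close>.\<close>

lemma ex_linear_isometry:
  assumes "DIM('a::euclidean_space) = DIM('b::euclidean_space)"
  shows "\<exists>f :: 'a \<Rightarrow> 'b. \<forall>x y. f x \<bullet> f y = x \<bullet> y"
proof -
  have d: "dim (UNIV :: 'a set) = dim (UNIV :: 'b set)" using assms by simp
  obtain f :: "'a \<Rightarrow> 'b" and g where f: "linear f" "\<And>x. x \<in> UNIV \<Longrightarrow> norm (f x) = norm x"
    using isometries_subspaces[OF subspace_UNIV subspace_UNIV d] by metis
  have "f x \<bullet> f y = x \<bullet> y" for x y
    using f(2) unfolding dot_norm linear_add[OF f(1), symmetric] by simp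
  then show ?thesis by blast
qed

text \<open>A facet misses at most two of the five vertices, and then the affine dependency makes the weighted slacks
  \<open>l v * s F v\<close> at these two agree.\<close>

lemma few_vertices_factorization:
  fixes P :: "'a::euclidean_space set"
  assumes poly: "polytope P" and dim: "aff_dim P = 3" "DIM('a) = 3" and few: "card (vertices P) \<le> 5"
  shows "\<exists>a b. psd_factorization P a b"
proof -
  interpret polytope3 P using poly dim(1) by unfold_locales
  interpret incidence "vertices P" "{F. F facet_of P}" "(\<in>)" by (rule incidence[OF dim(2)])
  obtain c d where "\<forall>F. F facet_of P \<longrightarrow> P \<subseteq> {x. c F \<bullet> x \<le> d F} \<and> F = P \<inter> {x. c F \<bullet> x = d F}"
    using facet_functionals[OF poly] by (elim exE)
  then have cd: "P \<subseteq> {x. c F \<bullet> x \<le> d F}" "F = P \<inter> {x. c F \<bullet> x = d F}" if "F facet_of P" for F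
    using that by blast+
  define s where "s = (\<lambda>F v. d F - c F \<bullet> v)"
  have s0: "s F v = 0 \<longleftrightarrow> v \<in> F" and s1: "0 \<le> s F v" if "F facet_of P" "v \<in> vertices P" for F v
  proof -
    have v: "v \<in> P" using that(2) vertices_subset by blast
    have "v \<in> F \<longleftrightarrow> c F \<bullet> v = d F" using v cd(2)[OF that(1)] by blast
    then show "s F v = 0 \<longleftrightarrow> v \<in> F" unfolding s_def by auto
    show "0 \<le> s F v" using v cd(1)[OF that(1)] unfolding s_def by auto
  qed
  have missing: "card {v \<in> vertices P. v \<notin> F} \<le> card (vertices P) - 3" if F: "F facet_of P" for F
  proof -
    have "3 \<le> card (on F)" using on_ge3[of F] F by simp
    moreover have "{v \<in> vertices P. v \<notin> F} = vertices P - on F" by (auto simp: on_def)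
    moreover have "card (vertices P - on F) = card (vertices P) - card (on F)"
      by (rule card_Diff_subset[OF finite_on]) (auto simp: on_def)
    ultimately show ?thesis by simp
  qed
  have "\<exists>l. (\<forall>v\<in>vertices P. 0 < l v) \<and> (\<forall>F u w. F facet_of P \<longrightarrow> u \<in> vertices P - F \<longrightarrow> w \<in> vertices P - F \<longrightarrow> l u * s F u = l w * s F w)"
  proof (cases "card (vertices P) = 5")
    case False
    have "u = w" if "F facet_of P" "u \<in> vertices P - F" "w \<in> vertices P - F" for F u w
    proof -
      have "card {u, w} \<le> card {v \<in> vertices P. v \<notin> F}" by (rule card_mono) (use that finV in auto)
      also have "\<dots> \<le> 1" using missing[OF that(1)] few False by simp
      finally show "u = w" by (cases "u = w") simp_all
    qed
    then show ?thesis by (intro exI[of _ "\<lambda>_. 1"]) auto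
  next
    case c5: True
    have "affine_dependent (vertices P)" by (rule affine_dependent_biggerset[OF finV]) (simp add: c5 dim(2))
    then obtain f where f: "sum f (vertices P) = 0" "\<exists>v\<in>vertices P. f v \<noteq> 0" "(\<Sum>v\<in>vertices P. f v *\<^sub>R v) = 0"
      unfolding affine_dependent_explicit_finite[OF finV] by blast
    \<comment> \<open>Weight 1 is a default at a vertex with coefficient 0. By the argument below, a
      facet missing such a vertex misses no other, so there is nothing to equalize.\<close>
    define l where "l = (\<lambda>v. if f v = 0 then 1 else \<bar>f v\<bar>)"
    have "l u * s F u = l w * s F w" if F: "F facet_of P" and uw: "u \<in> vertices P - F" "w \<in> vertices P - F" for F u w
    proof (cases "u = w")
      case False
      have c2: "card {v \<in> vertices P. v \<notin> F} \<le> card {u, w}" using missing[OF F] c5 False by simp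
      have uw': "{v \<in> vertices P. v \<notin> F} = {u, w}"
        by (rule card_subset_eq[symmetric]) (use uw finV c2 card_mono[of "{v \<in> vertices P. v \<notin> F}" "{u, w}"] in auto)
      have sub: "{u, w} \<subseteq> vertices P" using uw by simp
      have "0 = d F * sum f (vertices P) - c F \<bullet> (\<Sum>v\<in>vertices P. f v *\<^sub>R v)" using f by simp
      also have "\<dots> = (\<Sum>v\<in>vertices P. f v * s F v)"
        by (simp add: s_def right_diff_distrib sum_subtractf sum_distrib_left inner_sum_right mult.commute)
      also have "\<dots> = (\<Sum>v\<in>{u, w}. f v * s F v)"
        by (rule sum.mono_neutral_right[OF finV sub]) (use s0[OF F] uw' in auto)
      finally have e: "f u * s F u = - (f w * s F w)" using False by simp
      have sp: "s F u > 0" "s F w > 0" using s0[OF F] s1[OF F] uw by (simp_all add: order_less_le)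
      \<comment> \<open>Otherwise \<open>f w\<close> vanishes too, and the dependency lives on the
        three vertices of \<open>F\<close>, which are affinely independent.\<close>
      have "f u \<noteq> 0"
      proof
        assume z: "f u = 0"
        then have z': "f w = 0" using e sp by simp
        have onF: "on F = vertices P - {u, w}" unfolding on_def using uw' by blast
        have "card (on F) = 3" unfolding onF using c5 card_Diff_subset[of "{u, w}" "vertices P"] sub False by simp
        then obtain p q r where pqr: "on F = {p, q, r}" "distinct [p, q, r]" by (auto simp: card_3_iff)
        have onV: "on F \<subseteq> vertices P" by (simp add: on_def)
        have ind: "\<not> affine_dependent (on F)" unfolding pqr(1)
          by (rule three_vertices_not_collinear[of _ P, OF _ _ _ pqr(2)]) (use onV pqr(1) in simp_all)
        have zz: "f v = 0" if "v \<in> vertices P - on F" for v using that z z' unfolding onF by auto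
        have "sum f (on F) = 0" using f(1) sum.mono_neutral_right[OF finV onV, of f] zz by simp
        moreover have "(\<Sum>v\<in>on F. f v *\<^sub>R v) = 0" using f(3) sum.mono_neutral_right[OF finV onV, of "\<lambda>v. f v *\<^sub>R v"] zz by simp
        ultimately have "\<forall>v\<in>on F. f v = 0" using ind unfolding affine_dependent_explicit_finite[OF finite_on] by blast
        then show False using f(2) zz by blast
      qed
      then have "f w \<noteq> 0" using e sp by auto
      have "\<bar>f u * s F u\<bar> = \<bar>f w * s F w\<bar>" using e by simp
      then show ?thesis using sp \<open>f u \<noteq> 0\<close> \<open>f w \<noteq> 0\<close> by (simp add: l_def abs_mult)
    qed simp
    moreover have "\<forall>v\<in>vertices P. 0 < l v" by (simp add: l_def)
    ultimately show ?thesis by blast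
  qed
  then obtain l where l: "\<forall>v\<in>vertices P. 0 < l v"
    and ls: "\<forall>F u w. F facet_of P \<longrightarrow> u \<in> vertices P - F \<longrightarrow> w \<in> vertices P - F \<longrightarrow> l u * s F u = l w * s F w"
    by (elim exE conjE)
  have "DIM('a \<times> real) = DIM(real^4)" using dim(2) by simp
  then obtain \<iota> :: "'a \<times> real \<Rightarrow> real^4" where \<iota>: "\<forall>x y. \<iota> x \<bullet> \<iota> y = x \<bullet> y" using ex_linear_isometry by blast
  \<comment> \<open>The common weighted slack at the vertices off \<open>F\<close>. Scaling the
    homogeneous vectors by \<open>sqrt (l v)\<close> and \<open>1 / sqrt (k F)\<close> turns the
    squared slack into the slack itself.\<close>
  define k where "k = (\<lambda>F. let u = SOME u. u \<in> vertices P - F in l u * s F u)"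
  have k: "l v * s F v = k F" if "F facet_of P" "v \<in> vertices P - F" for F v
  proof -
    have "(SOME u. u \<in> vertices P - F) \<in> vertices P - F" using that(2) by (rule someI)
    then show ?thesis unfolding k_def Let_def using ls that by blast
  qed
  define a where "a = (\<lambda>v. sqrt (l v) *\<^sub>R \<iota> (v, 1))"
  define b where "b = (\<lambda>F. (1 / sqrt (k F)) *\<^sub>R \<iota> (- c F, d F))"
  have "psd_factorization P a b"
    unfolding psd_factorization_def
  proof (intro exI[of _ c] exI[of _ d] allI impI)
    fix F assume F: "F facet_of P"
    have "d F - c F \<bullet> v = (a v \<bullet> b F)\<^sup>2" if v: "v \<in> vertices P" for v
    proof (cases "v \<in> F")
      case True
      then have "s F v = 0" using s0[OF F v] by simp
      moreover have "a v \<bullet> b F = sqrt (l v) / sqrt (k F) * s F v" using \<iota> by (simp add: a_def b_def s_def inner_commute)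
      ultimately show ?thesis by (simp add: s_def)
    next
      case False
      then have sp: "s F v > 0" using s0[OF F v] s1[OF F v] by (simp add: order_less_le)
      have lk: "l v > 0" "k F = l v * s F v" using l v k[OF F, of v] False by simp_all
      have "a v \<bullet> b F = sqrt (l v) / sqrt (k F) * s F v" using \<iota> by (simp add: a_def b_def s_def inner_commute)
      also have "(\<dots>)\<^sup>2 = l v / k F * (s F v)\<^sup>2" using lk sp by (simp add: power_mult_distrib power_divide)
      also have "\<dots> = s F v" using lk sp by (simp add: power2_eq_square)
      finally show ?thesis by (simp add: s_def)
    qed
    then show "P \<subseteq> {x. c F \<bullet> x \<le> d F} \<and> F = P \<inter> {x. c F \<bullet> x = d F} \<and> (\<forall>v\<in>vertices P. d F - c F \<bullet> v = (a v \<bullet> b F)\<^sup>2)"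
      using cd[OF F] by blast
  qed
  then show ?thesis by blast
qed

section \<open>Factorizations of biplanar octahedra\<close>

lemma octahedron_sets_swap:
  "octahedron_sets y y' x x' z z' = octahedron_sets x x' y y' z z'"
  "octahedron_sets x x' z z' y y' = octahedron_sets x x' y y' z z'"
  unfolding octahedron_sets_def by (simp_all add: insert_commute)

lemma octahedral_swap:
  assumes "octahedral P x x' y y' z z'"
  shows "octahedral P y y' x x' z z'" "octahedral P x x' z z' y y'"
proof -
  have P: "distinct [x, x', y, y', z, z']" "vertices P = {x, x', y, y', z, z'}" "facet_sets P = octahedron_sets x x' y y' z z'"
    using assms unfolding octahedral_def by simp_all
  have d: "distinct [y, y', x, x', z, z']" "distinct [x, x', z, z', y, y']" using P(1) by auto
  have e: "{x, x', y, y', z, z'} = {y, y', x, x', z, z'}" "{x, x', y, y', z, z'} = {x, x', z, z', y, y'}" by auto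
  show "octahedral P y y' x x' z z'" unfolding octahedral_def octahedron_sets_swap(1)[of y y' x x' z z'] P(2,3) using d(1) e(1) by blast
  show "octahedral P x x' z z' y y'" unfolding octahedral_def octahedron_sets_swap(2)[of x x' z z' y y'] P(2,3) using d(2) e(2) by blast
qed

lemma octahedral_complement_facet:
  assumes "octahedral P x x' y y' z z'" "\<xi> \<in> {x, x'}" "\<eta> \<in> {y, y'}" "\<zeta> \<in> {z, z'}"
  shows "vertices P - {\<xi>, \<eta>, \<zeta>} \<in> facet_sets P"
  using assms octahedron_sets_complement[of x x' y y' z z' \<xi> \<eta> \<zeta>] unfolding octahedral_def by simp

text \<open>Extended by zero, the dependency vanishes at \<open>y\<close>, so the facet missing
  \<xi>, \<open>y\<close> and \<zeta> sees only its coefficients at \<xi> and \<zeta>.\<close>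

lemma octahedral_opposite_signs:
  assumes poly: "polytope P" and oct: "octahedral P x x' y y' z z'"
    and f: "(\<Sum>v\<in>{x, x', z, z'}. f v *\<^sub>R (v, 1 :: real)) = 0" and \<xi>\<zeta>: "\<xi> \<in> {x, x'}" "\<zeta> \<in> {z, z'}"
  shows "sgn (f \<xi>) = - sgn (f \<zeta>)"
proof -
  have dst: "distinct [x, x', y, y', z, z']" and V: "vertices P = {x, x', y, y', z, z'}" using oct unfolding octahedral_def by simp_all
  let ?W = "{x, x', z, z'}"
  define g where "g = (\<lambda>v. if v \<in> ?W then f v else 0)"
  have sub: "?W \<subseteq> vertices P" unfolding V by auto
  have g: "(\<Sum>v\<in>vertices P. g v *\<^sub>R (v, 1 :: real)) = 0"
  proof -
    have "(\<Sum>v\<in>vertices P. g v *\<^sub>R (v, 1 :: real)) = (\<Sum>v\<in>?W. g v *\<^sub>R (v, 1))"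
      by (rule sum.mono_neutral_right[OF finite_vertices[OF poly] sub]) (simp add: g_def zero_prod_def)
    also have "\<dots> = (\<Sum>v\<in>?W. f v *\<^sub>R (v, 1))" by (rule sum.cong) (simp_all add: g_def)
    finally show ?thesis using f by simp
  qed
  then have g': "sum g (vertices P) = 0" "(\<Sum>v\<in>vertices P. g v *\<^sub>R v) = 0"
    by (simp_all add: sum_prod zero_prod_def)
  have A: "vertices P - {\<xi>, y, \<zeta>} \<in> facet_sets P" by (rule octahedral_complement_facet[OF oct]) (use \<xi>\<zeta> in simp_all)
  have in_V: "\<xi> \<in> vertices P" "\<zeta> \<in> vertices P" using sub \<xi>\<zeta> by auto
  have ne: "\<xi> \<noteq> \<zeta>" using \<xi>\<zeta> dst by auto
  have y: "g y = 0" using dst by (auto simp: g_def)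
  have "sgn (g \<xi>) = - sgn (g \<zeta>)"
    by (rule facet_set_opposite_signs[OF poly A _ _ ne _ g']) (use in_V y in auto)
  then show ?thesis using \<xi>\<zeta> unfolding g_def by auto
qed

text \<open>Geometrically, the diagonals of the planar quadrilateral cross: its dependency has one
  sign on \<open>x, x'\<close> and the other on \<open>z, z'\<close>. Multiplication by the sign at
  \<open>x\<close> makes all four coefficients positive.\<close>

lemma octahedral_planar_relation:
  assumes poly: "polytope P" and oct: "octahedral P x x' y y' z z'" and dep: "affine_dependent {x, x', z, z'}"
  shows "\<exists>c c' g g'. 0 < c \<and> 0 < c' \<and> 0 < g \<and> 0 < g' \<and>
    c *\<^sub>R (x, 1 :: real) + c' *\<^sub>R (x', 1) = g *\<^sub>R (z, 1) + g' *\<^sub>R (z', 1)"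
proof -
  have dst: "distinct [x, x', y, y', z, z']" using oct unfolding octahedral_def by simp
  obtain f where f: "\<exists>v\<in>{x, x', z, z'}. f v \<noteq> 0" "(\<Sum>v\<in>{x, x', z, z'}. f v *\<^sub>R (v, 1 :: real)) = 0"
    using dep affine_dependent_homogeneous_iff[of "{x, x', z, z'}"] by auto
  have sg: "sgn (f x) = - sgn (f z)" "sgn (f x) = - sgn (f z')" "sgn (f x') = - sgn (f z)"
    by (rule octahedral_opposite_signs[OF poly oct f(2)]; simp)+
  have nz: "f x \<noteq> 0"
  proof
    assume "f x = 0"
    then have "f x = 0" "f z = 0" "f z' = 0" "f x' = 0" using sg by (simp_all add: sgn_zero_iff)
    then show False using f(1) by simp
  qed
  define s where "s = sgn (f x)"
  have s: "s * s = 1" using nz unfolding s_def by (simp add: sgn_if)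
  have eq: "f x *\<^sub>R (x, 1 :: real) + f x' *\<^sub>R (x', 1) = - (f z *\<^sub>R (z, 1) + f z' *\<^sub>R (z', 1))"
    unfolding eq_neg_iff_add_eq_0 using f(2) dst by (simp add: add.assoc)
  have pos: "0 < s * f x" "0 < s * f x'" "0 < - s * f z" "0 < - s * f z'"
    using nz sg unfolding s_def by (auto simp: sgn_if split: if_splits)
  have "(s * f x) *\<^sub>R (x, 1 :: real) + (s * f x') *\<^sub>R (x', 1) = s *\<^sub>R (f x *\<^sub>R (x, 1 :: real) + f x' *\<^sub>R (x', 1))"
    by (simp only: scaleR_add_right scaleR_scaleR)
  also have "\<dots> = (- s * f z) *\<^sub>R (z, 1) + (- s * f z') *\<^sub>R (z', 1)"
    unfolding eq by (simp only: scaleR_add_right scaleR_scaleR scaleR_minus_right minus_add_distrib mult_minus_left scaleR_minus_left)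
  finally show ?thesis using pos by blast
qed

lemma sqrt_add_of_mult_eq_0:
  assumes "0 \<le> a" "0 \<le> b" "a * b = (0 :: real)"
  shows "sqrt (a + b) = sqrt a + sqrt b"
  using assms by auto

text \<open>Square roots turn the two relations between the vertices into linear relations between the
  \<open>a\<close>'s, because each facet contains one vertex of each antipodal pair.\<close>

lemma octahedral_factorization:
  fixes P :: "'a::euclidean_space set"
  assumes poly: "polytope P" and oct: "octahedral P x x' y y' z z'"
    and dep: "affine_dependent {x, x', z, z'}" "affine_dependent {y, y', z, z'}"
  shows "\<exists>a b. psd_factorization P a b"
proof -
  have dst: "distinct [x, x', y, y', z, z']" and V: "vertices P = {x, x', y, y', z, z'}"
    and K: "facet_sets P = octahedron_sets x x' y y' z z'" using oct unfolding octahedral_def by simp_all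
  obtain c c' g g' where c: "0 < c" "0 < c'" "0 < g" "0 < g'"
    and cr: "c *\<^sub>R (x, 1 :: real) + c' *\<^sub>R (x', 1) = g *\<^sub>R (z, 1) + g' *\<^sub>R (z', 1)"
    using octahedral_planar_relation[OF poly oct dep(1)] by blast
  obtain e e' h h' where e: "0 < e" "0 < e'" "0 < h" "0 < h'"
    and er: "e *\<^sub>R (y, 1 :: real) + e' *\<^sub>R (y', 1) = h *\<^sub>R (z, 1) + h' *\<^sub>R (z', 1)"
    using octahedral_planar_relation[OF poly octahedral_swap(1)[OF oct] dep(2)] by blast
  obtain C D where CD: "\<forall>F. F facet_of P \<longrightarrow> P \<subseteq> {x. C F \<bullet> x \<le> D F} \<and> F = P \<inter> {x. C F \<bullet> x = D F}"
    using facet_functionals[OF poly] by (elim exE)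
  define s where "s = (\<lambda>F v. D F - C F \<bullet> v)"
  define ax4 :: "4 \<Rightarrow> real^4" where "ax4 = (\<lambda>i. axis i 1)"
  \<comment> \<open>The coordinates are the roots of the slacks at \<open>x\<close>,
    \<open>y\<close>, \<open>z\<close>, \<open>z'\<close>, so these vertices receive the standard
    basis. The vectors of \<open>x'\<close> and \<open>y'\<close> are then solved from the two
    relations with roots in place of slacks.\<close>
  define b where "b = (\<lambda>F. sqrt (s F x) *\<^sub>R ax4 1 + sqrt (s F y) *\<^sub>R ax4 2 + sqrt (s F z) *\<^sub>R ax4 3 + sqrt (s F z') *\<^sub>R ax4 4)"
  define a where "a = (\<lambda>v. if v = x then ax4 1 else if v = y then ax4 2 else if v = z then ax4 3 else if v = z' then ax4 4
    else if v = x' then (1 / sqrt c') *\<^sub>R (sqrt g *\<^sub>R ax4 3 + sqrt g' *\<^sub>R ax4 4 - sqrt c *\<^sub>R ax4 1)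
    else (1 / sqrt e') *\<^sub>R (sqrt h *\<^sub>R ax4 3 + sqrt h' *\<^sub>R ax4 4 - sqrt e *\<^sub>R ax4 2))"
  have ax4_nth: "ax4 i $ j = (if i = j then 1 else 0)" for i j by (simp add: ax4_def axis_def)
  have ax4_inner: "ax4 i \<bullet> w = w $ i" for i w by (simp add: ax4_def inner_axis')
  have ax4: "ax4 1 \<bullet> b F = sqrt (s F x)" "ax4 2 \<bullet> b F = sqrt (s F y)" "ax4 3 \<bullet> b F = sqrt (s F z)" "ax4 4 \<bullet> b F = sqrt (s F z')" for F
    unfolding ax4_inner by (simp_all add: b_def ax4_nth)
  have "psd_factorization P a b"
    unfolding psd_factorization_def
  proof (intro exI[of _ C] exI[of _ D] allI impI)
    fix F assume F: "F facet_of P"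
    have CDF: "P \<subseteq> {x. C F \<bullet> x \<le> D F}" "F = P \<inter> {x. C F \<bullet> x = D F}" using CD F by blast+
    have s0: "s F v = 0 \<longleftrightarrow> v \<in> vertices P \<inter> F" and s1: "0 \<le> s F v" if "v \<in> vertices P" for v
    proof -
      have v: "v \<in> P" using that vertices_subset by blast
      have "v \<in> F \<longleftrightarrow> C F \<bullet> v = D F" using v CDF(2) by blast
      then show "s F v = 0 \<longleftrightarrow> v \<in> vertices P \<inter> F" using that unfolding s_def by auto
      show "0 \<le> s F v" using v CDF(1) unfolding s_def by auto
    qed
    have lin: "s F u = (u, 1 :: real) \<bullet> (- C F, D F)" for u by (simp add: s_def inner_commute)
    have cs: "c * s F x + c' * s F x' = g * s F z + g' * s F z'"
      using arg_cong[OF cr, of "\<lambda>w. w \<bullet> (- C F, D F)"] unfolding inner_add_left inner_scaleR_left lin .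
    have es: "e * s F y + e' * s F y' = h * s F z + h' * s F z'"
      using arg_cong[OF er, of "\<lambda>w. w \<bullet> (- C F, D F)"] unfolding inner_add_left inner_scaleR_left lin .
    have "vertices P \<inter> F \<in> octahedron_sets x x' y y' z z'" unfolding K[symmetric] facet_sets_def using F by blast
    then have "(x \<in> vertices P \<inter> F \<or> x' \<in> vertices P \<inter> F) \<and> (y \<in> vertices P \<inter> F \<or> y' \<in> vertices P \<inter> F) \<and> (z \<in> vertices P \<inter> F \<or> z' \<in> vertices P \<inter> F)"
      unfolding octahedron_sets_def by (elim insertE emptyE) simp_all
    then have prods: "s F x * s F x' = 0" "s F y * s F y' = 0" "s F z * s F z' = 0"
      using s0 V by auto
    have nn: "0 \<le> s F x" "0 \<le> s F x'" "0 \<le> s F y" "0 \<le> s F y'" "0 \<le> s F z" "0 \<le> s F z'" by (rule s1; simp add: V)+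
    have ch: "sqrt c * sqrt (s F x) + sqrt c' * sqrt (s F x') = sqrt g * sqrt (s F z) + sqrt g' * sqrt (s F z')"
    proof -
      have "sqrt (c * s F x + c' * s F x') = sqrt (c * s F x) + sqrt (c' * s F x')"
        by (rule sqrt_add_of_mult_eq_0) (use c nn prods in auto)
      moreover have "sqrt (g * s F z + g' * s F z') = sqrt (g * s F z) + sqrt (g' * s F z')"
        by (rule sqrt_add_of_mult_eq_0) (use c nn prods in auto)
      ultimately show ?thesis unfolding cs by (simp add: real_sqrt_mult)
    qed
    have eh: "sqrt e * sqrt (s F y) + sqrt e' * sqrt (s F y') = sqrt h * sqrt (s F z) + sqrt h' * sqrt (s F z')"
    proof -
      have "sqrt (e * s F y + e' * s F y') = sqrt (e * s F y) + sqrt (e' * s F y')"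
        by (rule sqrt_add_of_mult_eq_0) (use e nn prods in auto)
      moreover have "sqrt (h * s F z + h' * s F z') = sqrt (h * s F z) + sqrt (h' * s F z')"
        by (rule sqrt_add_of_mult_eq_0) (use e nn prods in auto)
      ultimately show ?thesis unfolding es by (simp add: real_sqrt_mult)
    qed
    have "a x' \<bullet> b F = sqrt (s F x')"
    proof -
      have ax': "a x' = (1 / sqrt c') *\<^sub>R (sqrt g *\<^sub>R ax4 3 + sqrt g' *\<^sub>R ax4 4 - sqrt c *\<^sub>R ax4 1)" unfolding a_def using dst by auto
      have "a x' \<bullet> b F = (sqrt g * sqrt (s F z) + sqrt g' * sqrt (s F z') - sqrt c * sqrt (s F x)) / sqrt c'"
        unfolding ax' inner_scaleR_left inner_diff_left inner_add_left ax4 by simp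
      also have "\<dots> = sqrt (s F x')" unfolding ch[symmetric] using c by simp
      finally show ?thesis .
    qed
    moreover have "a y' \<bullet> b F = sqrt (s F y')"
    proof -
      have ay': "a y' = (1 / sqrt e') *\<^sub>R (sqrt h *\<^sub>R ax4 3 + sqrt h' *\<^sub>R ax4 4 - sqrt e *\<^sub>R ax4 2)" unfolding a_def using dst by auto
      have "a y' \<bullet> b F = (sqrt h * sqrt (s F z) + sqrt h' * sqrt (s F z') - sqrt e * sqrt (s F y)) / sqrt e'"
        unfolding ay' inner_scaleR_left inner_diff_left inner_add_left ax4 by simp
      also have "\<dots> = sqrt (s F y')" unfolding eh[symmetric] using e by simp
      finally show ?thesis .
    qed
    moreover have "a x \<bullet> b F = sqrt (s F x)" "a y \<bullet> b F = sqrt (s F y)" "a z \<bullet> b F = sqrt (s F z)" "a z' \<bullet> b F = sqrt (s F z')"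
      unfolding a_def using dst ax4 by auto
    ultimately have "a v \<bullet> b F = sqrt (s F v)" if "v \<in> vertices P" for v using that unfolding V by blast
    then have "D F - C F \<bullet> v = (a v \<bullet> b F)\<^sup>2" if "v \<in> vertices P" for v
      using s1[OF that] that by (simp add: s_def)
    then show "P \<subseteq> {x. C F \<bullet> x \<le> D F} \<and> F = P \<inter> {x. C F \<bullet> x = D F} \<and>
      (\<forall>v\<in>vertices P. D F - C F \<bullet> v = (a v \<bullet> b F)\<^sup>2)" using CDF by blast
  qed
  then show ?thesis by blast
qed

text \<open>A coplanar quadruple contains no three vertices of a facet, since the fourth vertex
  would lie in the facet plane. A member of each antipodal pair would give such three vertices, so
  the quadruple misses one pair entirely.\<close>

lemma octahedral_coplanar_pairs:
  assumes poly: "polytope P" and oct: "octahedral P x x' y y' z z'"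
    and W: "W \<subseteq> vertices P" "card W = 4" "affine_dependent W"
  shows "W = {x, x', y, y'} \<or> W = {x, x', z, z'} \<or> W = {y, y', z, z'}"
proof -
  have dst: "distinct [x, x', y, y', z, z']" and V: "vertices P = {x, x', y, y', z, z'}"
    and K: "facet_sets P = octahedron_sets x x' y y' z z'" using oct unfolding octahedral_def by simp_all
  have noA: "\<not> {\<xi>, \<eta>, \<zeta>} \<subseteq> W" if A: "{\<xi>, \<eta>, \<zeta>} \<in> facet_sets P" "distinct [\<xi>, \<eta>, \<zeta>]" for \<xi> \<eta> \<zeta>
  proof
    let ?A = "{\<xi>, \<eta>, \<zeta>}"
    assume sub: "?A \<subseteq> W"
    have fin: "finite W" using W(1) finite_vertices[OF poly] finite_subset by blast
    have "card (W - ?A) = 1" using card_Diff_subset[OF _ sub] A(2) W(2) by simp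
    then obtain v where v: "W - ?A = {v}" by (auto simp: card_1_singleton_iff)
    have Wv: "W = insert v ?A" and vA: "v \<notin> ?A" and vV: "v \<in> vertices P" using v sub W(1) by blast+
    obtain F where F: "F facet_of P" "vertices P \<inter> F = ?A" using A(1) unfolding facet_sets_def by auto
    obtain c d where cd: "F = P \<inter> {x. c \<bullet> x = d}" using facet_functional[OF poly F(1)] by metis
    have "v \<notin> F" using F(2) vA vV by blast
    then have "c \<bullet> v \<noteq> d" using vV vertices_subset[of P] unfolding cd by blast
    moreover have "?A \<subseteq> {x. c \<bullet> x = d}" using F(2) unfolding cd by blast
    then have "affine hull ?A \<subseteq> {x. c \<bullet> x = d}" by (rule hull_minimal) (rule affine_hyperplane)
    ultimately have "v \<notin> affine hull ?A" by blast
    moreover have "\<not> affine_dependent ?A"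
      by (rule three_vertices_not_collinear[of _ P, OF _ _ _ A(2)]) (use sub W(1) in auto)
    ultimately have "\<not> affine_dependent W" unfolding Wv by (simp add: affine_independent_insert)
    then show False using W(3) by blast
  qed
  have "\<xi> \<notin> W \<or> \<eta> \<notin> W \<or> \<zeta> \<notin> W" if "\<xi> \<in> {x, x'}" "\<eta> \<in> {y, y'}" "\<zeta> \<in> {z, z'}" for \<xi> \<eta> \<zeta>
  proof -
    have "{\<xi>, \<eta>, \<zeta>} \<in> facet_sets P" unfolding K octahedron_sets_def
      using that by (elim insertE emptyE; hypsubst) (simp_all only: insert_iff simp_thms)
    moreover have "distinct [\<xi>, \<eta>, \<zeta>]" using that dst by auto
    ultimately show ?thesis using noA by blast
  qed
  then have "(z \<notin> W \<and> z' \<notin> W) \<or> (y \<notin> W \<and> y' \<notin> W) \<or> (x \<notin> W \<and> x' \<notin> W)" by blast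
  then have "W \<subseteq> {x, x', y, y'} \<or> W \<subseteq> {x, x', z, z'} \<or> W \<subseteq> {y, y', z, z'}" using W(1) unfolding V by blast
  moreover have "W = S" if "W \<subseteq> S" "card S = 4" "finite S" for S
    by (rule card_subset_eq) (use that W(2) in simp_all)
  moreover have "card {x, x', y, y'} = 4" "card {x, x', z, z'} = 4" "card {y, y', z, z'} = 4" using dst by auto
  ultimately show ?thesis by auto
qed

lemma biplanar_octahedron_factorization:
  assumes bi: "biplanar_octahedron P"
  shows "\<exists>a b. psd_factorization P a b"
proof -
  have poly: "polytope P" using bi unfolding biplanar_octahedron_def octahedron_def by blast
  obtain x x' y y' z z' where oct: "octahedral P x x' y y' z z'"
    using bi unfolding biplanar_octahedron_def octahedron_iff_octahedral by blast
  obtain E E' where E: "E \<noteq> E'" "planar_wrt P E" "planar_wrt P E'" using bi unfolding biplanar_octahedron_def by blast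
  have plane: "\<exists>W. W \<subseteq> vertices P \<and> card W = 4 \<and> affine_dependent W \<and> affine hull W = E" if E: "planar_wrt P E" for E
  proof -
    obtain W where W: "affine E" "aff_dim E = 2" "W \<subseteq> vertices P" "W \<subseteq> P \<inter> E" "card W = 4"
      using E unfolding planar_wrt_def by blast
    have WE: "W \<subseteq> E" using W(4) by blast
    have "aff_dim W \<le> 2" using aff_dim_subset[OF WE] W(2) by simp
    then have dep: "affine_dependent W" using affine_independent_iff_card[of W] W(5) by auto
    have "affine hull W = affine hull E"
    proof -
      have "aff_dim (affine hull W) = 2" using planar_wrt_affine_hull[OF poly W(3,5) dep] unfolding planar_wrt_def by blast
      then have "aff_dim W = aff_dim E" using W(2) by simp
      then show ?thesis using aff_dim_eq_full_gen[OF WE] by blast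
    qed
    then have "affine hull W = E" using W(1) by (simp add: hull_same)
    then show ?thesis using W dep by blast
  qed
  obtain W where W: "W \<subseteq> vertices P" "card W = 4" "affine_dependent W" "affine hull W = E" using plane[OF E(2)] by blast
  obtain W' where W': "W' \<subseteq> vertices P" "card W' = 4" "affine_dependent W'" "affine hull W' = E'" using plane[OF E(3)] by blast
  have ne: "W \<noteq> W'" using E(1) W(4) W'(4) by blast
  note p = octahedral_coplanar_pairs[OF poly oct W(1-3)] octahedral_coplanar_pairs[OF poly oct W'(1-3)]
  have "affine_dependent {x, x', y, y'} \<and> affine_dependent {x, x', z, z'} \<or> affine_dependent {x, x', y, y'} \<and> affine_dependent {y, y', z, z'} \<or>
    affine_dependent {x, x', z, z'} \<and> affine_dependent {y, y', z, z'}"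
    using p ne W(3) W'(3) by metis
  moreover have "{x, x', y, y'} = {y, y', x, x'}" "{x, x', z, z'} = {z, z', x, x'}" "{y, y', z, z'} = {z, z', y, y'}" by auto
  ultimately consider "affine_dependent {y, y', x, x'}" "affine_dependent {z, z', x, x'}"
    | "affine_dependent {x, x', y, y'}" "affine_dependent {z, z', y, y'}"
    | "affine_dependent {x, x', z, z'}" "affine_dependent {y, y', z, z'}" by auto
  then show ?thesis
  proof cases
    case 1
    have "octahedral P y y' z z' x x'" using octahedral_swap(2)[OF octahedral_swap(1)[OF oct]] .
    then show ?thesis by (rule octahedral_factorization[OF poly _ 1])
  next
    case 2
    show ?thesis by (rule octahedral_factorization[OF poly octahedral_swap(2)[OF oct] 2])
  next
    case 3
    show ?thesis by (rule octahedral_factorization[OF poly oct 3])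
  qed
qed

section \<open>Few vertices or few facets, and the listed types\<close>

lemma card_vertices_hull_le:
  assumes "finite S" "P = convex hull S"
  shows "card (vertices P) \<le> card S"
  using assms extreme_points_of_convex_hull[of S] unfolding vertices_def by (intro card_mono) auto

lemma card_facet_sets:
  assumes poly: "polytope P"
  shows "card (facet_sets P) = card {F. F facet_of P}"
proof -
  have "facet_sets P = (\<lambda>F. vertices P \<inter> F) ` {F. F facet_of P}" unfolding facet_sets_def by blast
  moreover have "inj_on (\<lambda>F. vertices P \<inter> F) {F. F facet_of P}"
  proof
    fix F G assume "F \<in> {F. F facet_of P}" "G \<in> {F. F facet_of P}" "vertices P \<inter> F = vertices P \<inter> G"
    then show "F = G" using face_eq_iff_vertices[OF poly, of F G] by (simp add: facet_of_imp_face_of)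
  qed
  ultimately show ?thesis by (simp add: card_image)
qed

lemma combinatorially_equivalent_card:
  assumes P: "polytope P" and Q: "polytope Q" and eqv: "combinatorially_equivalent P Q"
  shows "card (vertices P) = card (vertices Q)" "card {F. F facet_of P} \<le> card {F. F facet_of Q}"
proof -
  obtain \<phi> where \<phi>: "bij_betw \<phi> (vertices P) (vertices Q)"
    by (rule vertex_bij_of_combinatorially_equivalent[OF P Q eqv])
  then show "card (vertices P) = card (vertices Q)" by (rule bij_betw_same_card)
  obtain \<psi> where \<psi>: "(`) \<psi> ` facet_sets Q = facet_sets P"
    by (rule vertex_bij_of_combinatorially_equivalent[OF Q P combinatorially_equivalent_sym[OF eqv]])
  have "finite {F. F facet_of Q}" using Q by (rule finite_polytope_facets)
  moreover have "facet_sets Q = (\<lambda>F. vertices Q \<inter> F) ` {F. F facet_of Q}" unfolding facet_sets_def by blast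
  ultimately have "finite (facet_sets Q)" by simp
  then have "card (facet_sets P) \<le> card (facet_sets Q)" unfolding \<psi>[symmetric] by (rule card_image_le)
  then show "card {F. F facet_of P} \<le> card {F. F facet_of Q}" by (simp only: card_facet_sets[OF P] card_facet_sets[OF Q])
qed

lemma psd_factorization_translation_iff:
  "(\<exists>a b. psd_factorization ((+) t ` P) a b) \<longleftrightarrow> (\<exists>a b. psd_factorization P a b)"
proof
  assume "\<exists>a b. psd_factorization ((+) t ` P) a b"
  then obtain a b where "psd_factorization ((+) t ` P) a b" by blast
  then have "psd_factorization ((+) (- t) ` (+) t ` P) (\<lambda>x. a (x - (- t))) (\<lambda>G. b ((+) (- (- t)) ` G))"
    by (rule psd_factorization_translation)
  moreover have "(+) (- t) ` (+) t ` P = P" by (simp add: image_image)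
  ultimately show "\<exists>a b. psd_factorization P a b" by auto
next
  assume "\<exists>a b. psd_factorization P a b"
  then show "\<exists>a b. psd_factorization ((+) t ` P) a b" using psd_factorization_translation by blast
qed

text \<open>The polar of a translate has at most five vertices, and its factorization is carried
  back by polarity.\<close>

lemma few_facets_factorization:
  fixes P :: "'a::euclidean_space set"
  assumes poly: "polytope P" and dim: "aff_dim P = 3" "DIM('a) = 3" and few: "card {F. F facet_of P} \<le> 5"
  shows "\<exists>a b. psd_factorization P a b"
proof -
  obtain t where t: "origin_polytope ((+) t ` P)" by (rule ex_origin_translate[OF poly]) (use dim in auto)
  interpret origin_polytope "(+) t ` P" by (rule t)
  interpret R: origin_polytope "polar ((+) t ` P)" by (rule origin_polytope_polar)
  have "{G. G facet_of (+) t ` P} = (`) ((+) t) ` {F. F facet_of P}"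
    using facet_of_translationE[of _ t P] facet_of_translation_iff[of t _ P] by blast
  then have "card {G. G facet_of (+) t ` P} \<le> 5" using few by (simp add: card_image inj_on_def inj_image_eq_iff)
  moreover have "card {G. G facet_of (+) t ` P} = card (vertices (polar ((+) t ` P)))"
    by (rule bij_betw_same_card[OF bij_normal])
  ultimately have "\<exists>a b. psd_factorization (polar ((+) t ` P)) a b"
    by (intro few_vertices_factorization[OF R.poly]) (use R.aff_dim_full dim in auto)
  then have "\<exists>a b. psd_factorization ((+) t ` P) a b" using R.psd_factorization_polar unfolding bipolar by blast
  then show ?thesis by (simp only: psd_factorization_translation_iff)
qed

text \<open>According to the sign of the facet functional on the translation vector
  \<open>d\<close>, the facet is the shifted base, the base, or a side over an edge of the base,
  which makes five possible vertex sets.\<close>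

lemma prism_few_facets:
  fixes Q :: "(real^3) set"
  assumes T: "2 simplex T" and Q: "prism_over T Q"
  shows "polytope Q" "card {F. F facet_of Q} \<le> 5"
proof -
  obtain C where C: "\<not> affine_dependent C" "int (card C) = 3" "T = convex hull C"
    using T unfolding simplex_def by auto
  have "card C = 3" using C(2) by simp
  then obtain t1 t2 t3 where t: "C = {t1, t2, t3}" "distinct [t1, t2, t3]" by (auto simp: card_3_iff)
  obtain d where d: "\<forall>x\<in>T. x + d \<notin> affine hull T" and Qd: "Q = convex hull (T \<union> (\<lambda>x. x + d) ` T)"
    using Q unfolding prism_over_def by blast
  let ?m = "\<lambda>x. x + d"
  have "?m ` T = convex hull (?m ` C)" using convex_hull_translation[of d C] unfolding C(3) by (simp add: add.commute)
  then have QC: "Q = convex hull (C \<union> ?m ` C)"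
    unfolding Qd C(3) by (simp only: hull_Un_left[symmetric] hull_Un_right[symmetric])
  have finC: "finite C" using t(1) by simp
  show poly: "polytope Q" unfolding QC by (rule polytope_convex_hull) (use finC in simp)
  have t1T: "t1 \<in> T" unfolding C(3) t(1) by (rule hull_inc) simp
  have "aff_dim C = 2" using affine_independent_iff_card[of C] C(1,2) by simp
  then have "aff_dim (insert (t1 + d) C) = 3"
    unfolding aff_dim_insert using d t1T unfolding C(3) affine_hull_convex_hull by auto
  moreover have "insert (t1 + d) C \<subseteq> Q" unfolding QC using t(1) by (intro subset_trans[OF _ hull_subset]) auto
  ultimately have "3 \<le> aff_dim Q" using aff_dim_subset by metis
  then have dim: "aff_dim Q = 3" using aff_dim_le_DIM[of Q] by simp
  interpret polytope3 Q using poly dim by unfold_locales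
  interpret incidence "vertices Q" "{F. F facet_of Q}" "(\<in>)" by (rule incidence) simp
  have VC: "vertices Q \<subseteq> C \<union> ?m ` C" unfolding vertices_def QC by (rule extreme_points_of_convex_hull)
  have mC: "card (?m ` C) = 3" using card_image[of ?m C] C(2) by (simp add: inj_on_def)
  let ?X = "{C, ?m ` C} \<union> (\<lambda>S. S \<union> ?m ` S) ` {{t1, t2}, {t1, t3}, {t2, t3}}"
  have "vertices Q \<inter> F \<in> (\<lambda>X. vertices Q \<inter> X) ` ?X" if F: "F facet_of Q" for F
  proof -
    obtain c m where cm: "Q \<subseteq> {x. c \<bullet> x \<le> m}" "F = Q \<inter> {x. c \<bullet> x = m}" using facet_functional[OF poly F] by metis
    have VF: "v \<in> F \<longleftrightarrow> c \<bullet> v = m" if "v \<in> Q" for v using that cm(2) by blast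
    have CQ: "C \<subseteq> Q" "?m ` C \<subseteq> Q" unfolding QC by (rule subset_trans[OF _ hull_subset]; simp)+
    have le: "c \<bullet> x \<le> m" if "x \<in> Q" for x using cm(1) that by blast
    have fin: "finite (vertices Q \<inter> F)" using finite_vertices[OF poly] by simp
    have ge3: "3 \<le> card (vertices Q \<inter> F)" using on_ge3[of F] F unfolding on_def by (simp add: Int_def)
    consider "c \<bullet> d > 0" | "c \<bullet> d < 0" | "c \<bullet> d = 0" by linarith
    then show ?thesis
    proof cases
      case 1
      have "vertices Q \<inter> F \<subseteq> ?m ` C"
      proof
        fix v assume v: "v \<in> vertices Q \<inter> F"
        have "v \<notin> C"
        proof
          assume "v \<in> C"
          then have "v + d \<in> Q" "v \<in> Q" using CQ by auto
          then have "c \<bullet> v + c \<bullet> d \<le> m" "c \<bullet> v = m" using le[of "v + d"] VF[of v] v by (auto simp: inner_add_right)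
          then show False using 1 by simp
        qed
        then show "v \<in> ?m ` C" using v VC by blast
      qed
      then have "vertices Q \<inter> F = ?m ` C" by (intro card_seteq) (use finC ge3 mC in auto)
      then show ?thesis by (intro image_eqI[of _ _ "?m ` C"]) auto
    next
      case 2
      have "vertices Q \<inter> F \<subseteq> C"
      proof
        fix v assume v: "v \<in> vertices Q \<inter> F"
        have "v \<notin> ?m ` C"
        proof
          assume "v \<in> ?m ` C"
          then obtain u where u: "u \<in> C" "v = u + d" by blast
          have "u \<in> Q" "v \<in> Q" using u CQ by auto
          then have "c \<bullet> u \<le> m" "c \<bullet> u + c \<bullet> d = m" using le[of u] VF[of v] v u(2) by (auto simp: inner_add_right)
          then show False using 2 by simp
        qed
        then show "v \<in> C" using v VC by blast
      qed
      then have "vertices Q \<inter> F = C" by (intro card_seteq) (use finC ge3 C(2) in auto)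
      then show ?thesis by (intro image_eqI[of _ _ C]) auto
    next
      case 3
      define S where "S = {x \<in> C. c \<bullet> x = m}"
      have "vertices Q \<inter> F = vertices Q \<inter> (S \<union> ?m ` S)"
      proof (intro equalityI subsetI)
        fix v assume v: "v \<in> vertices Q \<inter> F"
        then have "v \<in> Q" using vertices_subset[of Q] by blast
        then have cv: "c \<bullet> v = m" using VF v by blast
        have "v \<in> C \<union> ?m ` C" using v VC by blast
        then show "v \<in> vertices Q \<inter> (S \<union> ?m ` S)" using v cv 3 unfolding S_def by (auto simp: inner_add_right)
      next
        fix v assume v: "v \<in> vertices Q \<inter> (S \<union> ?m ` S)"
        then have "v \<in> Q" using vertices_subset[of Q] by blast
        moreover have "c \<bullet> v = m" using v 3 unfolding S_def by (auto simp: inner_add_right)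
        ultimately show "v \<in> vertices Q \<inter> F" using VF v by blast
      qed
      \<comment> \<open>All three base points on the facet hyperplane would put the whole prism into
        it; at most one would leave the facet with fewer than three vertices.\<close>
      moreover have "S \<in> {{t1, t2}, {t1, t3}, {t2, t3}}"
      proof -
        have SC: "S \<subseteq> C" unfolding S_def by blast
        have "S \<noteq> C"
        proof
          assume "S = C"
          then have "\<forall>x\<in>C. c \<bullet> x = m" unfolding S_def by blast
          then have "C \<union> ?m ` C \<subseteq> {x. c \<bullet> x = m}" using 3 by (auto simp: inner_add_right)
          then have "Q \<subseteq> {x. c \<bullet> x = m}" unfolding QC by (rule hull_minimal) (rule convex_hyperplane)
          then have "F = Q" using cm(2) by blast
          then show False using F by simp
        qed
        moreover have "\<not> card S \<le> 1"
        proof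
          assume S1: "card S \<le> 1"
          have finS: "finite S" using SC finC finite_subset by blast
          have "card (vertices Q \<inter> F) \<le> card (S \<union> ?m ` S)"
            unfolding \<open>vertices Q \<inter> F = vertices Q \<inter> (S \<union> ?m ` S)\<close> by (rule card_mono) (use finS in auto)
          also have "\<dots> \<le> card S + card (?m ` S)" by (rule card_Un_le)
          also have "\<dots> \<le> 2" using S1 card_image_le[OF finS, of ?m] by simp
          finally show False using ge3 by simp
        qed
        moreover have "S = (if c \<bullet> t1 = m then {t1} else {}) \<union> ((if c \<bullet> t2 = m then {t2} else {}) \<union> (if c \<bullet> t3 = m then {t3} else {}))"
          unfolding S_def t(1) by auto
        ultimately show ?thesis unfolding t(1)
          by (cases "c \<bullet> t1 = m"; cases "c \<bullet> t2 = m"; cases "c \<bullet> t3 = m") (simp_all add: insert_commute)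
      qed
      ultimately show ?thesis by (intro image_eqI[of _ _ "S \<union> ?m ` S"]) blast+
    qed
  qed
  then have "facet_sets Q \<subseteq> (\<lambda>X. vertices Q \<inter> X) ` ?X" unfolding facet_sets_def by blast
  then have "card (facet_sets Q) \<le> card ((\<lambda>X. vertices Q \<inter> X) ` ?X)" by (rule card_mono[rotated]) simp
  also have "\<dots> \<le> card ?X" by (rule card_image_le) simp
  also have "\<dots> \<le> card {C, ?m ` C} + card ((\<lambda>S. S \<union> ?m ` S) ` {{t1, t2}, {t1, t3}, {t2, t3}})" by (rule card_Un_le)
  also have "\<dots> \<le> 2 + 3"
  proof (rule add_mono)
    show "card {C, ?m ` C} \<le> 2" by (simp add: card_insert_if)
    have "card ((\<lambda>S. S \<union> ?m ` S) ` {{t1, t2}, {t1, t3}, {t2, t3}}) \<le> card {{t1, t2}, {t1, t3}, {t2, t3}}" by (rule card_image_le) simp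
    also have "\<dots> \<le> 3" by (simp add: card_insert_if)
    finally show "card ((\<lambda>S. S \<union> ?m ` S) ` {{t1, t2}, {t1, t3}, {t2, t3}}) \<le> 3" .
  qed
  finally show "card {F. F facet_of Q} \<le> 5" unfolding card_facet_sets[OF poly] by simp
qed

lemma listed_factorization:
  fixes P :: "(real^3) set"
  assumes poly: "polytope P" and dim: "aff_dim P = 3"
    and P: "3 simplex P \<or> quadrilateral_pyramid P \<or> bisimplex P \<or>
      combinatorial_triangular_prism P \<or> biplanar_octahedron P \<or> biplanar_cuboid P"
  shows "\<exists>a b. psd_factorization P a b"
proof -
  have few: "\<exists>a b. psd_factorization P a b" if "card (vertices P) \<le> 5"
    using few_vertices_factorization[OF poly dim _ that] by simp
  from P show ?thesis
  proof (elim disjE)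
    assume "3 simplex P"
    then obtain C where C: "int (card C) = 4" "P = convex hull C" unfolding simplex_def by auto
    then have "finite C" using card.infinite by fastforce
    then have "card (vertices P) \<le> card C" using C(2) by (rule card_vertices_hull_le)
    then show ?thesis using few C(1) by simp
  next
    assume "quadrilateral_pyramid P"
    then obtain B a where B: "polytope B" "card (vertices B) = 4" "P = convex hull (insert a B)"
      unfolding quadrilateral_pyramid_def convex_quadrilateral_def pyramid_over_def by blast
    have "P = convex hull (insert a (vertices B))"
      using hull_insert[of convex a "vertices B"] unfolding B(3) convex_hull_vertices[OF B(1)] by simp
    then have "card (vertices P) \<le> card (insert a (vertices B))"
      using card_vertices_hull_le[of "insert a (vertices B)" P] finite_vertices[OF B(1)] by simp
    also have "\<dots> \<le> 5" using card_insert_le_m1[of 5 "vertices B" a] B(2) by simp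
    finally show ?thesis by (rule few)
  next
    assume "bisimplex P"
    then obtain T Q where T: "2 simplex T" "bipyramid_over T (Q :: (real^3) set)" "combinatorially_equivalent P Q"
      unfolding bisimplex_def by blast
    obtain C where C: "int (card C) = 3" "T = convex hull C" using T(1) unfolding simplex_def by auto
    have finC: "finite C" using C(1) card.infinite by fastforce
    obtain a b where Q: "Q = convex hull (insert a (insert b T))" using T(2) unfolding bipyramid_over_def by blast
    have QC: "Q = convex hull (insert a (insert b C))"
      unfolding Q C(2) using hull_insert[of convex a "insert b C"] hull_insert[of convex b C] hull_insert[of convex a "insert b (convex hull C)"] by simp
    have pQ: "polytope Q" unfolding QC by (rule polytope_convex_hull) (use finC in simp)
    have "card (vertices P) = card (vertices Q)" by (rule combinatorially_equivalent_card(1)[OF poly pQ T(3)])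
    also have "\<dots> \<le> card (insert a (insert b C))" using QC by (intro card_vertices_hull_le) (use finC in simp_all)
    also have "\<dots> \<le> 5" using C(1) finC by (simp add: card_insert_if)
    finally show ?thesis by (rule few)
  next
    assume "combinatorial_triangular_prism P"
    then obtain T Q where T: "2 simplex T" "prism_over T (Q :: (real^3) set)" "combinatorially_equivalent P Q"
      unfolding combinatorial_triangular_prism_def by blast
    note Q = prism_few_facets[OF T(1,2)]
    have "card {F. F facet_of P} \<le> 5" using combinatorially_equivalent_card(2)[OF poly Q(1) T(3)] Q(2) by simp
    then show ?thesis using few_facets_factorization[OF poly dim] by simp
  next
    assume "biplanar_octahedron P"
    then show ?thesis by (rule biplanar_octahedron_factorization)
  next
    assume "biplanar_cuboid P"
    then obtain d where d: "0 \<in> interior ((\<lambda>x. x + d) ` P)" "biplanar_octahedron (polar ((\<lambda>x. x + d) ` P))"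
      unfolding biplanar_cuboid_def by blast
    have e: "(\<lambda>x. x + d) ` P = (+) d ` P" by (simp add: add.commute)
    have "polytope ((+) d ` P)" using poly by (subst polytope_translation_eq)
    then interpret origin_polytope "(+) d ` P" using d(1) unfolding e by unfold_locales
    interpret R: origin_polytope "polar ((+) d ` P)" by (rule origin_polytope_polar)
    have "\<exists>a b. psd_factorization (polar ((+) d ` P)) a b" using biplanar_octahedron_factorization[OF d(2)] unfolding e .
    then have "\<exists>a b. psd_factorization ((+) d ` P) a b" using R.psd_factorization_polar unfolding bipolar by blast
    then show ?thesis by (simp only: psd_factorization_translation_iff)
  qed
qed

section \<open>The classification\<close>

text \<open>The quadrilateral facet recorded in the pyramid case serves to exclude this case when
  the lemma is applied to a polar.\<close>

lemma degree_four_cases: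
  fixes P :: "(real^3) set"
  assumes poly: "polytope P" and dim: "aff_dim P = 3" and fac: "psd_factorization P a b"
    and v: "v \<in> vertices P" "card {F. F facet_of P \<and> v \<in> F} = 4"
  shows "(quadrilateral_pyramid P \<and> (\<exists>G. G facet_of P \<and> card (vertices P \<inter> G) = 4)) \<or>
    (\<exists>s s' t1 t2 t3. bisimplicial P s s' t1 t2 t3) \<or> (\<exists>x x' y y' z z'. octahedral P x x' y y' z z')"
proof -
  interpret polytope3 P using poly dim by unfold_locales
  obtain c d where "connected_psd_incidence (vertices P) {F. F facet_of P} (\<in>) (\<lambda>v. (v, 1 :: real)) (\<lambda>F. (- c F, d F)) a b"
    using psd_incidence[OF _ fac] by auto
  then interpret I: connected_psd_incidence "vertices P" "{F. F facet_of P}" "(\<in>)" "\<lambda>v. (v, 1 :: real)" "\<lambda>F. (- c F, d F)" a b .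
  have on: "I.on F = vertices P \<inter> F" for F unfolding I.on_def by blast
  have onK: "I.on ` {F. F facet_of P} = facet_sets P" unfolding on facet_sets_def by blast
  have "card (I.star v) = 4" unfolding I.star_def using v(2) by simp
  note cl = I.degree_four_classification[OF v(1) this, unfolded onK, unfolded on]
  from cl show ?thesis
  proof (elim disjE exE conjE)
    fix x u1 u2 u3 u4 G
    assume *: "distinct [x, u1, u2, u3, u4]" "vertices P = {x, u1, u2, u3, u4}" "G \<in> {F. F facet_of P}" "vertices P \<inter> G = {u1, u2, u3, u4}"
    have "quadrilateral_pyramid P" by (rule pyramid_pattern[OF poly dim *(1,2) _ *(4)]) (use *(3) in simp)
    moreover have "card (vertices P \<inter> G) = 4" unfolding *(4) using *(1) by simp
    ultimately show ?thesis using *(3) by blast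
  next
    fix s s' t1 t2 t3
    assume "distinct [s, s', t1, t2, t3]" "vertices P = {s, s', t1, t2, t3}" "facet_sets P = bisimplex_sets s s' t1 t2 t3"
    then have "bisimplicial P s s' t1 t2 t3" unfolding bisimplicial_def by (intro conjI)
    then show ?thesis by blast
  next
    fix x x' y y' z z'
    assume "distinct [x, x', y, y', z, z']" "vertices P = {x, x', y, y', z, z'}" "facet_sets P = octahedron_sets x x' y y' z z'"
    then have "octahedral P x x' y y' z z'" unfolding octahedral_def by (intro conjI)
    then show ?thesis by blast
  qed
qed

lemma biplanar_octahedron_of_octahedral:
  assumes poly: "polytope P" and dim: "aff_dim P = 3" and fac: "psd_factorization P a b" and oct: "octahedral P x x' y y' z z'"
  shows "biplanar_octahedron P"
proof -
  have "octahedron P" unfolding octahedron_iff_octahedral using poly oct by blast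
  moreover have "\<exists>E E'. E \<noteq> E' \<and> planar_wrt P E \<and> planar_wrt P E'"
    by (rule octahedron_pattern_two_planes[OF poly dim fac]) (use oct in \<open>unfold octahedral_def, blast+\<close>)
  ultimately show ?thesis unfolding biplanar_octahedron_def by blast
qed

lemma (in origin_polytope) card_facets_at_normal:
  assumes F: "F facet_of P"
  shows "card {G. G facet_of polar P \<and> normal F \<in> G} = card (vertices P \<inter> F)"
proof -
  have "{G. G facet_of polar P \<and> normal F \<in> G} = {G \<in> dual_facet ` vertices P. normal F \<in> G}"
    unfolding facets_polar[symmetric] by blast
  also have "\<dots> = dual_facet ` (vertices P \<inter> F)" using normal_mem_dual_facet[OF F] by blast
  finally show ?thesis
    using card_image[OF inj_on_subset[OF inj_dual_facet, of "vertices P \<inter> F"]] by simp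
qed

lemma (in origin_polytope) card_dual_facet:
  assumes v: "v \<in> vertices P"
  shows "card (vertices (polar P) \<inter> dual_facet v) = card {F. F facet_of P \<and> v \<in> F}"
proof -
  have "vertices (polar P) \<inter> dual_facet v = normal ` {F. F facet_of P \<and> v \<in> F}"
    unfolding vertices_polar using normal_mem_dual_facet[OF _ v] by blast
  moreover have "inj_on normal {F. F facet_of P \<and> v \<in> F}" by (rule inj_on_subset[OF inj_normal]) blast
  ultimately show ?thesis by (simp add: card_image)
qed

text \<open>A quadrilateral facet is a vertex of degree four of the polar, where
  \<open>degree_four_cases\<close> applies. If the polar is a pyramid, its base comes from a vertex
  of degree four of \<open>P\<close>, which \<open>deg\<close> excludes.\<close>

lemma quadrilateral_facet_cases:
  fixes P :: "(real^3) set"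
  assumes poly: "polytope P" and dim: "aff_dim P = 3" and fac: "psd_factorization P a b"
    and deg: "\<And>v. v \<in> vertices P \<Longrightarrow> card {F. F facet_of P \<and> v \<in> F} \<noteq> 4"
    and F: "F facet_of P" "card (vertices P \<inter> F) = 4"
  shows "combinatorial_triangular_prism P \<or> biplanar_cuboid P"
proof -
  obtain t where t: "origin_polytope ((+) t ` P)" by (rule ex_origin_translate[OF poly]) (use dim in auto)
  define P' where "P' = (+) t ` P"
  interpret P': origin_polytope P' unfolding P'_def by (rule t)
  interpret R: origin_polytope "polar P'" by (rule P'.origin_polytope_polar)
  have Rdim: "aff_dim (polar P') = 3" using R.aff_dim_full by simp
  have eqv: "combinatorially_equivalent P P'"
    using combinatorially_equivalent_translation[of P t] unfolding P'_def by (simp add: add.commute)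
  obtain a' b' where "psd_factorization P' a' b'" using psd_factorization_translation[OF fac] unfolding P'_def by blast
  then obtain a'' b'' where fac': "psd_factorization (polar P') a'' b''" using P'.psd_factorization_polar by blast
  have F': "(+) t ` F facet_of P'" unfolding P'_def facet_of_translation_iff by (rule F(1))
  have "vertices P' \<inter> (+) t ` F = (+) t ` (vertices P \<inter> F)"
    unfolding P'_def vertices_translation by (simp add: image_Int)
  then have "card (vertices P' \<inter> (+) t ` F) = 4" using F(2) by (simp add: card_image)
  then have "card {G. G facet_of polar P' \<and> P'.normal ((+) t ` F) \<in> G} = 4"
    unfolding P'.card_facets_at_normal[OF F'] .
  moreover have "P'.normal ((+) t ` F) \<in> vertices (polar P')" unfolding P'.vertices_polar using F' by blast
  ultimately have "(quadrilateral_pyramid (polar P') \<and> (\<exists>G. G facet_of polar P' \<and> card (vertices (polar P') \<inter> G) = 4)) \<or>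
    (\<exists>s s' t1 t2 t3. bisimplicial (polar P') s s' t1 t2 t3) \<or> (\<exists>x x' y y' z z'. octahedral (polar P') x x' y y' z z')"
    by (intro degree_four_cases[OF R.poly Rdim fac'])
  then show ?thesis
  proof (elim disjE exE conjE)
    fix G assume G: "G facet_of polar P'" "card (vertices (polar P') \<inter> G) = 4"
    obtain w where w: "w \<in> vertices P'" "G = P'.dual_facet w" by (rule P'.facet_polar_is_dual_facet[OF G(1)])
    have c4: "card {F. F facet_of P' \<and> w \<in> F} = 4" using G(2) P'.card_dual_facet[OF w(1)] w(2) by simp
    obtain v where v: "v \<in> vertices P" "w = t + v" using w(1) unfolding P'_def vertices_translation by blast
    have "{F. F facet_of P' \<and> w \<in> F} = (`) ((+) t) ` {F. F facet_of P \<and> v \<in> F}"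
    proof
      show "{F. F facet_of P' \<and> w \<in> F} \<subseteq> (`) ((+) t) ` {F. F facet_of P \<and> v \<in> F}"
      proof
        fix H assume "H \<in> {F. F facet_of P' \<and> w \<in> F}"
        then have H: "H facet_of (+) t ` P" "t + v \<in> H" unfolding P'_def v(2) by simp_all
        obtain H' where H': "H' facet_of P" "H = (+) t ` H'" by (rule facet_of_translationE[OF H(1)])
        have "v \<in> H'" using H(2) unfolding H'(2) by auto
        then show "H \<in> (`) ((+) t) ` {F. F facet_of P \<and> v \<in> F}" using H' by blast
      qed
      show "(`) ((+) t) ` {F. F facet_of P \<and> v \<in> F} \<subseteq> {F. F facet_of P' \<and> w \<in> F}"
        unfolding P'_def v(2) by (auto simp: facet_of_translation_iff)
    qed
    then have "card {F. F facet_of P \<and> v \<in> F} = 4" using c4 by (simp add: card_image inj_on_def inj_image_eq_iff)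
    then show ?thesis using deg[OF v(1)] by blast
  next
    fix s s' t1 t2 t3 assume bs: "bisimplicial (polar P') s s' t1 t2 t3"
    interpret B: origin_polytope standard_bisimplex by (rule origin_polytope_standard_bisimplex)
    have "combinatorially_equivalent (polar P') standard_bisimplex"
      by (rule bisimplicial_equivalent[OF R.poly B.poly bs bisimplicial_standard_bisimplex])
    then have "combinatorially_equivalent (polar (polar P')) (polar standard_bisimplex)"
      by (rule combinatorially_equivalent_polar[OF R.origin_polytope_axioms B.origin_polytope_axioms])
    then have "combinatorially_equivalent P' standard_prism" unfolding P'.bipolar polar_standard_bisimplex .
    then have "combinatorially_equivalent P standard_prism" by (rule combinatorially_equivalent_trans[OF eqv])
    then show ?thesis
      unfolding combinatorial_triangular_prism_def using poly prism_over_standard_prism by blast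
  next
    fix x x' y y' z z' assume oct: "octahedral (polar P') x x' y y' z z'"
    interpret O: origin_polytope regular_octahedron by (rule origin_polytope_regular_octahedron)
    have bi: "biplanar_octahedron (polar P')" by (rule biplanar_octahedron_of_octahedral[OF R.poly Rdim fac' oct])
    then have "combinatorially_equivalent (polar P') regular_octahedron"
      unfolding biplanar_octahedron_def octahedron_def by blast
    then have "combinatorially_equivalent (polar (polar P')) (polar regular_octahedron)"
      by (rule combinatorially_equivalent_polar[OF R.origin_polytope_axioms O.origin_polytope_axioms])
    then have "combinatorially_equivalent P' (cbox (- One) (One :: real^3))" unfolding P'.bipolar polar_regular_octahedron .
    then have "combinatorially_equivalent P (cbox (- One) (One :: real^3))" by (rule combinatorially_equivalent_trans[OF eqv])
    then have "combinatorially_equivalent P (cbox 0 (One :: real^3))" using cube_equivalent_unit_cube by (rule combinatorially_equivalent_trans)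
    then have cub: "cuboid P" unfolding cuboid_def using poly by blast
    have e: "(\<lambda>x. x + t) ` P = P'" unfolding P'_def by (simp add: add.commute)
    show ?thesis unfolding biplanar_cuboid_def using cub bi P'.zero_int unfolding e[symmetric] by blast
  qed
qed

theorem theorem4p11:
  fixes P :: "(real^3) set"
  assumes "polytope P" and "aff_dim P = 3"
  shows "psd_rank P = 4 \<longleftrightarrow>
    3 simplex P \<or> quadrilateral_pyramid P \<or> bisimplex P \<or>
    combinatorial_triangular_prism P \<or> biplanar_octahedron P \<or> biplanar_cuboid P"
proof -
  interpret polytope3 P using assms by unfold_locales
  have iff: "psd_rank P = 4 \<longleftrightarrow> (\<exists>a b. psd_factorization P a b)" by (rule psd_rank_four_iff[OF assms]) simp
  have "3 simplex P \<or> quadrilateral_pyramid P \<or> bisimplex P \<or>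
    combinatorial_triangular_prism P \<or> biplanar_octahedron P \<or> biplanar_cuboid P" if fac: "psd_factorization P a b" for a b
  proof (cases "\<exists>v\<in>vertices P. card {F. F facet_of P \<and> v \<in> F} = 4")
    case True
    then obtain v where v: "v \<in> vertices P" "card {F. F facet_of P \<and> v \<in> F} = 4" by blast
    from degree_four_cases[OF assms fac v] show ?thesis
    proof (elim disjE exE conjE)
      fix s s' t1 t2 t3 assume "bisimplicial P s s' t1 t2 t3"
      then have "bisimplex P" unfolding bisimplicial_def by (elim conjE) (rule bisimplex_pattern[OF assms])
      then show ?thesis by blast
    next
      fix x x' y y' z z' assume "octahedral P x x' y y' z z'"
      then have "biplanar_octahedron P" by (rule biplanar_octahedron_of_octahedral[OF assms fac])
      then show ?thesis by blast
    qed blast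
  next
    case False
    then have n4: "card {F. F facet_of P \<and> v \<in> F} \<noteq> 4" if "v \<in> vertices P" for v using that by blast
    show ?thesis
    proof (cases "\<exists>F. F facet_of P \<and> card (vertices P \<inter> F) = 4")
      case True
      then obtain F where F: "F facet_of P" "card (vertices P \<inter> F) = 4" by blast
      have "combinatorial_triangular_prism P \<or> biplanar_cuboid P" by (rule quadrilateral_facet_cases[OF assms fac n4 F])
      then show ?thesis by blast
    next
      case nF: False
      obtain c d where "connected_psd_incidence (vertices P) {F. F facet_of P} (\<in>) (\<lambda>v. (v, 1 :: real)) (\<lambda>F. (- c F, d F)) a b"
        using psd_incidence[OF _ fac] by auto
      then interpret I: connected_psd_incidence "vertices P" "{F. F facet_of P}" "(\<in>)" "\<lambda>v. (v, 1 :: real)" "\<lambda>F. (- c F, d F)" a b .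
      have on: "I.on F = vertices P \<inter> F" for F unfolding I.on_def by blast
      have d3: "card (I.star v) = 3" if "v \<in> vertices P" for v
        using I.star_card[OF that] n4[OF that] unfolding I.star_def by simp
      have t3: "card (I.on F) = 3" if "F \<in> {F. F facet_of P}" for F
        using I.on_card[OF that] nF that unfolding on by blast
      have "P \<noteq> {}" using assms(2) by auto
      then have "vertices P \<noteq> {}" using convex_hull_vertices[OF assms(1)] by auto
      then obtain v where v: "v \<in> vertices P" by blast
      have c4: "card (vertices P) = 4" by (rule I.simplicial_simple[OF d3 t3 v])
      have "\<not> affine_dependent (vertices P)"
        unfolding affine_independent_iff_card using c4 vertices_aff_dim[OF assms(1)] assms(2) finite_vertices[OF assms(1)] by simp
      then have "3 simplex P"
        unfolding simplex_def using c4 convex_hull_vertices[OF assms(1)] by (intro exI[of _ "vertices P"]) simp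
      then show ?thesis by blast
    qed
  qed
  then show ?thesis unfolding iff using listed_factorization[OF assms] by blast
qed

end
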